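(* Let $n\ge4$ be an integer, and let $\mathcal{M}_{\mathrm{sf}}$ be the set of square-free integers $m$ such that $X^n-m$ is irreducible over $\mathbb{Q}$. Then the set $\{m\in\mathcal{M}_{\mathrm{sf}}:\ \mathcal{O}_{K_m}\text{ is monogenic}\}$ has two-sided natural density $$\frac{6}{\pi^2}\prod_{p\mid n}\frac{p}{p+1},$$ where the product runs over the primes $p$ dividing $n$.
   Context: For $m\in\mathcal{M}_{\mathrm{sf}}$, $K_m=\mathbb{Q}(\alpha)$ with $\alpha^n=m$, and $\mathcal{O}_{K_m}$ is its ring of integers; it is monogenic if $\mathcal{O}_{K_m}=\mathbb{Z}[\theta]$ for some $\theta\in\mathcal{O}_{K_m}$. The two-sided natural density of $A\subseteq\mathbb{Z}$ is $\lim_{X\to\infty}\#\{m\in A:|m|\le X\}/(2X)$, when the limit exists. *)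

theory Defs
  imports
    Complex_Main
    "HOL-Computational_Algebra.Computational_Algebra"
    "HOL-Algebra.Generated_Rings"
    "HOL-Algebra.Generated_Fields"
    "HOL-Algebra.Algebraic_Closure_Type"
begin

(* Number fields are taken inside the complex numbers. HOL-Algebra shadows some
   type-class names (irreducible, monom, ...), hence the qualified names below. *)

definition rat_adjoin :: "complex \<Rightarrow> complex set" where
  "rat_adjoin \<alpha> = generate_field ring_of_type_algebra {\<alpha>}"

definition int_adjoin :: "complex \<Rightarrow> complex set" where
  "int_adjoin \<theta> = generate_ring ring_of_type_algebra {\<theta>}"

definition ring_of_integers :: "complex set \<Rightarrow> complex set" where
  "ring_of_integers K = {x \<in> K. algebraic_int x}"

definition monogenic :: "complex set \<Rightarrow> bool" where
  "monogenic R \<longleftrightarrow> (\<exists>\<theta>\<in>R. R = int_adjoin \<theta>)"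

definition M_sf :: "nat \<Rightarrow> int set" where
  "M_sf n = {m. squarefree m \<and>
     Factorial_Ring.irreducible (Polynomial.monom 1 n - [:of_int m:] :: rat Polynomial.poly)}"

definition has_two_sided_density :: "int set \<Rightarrow> real \<Rightarrow> bool" where
  "has_two_sided_density A d \<longleftrightarrow>
     ((\<lambda>x::real. real (card {m \<in> A. real_of_int \<bar>m\<bar> \<le> x}) / (2 * x)) \<longlongrightarrow> d) at_top"

end

theory Submission
  imports Defs "Jordan_Normal_Form.Char_Poly" "HOL-Number_Theory.Number_Theory" "HOL-Analysis.Analysis" "HOL-Real_Asymp.Real_Asymp"
begin

text \<open>The number of residues \<open>r\<close> modulo \<open>q\<^sup>2\<close> with \<open>r ^ q = r\<close> is \<open>q\<close>. Hence the squarefree integers \<open>m\<close> with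
\<open>\<not> q\<^sup>2 dvd m ^ q - m\<close> for every prime \<open>q\<close> dividing \<open>n\<close> have density
\<open>\<Prod>p. 1 - 1 / p\<^sup>2\<close> corrected by the factor \<open>(1 - 1 / q) / (1 - 1 / q\<^sup>2) = q / (q + 1)\<close> at each such \<open>q\<close>
(\<open>density_good\<close>). These \<open>m\<close> are exactly the ones for which \<open>\<int>[\<alpha>]\<close> is the full ring of integers: at a prime
dividing \<open>m\<close> the polynomial \<open>X ^ n - m\<close> is Eisenstein (\<open>ramified_prime_maximal\<close>), at a prime \<open>q\<close> dividing \<open>n\<close> but
not \<open>m\<close> the condition makes \<open>\<int>[\<alpha>]\<close> regular (\<open>unramified_prime_maximal\<close>), and no other prime divides the discriminant.
So they give monogenic fields (\<open>good_imp_monogenic\<close>), and it remains to see that all other monogenic \<open>m\<close> together have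
density zero.

Let \<open>q\<close> divide \<open>n\<close>, let \<open>q\<^sup>2\<close> divide \<open>m ^ q - m\<close>, and suppose that the ring of integers is \<open>\<int>[\<theta>]\<close>. Write
\<open>\<alpha>\<^sub>i\<close> and \<open>\<theta>\<^sub>i\<close> for the conjugates. The product \<open>I\<close> of all \<open>(\<alpha>\<^sub>j - \<alpha>\<^sub>i) / (\<theta>\<^sub>j - \<theta>\<^sub>i)\<close> with
\<open>i < j\<close> is, up to sign, the index of \<open>\<int>[\<alpha>]\<close>. It is divisible by \<open>q\<close>, since an explicit integer (\<open>wild_integer\<close>)
lies outside \<open>\<int>[\<alpha>]\<close> (\<open>prime_dvd_index\<close>), and its square divides \<open>n ^ n\<close>. On the other hand \<open>m\<close> is totally ramified, so modulo
every prime dividing \<open>m\<close> all these quotients are congruent to one constant \<open>c\<close>, and \<open>I\<close> is congruent to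
\<open>c ^ (n * (n - 1) div 2)\<close>. The same is true of the partial products over the pairs with \<open>i = j\<close> modulo a prime \<open>l\<close> dividing \<open>n\<close>
(\<open>index_congruence\<close>). Eliminating \<open>c\<close> gives congruences modulo \<open>m\<close> between integers that are bounded in terms of \<open>n\<close>; for large \<open>m\<close>
they are equalities (\<open>index_powers_equal\<close>), and these force \<open>n = q ^ k\<close> and \<open>\<bar>I\<bar> = q ^ W\<close> with \<open>W\<close> prime
to \<open>q\<close> (\<open>index_is_prime_power\<close>). As \<open>q\<close> divides \<open>n * (n - 1) div 2\<close> for \<open>n \<ge> 4\<close>, it follows that \<open>q\<close> or \<open>- q\<close> is a \<open>q\<close>-th power modulo
every prime divisor of \<open>m\<close> (\<open>bad_monogenic_imp_power_residue\<close>).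

Such \<open>m\<close> are rare (\<open>density_power_residue_set\<close>). If \<open>b\<close> is a \<open>q\<close>-th power modulo all primes dividing the squarefree \<open>m\<close>, then
\<open>x ^ q = b\<close> has at least \<open>2 ^ k\<close> solutions modulo \<open>m\<close>, where \<open>k\<close> counts the prime divisors of \<open>m\<close> that are \<open>1\<close> modulo
\<open>q\<close>. On average over \<open>m\<close> the number of solutions is bounded (\<open>card_root_pairs_le\<close>), whereas almost all integers have
more than any given number of prime divisors that are \<open>1\<close> modulo \<open>q\<close>, because the reciprocals of these primes have a
divergent sum (\<open>reciprocal_primes_1_mod_prime_not_summable\<close>).\<close>

hide_const (open) Determinants.det Finite_Cartesian_Product.mat Finite_Cartesian_Product.vec
  Finite_Cartesian_Product.row Finite_Cartesian_Product.column
no_notation Finite_Cartesian_Product.vec.vec_nth (infixl "$" 90)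
no_notation Formal_Power_Series.fps.fps_nth (infixl "$" 75)
no_notation Matrix.scalar_prod (infix "\<bullet>" 70)

section \<open>Densities of sets defined by congruences\<close>

lemma finite_int_abs_le: "finite {m \<in> A. real_of_int \<bar>m\<bar> \<le> x}"
proof (rule finite_subset)
  show "{m \<in> A. real_of_int \<bar>m\<bar> \<le> x} \<subseteq> {- \<lceil>x\<rceil>..\<lceil>x\<rceil>}"
    by (auto simp: abs_le_iff) linarith+
qed simp

lemma density_finite: assumes "finite A" shows "has_two_sided_density A 0"
  unfolding has_two_sided_density_def
proof (rule Lim_null_comparison)
  show "\<forall>\<^sub>F x in at_top. norm (real (card {m \<in> A. real_of_int \<bar>m\<bar> \<le> x}) / (2 * x)) \<le> real (card A) / (2 * x)"
    using eventually_gt_at_top[of 0] 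
    by eventually_elim (auto intro!: divide_right_mono card_mono assms)
  show "((\<lambda>x. real (card A) / (2 * x)) \<longlongrightarrow> 0) at_top"
    by real_asymp
qed

lemma residue_class_count:
  fixes c u :: int and x :: real
  assumes "c > 0" "x \<ge> 0"
  shows "\<bar>real (card {m \<in> {m. m mod c = u mod c}. real_of_int \<bar>m\<bar> \<le> x}) - 2 * x / c\<bar> \<le> 1"
proof -
  define lo hi where "lo = \<lceil>(- x - u) / c\<rceil>" and "hi = \<lfloor>(x - u) / c\<rfloor>"
  have "{m \<in> {m. m mod c = u mod c}. real_of_int \<bar>m\<bar> \<le> x} = (\<lambda>k. u + c * k) ` {lo..hi}"
  proof (intro equalityI subsetI)
    fix m assume m: "m \<in> {m \<in> {m. m mod c = u mod c}. real_of_int \<bar>m\<bar> \<le> x}"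
    then have "c dvd m - u" by (simp add: mod_eq_dvd_iff)
    then obtain k where k: "m = u + c * k" by (metis add.commute diff_add_cancel dvdE)
    have "- x \<le> u + c * real_of_int k" "u + c * real_of_int k \<le> x" using m k by (auto simp: abs_le_iff)
    then have "k \<in> {lo..hi}" using assms
      by (auto simp: lo_def hi_def ceiling_le_iff le_floor_iff field_simps)
    then show "m \<in> (\<lambda>k. u + c * k) ` {lo..hi}" using k by auto
  next
    fix m assume "m \<in> (\<lambda>k. u + c * k) ` {lo..hi}"
    then obtain k where k: "m = u + c * k" "lo \<le> k" "k \<le> hi" by (elim imageE) auto
    have "- x \<le> u + c * real_of_int k" "u + c * real_of_int k \<le> x" using k assms
      by (auto simp: lo_def hi_def ceiling_le_iff le_floor_iff field_simps)
    then show "m \<in> {m \<in> {m. m mod c = u mod c}. real_of_int \<bar>m\<bar> \<le> x}"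
      using k by (auto simp: abs_le_iff)
  qed
  moreover have "inj_on (\<lambda>k. u + c * k) {lo..hi}" using assms by (auto simp: inj_on_def)
  ultimately have "card {m \<in> {m. m mod c = u mod c}. real_of_int \<bar>m\<bar> \<le> x} = nat (hi - lo + 1)"
    by (simp add: card_image)
  moreover have "(x - u) / c - (- x - u) / c = 2 * x / c" using assms by (simp add: field_simps)
  moreover have "2 * x / c \<ge> 0" using assms by auto
  ultimately show ?thesis unfolding lo_def hi_def by linarith
qed

lemma density_residue_class:
  fixes c u :: int
  assumes "c > 0"
  shows "has_two_sided_density {m. m mod c = u mod c} (1 / c)"
proof -
  let ?f = "\<lambda>x. real (card {m \<in> {m. m mod c = u mod c}. real_of_int \<bar>m\<bar> \<le> x})"
  have "((\<lambda>x. ?f x / (2 * x) - 1 / c) \<longlongrightarrow> 0) at_top"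
  proof (rule Lim_null_comparison)
    show "\<forall>\<^sub>F x in at_top. norm (?f x / (2 * x) - 1 / c) \<le> 1 / (2 * x)"
      using eventually_gt_at_top[of 0]
    proof eventually_elim
      case (elim x)
      have "?f x / (2 * x) - 1 / c = (?f x - 2 * x / c) / (2 * x)"
        using elim assms by (simp add: field_simps)
      then have "norm (?f x / (2 * x) - 1 / c) = \<bar>?f x - 2 * x / c\<bar> / (2 * x)" using elim by (simp del: of_int_abs)
      also have "\<dots> \<le> 1 / (2 * x)" using residue_class_count[OF assms, of x u] elim
        by (intro divide_right_mono) auto
      finally show ?case .
    qed
    show "((\<lambda>x::real. 1 / (2 * x)) \<longlongrightarrow> 0) at_top" by real_asymp
  qed
  then show ?thesis unfolding has_two_sided_density_def by (rule LIM_zero_cancel)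
qed

lemma density_disjoint_Union:
  assumes "finite R" "\<And>r. r \<in> R \<Longrightarrow> has_two_sided_density (A r) (d r)"
    and "disjoint_family_on A R"
  shows "has_two_sided_density (\<Union>r\<in>R. A r) (\<Sum>r\<in>R. d r)"
proof -
  have eq: "real (card {m \<in> (\<Union>r\<in>R. A r). real_of_int \<bar>m\<bar> \<le> x}) / (2 * x)
     = (\<Sum>r\<in>R. real (card {m \<in> A r. real_of_int \<bar>m\<bar> \<le> x}) / (2 * x))" for x
  proof -
    have "{m \<in> (\<Union>r\<in>R. A r). real_of_int \<bar>m\<bar> \<le> x} = (\<Union>r\<in>R. {m \<in> A r. real_of_int \<bar>m\<bar> \<le> x})" by auto
    also have "card \<dots> = (\<Sum>r\<in>R. card {m \<in> A r. real_of_int \<bar>m\<bar> \<le> x})"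
      using assms by (intro card_UN_disjoint) (auto simp: finite_int_abs_le[simplified] disjoint_family_on_def)
    finally show ?thesis by (simp add: sum_divide_distrib)
  qed
  show ?thesis unfolding has_two_sided_density_def eq
    using assms(2) unfolding has_two_sided_density_def by (intro tendsto_sum)
qed

text \<open>The Chinese remainder theorem as an induction on \<open>I\<close>: the additional residue class modulo \<open>c\<close>, coprime to the remaining moduli, absorbs one modulus after the other.\<close>

lemma density_congruences_aux:
  fixes a :: "'i \<Rightarrow> int"
  assumes "finite I" "\<And>i. i \<in> I \<Longrightarrow> a i > 0"
    and "\<And>i j. i \<in> I \<Longrightarrow> j \<in> I \<Longrightarrow> i \<noteq> j \<Longrightarrow> coprime (a i) (a j)"
    and "\<And>i. i \<in> I \<Longrightarrow> R i \<subseteq> {0..<a i}"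
    and "c > 0" "\<And>i. i \<in> I \<Longrightarrow> coprime c (a i)"
  shows "has_two_sided_density {m. m mod c = u mod c \<and> (\<forall>i\<in>I. m mod a i \<in> R i)}
           (1 / c * (\<Prod>i\<in>I. card (R i) / a i))"
  using assms
proof (induction I arbitrary: c u rule: finite_induct)
  case empty
  then show ?case using density_residue_class by simp
next
  case (insert i I)
  have ai: "a i > 0" "coprime c (a i)" and Ri: "R i \<subseteq> {0..<a i}" "finite (R i)"
    using insert.prems finite_subset[of "R i" "{0..<a i}"] by auto
  have "\<exists>v. \<forall>m. (m mod (c * a i) = v mod (c * a i)) = (m mod c = u mod c \<and> m mod a i = r mod a i)" for r
  proof -
    obtain v where v: "[v = u] (mod c)" "[v = r] (mod a i)"
      using binary_chinese_remainder_int ai by blast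
    have "(m mod (c * a i) = v mod (c * a i)) = (m mod c = u mod c \<and> m mod a i = r mod a i)" for m
    proof -
      have "[m = v] (mod c * a i) \<longleftrightarrow> [m = v] (mod c) \<and> [m = v] (mod a i)"
        using coprime_cong_mult ai(2) by (meson cong_dvd_modulus dvd_triv_left dvd_triv_right)
      then show ?thesis using v unfolding unique_euclidean_semiring_class.cong_def by metis
    qed
    then show ?thesis by blast
  qed
  then obtain v where v: "\<And>r m. (m mod (c * a i) = v r mod (c * a i)) = (m mod c = u mod c \<and> m mod a i = r mod a i)"
    by metis
  define B where "B r = {m. m mod (c * a i) = v r mod (c * a i) \<and> (\<forall>j\<in>I. m mod a j \<in> R j)}" for r
  have "has_two_sided_density (B r) (1 / (c * a i) * (\<Prod>j\<in>I. card (R j) / a j))" if "r \<in> R i" for r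
    unfolding B_def of_int_mult[symmetric]
  proof (rule insert.IH)
    show "coprime (c * a i) (a j)" if "j \<in> I" for j
      using insert.prems(2)[of i j] insert.prems(5)[of j] insert.hyps that by auto
  qed (use insert ai in auto)
  then have "has_two_sided_density (\<Union>r\<in>R i. B r) (\<Sum>r\<in>R i. 1 / (c * a i) * (\<Prod>j\<in>I. card (R j) / a j))"
  proof (intro density_disjoint_Union)
    have red: "r mod a i = r" if "r \<in> R i" for r
      using that Ri(1) by (intro mod_pos_pos_trivial) auto
    show "disjoint_family_on B (R i)"
      unfolding disjoint_family_on_def
    proof (intro ballI impI)
      fix r s assume rs: "r \<in> R i" "s \<in> R i" "r \<noteq> s"
      show "B r \<inter> B s = {}"
      proof (rule ccontr)
        assume "B r \<inter> B s \<noteq> {}"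
        then obtain m where "m \<in> B r" "m \<in> B s" by blast
        then have "m mod a i = r mod a i" "m mod a i = s mod a i" unfolding B_def using v by blast+
        then show False using rs red by metis
      qed
    qed
  qed (use Ri in auto)
  moreover have "(\<Union>r\<in>R i. B r) = {m. m mod c = u mod c \<and> (\<forall>j\<in>insert i I. m mod a j \<in> R j)}"
    using Ri(1) by (auto simp: B_def v)
  moreover have "(\<Sum>r\<in>R i. 1 / (c * a i) * (\<Prod>j\<in>I. card (R j) / a j)) = 1 / c * (\<Prod>j\<in>insert i I. card (R j) / a j)"
    using insert.hyps by simp
  ultimately show ?case by simp
qed

lemma density_congruences:
  fixes a :: "'i \<Rightarrow> int"
  assumes "finite I" "\<And>i. i \<in> I \<Longrightarrow> a i > 0"
    and "\<And>i j. i \<in> I \<Longrightarrow> j \<in> I \<Longrightarrow> i \<noteq> j \<Longrightarrow> coprime (a i) (a j)"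
    and "\<And>i. i \<in> I \<Longrightarrow> R i \<subseteq> {0..<a i}"
  shows "has_two_sided_density {m. \<forall>i\<in>I. m mod a i \<in> R i} (\<Prod>i\<in>I. card (R i) / a i)"
  using density_congruences_aux[OF assms, where c = 1 and u = 0] by simp

section \<open>Euler products and partial summation\<close>

text \<open>Eratosthenes: multiplying the sum over the \<open>n\<close> that survive \<open>P\<close> by \<open>1 - f p\<close> removes the multiples of \<open>p\<close>.\<close>

lemma rough_sum_times_Euler_factor:
  fixes f :: "nat \<Rightarrow> 'a :: {real_normed_field, banach}"
  assumes summ: "(\<lambda>n. norm (f n)) summable_on UNIV"
    and mult: "\<And>m n. f (m * n) = f m * f n"
    and P: "finite P" "\<And>p. p \<in> P \<Longrightarrow> prime p"
  shows "infsum f UNIV * (\<Prod>p\<in>P. 1 - f p) = infsum f {n. \<forall>p\<in>P. \<not> p dvd n}"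
  using P
proof (induction P rule: finite_induct)
  case empty
  then show ?case by simp
next
  case (insert p P)
  have sm: "f summable_on A" for A
    using summ abs_summable_summable summable_on_subset_banach by blast
  define A where "A = {n. \<forall>q\<in>P. \<not> q dvd n}"
  have p: "prime p" using insert by auto
  have pA: "p * n \<in> A \<longleftrightarrow> n \<in> A" for n
  proof -
    have "q dvd p * n \<longleftrightarrow> q dvd n" if "q \<in> P" for q
    proof -
      have "prime q" "q \<noteq> p" using insert that by auto
      then show ?thesis using p prime_dvd_mult_iff primes_dvd_imp_eq by blast
    qed
    then show ?thesis by (auto simp: A_def)
  qed
  have "{n. \<forall>q\<in>insert p P. \<not> q dvd n} = A - (\<lambda>n. p * n) ` A"
    using pA by (auto simp: A_def elim!: dvdE)
  moreover have "(\<lambda>n. p * n) ` A \<subseteq> A" using pA by auto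
  ultimately have "infsum f {n. \<forall>q\<in>insert p P. \<not> q dvd n} = infsum f A - infsum f ((\<lambda>n. p * n) ` A)"
    using infsum_Diff[OF sm sm] by metis
  also have "infsum f ((\<lambda>n. p * n) ` A) = infsum (f \<circ> (\<lambda>n. p * n)) A"
    using p by (intro infsum_reindex) (auto simp: inj_on_def)
  also have "\<dots> = f p * infsum f A"
    by (simp add: o_def mult infsum_cmult_right')
  finally show ?case using insert by (simp add: A_def algebra_simps)
qed

text \<open>After sieving by all primes up to \<open>x\<close>, apart from \<open>n = 1\<close> only terms beyond \<open>x\<close> are left, and they are bounded by a tail of the series. The product form avoids dividing by Euler factors.\<close>

lemma Euler_product_tendsto:
  fixes f :: "nat \<Rightarrow> 'a :: {real_normed_field, banach}"
  assumes summ: "summable (\<lambda>n. norm (f n))"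
    and mult: "\<And>m n. f (m * n) = f m * f n" and f0: "f 0 = 0" and f1: "f 1 = 1"
  shows "(\<lambda>x. suminf f * (\<Prod>p | prime p \<and> p \<le> x. 1 - f p)) \<longlonglongrightarrow> 1"
proof -
  have summ': "(\<lambda>n. norm (f n)) summable_on UNIV"
    using summ by (simp add: summable_on_UNIV_nonneg_real_iff)
  have sm: "f summable_on A" for A
    using summ' abs_summable_summable summable_on_subset_banach by blast
  have smn: "(\<lambda>n. norm (f n)) summable_on A" for A
    using summ' summable_on_subset_banach by blast
  have "f sums infsum f UNIV" using sm[of UNIV] by (intro has_sum_imp_sums) simp
  then have suminf: "suminf f = infsum f UNIV" by (simp add: sums_iff)
  have bound: "norm (suminf f * (\<Prod>p | prime p \<and> p \<le> x. 1 - f p) - 1) \<le> suminf (\<lambda>n. norm (f (n + x)))" if "x \<ge> 1" for x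
  proof -
    define A where "A = {n. \<forall>p\<in>{p. prime p \<and> p \<le> x}. \<not> p dvd n}"
    have "suminf f * (\<Prod>p | prime p \<and> p \<le> x. 1 - f p) = infsum f A"
      unfolding suminf A_def by (rule rough_sum_times_Euler_factor[OF summ' mult]) auto
    also have "A = insert 1 (A - {1})" by (auto simp: A_def)
    also have "infsum f \<dots> = f 1 + infsum f (A - {1})"
      using sm by (subst infsum_insert) auto
    finally have "norm (suminf f * (\<Prod>p | prime p \<and> p \<le> x. 1 - f p) - 1) = norm (infsum f (A - {1}))"
      using f1 by simp
    also have "\<dots> \<le> infsum (\<lambda>n. norm (f n)) (A - {1})"
      by (rule norm_infsum_bound) (rule smn)
    also have "\<dots> \<le> infsum (\<lambda>n. norm (f n)) {x..}"
    proof (rule infsum_mono_neutral)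
      fix n assume n: "n \<in> A - {1} - {x..}"
      show "norm (f n) \<le> 0"
      proof (cases "n = 0")
        case False
        then obtain p where p: "prime p" "p dvd n" using n prime_factor_nat[of n] by auto
        then have "p \<le> x" using n False dvd_imp_le[of p n] by auto
        then show ?thesis using p n by (auto simp: A_def)
      qed (use f0 in auto)
    qed (use smn in auto)
    also have "{x..} = (\<lambda>n. n + x) ` UNIV" 
      by (auto simp: image_iff) (metis add.commute le_Suc_ex)
    also have "infsum (\<lambda>n. norm (f n)) \<dots> = infsum (\<lambda>n. norm (f (n + x))) UNIV"
      by (subst infsum_reindex) (auto simp: o_def)
    also have "\<dots> = suminf (\<lambda>n. norm (f (n + x)))"
    proof -
      have "summable (\<lambda>n. norm (f (n + x)))" using summ by (subst summable_iff_shift)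
      then show ?thesis by (intro infsum_nonneg_is_SUPREMUM_real[THEN trans] sums_unique) 
        (auto simp: summable_on_UNIV_nonneg_real_iff intro!: has_sum_imp_sums)
    qed
    finally show ?thesis .
  qed
  have "(\<lambda>x. suminf (\<lambda>n. norm (f (n + x)))) \<longlonglongrightarrow> 0"
    using suminf_exist_split2[OF summ] .
  then have "(\<lambda>x. suminf f * (\<Prod>p | prime p \<and> p \<le> x. 1 - f p) - 1) \<longlonglongrightarrow> 0"
    by (rule Lim_null_comparison[rotated]) (use bound in \<open>auto simp: eventually_sequentially\<close>)
  then show ?thesis by (rule LIM_zero_cancel)
qed

lemma prime_square_product_tendsto:
  "(\<lambda>x. \<Prod>p | prime p \<and> p \<le> x. 1 - 1 / (real p)\<^sup>2) \<longlonglongrightarrow> 6 / pi\<^sup>2"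
proof -
  define f where "f n = 1 / (real n)\<^sup>2" for n
  have "(\<lambda>n. f (n + 1)) sums (pi\<^sup>2 / 6)" using inverse_squares_sums by (simp add: f_def)
  then have s: "f sums (pi\<^sup>2 / 6)" using sums_iff_shift[of f 1 "pi\<^sup>2/6"] by (simp add: f_def)
  have "(\<lambda>x. suminf f * (\<Prod>p | prime p \<and> p \<le> x. 1 - f p)) \<longlonglongrightarrow> 1"
    proof (rule Euler_product_tendsto)
    show "summable (\<lambda>n. norm (f n))" using s by (simp add: sums_iff f_def[abs_def])
  qed (auto simp: f_def power_mult_distrib)
  then have "(\<lambda>x. 6 / pi\<^sup>2 * (suminf f * (\<Prod>p | prime p \<and> p \<le> x. 1 - f p))) \<longlonglongrightarrow> 6 / pi\<^sup>2 * 1"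
    by (intro tendsto_intros)
  moreover have "suminf f = pi\<^sup>2 / 6" using s by (simp add: sums_iff)
  ultimately show ?thesis by (simp add: f_def field_simps)
qed

text \<open>Partial summation. For \<open>h n = n powr -1 - n powr -s\<close> the total variation is of order \<open>s - 1\<close>, so keeping it in the bound makes this lemma yield a Lipschitz estimate at \<open>1\<close> as well as convergence.\<close>

lemma Abel_sums:
  fixes f :: "nat \<Rightarrow> complex" and h :: "nat \<Rightarrow> real"
  assumes f0: "f 0 = 0" and B: "\<And>N. norm (\<Sum>n<N. f n) \<le> B"
    and h: "h \<longlonglongrightarrow> 0" and v: "summable (\<lambda>n. \<bar>h (Suc n) - h (Suc (Suc n))\<bar>)"
  shows "summable (\<lambda>n. f n * h n)"
    and "norm (\<Sum>n. f n * h n) \<le> B * (\<Sum>n. \<bar>h (Suc n) - h (Suc (Suc n))\<bar>)"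
proof -
  define Xs where "Xs N = (\<Sum>n<N. f n)" for N
  define t where "t n = Xs (Suc (Suc n)) * (h (Suc n) - h (Suc (Suc n)))" for n
  have tb: "norm (t n) \<le> B * \<bar>h (Suc n) - h (Suc (Suc n))\<bar>" for n
    unfolding t_def norm_mult using B[of "Suc (Suc n)"]
    by (simp add: Xs_def mult_right_mono flip: of_real_diff)
  have st: "summable (\<lambda>n. norm (t n))"
    by (rule summable_comparison_test'[OF summable_mult[OF v, of B]]) (use tb in auto)
  have part: "(\<Sum>n<Suc N. f n * h n) = (\<Sum>n<N. t n) + Xs (Suc N) * h (Suc N)" for N
  proof (induction N)
    case 0
    show ?case using f0 by (simp add: Xs_def)
  next
    case (Suc N)
    have "f (Suc N) = Xs (Suc (Suc N)) - Xs (Suc N)" by (simp add: Xs_def)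
    then show ?case using Suc by (simp add: t_def ring_distribs)
  qed
  have "(\<lambda>N. (\<Sum>n<N. t n) + Xs (Suc N) * h (Suc N)) \<longlonglongrightarrow> suminf t + 0"
  proof (rule tendsto_add)
    show "(\<lambda>N. \<Sum>n<N. t n) \<longlonglongrightarrow> suminf t"
      using summable_norm_cancel[OF st] by (rule summable_LIMSEQ)
    show "(\<lambda>N. Xs (Suc N) * h (Suc N)) \<longlonglongrightarrow> 0"
    proof (rule Lim_null_comparison)
      show "\<forall>\<^sub>F N in sequentially. norm (Xs (Suc N) * h (Suc N)) \<le> B * \<bar>h (Suc N)\<bar>"
        using mult_right_mono[OF B] by (auto simp: norm_mult Xs_def simp del: sum.lessThan_Suc intro!: always_eventually)
      have "(\<lambda>N. B * \<bar>h (Suc N)\<bar>) \<longlonglongrightarrow> B * \<bar>0\<bar>"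
        using h by (intro tendsto_intros) (rule LIMSEQ_Suc)
      then show "(\<lambda>N. B * \<bar>h (Suc N)\<bar>) \<longlonglongrightarrow> 0" by simp
    qed
  qed
  then have "(\<lambda>N. \<Sum>n<Suc N. f n * h n) \<longlonglongrightarrow> suminf t" by (simp only: part) simp
  then have "(\<lambda>n. f n * h n) sums suminf t" unfolding sums_def by (rule LIMSEQ_imp_Suc)
  then show "summable (\<lambda>n. f n * h n)" and "norm (\<Sum>n. f n * h n) \<le> B * (\<Sum>n. \<bar>h (Suc n) - h (Suc (Suc n))\<bar>)"
  proof (simp_all add: sums_iff)
    have "norm (suminf t) \<le> (\<Sum>n. norm (t n))" by (rule summable_norm[OF st])
    also have "\<dots> \<le> (\<Sum>n. B * \<bar>h (Suc n) - h (Suc (Suc n))\<bar>)"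
      by (intro suminf_le tb st summable_mult v)
    finally show "norm (suminf t) \<le> B * (\<Sum>n. \<bar>h (Suc n) - h (Suc (Suc n))\<bar>)"
      using suminf_mult[OF v] by simp
  qed
qed

lemma Abel_sums_antimono:
  fixes f :: "nat \<Rightarrow> complex" and h :: "nat \<Rightarrow> real"
  assumes f0: "f 0 = 0" and B: "\<And>N. norm (\<Sum>n<N. f n) \<le> B"
    and h: "h \<longlonglongrightarrow> 0" and m: "\<And>n. n > 0 \<Longrightarrow> h (Suc n) \<le> h n"
  shows "summable (\<lambda>n. f n * h n)" and "norm (\<Sum>n. f n * h n) \<le> B * h 1"
proof -
  have "(\<lambda>n. h (Suc n) - h (Suc (Suc n))) sums (h (Suc 0) - 0)"
    using LIMSEQ_Suc[OF h] by (rule telescope_sums')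
  then have s: "(\<lambda>n. \<bar>h (Suc n) - h (Suc (Suc n))\<bar>) sums h 1"
    using m by (simp add: abs_of_nonneg)
  show "summable (\<lambda>n. f n * h n)" and "norm (\<Sum>n. f n * h n) \<le> B * h 1"
    using Abel_sums[OF f0 B h] s by (auto simp: sums_iff)
qed

text \<open>Full periods contribute nothing, so every partial sum is a sum over less than one period.\<close>

lemma periodic_partial_sums_bounded:
  fixes f :: "nat \<Rightarrow> complex"
  assumes per: "\<And>n. f (n + l) = f n" and z: "(\<Sum>n<l. f n) = 0" and b: "\<And>n. norm (f n) \<le> 1" and l: "l > 0"
  shows "norm (\<Sum>n<N. f n) \<le> l"
proof (induction N rule: less_induct)
  case (less N)
  show ?case
  proof (cases "N < l")
    case True
    have "norm (\<Sum>n<N. f n) \<le> of_nat (card {..<N}) * 1" by (intro sum_norm_bound b)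
    then show ?thesis using True by simp
  next
    case False
    then obtain M where M: "N = l + M" by (metis le_add_diff_inverse not_less)
    have "(\<Sum>n<l + M. f n) = (\<Sum>n<l. f n) + (\<Sum>n<M. f (n + l))"
      by (induction M) (auto simp: add.commute add.assoc add.left_commute)
    then have "(\<Sum>n<N. f n) = (\<Sum>n<M. f n)" using z per M by simp
    then show ?thesis using less[of M] M l by simp
  qed
qed

section \<open>Analytic estimates near 1 and products over roots of unity\<close>

text \<open>Comparison with the telescoping series of \<open>x powr (1 - s) / (s - 1)\<close>, the primitive of \<open>- x powr -s\<close>.\<close>

lemma zeta_telescope_bounds:
  fixes s :: real
  assumes "1 < s"
  shows "summable (\<lambda>n. real (Suc n) powr -s)" (is ?A)
    and "1 / (s - 1) \<le> (\<Sum>n. real (Suc n) powr -s)" (is ?B)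
    and "(\<Sum>n. real (Suc n) powr -s) \<le> 1 + 1 / (s - 1)" (is ?C)
proof -
  define g where "g x = x powr (1 - s) / (s - 1)" for x :: real
  have step: "real (Suc (Suc n)) powr -s \<le> g (real (Suc n)) - g (real (Suc (Suc n)))
      \<and> g (real (Suc n)) - g (real (Suc (Suc n))) \<le> real (Suc n) powr -s" for n
  proof -
    have "\<exists>z. real (Suc n) < z \<and> z < real (Suc (Suc n)) \<and>
       g (real (Suc (Suc n))) - g (real (Suc n)) = (real (Suc (Suc n)) - real (Suc n)) * (- (z powr -s))"
    proof (rule MVT2)
      fix x assume "real (Suc n) \<le> x" "x \<le> real (Suc (Suc n))"
      then have "x > 0" by simp
      then show "(g has_real_derivative - (x powr -s)) (at x)"
        unfolding g_def using assms DERIV_cdivide[OF has_real_derivative_powr[OF \<open>x > 0\<close>, of "1 - s"], of "s - 1"]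
        by (elim DERIV_cong) (simp add: field_simps)
    qed simp
    then obtain z where z: "real (Suc n) < z" "z < real (Suc (Suc n))"
      "g (real (Suc (Suc n))) - g (real (Suc n)) = - (z powr -s)" by auto
    have "z powr -s \<le> real (Suc n) powr -s" "real (Suc (Suc n)) powr -s \<le> z powr -s"
      using z assms by (auto intro!: powr_mono2')
    then show ?thesis using z by linarith
  qed
  have g0: "(\<lambda>n. g (real (Suc n))) \<longlonglongrightarrow> 0"
    unfolding g_def using assms by real_asymp
  have tel: "(\<lambda>n. g (real (Suc n)) - g (real (Suc (Suc n)))) sums (1 / (s - 1))"
    using telescope_sums'[OF g0] assms by (simp add: g_def)
  have "summable (\<lambda>n. real (Suc (Suc n)) powr -s)"
    by (rule summable_comparison_test'[OF sums_summable[OF tel]]) (use step in auto)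
  then show A: ?A using summable_Suc_iff[of "\<lambda>n. real (Suc n) powr -s"] by simp
  show ?B using suminf_le[OF _ sums_summable[OF tel] A] step tel by (simp add: sums_iff)
  have "(\<Sum>n. real (Suc (Suc n)) powr -s) \<le> 1 / (s - 1)"
    using suminf_le[OF _ _ sums_summable[OF tel], of "\<lambda>n. real (Suc (Suc n)) powr -s"] step tel A
      summable_Suc_iff[of "\<lambda>n. real (Suc n) powr -s"] by (simp add: sums_iff)
  then show ?C using suminf_split_head[OF A] by simp
qed

text \<open>The function \<open>x powr -1 - x powr -s\<close> has total variation of order \<open>s - 1\<close>, uniformly in \<open>s\<close>; this is what replaces differentiability of \<open>L\<close>-functions at \<open>1\<close>.\<close>

lemma powr_difference_variation:
  "\<exists>C. \<forall>s::real. 1 < s \<longrightarrow> s \<le> 2 \<longrightarrow>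
     summable (\<lambda>n. \<bar>(real (Suc n) powr -1 - real (Suc n) powr -s) - (real (Suc (Suc n)) powr -1 - real (Suc (Suc n)) powr -s)\<bar>) \<and>
     (\<Sum>n. \<bar>(real (Suc n) powr -1 - real (Suc n) powr -s) - (real (Suc (Suc n)) powr -1 - real (Suc (Suc n)) powr -s)\<bar>) \<le> C * (s - 1)"
proof -
  have summ: "summable (\<lambda>n. real (Suc n) powr -(3/2))" by (rule zeta_telescope_bounds) simp
  define C where "C = 2 * (\<Sum>n. real (Suc n) powr -(3/2))"
  have "summable (\<lambda>n. \<bar>(real (Suc n) powr -1 - real (Suc n) powr -s) - (real (Suc (Suc n)) powr -1 - real (Suc (Suc n)) powr -s)\<bar>) \<and>
     (\<Sum>n. \<bar>(real (Suc n) powr -1 - real (Suc n) powr -s) - (real (Suc (Suc n)) powr -1 - real (Suc (Suc n)) powr -s)\<bar>) \<le> C * (s - 1)"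
    if s: "1 < s" "s \<le> 2" for s :: real
  proof -
    define k where "k x = x powr -1 - x powr -s" for x :: real
    have step: "\<bar>k (real (Suc n)) - k (real (Suc (Suc n)))\<bar> \<le> 2 * (s - 1) * real (Suc n) powr -(3/2)" for n
    proof -
      have "\<exists>z. real (Suc n) < z \<and> z < real (Suc (Suc n)) \<and>
         k (real (Suc (Suc n))) - k (real (Suc n)) = (real (Suc (Suc n)) - real (Suc n)) * (- (z powr -2) + s * z powr (-s - 1))"
      proof (rule MVT2)
        fix x assume "real (Suc n) \<le> x" "x \<le> real (Suc (Suc n))"
        then have "x > 0" by simp
        then show "(k has_real_derivative (- (x powr -2) + s * x powr (-s - 1))) (at x)"
          unfolding k_def using DERIV_diff[OF has_real_derivative_powr[OF \<open>x > 0\<close>, of "-1"] has_real_derivative_powr[OF \<open>x > 0\<close>, of "-s"]]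
          by simp
      qed simp
      then obtain z where z: "real (Suc n) < z" "z < real (Suc (Suc n))"
        "k (real (Suc (Suc n))) - k (real (Suc n)) = - (z powr -2) + s * z powr (-s - 1)" by auto
      have z1: "z > 1" using z(1) by simp
      define e where "e = s - 1"
      have e: "0 < e" "s = 1 + e" using s by (auto simp: e_def)
      have le1: "z powr -e \<le> 1" using z1 e using powr_mono[of "-e" 0 z] by simp
      have "1 + -e * ln z \<le> exp (-e * ln z)" by (rule exp_ge_add_one_self)
      then have ge: "1 - e * ln z \<le> z powr -e" using z1 by (simp add: powr_def)
      have lnz: "1 + ln z \<le> 2 * z powr (1/2)"
      proof -
        have "ln (z powr (1/2)) \<le> z powr (1/2) - 1" using z1 by (intro ln_le_minus_one) simp
        moreover have "ln (z powr (1/2)) = 1/2 * ln z" using z1 by (simp add: ln_powr)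
        ultimately show ?thesis by simp
      qed
      have "- (z powr -2) + s * z powr (-s - 1) = z powr -2 * (s * z powr -e - 1)"
      proof -
        have "z powr (-s - 1) = z powr -2 * z powr -e" using z1 e by (simp flip: powr_add)
        then show ?thesis by (simp add: algebra_simps)
      qed
      moreover have "\<bar>s * z powr -e - 1\<bar> \<le> e * (1 + ln z)"
      proof -
        have "s * z powr -e - 1 \<le> e" using le1 e by (simp add: algebra_simps) (smt (verit) mult_left_le)
        moreover have "s * z powr -e - 1 \<ge> - (e * ln z)"
          using ge e by (simp add: algebra_simps) (smt (verit) mult_nonneg_nonneg powr_ge_zero)
        moreover have "e * ln z \<ge> 0" using z1 e by simp
        ultimately show ?thesis using e by (simp add: algebra_simps)
      qed
      ultimately have "\<bar>- (z powr -2) + s * z powr (-s - 1)\<bar> \<le> z powr -2 * (e * (1 + ln z))"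
        by (simp add: abs_mult mult_left_mono)
      also have "\<dots> \<le> z powr -2 * (e * (2 * z powr (1/2)))"
        using lnz e by (intro mult_left_mono) auto
      also have "\<dots> = 2 * e * z powr -(3/2)" by (simp flip: powr_add)
      also have "\<dots> \<le> 2 * e * real (Suc n) powr -(3/2)"
        using z(1) e by (intro mult_left_mono powr_mono2') auto
      finally have "\<bar>k (real (Suc (Suc n))) - k (real (Suc n))\<bar> \<le> 2 * e * real (Suc n) powr -(3/2)"
        unfolding z(3) .
      then show ?thesis by (subst abs_minus_commute) (simp only: e_def)
    qed
    have sm: "summable (\<lambda>n. 2 * (s - 1) * real (Suc n) powr -(3/2))" using summ by (rule summable_mult)
    have "summable (\<lambda>n. \<bar>k (real (Suc n)) - k (real (Suc (Suc n)))\<bar>)"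
      by (rule summable_comparison_test'[OF sm]) (use step in auto)
    moreover from this have "(\<Sum>n. \<bar>k (real (Suc n)) - k (real (Suc (Suc n)))\<bar>) \<le> C * (s - 1)"
      using suminf_le[OF step _ sm] suminf_mult[OF summ, of "2 * (s - 1)"] by (simp add: C_def algebra_simps)
    ultimately show ?thesis by (simp add: k_def)
  qed
  then show ?thesis by blast
qed

text \<open>A convergent product of factors at least \<open>1/2\<close> stays away from zero, by comparison with the exponential of the series.\<close>

lemma prod_one_minus_bounded_below:
  fixes a :: "nat \<Rightarrow> real"
  assumes "summable a" "\<And>n. 0 \<le> a n" "\<And>n. a n \<le> 1/2"
  obtains c where "c > 0" "\<And>A. finite A \<Longrightarrow> c \<le> (\<Prod>n\<in>A. 1 - a n)"
proof
  show "exp (- 2 * suminf a) > 0" by simp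
  fix A :: "nat set" assume A: "finite A"
  have ge: "exp (- 2 * a n) \<le> 1 - a n" for n
  proof -
    have "- a n - 2 * (a n)\<^sup>2 \<le> ln (1 - a n)" using assms by (intro ln_one_minus_pos_lower_bound) auto
    moreover have "2 * (a n)\<^sup>2 \<le> a n" using assms(2,3)[of n] by (simp add: power2_eq_square mult_left_le_one_le mult_le_cancel_left1 algebra_simps) (smt (verit) mult_left_le)
    ultimately have "- 2 * a n \<le> ln (1 - a n)" by simp
    then show ?thesis using assms(3)[of n] by (simp add: ln_ge_iff)
  qed
  have "exp (- 2 * suminf a) \<le> exp (\<Sum>n\<in>A. - 2 * a n)"
    using sum_le_suminf[OF assms(1) A] assms(2) by (simp add: sum_negf sum_distrib_left[symmetric])
  also have "\<dots> = (\<Prod>n\<in>A. exp (- 2 * a n))" using A by (rule exp_sum)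
  also have "\<dots> \<le> (\<Prod>n\<in>A. 1 - a n)" by (intro prod_mono) (use ge in auto)
  finally show "exp (- 2 * suminf a) \<le> (\<Prod>n\<in>A. 1 - a n)" .
qed

lemma prod_minus_powers_of_root:
  fixes w x :: "'a :: field"
  assumes "f > 0" "w ^ f = 1" "\<And>i. 0 < i \<Longrightarrow> i < f \<Longrightarrow> w ^ i \<noteq> 1"
  shows "(\<Prod>k<f. x - w ^ k) = x ^ f - 1"
proof -
  define p where "p = (\<Prod>k<f. [:- (w ^ k), 1:])"
  define q where "q = monom 1 f - 1 - p"
  have w0: "w \<noteq> 0" using assms(1,2) by (auto simp: power_0_left)
  have inj: "inj_on (\<lambda>k. w ^ k) {..<f}"
  proof (rule linorder_inj_onI)
    fix i j assume ij: "i < j" "i \<in> {..<f}" "j \<in> {..<f}"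
    have "w ^ (j - i) \<noteq> 1" using ij by (intro assms(3)) auto
    moreover have "w ^ j = w ^ i * w ^ (j - i)" using ij by (simp flip: power_add)
    ultimately show "w ^ i \<noteq> w ^ j" using w0 by auto
  qed auto
  have degp: "degree p = f" unfolding p_def by (subst degree_prod_eq_sum_degree) auto
  have lcp: "lead_coeff p = 1" unfolding p_def lead_coeff_prod by simp
  have "q = 0"
  proof (rule ccontr)
    assume q: "q \<noteq> 0"
    have "degree q \<le> f" unfolding q_def
      by (intro degree_diff_le) (auto simp: degp degree_monom_le)
    moreover have "coeff q f = 0" using lcp assms(1) by (simp add: q_def degp coeff_1)
    ultimately have dq: "degree q < f" using q
      by (metis le_neq_implies_less leading_coeff_0_iff)
    have "(\<lambda>k. w ^ k) ` {..<f} \<subseteq> {x. poly q x = 0}"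
    proof clarify
      fix k assume "k < f"
      then have "poly p (w ^ k) = 0" by (auto simp: p_def poly_prod intro!: prod_zero)
      moreover have "(w ^ k) ^ f = 1" using assms(2) by (metis power_mult mult.commute power_one)
      ultimately show "poly q (w ^ k) = 0" by (simp add: q_def poly_monom)
    qed
    then have "f \<le> card {x. poly q x = 0}"
      using card_mono[OF poly_roots_finite[OF q]] inj by (metis card_image card_lessThan)
    then show False using poly_roots_degree[OF q] dq by linarith
  qed
  then have "poly p x = x ^ f - 1" by (simp add: q_def poly_monom) (metis (no_types, lifting) diff_eq_diff_eq eq_iff_diff_eq_0 poly_1 poly_diff poly_monom mult_1)
  then show ?thesis by (simp add: p_def poly_prod)
qed

text \<open>Each residue modulo \<open>f\<close> occurs \<open>e\<close> times as an exponent. For a character group this computes the product of the local factors of all \<open>L\<close>-functions at one prime.\<close>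

lemma prod_one_minus_powers_of_root:
  fixes w t :: "'a :: field"
  assumes "f > 0" "w ^ f = 1" "\<And>i. 0 < i \<Longrightarrow> i < f \<Longrightarrow> w ^ i \<noteq> 1"
  shows "(\<Prod>k<f * e. 1 - w ^ k * t) = (1 - t ^ f) ^ e"
proof (induction e)
  case (Suc e)
  have base: "(\<Prod>k<f. 1 - w ^ k * t) = 1 - t ^ f"
  proof (cases "t = 0")
    case False
    have "(\<Prod>k<f. 1 - w ^ k * t) = (\<Prod>k<f. t * (inverse t - w ^ k))"
      using False by (intro prod.cong) (auto simp: field_simps)
    also have "\<dots> = t ^ f * (inverse t ^ f - 1)"
      by (simp add: prod.distrib prod_minus_powers_of_root[OF assms])
    finally show ?thesis using False by (simp add: right_diff_distrib power_inverse)
  qed (use assms in \<open>simp add: power_0_left\<close>)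
  have "(\<Prod>k<f * Suc e. 1 - w ^ k * t) = (\<Prod>k<f * e + f. 1 - w ^ k * t)" by (simp add: add.commute)
  also have "\<dots> = (\<Prod>k<f * e. 1 - w ^ k * t) * (\<Prod>k<f. 1 - w ^ (f * e + k) * t)"
  proof -
    have "(\<Prod>k<a + b. h k) = (\<Prod>k<a. h k) * (\<Prod>k<b. h (a + k))" for a b and h :: "nat \<Rightarrow> 'a"
      by (induction b) (auto simp: mult.assoc)
    then show ?thesis by blast
  qed
  also have "(\<Prod>k<f. 1 - w ^ (f * e + k) * t) = (\<Prod>k<f. 1 - w ^ k * t)"
    by (simp add: power_add power_mult assms(2))
  finally show ?case by (simp add: Suc base)
qed simp

section \<open>Nonvanishing at 1 for real characters\<close>

lemma sum_divisors_prime_power_mult: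
  fixes f :: "nat \<Rightarrow> real"
  assumes mult: "\<And>m n. f (m * n) = f m * f n" and f1: "f 1 = 1"
    and p: "prime p" "\<not> p dvd M" and M: "M > 0"
  shows "(\<Sum>d | d dvd p ^ a * M. f d) = (\<Sum>i\<le>a. f p ^ i) * (\<Sum>d | d dvd M. f d)"
proof -
  have fpow: "f (p ^ i) = f p ^ i" for i by (induction i) (use mult f1 in auto)
  have "{d. d dvd p ^ a * M} = (\<lambda>(i, d). p ^ i * d) ` ({..a} \<times> {d. d dvd M})"
  proof (intro equalityI subsetI)
    fix d assume "d \<in> {d. d dvd p ^ a * M}"
    then obtain b c where bc: "d = b * c" "b dvd p ^ a" "c dvd M" using division_decomp by blast
    then obtain i where "i \<le> a" "b = p ^ i" using divides_primepow_nat[OF p(1)] by auto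
    then show "d \<in> (\<lambda>(i, d). p ^ i * d) ` ({..a} \<times> {d. d dvd M})" using bc by auto
  qed (auto intro!: mult_dvd_mono le_imp_power_dvd)
  moreover have "inj_on (\<lambda>(i, d). p ^ i * d) ({..a} \<times> {d. d dvd M})"
  proof (rule inj_onI, clarify)
    fix i d j e assume h: "d dvd M" "e dvd M" "p ^ i * d = p ^ j * e"
    have nd: "\<not> p dvd d" "\<not> p dvd e" "d > 0" "e > 0" using h p M dvd_trans by (auto intro: Nat.gr0I)
    have "multiplicity p (p ^ i * d) = i" "multiplicity p (p ^ j * e) = j"
      using nd p by (auto simp: prime_elem_multiplicity_mult_distrib not_dvd_imp_multiplicity_0 multiplicity_same_power)
    then show "i = j \<and> d = e" using h p by auto
  qed
  ultimately have "(\<Sum>d | d dvd p ^ a * M. f d) = (\<Sum>(i, d)\<in>{..a} \<times> {d. d dvd M}. f (p ^ i * d))"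
    by (simp add: sum.reindex case_prod_unfold)
  also have "\<dots> = (\<Sum>i\<le>a. \<Sum>d | d dvd M. f p ^ i * f d)"
    by (simp add: sum.cartesian_product mult fpow)
  finally show ?thesis by (simp add: sum_product)
qed

text \<open>Multiplicativity reduces to prime powers, where the divisor sum is \<open>1 + f p + ... + f p ^ a\<close> with \<open>f p\<close> in \<open>{-1, 0, 1}\<close>; it is nonnegative, and at least \<open>1\<close> when \<open>a\<close> is even.\<close>

lemma sum_divisors_real_character:
  fixes f :: "nat \<Rightarrow> real"
  assumes mult: "\<And>m n. f (m * n) = f m * f n" and f1: "f 1 = 1" and val: "\<And>n. f n \<in> {-1, 0, 1}"
  shows "N > 0 \<Longrightarrow> (\<Sum>d | d dvd N. f d) \<ge> 0" and "k > 0 \<Longrightarrow> (\<Sum>d | d dvd k ^ 2. f d) \<ge> 1"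
proof -
  have geo: "(\<Sum>i\<le>a. f p ^ i) \<ge> 0 \<and> (even a \<longrightarrow> (\<Sum>i\<le>a. f p ^ i) \<ge> 1)" for a p
  proof -
    have m1: "(\<Sum>i\<le>a. (-1) ^ i :: real) = (if even a then 1 else 0)" by (induction a) auto
    have z: "(\<Sum>i\<le>a. 0 ^ i :: real) = 1" by (induction a) auto
    show ?thesis using val[of p] m1 z by auto
  qed
  show "N > 0 \<Longrightarrow> (\<Sum>d | d dvd N. f d) \<ge> 0"
  proof (induction N rule: less_induct)
    case (less N)
    show ?case
    proof (cases "N = 1")
      case True
      then show ?thesis using f1 by simp
    next
      case False
      then obtain p where p: "prime p" "p dvd N" using prime_factor_nat by blast
      obtain a M where aM: "N = p ^ a * M" "\<not> p dvd M"
        using multiplicity_decompose'[of N p] less.prems p by (metis mult.commute not_prime_unit not_gr_zero)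
      have "M > 0" using aM less.prems by (auto intro: Nat.gr0I)
      moreover have "M < N"
      proof -
        have "a > 0" using aM p by (auto intro: Nat.gr0I)
        then have "p ^ a > 1" using prime_gt_1_nat[OF p(1)] by (intro one_less_power) auto
        then show ?thesis using aM \<open>M > 0\<close> by simp
      qed
      ultimately show ?thesis using less.IH sum_divisors_prime_power_mult[OF mult f1 p(1) aM(2)] aM(1) geo by simp
    qed
  qed
  show "k > 0 \<Longrightarrow> (\<Sum>d | d dvd k ^ 2. f d) \<ge> 1"
  proof (induction k rule: less_induct)
    case (less N)
    show ?case
    proof (cases "N = 1")
      case True
      then show ?thesis using f1 by simp
    next
      case False
      then obtain p where p: "prime p" "p dvd N" using prime_factor_nat by blast
      obtain a M where aM: "N = p ^ a * M" "\<not> p dvd M"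
        using multiplicity_decompose'[of N p] less.prems p by (metis mult.commute not_prime_unit not_gr_zero)
      have M: "M > 0" using aM less.prems by (auto intro: Nat.gr0I)
      have "M < N"
      proof -
        have "a > 0" using aM p by (auto intro: Nat.gr0I)
        then have "p ^ a > 1" using prime_gt_1_nat[OF p(1)] by (intro one_less_power) auto
        then show ?thesis using aM \<open>M > 0\<close> by simp
      qed
      then have IH: "(\<Sum>d | d dvd M ^ 2. f d) \<ge> 1" using less.IH M by simp
      have "\<not> p dvd M ^ 2" using aM(2) p(1) prime_dvd_power by blast
      then have "(\<Sum>d | d dvd p ^ (2 * a) * M ^ 2. f d) = (\<Sum>i\<le>2 * a. f p ^ i) * (\<Sum>d | d dvd M ^ 2. f d)"
        using M by (intro sum_divisors_prime_power_mult[OF mult f1 p(1)]) auto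
      moreover have "N ^ 2 = p ^ (2 * a) * M ^ 2" unfolding aM(1) by (simp add: power_mult_distrib mult.commute flip: power_mult)
      moreover have "(\<Sum>i\<le>2 * a. f p ^ i) \<ge> 1" using geo[of p "2 * a"] by simp
      ultimately show ?thesis using IH mult_mono[of 1 "\<Sum>i\<le>2 * a. f p ^ i" 1] by simp
    qed
  qed
qed

text \<open>After clearing \<open>1 - x ^ n = (1 - x) * (\<Sum>i<n. x ^ i)\<close>, monotonicity follows from the inequality of arithmetic and geometric means for the terms of the geometric sum.\<close>

lemma Lambert_coefficients_antimono:
  fixes x :: real
  assumes x: "0 < x" "x < 1" and n: "n > 0"
  shows "1 / (real (Suc n) * (1 - x)) - x ^ Suc n / (1 - x ^ Suc n) \<le> 1 / (real n * (1 - x)) - x ^ n / (1 - x ^ n)"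
proof -
  \<comment> \<open>Pairing opposite terms of the geometric sum gives squares of powers of \<open>y\<close>.\<close>
  define y where "y = sqrt x"
  have y: "0 < y" "y < 1" "x = y ^ 2" using x by (auto simp: y_def)
  define S where "S n = (\<Sum>i<n. x ^ i)" for n
  have S: "1 - x ^ n = (1 - x) * S n" for n unfolding S_def using one_diff_power_eq by blast
  have Sge: "S n \<ge> real n * y ^ (n - 1)" for n
  proof -
    have "2 * S n = (\<Sum>i<n. x ^ i) + (\<Sum>i<n. x ^ (n - Suc i))"
      unfolding S_def by (subst (2) sum.nat_diff_reindex[symmetric]) simp
    also have "\<dots> = (\<Sum>i<n. (y ^ i)\<^sup>2 + (y ^ (n - Suc i))\<^sup>2)"
      by (simp add: y sum.distrib mult.commute flip: power_mult)
    also have "\<dots> \<ge> (\<Sum>i<n. 2 * y ^ (n - 1))"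
    proof (rule sum_mono)
      fix i assume "i \<in> {..<n}"
      then have "y ^ (n - 1) = y ^ i * y ^ (n - Suc i)" by (simp flip: power_add)
      then show "2 * y ^ (n - 1) \<le> (y ^ i)\<^sup>2 + (y ^ (n - Suc i))\<^sup>2"
        using sum_squares_bound[of "y ^ i" "y ^ (n - Suc i)"] by simp
    qed
    finally show ?thesis by simp
  qed
  have Spos: "S n > 0" "S (Suc n) > 0" using Sge[of n] Sge[of "Suc n"] y n by (smt (verit) of_nat_0_less_iff mult_pos_pos zero_less_power zero_less_Suc)+
  have rec: "S (Suc n) = 1 + x * S n" unfolding S_def by (simp add: sum.lessThan_Suc_shift sum_distrib_left del: sum.lessThan_Suc)
  have "real n * real (Suc n) * x ^ n \<le> (real n * y ^ (n - 1)) * (real (Suc n) * y ^ n)"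
  proof -
    have "x ^ n = y ^ (n + n)" by (simp add: y mult_2 flip: power_mult)
    also have "\<dots> \<le> y ^ (n - 1 + n)" using y by (intro power_decreasing) auto
    finally show ?thesis by (simp add: power_add mult_left_mono mult.assoc mult.left_commute)
  qed
  also have "\<dots> \<le> S n * S (Suc n)"
    using Sge[of n] Sge[of "Suc n"] Spos y by (intro mult_mono) auto
  finally have main: "real n * real (Suc n) * x ^ n \<le> S n * S (Suc n)" .
  have "x ^ n / S n - x ^ Suc n / S (Suc n) = x ^ n / (S n * S (Suc n))"
    using Spos by (simp add: rec field_simps)
  also have "\<dots> \<le> 1 / (real n * real (Suc n))"
    using main Spos n by (subst pos_divide_le_eq) (simp_all add: pos_le_divide_eq mult.commute)
  also have "\<dots> = 1 / real n - 1 / real (Suc n)" using n by (simp add: field_simps)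
  finally have "1 / real (Suc n) - x ^ Suc n / S (Suc n) \<le> 1 / real n - x ^ n / S n" by simp
  then have "(1 / real (Suc n) - x ^ Suc n / S (Suc n)) / (1 - x) \<le> (1 / real n - x ^ n / S n) / (1 - x)"
    using x by (intro divide_right_mono) auto
  then show ?thesis unfolding S by (simp add: diff_divide_distrib mult.commute)
qed

text \<open>The elementary argument of Monsky. If the series \<open>\<Sum>n. f n / n\<close> vanished, the Lambert series \<open>\<Sum>n. f n * x ^ n / (1 - x ^ n)\<close> could be compared with it and would stay bounded as \<open>x\<close> tends to \<open>1\<close>. Expanded in powers of \<open>x\<close>, the Lambert series has the divisor sums of \<open>f\<close> as coefficients; these are nonnegative and at least \<open>1\<close> at squares, so it dominates \<open>\<Sum>k. x ^ (k ^ 2)\<close>, which is unbounded.\<close>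

lemma real_character_nonvanishing:
  fixes f :: "nat \<Rightarrow> real"
  assumes mult: "\<And>m n. f (m * n) = f m * f n" and f1: "f 1 = 1" and f0: "f 0 = 0"
    and val: "\<And>n. f n \<in> {-1, 0, 1}"
    and B: "\<And>N. \<bar>\<Sum>n<N. f n\<bar> \<le> B"
  shows "\<not> (\<lambda>n. f n / n) sums 0"
proof
  assume s0: "(\<lambda>n. f n / n) sums 0"
  define K where "K = nat \<lceil>B\<rceil> + 1"
  have bound: "(\<Sum>k=1..K. x ^ (k ^ 2)) \<le> B" if x: "0 < x" "x < 1" for x :: real
  proof -
    define b where "b n = 1 / (real n * (1 - x)) - x ^ n / (1 - x ^ n)" for n
    have b0: "b \<longlonglongrightarrow> 0"
    proof -
      have "(\<lambda>n. 1 / (real n * (1 - x))) \<longlonglongrightarrow> 0" using x by real_asymp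
      moreover have "(\<lambda>n. x ^ n / (1 - x ^ n)) \<longlonglongrightarrow> 0 / (1 - 0)"
        using x by (intro tendsto_intros LIMSEQ_realpow_zero) auto
      ultimately have "b \<longlonglongrightarrow> 0 - 0 / (1 - 0)" unfolding b_def by (rule tendsto_diff)
      then show ?thesis by simp
    qed
    have bmono: "b (Suc n) \<le> b n" if "n > 0" for n
      unfolding b_def using Lambert_coefficients_antimono[OF x that] .
    have Bc: "norm (\<Sum>n<N. complex_of_real (f n)) \<le> B" for N
      using B[of N] by (simp flip: of_real_sum)
    have b1: "b 1 = 1" using x by (simp add: b_def diff_divide_distrib[symmetric])
    have sb: "summable (\<lambda>n. complex_of_real (f n) * b n)" "norm (\<Sum>n. complex_of_real (f n) * b n) \<le> B * b 1"
      using Abel_sums_antimono[of "\<lambda>n. complex_of_real (f n)" B b] f0 Bc b0 bmono by auto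
    have sb': "summable (\<lambda>n. f n * b n)" "\<bar>\<Sum>n. f n * b n\<bar> \<le> B"
    proof -
      have "summable (\<lambda>n. complex_of_real (f n * b n))" using sb(1) by simp
      then show s: "summable (\<lambda>n. f n * b n)" by (simp only: summable_of_real_iff)
      have "(\<Sum>n. complex_of_real (f n) * b n) = complex_of_real (\<Sum>n. f n * b n)"
        using suminf_of_real[OF s, where 'a = complex] by simp
      then show "\<bar>\<Sum>n. f n * b n\<bar> \<le> B" using sb(2) b1 by simp
    qed
    define G where "G M = (\<Sum>n\<in>{1..M}. f n * (x ^ n / (1 - x ^ n)))" for M
    have lim: "(\<lambda>M. 1 / (1 - x) * (\<Sum>n<Suc M. f n / n) - (\<Sum>n<Suc M. f n * b n)) \<longlonglongrightarrow> 1 / (1 - x) * 0 - (\<Sum>n. f n * b n)"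
    proof (intro tendsto_diff tendsto_mult tendsto_const)
      show "(\<lambda>M. \<Sum>n<Suc M. f n / n) \<longlonglongrightarrow> 0" using s0 unfolding sums_def by (rule LIMSEQ_Suc)
      show "(\<lambda>M. \<Sum>n<Suc M. f n * b n) \<longlonglongrightarrow> (\<Sum>n. f n * b n)"
        using summable_LIMSEQ[OF sb'(1)] by (rule LIMSEQ_Suc)
    qed
    have Geq: "G M = 1 / (1 - x) * (\<Sum>n<Suc M. f n / n) - (\<Sum>n<Suc M. f n * b n)" for M
    proof -
      have "1 / (1 - x) * (\<Sum>n<Suc M. f n / n) - (\<Sum>n<Suc M. f n * b n) = (\<Sum>n<Suc M. f n * (x ^ n / (1 - x ^ n)))"
        unfolding sum_distrib_left sum_subtractf[symmetric] b_def
        using x by (intro sum.cong) (auto simp: field_simps)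
      also have "\<dots> = G M" unfolding G_def using f0 
        by (intro sum.mono_neutral_right) (auto simp: Suc_le_eq)
      finally show ?thesis by simp
    qed
    have Glim: "G \<longlonglongrightarrow> - (\<Sum>n. f n * b n)"
      using lim unfolding Geq[symmetric] by simp
    have low: "(\<Sum>k=1..K. x ^ (k ^ 2)) - real M * x ^ M / (1 - x) \<le> G M" if M: "M \<ge> K ^ 2" for M
    proof -
      define r where "r N = (\<Sum>d | d dvd N. f d)" for N
      have "(\<Sum>k=1..K. x ^ (k ^ 2)) = (\<Sum>N\<in>(\<lambda>k. k ^ 2) ` {1..K}. x ^ N)"
        by (subst sum.reindex) (auto simp: inj_on_def)
      also have "\<dots> \<le> (\<Sum>N\<in>(\<lambda>k. k ^ 2) ` {1..K}. r N * x ^ N)"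
        using sum_divisors_real_character(2)[OF mult f1 val] x by (intro sum_mono) (auto simp: r_def)
      also have "\<dots> \<le> (\<Sum>N\<in>{1..M}. r N * x ^ N)"
      proof (rule sum_mono2)
        show "(\<lambda>k. k ^ 2) ` {1..K} \<subseteq> {1..M}" using M
          by auto (meson le_trans power_mono zero_le)
        show "0 \<le> r N * x ^ N" if "N \<in> {1..M} - (\<lambda>k. k ^ 2) ` {1..K}" for N
          using sum_divisors_real_character(1)[OF mult f1 val, of N] that x by (auto simp: r_def)
      qed simp
      also have "\<dots> = (\<Sum>N\<in>{1..M}. \<Sum>n | n \<in> {1..M} \<and> n dvd N. f n * x ^ N)"
      proof (rule sum.cong[OF refl])
        fix N assume "N \<in> {1..M}"
        then have "{n. n dvd N} = {n. n \<in> {1..M} \<and> n dvd N}" 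
          by (auto dest: dvd_imp_le intro: Nat.gr0I le_trans simp: Suc_le_eq)
        then show "r N * x ^ N = (\<Sum>n | n \<in> {1..M} \<and> n dvd N. f n * x ^ N)"
          by (simp add: r_def sum_distrib_right)
      qed
      also have "\<dots> = (\<Sum>n\<in>{1..M}. \<Sum>N | N \<in> {1..M} \<and> n dvd N. f n * x ^ N)"
        by (rule sum.swap_restrict) auto
      also have "\<dots> \<le> (\<Sum>n\<in>{1..M}. f n * (x ^ n / (1 - x ^ n)) + x ^ M / (1 - x))"
      proof (rule sum_mono)
        fix n assume n: "n \<in> {1..M}"
        have xn: "x ^ n \<le> x" "x ^ n < 1" "0 < x ^ n" using n x power_decreasing[of 1 n x] by (auto intro: order.strict_trans1)
        have "{N. N \<in> {1..M} \<and> n dvd N} = (\<lambda>j. n * j) ` {1..M div n}"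
          using n by (auto elim!: dvdE simp: less_eq_div_iff_mult_less_eq mult.commute)
        then have "(\<Sum>N | N \<in> {1..M} \<and> n dvd N. f n * x ^ N) = (\<Sum>j\<in>{1..M div n}. f n * x ^ (n * j))"
          using n by (simp add: sum.reindex inj_on_def)
        also have "\<dots> = f n * (\<Sum>j=1..M div n. (x ^ n) ^ j)" by (simp add: sum_distrib_left power_mult)
        also have "(\<Sum>j=1..M div n. (x ^ n) ^ j) = (x ^ n - (x ^ n) ^ Suc (M div n)) / (1 - x ^ n)"
          using xn sum_gp[of "x ^ n" 1 "M div n"] n by (auto simp: div_greater_zero_iff)
        also have "f n * \<dots> = f n * (x ^ n / (1 - x ^ n)) - f n * ((x ^ n) ^ Suc (M div n) / (1 - x ^ n))"
          by (simp add: diff_divide_distrib right_diff_distrib)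
        also have "\<dots> \<le> f n * (x ^ n / (1 - x ^ n)) + x ^ M / (1 - x)"
        proof -
          have "(x ^ n) ^ Suc (M div n) \<le> x ^ M"
          proof -
            have "M \<le> n * Suc (M div n)" using n by (metis dividend_less_times_div less_imp_le mult_Suc_right atLeastAtMost_iff less_eq_Suc_le One_nat_def)
            then show ?thesis using x unfolding power_mult[symmetric] by (intro power_decreasing) auto
          qed
          then have "(x ^ n) ^ Suc (M div n) / (1 - x ^ n) \<le> x ^ M / (1 - x)"
            using xn x by (intro frac_le) auto
          moreover have "0 \<le> (x ^ n) ^ Suc (M div n) / (1 - x ^ n)" using xn by simp
          ultimately show ?thesis using val[of n] by auto
        qed
        finally show "(\<Sum>N | N \<in> {1..M} \<and> n dvd N. f n * x ^ N) \<le> f n * (x ^ n / (1 - x ^ n)) + x ^ M / (1 - x)" .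
      qed
      also have "\<dots> = G M + real M * x ^ M / (1 - x)" by (simp add: sum.distrib G_def)
      finally show ?thesis by simp
    qed
    have "(\<lambda>M. (\<Sum>k=1..K. x ^ (k ^ 2)) - real M * x ^ M / (1 - x)) \<longlonglongrightarrow> (\<Sum>k=1..K. x ^ (k ^ 2)) - 0 / (1 - x)"
      using x by (intro tendsto_intros powser_times_n_limit_0[THEN tendsto_eq_rhs]) auto
    then have "(\<Sum>k=1..K. x ^ (k ^ 2)) - 0 / (1 - x) \<le> - (\<Sum>n. f n * b n)"
      by (rule tendsto_le[OF _ Glim, rotated]) (use low in \<open>auto simp: eventually_sequentially\<close>)
    then show ?thesis using sb'(2) by simp
  qed
  have "((\<lambda>x::real. \<Sum>k=1..K. x ^ (k ^ 2)) \<longlongrightarrow> (\<Sum>k=1..K. 1 ^ (k ^ 2))) (at_left 1)"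
    by (intro tendsto_intros)
  moreover have "\<forall>\<^sub>F x in at_left (1::real). (\<Sum>k=1..K. x ^ (k ^ 2)) \<le> B"
    using eventually_at_left_real[of 0 "1::real"] bound by (auto elim: eventually_mono)
  ultimately have "(\<Sum>k=1..K. (1::real) ^ (k ^ 2)) \<le> B"
    by (rule tendsto_upperbound) auto
  then show False by (simp add: K_def) linarith
qed

section \<open>Dirichlet characters and L-functions modulo a prime\<close>

definition prim_root :: "nat \<Rightarrow> complex" where
  "prim_root n = cis (2 * pi / real n)"

lemma prim_root_power_eq_1_iff: "n > 0 \<Longrightarrow> prim_root n ^ i = 1 \<longleftrightarrow> n dvd i"
proof -
  assume n: "n > 0"
  have "prim_root n ^ i = exp (2 * of_real pi * \<i> * of_nat i / of_nat n)"
    by (simp add: prim_root_def cis_conv_exp mult_ac flip: exp_of_nat_mult)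
  then show ?thesis using complex_root_unity_eq_1[of n i] n by simp
qed

lemma norm_prim_root [simp]: "norm (prim_root n) = 1" by (simp add: prim_root_def)

lemma prim_root_nonzero [simp]: "prim_root n \<noteq> 0" using norm_prim_root[of n] by fastforce

lemma prim_root_power_cong:
  assumes "n > 0" "[i = j] (mod n)"
  shows "prim_root n ^ i = prim_root n ^ j"
proof -
  have "prim_root n ^ i = prim_root n ^ (i mod n)" for i
  proof -
    have "prim_root n ^ i = prim_root n ^ (n * (i div n) + i mod n)" by simp
    also have "\<dots> = prim_root n ^ (i mod n)"
      unfolding power_add power_mult using prim_root_power_eq_1_iff[OF assms(1), of n] by simp
    finally show ?thesis .
  qed
  then show ?thesis using assms(2) unfolding unique_euclidean_semiring_class.cong_def by metis
qed

locale characters_mod_prime =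
  fixes l g :: nat
  assumes prime_l: "prime l" and gen: "residue_primroot l g"
begin

text \<open>Discrete logarithm to the base \<open>g\<close>, determined modulo \<open>l - 1\<close>.\<close>

definition ind :: "nat \<Rightarrow> nat" where "ind a = (SOME j. [g ^ j = a] (mod l))"

definition chi :: "nat \<Rightarrow> nat \<Rightarrow> complex" where
  "chi k a = (if l dvd a then 0 else prim_root (l - 1) ^ (k * ind a))"

lemma l_gt_1: "l > 1" using prime_l prime_gt_1_nat by blast

lemma ord_g: "ord l g = l - 1" and coprime_g: "coprime l g"
  using gen prime_l by (auto simp: residue_primroot_def totient_prime)

lemma g_power_ind: "\<not> l dvd a \<Longrightarrow> [g ^ ind a = a] (mod l)"
proof -
  assume a: "\<not> l dvd a"
  have "coprime a l" using prime_imp_coprime[OF prime_l a] by (metis coprime_commute)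
  then have "a mod l \<in> totatives l" using l_gt_1 a
    by (auto simp: in_totatives_iff mod_greater_zero_iff_not_dvd intro: less_imp_le)
  then have "a mod l \<in> (\<lambda>i. g ^ i mod l) ` {..<totient l}"
    using residue_primroot_is_generator[OF l_gt_1 gen] by (simp add: bij_betw_def)
  then have "\<exists>j. [g ^ j = a] (mod l)" by (auto simp: unique_euclidean_semiring_class.cong_def)
  then show ?thesis unfolding ind_def by (rule someI_ex)
qed

lemma g_power_cong_iff: "[g ^ i = g ^ j] (mod l) \<longleftrightarrow> [i = j] (mod l - 1)"
  using order_divides_expdiff[OF coprime_g] ord_g by simp

lemma root_power_cong:
  assumes "[i = j] (mod l - 1)"
  shows "prim_root (l - 1) ^ (k * i) = prim_root (l - 1) ^ (k * j)"
  using assms l_gt_1 by (intro prim_root_power_cong cong_mult) auto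

lemma chi_cong: "[a = b] (mod l) \<Longrightarrow> chi k a = chi k b"
proof -
  assume ab: "[a = b] (mod l)"
  then have dvd: "l dvd a \<longleftrightarrow> l dvd b" by (rule cong_dvd_iff)
  show ?thesis
  proof (cases "l dvd a")
    case False
    then have "[g ^ ind a = g ^ ind b] (mod l)"
      using g_power_ind[of a] g_power_ind[of b] dvd ab by (meson cong_sym cong_trans)
    then show ?thesis using False dvd root_power_cong by (simp add: chi_def g_power_cong_iff)
  qed (use dvd in \<open>simp add: chi_def\<close>)
qed

lemma chi_mult: "chi k (a * b) = chi k a * chi k b"
proof (cases "l dvd a \<or> l dvd b")
  case True
  then show ?thesis by (auto simp: chi_def)
next
  case False
  then have ab: "\<not> l dvd a * b" using prime_l prime_dvd_mult_iff by blast
  have "[g ^ ind (a * b) = a * b] (mod l)" using g_power_ind ab by blast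
  moreover have "[g ^ (ind a + ind b) = a * b] (mod l)"
    unfolding power_add using False by (intro cong_mult g_power_ind) auto
  ultimately have "[ind (a * b) = ind a + ind b] (mod l - 1)"
    using g_power_cong_iff by (meson cong_sym cong_trans)
  from root_power_cong[OF this, of k] show ?thesis
    using False ab by (simp add: chi_def power_add distrib_left)
qed

lemma chi_0 [simp]: "chi k 0 = 0" by (simp add: chi_def)

lemma ind_1: "[ind 1 = 0] (mod l - 1)"
  using g_power_ind[of 1] l_gt_1 g_power_cong_iff[of "ind 1" 0] by simp

lemma chi_1 [simp]: "chi k 1 = 1" "chi k (Suc 0) = 1"
  using root_power_cong[OF ind_1, of k] l_gt_1 by (auto simp: chi_def)

lemma norm_chi: "norm (chi k a) \<le> 1" by (simp add: chi_def norm_power)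

lemma chi_periodic: "chi k (n + l) = chi k n"
  by (rule chi_cong) (simp add: unique_euclidean_semiring_class.cong_def)

lemma chi_0_left: "chi 0 a = (if l dvd a then 0 else 1)" by (simp add: chi_def)

lemma chi_cnj: "k \<le> l - 1 \<Longrightarrow> chi (l - 1 - k) a = cnj (chi k a)"
proof -
  assume k: "k \<le> l - 1"
  let ?w = "prim_root (l - 1)"
  have "(l - 1 - k) * ind a + k * ind a = (l - 1) * ind a"
    using k by (metis distrib_right le_add_diff_inverse2)
  then have "?w ^ ((l - 1 - k) * ind a) * ?w ^ (k * ind a) = ?w ^ ((l - 1) * ind a)"
    by (metis power_add)
  also have "\<dots> = 1" using l_gt_1 by (simp add: prim_root_power_eq_1_iff)
  finally have 1: "?w ^ ((l - 1 - k) * ind a) * ?w ^ (k * ind a) = 1" .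
  have 2: "cnj (?w ^ (k * ind a)) * ?w ^ (k * ind a) = 1"
    using complex_norm_square[of "?w ^ (k * ind a)"] by (simp add: norm_power mult.commute)
  have "?w ^ ((l - 1 - k) * ind a) = cnj (?w ^ (k * ind a))"
    using 1 2 by (metis mult_cancel_right zero_neq_one mult_zero_right)
  then show ?thesis by (simp add: chi_def)
qed

lemma chi_sum_zero:
  assumes "\<not> (l - 1) dvd k"
  shows "(\<Sum>a<l. chi k a) = 0"
proof -
  have bij: "bij_betw (\<lambda>a. g * a mod l) {..<l} {..<l}"
  proof (rule bij_betw_imageI)
    show inj: "inj_on (\<lambda>a. g * a mod l) {..<l}"
    proof (rule inj_onI)
      fix a b assume ab: "a \<in> {..<l}" "b \<in> {..<l}" "g * a mod l = g * b mod l"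
      then have "[g * a = g * b] (mod l)" by (simp add: unique_euclidean_semiring_class.cong_def)
      then have "[a = b] (mod l)" using coprime_g by (simp add: cong_mult_lcancel_nat coprime_commute)
      then show "a = b" using ab by (simp add: unique_euclidean_semiring_class.cong_def)
    qed
    show "(\<lambda>a. g * a mod l) ` {..<l} = {..<l}"
      using l_gt_1 by (intro endo_inj_surj inj) auto
  qed
  have ng: "\<not> l dvd g" using coprime_g l_gt_1 by (metis coprime_absorb_left not_is_unit_0 is_unit_gcd_iff less_numeral_extra(4) nat_dvd_1_iff_1)
  have "[ind g = 1] (mod l - 1)"
    using g_power_ind[OF ng] g_power_cong_iff[of "ind g" 1] by simp
  then have "chi k g = prim_root (l - 1) ^ k" using ng root_power_cong[of "ind g" 1 k] by (simp add: chi_def)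
  then have g1: "chi k g \<noteq> 1" using prim_root_power_eq_1_iff[of "l - 1" k] l_gt_1 assms by simp
  have "(\<Sum>a<l. chi k a) = (\<Sum>a<l. chi k (g * a mod l))"
    using sum.reindex_bij_betw[OF bij, of "chi k"] by simp
  also have "\<dots> = (\<Sum>a<l. chi k (g * a))"
    by (intro sum.cong chi_cong) (auto simp: unique_euclidean_semiring_class.cong_def)
  also have "\<dots> = chi k g * (\<Sum>a<l. chi k a)" by (simp add: chi_mult sum_distrib_left)
  finally show ?thesis using g1 by (metis mult_cancel_right1)
qed

lemma chi_partial_sums:
  assumes "\<not> (l - 1) dvd k"
  shows "norm (\<Sum>a<N. chi k a) \<le> real l"
  using l_gt_1 by (intro periodic_partial_sums_bounded chi_periodic chi_sum_zero[OF assms] norm_chi) auto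

definition L :: "nat \<Rightarrow> real \<Rightarrow> complex" where
  "L k s = (\<Sum>n. chi k n * of_real (real n powr -s))"

lemma L_nontrivial:
  assumes "\<not> (l - 1) dvd k" "s > 0"
  shows "summable (\<lambda>n. chi k n * of_real (real n powr -s))" "norm (L k s) \<le> real l"
proof -
  have lim: "(\<lambda>n. real n powr -s) \<longlonglongrightarrow> 0" using assms(2) by real_asymp
  have "real (Suc n) powr -s \<le> real n powr -s" if "n > 0" for n using that assms(2) by (intro powr_mono2') auto
  note A = Abel_sums_antimono[of "chi k" "real l" "\<lambda>n. real n powr -s", OF chi_0 chi_partial_sums[OF assms(1)] lim this]
  show "summable (\<lambda>n. chi k n * of_real (real n powr -s))" by (rule A(1))
  show "norm (L k s) \<le> real l" using A(2) unfolding L_def by simp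
qed

text \<open>Partial summation against the variation of \<open>n powr -1 - n powr -s\<close>.\<close>

lemma L_near_1:
  assumes "\<not> (l - 1) dvd k"
  obtains C where "C \<ge> 0" "\<And>s. 1 < s \<Longrightarrow> s \<le> 2 \<Longrightarrow> norm (L k 1 - L k s) \<le> C * (s - 1)"
proof -
  obtain C where C: "\<forall>s::real. 1 < s \<longrightarrow> s \<le> 2 \<longrightarrow>
     summable (\<lambda>n. \<bar>(real (Suc n) powr -1 - real (Suc n) powr -s) - (real (Suc (Suc n)) powr -1 - real (Suc (Suc n)) powr -s)\<bar>) \<and>
     (\<Sum>n. \<bar>(real (Suc n) powr -1 - real (Suc n) powr -s) - (real (Suc (Suc n)) powr -1 - real (Suc (Suc n)) powr -s)\<bar>) \<le> C * (s - 1)"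
    using powr_difference_variation by (elim exE)
  have "norm (L k 1 - L k s) \<le> real l * max 0 C * (s - 1)" if s: "1 < s" "s \<le> 2" for s
  proof -
    have lim: "(\<lambda>n. real n powr -1 - real n powr -s) \<longlonglongrightarrow> 0" using s by real_asymp
    have "norm (\<Sum>n. chi k n * of_real (real n powr -1 - real n powr -s)) \<le> real l * (C * (s - 1))"
    proof (rule order.trans)
      let ?v = "\<Sum>n. \<bar>(real (Suc n) powr -1 - real (Suc n) powr -s) - (real (Suc (Suc n)) powr -1 - real (Suc (Suc n)) powr -s)\<bar>"
      show "norm (\<Sum>n. chi k n * of_real (real n powr -1 - real n powr -s)) \<le> real l * ?v"
        by (rule Abel_sums(2)[where f = "chi k" and h = "\<lambda>n. real n powr -1 - real n powr -s"])
          (use chi_partial_sums[OF assms] lim C s in auto)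
      show "real l * ?v \<le> real l * (C * (s - 1))"
        using C s by (intro mult_left_mono) auto
    qed
    also have "\<dots> \<le> real l * (max 0 C * (s - 1))" using s by (intro mult_left_mono mult_right_mono) auto
    also have "(\<Sum>n. chi k n * of_real (real n powr -1 - real n powr -s)) = L k 1 - L k s"
      unfolding L_def using suminf_diff[OF L_nontrivial(1)[OF assms, of 1] L_nontrivial(1)[OF assms, of s]] s
      by (simp add: right_diff_distrib)
    finally show ?thesis by (simp add: mult.assoc)
  qed
  then show ?thesis using that[of "real l * max 0 C"] by simp
qed

lemma L_abs_summable:
  assumes "s > 1"
  shows "summable (\<lambda>n. norm (chi k n * of_real (real n powr -s)))"
proof -
  have "summable (\<lambda>n. real n powr -s)"
    using zeta_telescope_bounds(1)[OF assms] summable_Suc_iff[of "\<lambda>n. real n powr -s"] by simp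
  then show ?thesis
    by (rule summable_comparison_test') (use norm_chi in \<open>auto simp: norm_mult mult_left_le_one_le\<close>)
qed

text \<open>The principal series is the zeta series without the multiples of \<open>l\<close>. Only the order of magnitude \<open>1 / (s - 1)\<close> matters, so for the lower bound the terms that are \<open>1\<close> modulo \<open>l\<close> suffice.\<close>

lemma L_0_bounds:
  assumes s: "1 < s" "s \<le> 2"
  shows "norm (L 0 s) \<le> 1 + 1 / (s - 1)" "1 / (real l ^ 2 * (s - 1)) \<le> norm (L 0 s)"
proof -
  define f where "f n = (if l dvd n then 0 else real n powr -s)" for n
  have pos: "0 \<le> f n" for n by (simp add: f_def)
  have ss: "summable (\<lambda>n. real n powr -s)"
    using zeta_telescope_bounds(1)[OF s(1)] summable_Suc_iff[of "\<lambda>n. real n powr -s"] by simp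
  have sf: "summable f"
    by (rule summable_comparison_test'[OF ss]) (auto simp: f_def)
  have "L 0 s = (\<Sum>n. of_real (f n))" unfolding L_def chi_0_left by (intro suminf_cong) (auto simp: f_def)
  then have Leq: "L 0 s = of_real (suminf f)" using suminf_of_real[OF sf, where 'a = complex] by (simp only:)
  have f0: "suminf f \<ge> 0" using sf pos by (intro suminf_nonneg)
  have "suminf f \<le> (\<Sum>n. real n powr -s)" by (intro suminf_le sf ss) (auto simp: f_def)
  also have "\<dots> = (\<Sum>n. real (Suc n) powr -s)" using suminf_split_head[OF ss] by simp
  also have "\<dots> \<le> 1 + 1 / (s - 1)" using zeta_telescope_bounds(3)[OF s(1)] .
  finally show "norm (L 0 s) \<le> 1 + 1 / (s - 1)" using Leq f0 by simp
  have inj: "inj (\<lambda>n. l * n + 1)" using l_gt_1 by (auto simp: inj_def)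
  have "(\<Sum>n. real (Suc n) powr -s) / real l ^ 2 = (\<Sum>n. real (Suc n) powr -s / real l ^ 2)"
    using suminf_divide[OF zeta_telescope_bounds(1)[OF s(1)]] by simp
  also have "\<dots> \<le> (\<Sum>n. f (l * n + 1))"
  proof (rule suminf_le)
    show s2: "summable (\<lambda>n. f (l * n + 1))"
      using summable_reindex[OF sf inj pos] by (simp add: o_def)
    show "summable (\<lambda>n. real (Suc n) powr -s / real l ^ 2)"
      using zeta_telescope_bounds(1)[OF s(1)] by (rule summable_divide)
    fix n
    have "\<not> l dvd l * n + 1"
      using l_gt_1 dvd_add_right_iff[of l "l * n" 1] by (simp del: One_nat_def)
    moreover have "real (Suc n) powr -s / real l ^ 2 \<le> real (l * n + 1) powr -s"
    proof -
      have "real (Suc n) powr -s / real l ^ 2 = real (Suc n) powr -s * real l powr -2"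
        using l_gt_1 by (simp add: powr_minus_divide powr_numeral)
      also have "\<dots> \<le> real (Suc n) powr -s * real l powr -s"
        using l_gt_1 s by (intro mult_left_mono powr_mono) auto
      also have "\<dots> = real (Suc n * l) powr -s" by (simp only: powr_mult of_nat_mult of_nat_0_le_iff)
      also have "\<dots> \<le> real (l * n + 1) powr -s"
      proof (rule powr_mono2')
        show "real (l * n + 1) \<le> real (Suc n * l)"
          unfolding of_nat_le_iff using l_gt_1 by (simp add: algebra_simps)
        show "0 < real (l * n + 1)" unfolding of_nat_0_less_iff by simp
      qed (use s in auto)
      finally show ?thesis .
    qed
    ultimately show "real (Suc n) powr -s / real l ^ 2 \<le> f (l * n + 1)" by (simp add: f_def)
  qed
  also have "\<dots> \<le> suminf f"
    using suminf_reindex_mono[OF sf inj pos] by (simp add: o_def)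
  finally have "(\<Sum>n. real (Suc n) powr -s) / real l ^ 2 \<le> suminf f" .
  moreover have "1 / (s - 1) / real l ^ 2 \<le> (\<Sum>n. real (Suc n) powr -s) / real l ^ 2"
    using zeta_telescope_bounds(2)[OF s(1)] by (intro divide_right_mono) auto
  ultimately show "1 / (real l ^ 2 * (s - 1)) \<le> norm (L 0 s)" using Leq f0 by (simp add: mult.commute)
qed

lemma L_Euler:
  assumes "s > 1"
  shows "(\<lambda>x. L k s * (\<Prod>p | prime p \<and> p \<le> x. 1 - chi k p * of_real (real p powr -s))) \<longlonglongrightarrow> 1"
  unfolding L_def
  by (rule Euler_product_tendsto) (use L_abs_summable[OF assms] in \<open>auto simp: chi_mult powr_mult\<close>)

end

section \<open>Reciprocals of the primes congruent to 1\<close>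

context characters_mod_prime begin

text \<open>If \<open>a\<close> has order \<open>f\<close> modulo \<open>l\<close>, the product is \<open>(1 - t ^ f) ^ ((l - 1) / f)\<close>. It is as small as \<open>(1 - t) ^ (l - 1)\<close> only for \<open>f = 1\<close>; for \<open>f \<ge> 2\<close> it involves no more than \<open>t ^ 2\<close>, which is summable over primes.\<close>

lemma local_factor:
  fixes t :: real
  assumes a: "\<not> l dvd a" and t: "0 < t" "t \<le> 1/2"
  obtains r where "(\<Prod>k<l - 1. 1 - chi k a * of_real t) = complex_of_real r" "r \<le> 1"
    "(1 - (if [a = 1] (mod l) then t else t ^ 2)) ^ (l - 1) \<le> r"
proof -
  define w where "w = prim_root (l - 1) ^ ind a"
  have chi: "chi k a = w ^ k" for k
    using a by (simp add: chi_def w_def mult.commute flip: power_mult)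
  have wl: "w ^ (l - 1) = 1" unfolding w_def using l_gt_1
    by (simp add: prim_root_power_eq_1_iff flip: power_mult)
  define f where "f = (LEAST f. f > 0 \<and> w ^ f = 1)"
  have f: "f > 0 \<and> w ^ f = 1" unfolding f_def by (rule LeastI[of _ "l - 1"]) (use wl l_gt_1 in auto)
  have fmin: "w ^ i \<noteq> 1" if "0 < i" "i < f" for i
    using not_less_Least[of i "\<lambda>f. f > 0 \<and> w ^ f = 1"] that unfolding f_def by auto
  have "w ^ ((l - 1) mod f) = 1"
  proof -
    have "w ^ (l - 1) = w ^ (f * ((l - 1) div f) + (l - 1) mod f)" by simp
    then show ?thesis unfolding power_add power_mult using wl f by simp
  qed
  then have "(l - 1) mod f = 0" using fmin[of "(l - 1) mod f"] f by (meson mod_less_divisor not_gr_zero)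
  then obtain e where e: "l - 1 = f * e" by (metis mod_0_imp_dvd dvdE)
  have el: "e \<le> l - 1" using e f by simp
  define r where "r = (1 - t ^ f) ^ e"
  have 1: "(\<Prod>k<l - 1. 1 - chi k a * of_real t) = complex_of_real r"
    unfolding chi e using prod_one_minus_powers_of_root[where f = f and w = w and e = e and t = "complex_of_real t"] f fmin by (simp add: r_def)
  have tf: "0 < t ^ f" "t ^ f \<le> t" using t f power_decreasing[of 1 f t] by auto
  have 2: "r \<le> 1" unfolding r_def using tf t by (intro power_le_one) auto
  let ?u = "if [a = 1] (mod l) then t else t ^ 2"
  have "t ^ f \<le> ?u"
  proof (cases "f = 1")
    case True
    then have "w = 1" using f by simp
    then have "(l - 1) dvd ind a" using l_gt_1 by (simp add: w_def prim_root_power_eq_1_iff)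
    then have "[g ^ ind a = g ^ 0] (mod l)" by (subst g_power_cong_iff) (simp add: cong_0_iff)
    then have "[a = 1] (mod l)" using g_power_ind[OF a] by (metis cong_sym cong_trans power_0)
    then show ?thesis using tf by simp
  next
    case False
    then have "t ^ f \<le> t ^ 2" using f t by (intro power_decreasing) auto
    moreover have "t ^ 2 \<le> t" using t power_decreasing[of 1 2 t] by simp
    ultimately show ?thesis by simp
  qed
  moreover have "?u \<le> t" using t power_decreasing[of 1 2 t] by simp
  moreover have "0 \<le> ?u" using t by simp
  ultimately have "(1 - ?u) ^ (l - 1) \<le> (1 - ?u) ^ e" "(1 - ?u) ^ e \<le> (1 - t ^ f) ^ e"
    using t el by (intro power_decreasing power_mono; simp)+
  then show ?thesis using that[OF 1 2] unfolding r_def by linarith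
qed

text \<open>In the Euler product of the product of all \<open>L\<close>-functions, only primes that are \<open>1\<close> modulo \<open>l\<close> contribute to first order. Under the hypothesis \<open>H\<close>, which is to be refuted, the product therefore remains bounded as \<open>s\<close> tends to \<open>1\<close>.\<close>

lemma L_product_bounds:
  assumes H: "summable (\<lambda>p. if prime p \<and> [p = 1] (mod l) then 1 / real p else 0)"
  obtains c where "c > 0" "\<And>s. 1 < s \<Longrightarrow> 1 \<le> norm (\<Prod>k<l - 1. L k s) \<and> norm (\<Prod>k<l - 1. L k s) \<le> c"
proof -
  define b where "b p = (if prime p then if [p = 1] (mod l) then 1 / real p else 1 / real p ^ 2 else 0)" for p :: nat
  have sq: "summable (\<lambda>p. 1 / real p ^ 2)" by (rule inverse_power_summable[of 2, where 'a = real, simplified inverse_eq_divide]) simp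
  have "summable b"
    by (rule summable_comparison_test'[OF summable_add[OF H sq]]) (auto simp: b_def)
  moreover have "0 \<le> b n" for n by (simp add: b_def)
  moreover have "b n \<le> 1/2" for n
  proof (cases "prime n")
    case True
    then have n: "real n \<ge> 2" using prime_ge_2_nat by simp
    have "1 / real n ^ 2 \<le> 1 / 2 ^ 2" using n by (intro divide_left_mono power_mono) auto
    then show ?thesis using n by (simp add: b_def field_simps)
  qed (simp add: b_def)
  ultimately obtain c where c: "c > 0" "\<And>A. finite A \<Longrightarrow> c \<le> (\<Prod>n\<in>A. 1 - b n)"
    using prod_one_minus_bounded_below by blast
  define c' where "c' = c ^ (l - 1)"
  have c': "c' > 0" using c by (simp add: c'_def)
  have main: "1 \<le> norm (\<Prod>k<l - 1. L k s) \<and> norm (\<Prod>k<l - 1. L k s) \<le> 1 / c'" if s: "1 < s" for s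
  proof -
    let ?F = "\<Prod>k<l - 1. L k s"
    define R where "R x = (\<Prod>p | prime p \<and> p \<le> x. \<Prod>k<l - 1. 1 - chi k p * of_real (real p powr -s))" for x
    have *: "(\<lambda>x. \<Prod>k<l - 1. L k s * (\<Prod>p | prime p \<and> p \<le> x. 1 - chi k p * of_real (real p powr -s))) \<longlonglongrightarrow> (\<Prod>k<l - 1. 1)"
      by (intro tendsto_prod L_Euler s)
    have lim: "(\<lambda>x. ?F * R x) \<longlonglongrightarrow> 1"
    proof -
      have "R x = (\<Prod>k<l - 1. \<Prod>p | prime p \<and> p \<le> x. 1 - chi k p * of_real (real p powr -s))" for x
        unfolding R_def by (rule prod.swap)
      with * show ?thesis by (simp only: prod.distrib) simp
    qed
    have "\<exists>r. (\<Prod>k<l - 1. 1 - chi k p * of_real (real p powr -s)) = complex_of_real r \<and> r \<le> 1 \<and> (1 - b p) ^ (l - 1) \<le> r"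
      if p: "prime p" for p
    proof (cases "l dvd p")
      case True
      then have "chi k p = 0" for k by (simp add: chi_def)
      moreover have "(1 - b p) ^ (l - 1) \<le> 1" using \<open>\<And>n. 0 \<le> b n\<close>[of p] \<open>\<And>n. b n \<le> 1/2\<close>[of p] by (intro power_le_one) auto
      ultimately show ?thesis by (intro exI[of _ 1]) simp
    next
      case False
      define t where "t = real p powr -s"
      have p2: "real p \<ge> 2" using p prime_ge_2_nat by simp
      have tp: "t \<le> 1 / real p" using p2 s powr_mono[of "-s" "-1" "real p"] by (simp add: t_def powr_minus_divide)
      have t: "0 < t" using p2 by (simp add: t_def)
      have "1 / real p \<le> 1/2" using p2 by (simp add: field_simps)
      with tp have t2: "t \<le> 1/2" by linarith
      from local_factor[OF False t t2] obtain r where r: "(\<Prod>k<l - 1. 1 - chi k p * of_real t) = complex_of_real r" "r \<le> 1"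
        "(1 - (if [p = 1] (mod l) then t else t ^ 2)) ^ (l - 1) \<le> r" by blast
      have "t ^ 2 \<le> 1 / real p ^ 2" using power_mono[OF tp, of 2] t by (simp add: power_divide)
      then have "(1 - b p) ^ (l - 1) \<le> (1 - (if [p = 1] (mod l) then t else t ^ 2)) ^ (l - 1)"
        using p tp \<open>\<And>n. b n \<le> 1/2\<close>[of p] by (intro power_mono) (auto simp: b_def)
      then show ?thesis using r by (auto simp: t_def)
    qed
    then obtain r where r: "\<And>p. prime p \<Longrightarrow> (\<Prod>k<l - 1. 1 - chi k p * of_real (real p powr -s)) = complex_of_real (r p)"
        "\<And>p. prime p \<Longrightarrow> r p \<le> 1" "\<And>p. prime p \<Longrightarrow> (1 - b p) ^ (l - 1) \<le> r p" by metis
    have bb: "0 < 1 - b p" for p using \<open>\<And>n. b n \<le> 1/2\<close>[of p] by simp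
    have rpos: "0 \<le> r p" if "prime p" for p using r(3)[OF that] bb[of p] by (smt (verit) zero_le_power)
    have R: "R x = of_real (\<Prod>p | prime p \<and> p \<le> x. r p)" for x unfolding R_def of_real_prod by (intro prod.cong r(1)) auto
    have Rle: "norm (R x) \<le> 1" and Rge: "c' \<le> norm (R x)" for x
    proof -
      have "0 \<le> (\<Prod>p | prime p \<and> p \<le> x. r p)" using rpos by (intro prod_nonneg) auto
      then have nR: "norm (R x) = (\<Prod>p | prime p \<and> p \<le> x. r p)" unfolding R norm_of_real by simp
      show "norm (R x) \<le> 1" unfolding nR using rpos r(2) by (intro prod_le_1) auto
      have "c \<le> (\<Prod>p | prime p \<and> p \<le> x. 1 - b p)" by (intro c(2)) auto
      then have "c' \<le> (\<Prod>p | prime p \<and> p \<le> x. 1 - b p) ^ (l - 1)" unfolding c'_def using c(1) by (intro power_mono) auto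
      also have "\<dots> = (\<Prod>p | prime p \<and> p \<le> x. (1 - b p) ^ (l - 1))" by (simp add: prod_power_distrib)
      also have "\<dots> \<le> (\<Prod>p | prime p \<and> p \<le> x. r p)" using r(3) bb by (intro prod_mono) (auto intro: less_imp_le)
      finally show "c' \<le> norm (R x)" using nR by simp
    qed
    have nlim: "(\<lambda>x. norm (?F * R x)) \<longlonglongrightarrow> 1" using tendsto_norm[OF lim] by simp
    have "1 \<le> norm ?F"
    proof (rule LIMSEQ_le_const2[OF nlim])
      show "\<exists>N. \<forall>x\<ge>N. norm (?F * R x) \<le> norm ?F"
        unfolding norm_mult using Rle by (auto intro!: mult_left_le)
    qed
    moreover have "norm ?F * c' \<le> 1"
    proof (rule LIMSEQ_le_const[OF nlim])
      show "\<exists>N. \<forall>x\<ge>N. norm ?F * c' \<le> norm (?F * R x)"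
        unfolding norm_mult using Rge by (auto intro!: mult_left_mono)
    qed
    ultimately show ?thesis using c' by (simp add: field_simps)
  qed
  show ?thesis using that[of "1 / c'"] main c' by simp
qed

text \<open>The character of order two takes the values \<open>-1\<close>, \<open>0\<close> and \<open>1\<close>.\<close>

lemma quadratic_L_nonzero:
  assumes k: "2 * k = l - 1" "k > 0"
  shows "L k 1 \<noteq> 0"
proof
  assume L0: "L k 1 = 0"
  let ?w = "prim_root (l - 1)"
  have lk: "\<not> (l - 1) dvd k" using k by (auto dest: dvd_imp_le)
  have "(?w ^ k) ^ 2 = 1" using k prim_root_power_eq_1_iff[of "l - 1" "k * 2"] by (simp add: mult.commute flip: power_mult)
  moreover have "?w ^ k \<noteq> 1" using lk k prim_root_power_eq_1_iff[of "l - 1" k] by simp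
  ultimately have wk: "?w ^ k = -1" using power2_eq_1_iff by blast
  define f where "f n = (if l dvd n then 0 else (-1) ^ ind n :: real)" for n
  have chif: "chi k n = of_real (f n)" for n by (simp add: chi_def f_def power_mult wk del: One_nat_def)
  have "\<not> (\<lambda>n. f n / n) sums 0"
  proof (rule real_character_nonvanishing)
    show "f (m * n) = f m * f n" for m n using chi_mult[of k m n] unfolding chif by (simp flip: of_real_mult)
    show "f 1 = 1" using chi_1(1)[of k] unfolding chif by simp
    show "f 0 = 0" by (simp add: f_def)
    show "f n \<in> {-1, 0, 1}" for n by (cases "even (ind n)") (auto simp: f_def)
    show "\<bar>\<Sum>n<N. f n\<bar> \<le> real l" for N
      using chi_partial_sums[OF lk, of N] unfolding chif by (simp flip: of_real_sum)
  qed
  moreover have "(\<lambda>n. f n / n) sums 0"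
  proof -
    have "(\<lambda>n. chi k n * of_real (real n powr -1)) sums 0"
      using L_nontrivial(1)[OF lk, of 1] L0 unfolding L_def by (simp add: sums_iff)
    then have "(\<lambda>n. complex_of_real (f n / n)) sums of_real 0"
      unfolding chif by (simp add: powr_minus_divide)
    then show ?thesis by (simp only: sums_of_real_iff)
  qed
  ultimately show False by blast
qed

text \<open>The principal factor has a simple pole at \<open>1\<close>. If no other factor vanishes there, the product is unbounded, against the upper bound. If a complex character has a zero, its conjugate has one too, and two zeros against one pole make the product tend to zero, against the lower bound \<open>1\<close>. The remaining case of a real character is \<open>quadratic_L_nonzero\<close>.\<close>

theorem primes_1_mod_not_summable:
  "\<not> summable (\<lambda>p. if prime p \<and> [p = 1] (mod l) then 1 / real p else 0)"
proof
  assume H: "summable (\<lambda>p. if prime p \<and> [p = 1] (mod l) then 1 / real p else 0)"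
  obtain c where c: "c > 0" "\<And>s. 1 < s \<Longrightarrow> 1 \<le> norm (\<Prod>k<l - 1. L k s) \<and> norm (\<Prod>k<l - 1. L k s) \<le> c"
    using L_product_bounds[OF H] by blast
  \<comment> \<open>A sequence tending to \<open>1\<close> from the right replaces the variable \<open>s\<close>.\<close>
  define s where "s j = 1 + 1 / real (Suc j)" for j
  have s: "1 < s j" "s j \<le> 2" "s j - 1 = 1 / real (Suc j)" for j by (auto simp: s_def field_simps)
  have ndvd: "\<not> (l - 1) dvd k" if "k \<in> {1..<l - 1}" for k using that by (auto dest: dvd_imp_le)
  have split: "(\<Prod>k<l - 1. h k) = h 0 * (\<Prod>k\<in>{1..<l - 1}. h k)" for h :: "nat \<Rightarrow> real"
  proof -
    have "{..<l - 1} = insert 0 {1..<l - 1}" using l_gt_1 by auto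
    then show ?thesis by simp
  qed
  show False
  proof (cases "\<forall>k\<in>{1..<l - 1}. L k 1 \<noteq> 0")
    case True
    have "(\<lambda>j. L k (s j)) \<longlonglongrightarrow> L k 1" if k: "k \<in> {1..<l - 1}" for k
    proof -
      obtain C where C: "C \<ge> 0" "\<And>s. 1 < s \<Longrightarrow> s \<le> 2 \<Longrightarrow> norm (L k 1 - L k s) \<le> C * (s - 1)"
        using L_near_1[OF ndvd[OF k]] by metis
      have "(\<lambda>j. L k (s j) - L k 1) \<longlonglongrightarrow> 0"
      proof (rule Lim_null_comparison)
        show "\<forall>\<^sub>F j in sequentially. norm (L k (s j) - L k 1) \<le> C * (1 / real (Suc j))"
          using C(2)[OF s(1,2)] s(3) by (auto simp: norm_minus_commute intro!: always_eventually)
        show "(\<lambda>j. C * (1 / real (Suc j))) \<longlonglongrightarrow> 0" by real_asymp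
      qed
      then show ?thesis by (rule LIM_zero_cancel)
    qed
    then have lim: "(\<lambda>j. \<Prod>k\<in>{1..<l - 1}. norm (L k (s j))) \<longlonglongrightarrow> (\<Prod>k\<in>{1..<l - 1}. norm (L k 1))"
      by (intro tendsto_prod tendsto_norm)
    define P where "P = (\<Prod>k\<in>{1..<l - 1}. norm (L k 1))"
    have P: "P > 0" unfolding P_def using True by (intro prod_pos) auto
    have "\<forall>\<^sub>F j in sequentially. (\<Prod>k\<in>{1..<l - 1}. norm (L k (s j))) > P / 2"
      using lim P unfolding P_def[symmetric] by (intro order_tendstoD(1)) auto
    moreover have "\<forall>\<^sub>F j in sequentially. real (Suc j) / real l ^ 2 * (P / 2) > c"
    proof -
      define Q where "Q = P / (2 * real l ^ 2)"
      have "Q > 0" using P l_gt_1 by (simp add: Q_def)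
      then have "filterlim (\<lambda>j. real (Suc j) * Q) at_top sequentially" by real_asymp
      then have "\<forall>\<^sub>F j in sequentially. real (Suc j) * Q > c" by (simp add: filterlim_at_top_dense)
      then show ?thesis by (simp add: Q_def mult_ac)
    qed
    ultimately have "\<forall>\<^sub>F j in sequentially. False"
    proof eventually_elim
      case (elim j)
      have "real (Suc j) / real l ^ 2 \<le> norm (L 0 (s j))" using L_0_bounds(2)[OF s(1,2)[of j]] s(3)[of j] by simp
      then have "real (Suc j) / real l ^ 2 * (P / 2) \<le> norm (L 0 (s j)) * (\<Prod>k\<in>{1..<l - 1}. norm (L k (s j)))"
        using elim P by (intro mult_mono) auto
      also have "\<dots> = norm (\<Prod>k<l - 1. L k (s j))" by (simp only: prod_norm[symmetric] split)
      finally show ?case using elim c(2)[OF s(1)[of j]] by linarith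
    qed
    then show False by simp
  next
    case False
    then obtain k where k: "k \<in> {1..<l - 1}" "L k 1 = 0" by blast
    define k' where "k' = l - 1 - k"
    have k': "k' \<in> {1..<l - 1}" using k by (auto simp: k'_def)
    have kk: "k \<noteq> k'"
    proof
      assume "k = k'"
      then have "2 * k = l - 1" "k > 0" using k by (auto simp: k'_def)
      then show False using quadratic_L_nonzero k by blast
    qed
    have cnj: "norm (L k' (s j)) = norm (L k (s j))" for j
    proof -
      have "(\<lambda>n. chi k n * of_real (real n powr -s j)) sums L k (s j)"
        unfolding L_def using L_nontrivial(1)[OF ndvd[OF k(1)], of "s j"] s(1)[of j] by (simp add: sums_iff)
      then have "(\<lambda>n. cnj (chi k n * of_real (real n powr -s j))) sums cnj (L k (s j))" by (simp only: sums_cnj)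
      moreover have e: "cnj (chi k n) = chi k' n" for n
        using chi_cnj[of k n] k(1) by (simp add: k'_def)
      ultimately have "(\<lambda>n. chi k' n * of_real (real n powr -s j)) sums cnj (L k (s j))"
        by (simp only: complex_cnj_mult complex_cnj_complex_of_real e)
      then have "L k' (s j) = cnj (L k (s j))" unfolding L_def by (simp only: sums_iff)
      then show ?thesis by simp
    qed
    obtain C where C: "C \<ge> 0" "\<And>s. 1 < s \<Longrightarrow> s \<le> 2 \<Longrightarrow> norm (L k 1 - L k s) \<le> C * (s - 1)"
      using L_near_1[OF ndvd[OF k(1)]] by metis
    have Lk: "norm (L k (s j)) \<le> C / real (Suc j)" for j
      using C(2)[OF s(1,2)[of j]] s(3)[of j] k(2) by simp
    have bound: "norm (\<Prod>k<l - 1. L k (s j)) \<le> (2 + real j) * (C / real (Suc j)) ^ 2 * real l ^ card ({1..<l - 1} - {k, k'})" for j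
    proof -
      have "norm (\<Prod>k<l - 1. L k (s j)) = norm (L 0 (s j)) * (\<Prod>k\<in>{1..<l - 1}. norm (L k (s j)))"
        by (simp only: prod_norm[symmetric] split)
      also have "(\<Prod>k\<in>{1..<l - 1}. norm (L k (s j))) = (\<Prod>k\<in>{k, k'}. norm (L k (s j))) * (\<Prod>k\<in>{1..<l - 1} - {k, k'}. norm (L k (s j)))"
        using k k' by (subst prod.subset_diff[of "{k, k'}"]) auto
      also have "(\<Prod>k\<in>{k, k'}. norm (L k (s j))) = norm (L k (s j)) ^ 2" using kk cnj by (simp add: power2_eq_square)
      also have "norm (L 0 (s j)) * (norm (L k (s j)) ^ 2 * (\<Prod>k\<in>{1..<l - 1} - {k, k'}. norm (L k (s j))))
        \<le> (2 + real j) * ((C / real (Suc j)) ^ 2 * real l ^ card ({1..<l - 1} - {k, k'}))"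
      proof (intro mult_mono power_mono Lk)
        show "norm (L 0 (s j)) \<le> 2 + real j" using L_0_bounds(1)[OF s(1,2)[of j]] s(3)[of j] by simp
        have "(\<Prod>k\<in>{1..<l - 1} - {k, k'}. norm (L k (s j))) \<le> (\<Prod>k\<in>{1..<l - 1} - {k, k'}. real l)"
          using L_nontrivial(2)[OF ndvd] s(1)[of j] by (intro prod_mono) auto
        then show "(\<Prod>k\<in>{1..<l - 1} - {k, k'}. norm (L k (s j))) \<le> real l ^ card ({1..<l - 1} - {k, k'})" by simp
      qed (auto intro!: mult_nonneg_nonneg prod_nonneg)
      finally show ?thesis by (simp add: mult.assoc)
    qed
    have "(\<lambda>j. (2 + real j) / real (Suc j) ^ 2 * (C ^ 2 * real l ^ card ({1..<l - 1} - {k, k'}))) \<longlonglongrightarrow> 0"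
      by (rule tendsto_mult_left_zero) real_asymp
    then have "(\<lambda>j. (2 + real j) * (C / real (Suc j)) ^ 2 * real l ^ card ({1..<l - 1} - {k, k'})) \<longlonglongrightarrow> 0"
      by (simp add: power_divide mult_ac)
    then have "\<forall>\<^sub>F j in sequentially. (2 + real j) * (C / real (Suc j)) ^ 2 * real l ^ card ({1..<l - 1} - {k, k'}) < 1"
      by (rule order_tendstoD) simp
    then have "\<forall>\<^sub>F j in sequentially. False"
    proof eventually_elim
      case (elim j)
      then show ?case using bound[of j] c(2)[OF s(1)[of j]] by linarith
    qed
    then show False by simp
  qed
qed

end

theorem reciprocal_primes_1_mod_prime_not_summable:
  assumes "prime l"
  shows "\<not> summable (\<lambda>p. if prime p \<and> [p = 1] (mod l) then 1 / real p else 0)"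
proof -
  obtain g where "residue_primroot l g"
    using prime_primitive_root_exists[of l] assms prime_gt_1_nat by auto
  then interpret characters_mod_prime l g using assms by unfold_locales
  show ?thesis by (rule primes_1_mod_not_summable)
qed

section \<open>Sets of density zero\<close>

lemma density_0_iff:
  "has_two_sided_density A 0 \<longleftrightarrow>
     (\<forall>e>0. \<forall>\<^sub>F x in at_top. real (card {m \<in> A. real_of_int \<bar>m\<bar> \<le> x}) \<le> e * (2 * x))"
proof
  assume A: "has_two_sided_density A 0"
  show "\<forall>e>0. \<forall>\<^sub>F x in at_top. real (card {m \<in> A. real_of_int \<bar>m\<bar> \<le> x}) \<le> e * (2 * x)"
  proof (intro allI impI)
    fix e :: real assume "e > 0"
    then have "\<forall>\<^sub>F x in at_top. real (card {m \<in> A. real_of_int \<bar>m\<bar> \<le> x}) / (2 * x) < e"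
      using A unfolding has_two_sided_density_def by (rule order_tendstoD(2)[rotated])
    then show "\<forall>\<^sub>F x in at_top. real (card {m \<in> A. real_of_int \<bar>m\<bar> \<le> x}) \<le> e * (2 * x)"
      using eventually_gt_at_top[of 0] by eventually_elim (simp add: field_simps)
  qed
next
  assume A: "\<forall>e>0. \<forall>\<^sub>F x in at_top. real (card {m \<in> A. real_of_int \<bar>m\<bar> \<le> x}) \<le> e * (2 * x)"
  show "has_two_sided_density A 0" unfolding has_two_sided_density_def
  proof (rule order_tendstoI)
    fix e :: real assume "e < 0"
    show "\<forall>\<^sub>F x in at_top. e < real (card {m \<in> A. real_of_int \<bar>m\<bar> \<le> x}) / (2 * x)"
      using eventually_gt_at_top[of 0]
    proof eventually_elim
      case (elim x)
      have "0 \<le> real (card {m \<in> A. real_of_int \<bar>m\<bar> \<le> x}) / (2 * x)" using elim by simp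
      then show ?case using \<open>e < 0\<close> by linarith
    qed
  next
    fix e :: real assume e: "e > 0"
    have "\<forall>\<^sub>F x in at_top. real (card {m \<in> A. real_of_int \<bar>m\<bar> \<le> x}) \<le> e / 2 * (2 * x)"
      using A half_gt_zero[OF e] by blast
    then show "\<forall>\<^sub>F x in at_top. real (card {m \<in> A. real_of_int \<bar>m\<bar> \<le> x}) / (2 * x) < e"
      using eventually_gt_at_top[of 0]
    proof eventually_elim
      case (elim x)
      then have "real (card {m \<in> A. real_of_int \<bar>m\<bar> \<le> x}) / (2 * x) \<le> e / 2" by (simp add: field_simps)
      then show ?case using e by linarith
    qed
  qed
qed

lemma density_0_subset:
  assumes "has_two_sided_density B 0" "A \<subseteq> B"
  shows "has_two_sided_density A 0"
  unfolding density_0_iff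
proof (intro allI impI)
  fix e :: real assume "e > 0"
  then have "\<forall>\<^sub>F x in at_top. real (card {m \<in> B. real_of_int \<bar>m\<bar> \<le> x}) \<le> e * (2 * x)"
    using assms(1) density_0_iff by blast
  then show "\<forall>\<^sub>F x in at_top. real (card {m \<in> A. real_of_int \<bar>m\<bar> \<le> x}) \<le> e * (2 * x)"
  proof eventually_elim
    case (elim x)
    have "card {m \<in> A. real_of_int \<bar>m\<bar> \<le> x} \<le> card {m \<in> B. real_of_int \<bar>m\<bar> \<le> x}"
      using assms(2) by (intro card_mono finite_int_abs_le) auto
    then show ?case using elim by linarith
  qed
qed

lemma density_0_Un:
  assumes "has_two_sided_density A 0" "has_two_sided_density B 0"
  shows "has_two_sided_density (A \<union> B) 0"
  unfolding density_0_iff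
proof (intro allI impI)
  fix e :: real assume "e > 0"
  then have "\<forall>\<^sub>F x in at_top. real (card {m \<in> A. real_of_int \<bar>m\<bar> \<le> x}) \<le> e / 2 * (2 * x)"
     "\<forall>\<^sub>F x in at_top. real (card {m \<in> B. real_of_int \<bar>m\<bar> \<le> x}) \<le> e / 2 * (2 * x)"
    using assms density_0_iff half_gt_zero by blast+
  then show "\<forall>\<^sub>F x in at_top. real (card {m \<in> A \<union> B. real_of_int \<bar>m\<bar> \<le> x}) \<le> e * (2 * x)"
  proof eventually_elim
    case (elim x)
    have "{m \<in> A \<union> B. real_of_int \<bar>m\<bar> \<le> x} = {m \<in> A. real_of_int \<bar>m\<bar> \<le> x} \<union> {m \<in> B. real_of_int \<bar>m\<bar> \<le> x}" by auto
    then have "card {m \<in> A \<union> B. real_of_int \<bar>m\<bar> \<le> x} \<le> card {m \<in> A. real_of_int \<bar>m\<bar> \<le> x} + card {m \<in> B. real_of_int \<bar>m\<bar> \<le> x}"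
      by (simp only: card_Un_le)
    then show ?case using elim by (simp add: field_simps)
  qed
qed

lemma density_0_Union:
  assumes "finite I" "\<And>i. i \<in> I \<Longrightarrow> has_two_sided_density (A i) 0"
  shows "has_two_sided_density (\<Union>i\<in>I. A i) 0"
  using assms by (induction I rule: finite_induct) (auto intro: density_0_Un density_finite)

lemma density_avoiding_primes:
  assumes "finite P" "\<And>p. p \<in> P \<Longrightarrow> prime p"
  shows "has_two_sided_density {m. \<forall>p\<in>P. \<not> int p dvd m} (\<Prod>p\<in>P. 1 - 1 / real p)"
proof -
  have "has_two_sided_density {m. \<forall>p\<in>P. m mod int p \<in> {1..<int p}} (\<Prod>p\<in>P. real (card {1..<int p}) / real_of_int (int p))"
  proof (rule density_congruences)
    show "coprime (int p) (int q)" if "p \<in> P" "q \<in> P" "p \<noteq> q" for p q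
      using primes_coprime[of p q] assms that by (metis coprime_int_iff)
  qed (use assms prime_gt_0_nat in auto)
  also have "{m. \<forall>p\<in>P. m mod int p \<in> {1..<int p}} = {m. \<forall>p\<in>P. \<not> int p dvd m}"
  proof -
    have "m mod int p \<in> {1..<int p} \<longleftrightarrow> \<not> int p dvd m" if "p \<in> P" for m p
    proof -
      have "0 \<le> m mod int p" "m mod int p < int p" using assms(2)[OF that] prime_gt_0_nat by auto
      then show ?thesis by (auto simp: dvd_eq_mod_eq_0)
    qed
    then show ?thesis by blast
  qed
  also have "(\<Prod>p\<in>P. real (card {1..<int p}) / real_of_int (int p)) = (\<Prod>p\<in>P. 1 - 1 / real p)"
    using assms(2) prime_gt_0_nat by (intro prod.cong) (auto simp: field_simps of_nat_diff Suc_leI)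
  finally show ?thesis .
qed

lemma ex_finite_prime_set_small_product:
  assumes ns: "\<not> summable (\<lambda>p. if Q p then 1 / real p else 0)" and e: "e > 0"
  obtains P where "finite P" "\<And>p. p \<in> P \<Longrightarrow> Q p \<and> p > N" "(\<Prod>p\<in>P. 1 - 1 / real p) < e"
proof -
  define f where "f p = (if Q p then 1 / real p else 0)" for p
  have "\<not> summable (\<lambda>p. f (p + Suc N))" using ns by (subst summable_iff_shift) (simp add: f_def[abs_def])
  moreover have "0 \<le> f p" for p by (simp add: f_def)
  ultimately obtain n where n: "(\<Sum>p<n. f (p + Suc N)) > - ln e"
    using summableI_nonneg_bounded[of "\<lambda>p. f (p + Suc N)" "- ln e"] by (meson not_le)
  define P where "P = {p \<in> {Suc N..<Suc N + n}. Q p}"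
  have "(\<Sum>p<n. f (p + Suc N)) = (\<Sum>p\<in>{Suc N..<Suc N + n}. f p)"
    by (rule sum.reindex_bij_witness[of _ "\<lambda>p. p - Suc N" "\<lambda>p. p + Suc N"]) auto
  also have "\<dots> = (\<Sum>p\<in>P. 1 / real p)" unfolding P_def f_def by (subst sum.inter_filter) auto
  finally have S: "(\<Sum>p\<in>P. 1 / real p) > - ln e" using n by simp
  have "(\<Prod>p\<in>P. 1 - 1 / real p) \<le> (\<Prod>p\<in>P. exp (- (1 / real p)))"
  proof (rule prod_mono)
    fix p assume "p \<in> P"
    then have "p > 0" by (auto simp: P_def)
    then show "0 \<le> 1 - 1 / real p \<and> 1 - 1 / real p \<le> exp (- (1 / real p))"
      using exp_ge_add_one_self[of "- (1 / real p)"] by simp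
  qed
  also have "\<dots> = exp (- (\<Sum>p\<in>P. 1 / real p))" by (simp add: exp_sum[symmetric] sum_negf P_def)
  also have "\<dots> < exp (ln e)" using S by simp
  finally have less: "(\<Prod>p\<in>P. 1 - 1 / real p) < e" using e by simp
  show ?thesis by (rule that[OF _ _ less]) (auto simp: P_def)
qed

text \<open>Divergence is not affected by discarding finitely many primes, so each set can be chosen beyond the previous ones.\<close>

lemma ex_disjoint_prime_sets:
  assumes ns: "\<not> summable (\<lambda>p. if Q p then 1 / real p else 0)" and e: "e > 0"
  shows "\<exists>F. (\<forall>i<k::nat. finite (F i) \<and> (\<forall>p\<in>F i. Q p) \<and> (\<Prod>p\<in>F i. 1 - 1 / real p) < e) \<and> disjoint_family_on F {..<k}"
proof (induction k)
  case 0
  show ?case by (simp add: disjoint_family_on_def)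
next
  case (Suc k)
  then obtain F where F: "\<forall>i<k. finite (F i) \<and> (\<forall>p\<in>F i. Q p) \<and> (\<Prod>p\<in>F i. 1 - 1 / real p) < e" "disjoint_family_on F {..<k}" by blast
  define N where "N = Max (insert 0 (\<Union>i<k. F i))"
  have N: "p \<le> N" if "p \<in> F i" "i < k" for p i
    unfolding N_def using that F(1) by (intro Max_ge) auto
  obtain P where P: "finite P" "\<And>p. p \<in> P \<Longrightarrow> Q p \<and> p > N" "(\<Prod>p\<in>P. 1 - 1 / real p) < e"
    using ex_finite_prime_set_small_product[OF ns e, of N] by blast
  have "(F(k := P)) i \<inter> (F(k := P)) j = {}" if "i < Suc k" "j < Suc k" "i \<noteq> j" for i j
    using that F(2) P(2) N by (fastforce simp: disjoint_family_on_def less_Suc_eq)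
  then show ?case using F(1) P by (intro exI[of _ "F(k := P)"]) (auto simp: disjoint_family_on_def less_Suc_eq)
qed

text \<open>With \<open>k\<close> disjoint finite sets of primes, each of them missed only by a small proportion of the integers, an integer with fewer than \<open>k\<close> prime factors satisfying \<open>Q\<close> must miss one set entirely.\<close>

lemma density_few_prime_factors:
  assumes ns: "\<not> summable (\<lambda>p. if prime p \<and> Q p then 1 / real p else 0)"
  shows "has_two_sided_density {m. m \<noteq> 0 \<and> card {p. prime p \<and> Q p \<and> int p dvd m} < k} 0" (is "has_two_sided_density ?A 0")
  unfolding density_0_iff
proof (intro allI impI)
  fix e :: real assume e: "e > 0"
  define e' where "e' = e / (real k + 1)"
  have e': "e' > 0" using e by (simp add: e'_def)
  obtain F where F: "\<And>i. i < k \<Longrightarrow> finite (F i) \<and> (\<forall>p\<in>F i. prime p \<and> Q p) \<and> (\<Prod>p\<in>F i. 1 - 1 / real p) < e'"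
     "disjoint_family_on F {..<k}" using ex_disjoint_prime_sets[OF ns e'] by blast
  define B where "B i = {m. \<forall>p\<in>F i. \<not> int p dvd m}" for i
  have sub: "?A \<subseteq> (\<Union>i<k. B i)"
  proof
    fix m assume m: "m \<in> ?A"
    show "m \<in> (\<Union>i<k. B i)"
    proof (rule ccontr)
      assume "m \<notin> (\<Union>i<k. B i)"
      then have "\<forall>i<k. \<exists>p. p \<in> F i \<and> int p dvd m" by (auto simp: B_def)
      then obtain q where q: "\<And>i. i < k \<Longrightarrow> q i \<in> F i \<and> int (q i) dvd m" by metis
      have "inj_on q {..<k}"
      proof (rule inj_onI)
        fix i j assume ij: "i \<in> {..<k}" "j \<in> {..<k}" "q i = q j"
        then have "q i \<in> F i \<inter> F j" using q[of i] q[of j] by auto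
        then show "i = j" using F(2) ij by (auto simp: disjoint_family_on_def)
      qed
      then have "card (q ` {..<k}) = k" by (simp add: card_image)
      moreover have "q ` {..<k} \<subseteq> {p. prime p \<and> Q p \<and> int p dvd m}" using q F(1) by auto
      moreover have "finite {p. prime p \<and> Q p \<and> int p dvd m}"
      proof (rule finite_subset)
        show "{p. prime p \<and> Q p \<and> int p dvd m} \<subseteq> {..nat \<bar>m\<bar>}"
          using m by (auto dest!: dvd_imp_le_int)
      qed simp
      ultimately have "k \<le> card {p. prime p \<and> Q p \<and> int p dvd m}" using card_mono by metis
      then show False using m by simp
    qed
  qed
  have "\<forall>\<^sub>F x in at_top. \<forall>i\<in>{..<k}. real (card {m \<in> B i. real_of_int \<bar>m\<bar> \<le> x}) \<le> e' * (2 * x)"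
  proof (intro eventually_ball_finite ballI)
    fix i assume i: "i \<in> {..<k}"
    then have "has_two_sided_density (B i) (\<Prod>p\<in>F i. 1 - 1 / real p)" unfolding B_def
      using F(1) by (intro density_avoiding_primes) auto
    then have "\<forall>\<^sub>F x in at_top. real (card {m \<in> B i. real_of_int \<bar>m\<bar> \<le> x}) / (2 * x) < e'"
      unfolding has_two_sided_density_def using F(1) i by (auto intro: order_tendstoD(2))
    then show "\<forall>\<^sub>F x in at_top. real (card {m \<in> B i. real_of_int \<bar>m\<bar> \<le> x}) \<le> e' * (2 * x)"
      using eventually_gt_at_top[of 0] by eventually_elim (simp add: field_simps)
  qed simp
  then show "\<forall>\<^sub>F x in at_top. real (card {m \<in> ?A. real_of_int \<bar>m\<bar> \<le> x}) \<le> e * (2 * x)"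
    using eventually_gt_at_top[of 0]
  proof eventually_elim
    case (elim x)
    have "card {m \<in> ?A. real_of_int \<bar>m\<bar> \<le> x} \<le> card (\<Union>i<k. {m \<in> B i. real_of_int \<bar>m\<bar> \<le> x})"
      using sub by (intro card_mono finite_UN_I finite_int_abs_le) auto
    also have "\<dots> \<le> (\<Sum>i<k. card {m \<in> B i. real_of_int \<bar>m\<bar> \<le> x})" by (rule card_UN_le) simp
    finally have "real (card {m \<in> ?A. real_of_int \<bar>m\<bar> \<le> x}) \<le> real (\<Sum>i<k. card {m \<in> B i. real_of_int \<bar>m\<bar> \<le> x})"
      by (rule of_nat_mono)
    also have "\<dots> = (\<Sum>i<k. real (card {m \<in> B i. real_of_int \<bar>m\<bar> \<le> x}))" by (rule of_nat_sum)
    also have "\<dots> \<le> (\<Sum>i<k. e' * (2 * x))" using elim by (intro sum_mono) auto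
    also have "\<dots> = real k * e' * (2 * x)" by simp
    also have "\<dots> \<le> e * (2 * x)" using elim e by (intro mult_right_mono) (auto simp: e'_def field_simps)
    finally show ?case .
  qed
qed

section \<open>Radicals\<close>

interpretation rat_poly_complex: map_poly_idom_hom "of_rat :: rat \<Rightarrow> complex" ..

definition rat_eval :: "rat poly \<Rightarrow> complex \<Rightarrow> complex" where
  "rat_eval P x = poly (map_poly of_rat P) x"

definition int_eval :: "int poly \<Rightarrow> complex \<Rightarrow> complex" where
  "int_eval P x = poly (map_poly of_int P) x"

lemma rat_eval_simps [simp]:
  "rat_eval 0 x = 0" "rat_eval 1 x = 1" "rat_eval (P + Q) x = rat_eval P x + rat_eval Q x"
  "rat_eval (P * Q) x = rat_eval P x * rat_eval Q x" "rat_eval (P - Q) x = rat_eval P x - rat_eval Q x"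
  "rat_eval (- P) x = - rat_eval P x" "rat_eval (monom c i) x = of_rat c * x ^ i"
  "rat_eval (pCons c P) x = of_rat c + x * rat_eval P x" "rat_eval (P ^ i) x = rat_eval P x ^ i"
  by (simp_all add: rat_eval_def rat_poly_complex.hom_mult rat_poly_complex.hom_add rat_poly_complex.hom_minus
      rat_poly_complex.hom_uminus poly_monom map_poly_monom of_rat_hom.map_poly_pCons_hom rat_poly_complex.hom_power)

lemma rat_eval_sum: "rat_eval (sum P A) x = (\<Sum>i\<in>A. rat_eval (P i) x)"
  by (simp add: rat_eval_def rat_poly_complex.hom_sum poly_sum)

lemma int_eval_simps [simp]:
  "int_eval 0 x = 0" "int_eval 1 x = 1" "int_eval (P + Q) x = int_eval P x + int_eval Q x"
  "int_eval (P * Q) x = int_eval P x * int_eval Q x" "int_eval (P - Q) x = int_eval P x - int_eval Q x"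
  "int_eval (- P) x = - int_eval P x" "int_eval (monom c i) x = of_int c * x ^ i"
  "int_eval (pCons c P) x = of_int c + x * int_eval P x" "int_eval (P ^ i) x = int_eval P x ^ i"
  by (simp_all add: int_eval_def of_int_poly_hom.hom_mult of_int_poly_hom.hom_add of_int_poly_hom.hom_minus
      of_int_poly_hom.hom_uminus poly_monom map_poly_monom of_int_hom.map_poly_pCons_hom of_int_poly_hom.hom_power)

lemma int_eval_sum: "int_eval (sum P A) x = (\<Sum>i\<in>A. int_eval (P i) x)"
  by (simp add: int_eval_def of_int_poly_hom.hom_sum poly_sum)

lemma int_eval_as_rat_eval: "int_eval P x = rat_eval (map_poly of_int P) x"
  by (simp add: int_eval_def rat_eval_def map_poly_map_poly o_def)

text \<open>All complex roots have the same absolute value, so the constant coefficient \<open>c\<close> of a monic factor of degree \<open>k\<close> satisfies \<open>\<bar>c\<bar> ^ n = \<bar>m\<bar> ^ k\<close>. A prime that divides \<open>m\<close> exactly once then shows that \<open>n\<close> divides \<open>k\<close>.\<close>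

lemma irreducible_radical:
  assumes m: "squarefree (m::int)" "\<bar>m\<bar> \<noteq> 1" and n: "n > 0"
  shows "irreducible (monom 1 n - [:of_int m:] :: rat poly)"
proof (rule irreducibleI)
  let ?f = "monom 1 n - [:of_int m:] :: rat poly"
  have m0: "m \<noteq> 0" using m(1) by auto
  have cn: "coeff ?f n = 1" using n by (cases n) auto
  have deg: "degree ?f = n"
  proof (rule antisym)
    show "degree ?f \<le> n" by (intro degree_diff_le) (auto simp: degree_monom_le)
    show "n \<le> degree ?f" using cn by (intro le_degree) simp
  qed
  show f0: "?f \<noteq> 0" using cn by (metis coeff_0 zero_neq_one)
  show "\<not> is_unit ?f" using is_unit_iff_degree[OF f0] deg n by simp
  fix g h assume gh: "?f = g * h"
  show "is_unit g \<or> is_unit h"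
  proof (rule ccontr)
    assume nu: "\<not> (is_unit g \<or> is_unit h)"
    have g0: "g \<noteq> 0" and h0: "h \<noteq> 0" using gh f0 by auto
    have dg: "degree g > 0" "degree h > 0" using nu is_unit_iff_degree g0 h0 by auto
    have dsum: "degree g + degree h = n" using degree_mult_eq[OF g0 h0] gh deg by simp
    define G where "G = (map_poly of_rat g :: complex poly)"
    have G0: "G \<noteq> 0" and dG: "degree G = degree g" using g0 by (auto simp: G_def degree_map_poly)
    obtain as where as: "smult (lead_coeff G) (\<Prod>a\<leftarrow>as. [:-a, 1:]) = G" "length as = degree G"
      using fundamental_theorem_algebra_factorized[of G] by blast
    have root: "norm a ^ n = real_of_int \<bar>m\<bar>" if "a \<in> set as" for a
    proof -
      have "poly (\<Prod>a\<leftarrow>as. [:-a, 1:]) a = 0" using that by (induction as) auto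
      then have "poly G a = 0" using as(1) by (metis mult_zero_right poly_smult)
      then have "rat_eval ?f a = 0" unfolding gh G_def by (simp flip: rat_eval_def)
      then have "a ^ n = of_int m" by simp
      then have "norm a ^ n = norm (complex_of_int m)" by (metis norm_power)
      then show ?thesis by simp
    qed
    have pr: "norm (\<Prod>a\<leftarrow>as. -a) ^ n = (real_of_int \<bar>m\<bar>) ^ length as"
      using root by (induction as) (auto simp: norm_mult power_mult_distrib)
    have "poly G 0 = lead_coeff G * (\<Prod>a\<leftarrow>as. -a)"
    proof -
      have "poly (\<Prod>a\<leftarrow>as. [:-a, 1:]) 0 = (\<Prod>a\<leftarrow>as. -a)" by (induction as) auto
      then show ?thesis using as(1) by (metis poly_smult)
    qed
    moreover have "poly G 0 = of_rat (coeff g 0)" by (simp add: G_def poly_0_coeff_0 coeff_map_poly)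
    moreover have "lead_coeff G = of_rat (lead_coeff g)" unfolding dG by (simp add: G_def coeff_map_poly)
    ultimately have "(\<Prod>a\<leftarrow>as. -a) = of_rat (coeff g 0 / lead_coeff g)"
      using g0 by (simp add: of_rat_divide)
    then have "norm (complex_of_rat (coeff g 0 / lead_coeff g)) ^ n = (real_of_int \<bar>m\<bar>) ^ degree g"
      using pr as(2) dG by simp
    moreover obtain u v where uv: "coeff g 0 / lead_coeff g = of_int u / of_int v" "v > 0"
      by (metis quotient_of_div quotient_of_denom_pos prod.exhaust)
    ultimately have "(real_of_int \<bar>u\<bar> / real_of_int \<bar>v\<bar>) ^ n = (real_of_int \<bar>m\<bar>) ^ degree g"
      by (simp add: of_rat_divide norm_divide)
    then have "real_of_int (\<bar>u\<bar> ^ n) = real_of_int (\<bar>m\<bar> ^ degree g * \<bar>v\<bar> ^ n)"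
      using uv(2) by (simp add: power_divide field_simps)
    then have eq: "\<bar>u\<bar> ^ n = \<bar>m\<bar> ^ degree g * \<bar>v\<bar> ^ n" by linarith
    obtain p where p: "prime p" "p dvd m" using m(2) m0 prime_divisor_exists[of m] zdvd1_eq[of m] by blast
    have mm: "multiplicity p \<bar>m\<bar> = 1"
    proof -
      have "\<not> p\<^sup>2 dvd m" using m(1) p by (auto simp: squarefree_def)
      then have "multiplicity p m = 1" using p m0
        by (intro multiplicity_eqI) (auto simp: power2_eq_square)
      then show ?thesis by (simp add: abs_if)
    qed
    have u0: "u \<noteq> 0" using eq m0 uv(2) n by (auto simp: power_0_left)
    have "multiplicity p (\<bar>u\<bar> ^ n) = n * multiplicity p \<bar>u\<bar>"
      using p u0 by (intro prime_elem_multiplicity_power_distrib) auto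
    moreover have "multiplicity p (\<bar>m\<bar> ^ degree g * \<bar>v\<bar> ^ n) = degree g + n * multiplicity p \<bar>v\<bar>"
    proof -
      have pe: "prime_elem p" using p(1) by (rule prime_imp_prime_elem)
      have "multiplicity p (\<bar>m\<bar> ^ degree g * \<bar>v\<bar> ^ n) = multiplicity p (\<bar>m\<bar> ^ degree g) + multiplicity p (\<bar>v\<bar> ^ n)"
        using m0 uv(2) by (intro prime_elem_multiplicity_mult_distrib pe) auto
      also have "multiplicity p (\<bar>m\<bar> ^ degree g) = degree g * multiplicity p \<bar>m\<bar>"
        using m0 by (intro prime_elem_multiplicity_power_distrib pe) auto
      also have "multiplicity p (\<bar>v\<bar> ^ n) = n * multiplicity p \<bar>v\<bar>"
        using uv(2) by (intro prime_elem_multiplicity_power_distrib pe) auto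
      finally show ?thesis using mm by simp
    qed
    ultimately have "n * multiplicity p \<bar>u\<bar> = degree g + n * multiplicity p \<bar>v\<bar>" using eq by simp
    then have "n dvd degree g" by (metis dvd_add_left_iff dvd_triv_left)
    then show False using dg dsum by (auto dest: dvd_imp_le)
  qed
qed

lemma radical_minimal_degree:
  fixes a :: complex
  assumes irr: "irreducible (monom 1 n - [:of_int m:] :: rat poly)" and a: "a ^ n = of_int m"
    and P: "degree P < n" "rat_eval P a = 0"
  shows "P = 0"
proof (rule ccontr)
  let ?f = "monom 1 n - [:of_int m:] :: rat poly"
  assume P0: "P \<noteq> 0"
  have n: "n > 0" using P(1) by simp
  have "coeff ?f n = 1" using n by (cases n) auto
  then have deg: "degree ?f \<ge> n" by (intro le_degree) simp
  have nd: "\<not> ?f dvd P"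
  proof
    assume "?f dvd P"
    then have "degree ?f \<le> degree P" using P0 by (rule dvd_imp_degree_le)
    then show False using deg P(1) by linarith
  qed
  have "prime_elem ?f" using irr by (rule irreducible_imp_prime_elem)
  then have "coprime ?f P" using nd by (rule prime_elem_imp_coprime)
  then have "fst (bezout_coefficients ?f P) * ?f + snd (bezout_coefficients ?f P) * P = 1"
    using bezout_coefficients_fst_snd[of ?f P] by (simp only: coprime_iff_gcd_eq_1)
  then obtain u v where uv: "u * ?f + v * P = 1" by blast
  have "rat_eval (u * ?f + v * P) a = 1" unfolding uv by simp
  then show False using P(2) a by simp
qed

lemma radical_powers_independent:
  fixes a :: complex
  assumes irr: "irreducible (monom 1 n - [:of_int m:] :: rat poly)" and a: "a ^ n = of_int m"
    and s: "(\<Sum>i<n. of_rat (c i) * a ^ i) = 0" and i: "i < n"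
  shows "c i = 0"
proof -
  define P where "P = (\<Sum>i<n. monom (c i) i)"
  have "degree P < n" unfolding P_def using i
    by (intro degree_sum_less) (auto intro: le_less_trans[OF degree_monom_le])
  moreover have "rat_eval P a = 0"
    using s by (simp add: P_def rat_eval_sum)
  ultimately have "P = 0" using radical_minimal_degree[OF irr a] by blast
  moreover have "coeff P i = c i" using i by (simp add: P_def coeff_sum)
  ultimately show ?thesis by simp
qed

section \<open>Multiplication matrices of radicals\<close>

lemma det_dvd_row_factors:
  fixes A :: "int mat"
  assumes A: "A \<in> carrier_mat n n" and c: "\<And>i j. i < n \<Longrightarrow> j < n \<Longrightarrow> c i dvd A $$ (i, j)"
  shows "(\<Prod>i<n. c i) dvd Determinant.det A"
  unfolding det_def'[OF A]
proof (rule dvd_sum)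
  fix p assume "p \<in> {p. p permutes {0..<n}}"
  then have p: "p permutes {0..<n}" by simp
  have "(\<Prod>i<n. c i) dvd (\<Prod>i<n. A $$ (i, p i))"
  proof (rule prod_dvd_prod)
    fix i assume "i \<in> {..<n}"
    then show "c i dvd A $$ (i, p i)" using c[of i "p i"] p permutes_in_image[OF p, of i] by auto
  qed
  then show "(\<Prod>i<n. c i) dvd signof p * (\<Prod>i = 0..<n. A $$ (i, p i))"
    by (simp add: lessThan_atLeast0)
qed

lemma det_bound:
  fixes A :: "int mat"
  assumes A: "A \<in> carrier_mat n n" and K: "\<And>i j. i < n \<Longrightarrow> j < n \<Longrightarrow> \<bar>A $$ (i, j)\<bar> \<le> K"
  shows "\<bar>Determinant.det A\<bar> \<le> fact n * K ^ n"
proof -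
  have "\<bar>Determinant.det A\<bar> \<le> (\<Sum>p | p permutes {0..<n}. \<bar>signof p * (\<Prod>i = 0..<n. A $$ (i, p i))\<bar>)"
    unfolding det_def'[OF A] by (rule sum_abs)
  also have "\<dots> \<le> (\<Sum>p | p permutes {0..<n}. K ^ n)"
  proof (rule sum_mono)
    fix p assume "p \<in> {p. p permutes {0..<n}}"
    then have p: "p permutes {0..<n}" by simp
    have "\<bar>\<Prod>i = 0..<n. A $$ (i, p i)\<bar> = (\<Prod>i = 0..<n. \<bar>A $$ (i, p i)\<bar>)" by (rule abs_prod)
    also have "\<dots> \<le> (\<Prod>i = 0..<n. K)"
    proof (rule prod_mono)
      fix i assume "i \<in> {0..<n}"
      then show "0 \<le> \<bar>A $$ (i, p i)\<bar> \<and> \<bar>A $$ (i, p i)\<bar> \<le> K"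
        using K[of i "p i"] permutes_in_image[OF p, of i] by auto
    qed
    finally show "\<bar>signof p * (\<Prod>i = 0..<n. A $$ (i, p i))\<bar> \<le> K ^ n"
      by (simp add: abs_mult sign_def)
  qed
  also have "\<dots> = fact n * K ^ n" by (simp add: card_permutations)
  finally show ?thesis .
qed

text \<open>Multiplication by \<open>\<Sum>k<l. v k * x ^ k\<close> modulo \<open>x ^ l - b\<close>, in the basis of powers of \<open>x\<close>.\<close>

definition mulmat :: "nat \<Rightarrow> int \<Rightarrow> (nat \<Rightarrow> int) \<Rightarrow> int mat" where
  "mulmat l b v = Matrix.mat l l (\<lambda>(i, j). if j \<le> i then v (i - j) else b * v (l + i - j))"

lemma mulmat_carrier [simp]: "mulmat l b v \<in> carrier_mat l l" by (simp add: mulmat_def)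

lemma index_mult_mat_sum:
  assumes "A \<in> carrier_mat n n" "B \<in> carrier_mat n n" "i < n" "j < n"
  shows "(A * B) $$ (i, j) = (\<Sum>k<n. A $$ (i, k) * B $$ (k, j))"
  using assms by (auto simp: scalar_prod_def lessThan_atLeast0 intro!: sum.cong)

lemma index_mult_mat_vec_sum:
  assumes "A \<in> carrier_mat n n" "w \<in> carrier_vec n" "i < n"
  shows "vec_index (A *\<^sub>v w) i = (\<Sum>j<n. A $$ (i, j) * vec_index w j)"
  using assms by (auto simp: scalar_prod_def lessThan_atLeast0 intro!: sum.cong)

text \<open>The row of powers of \<open>r\<close> is an eigenrow whenever \<open>r ^ l = b\<close>; the error term is kept so that the identity can also be read modulo \<open>m\<close>.\<close>

lemma mulmat_eigenrow:
  fixes r :: "'a :: comm_ring_1"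
  assumes j: "j < l"
  shows "(\<Sum>i<l. r ^ i * of_int (mulmat l b v $$ (i, j)))
    = r ^ j * (\<Sum>k<l. of_int (v k) * r ^ k) + (of_int b - r ^ l) * (\<Sum>i<j. r ^ i * of_int (v (l + i - j)))"
proof -
  have "(\<Sum>i<l. r ^ i * of_int (mulmat l b v $$ (i, j))) = (\<Sum>i<l. r ^ i * of_int (if j \<le> i then v (i - j) else b * v (l + i - j)))"
    using j by (intro sum.cong) (auto simp: mulmat_def)
  also have "\<dots> = (\<Sum>i\<in>{..<j} \<union> {j..<l}. r ^ i * of_int (if j \<le> i then v (i - j) else b * v (l + i - j)))"
    using j by (intro sum.cong) auto
  also have "(\<Sum>i\<in>{..<j} \<union> {j..<l}. r ^ i * of_int (if j \<le> i then v (i - j) else b * v (l + i - j)))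
      = (\<Sum>i<j. r ^ i * of_int (b * v (l + i - j))) + (\<Sum>i\<in>{j..<l}. r ^ i * of_int (v (i - j)))"
    by (subst sum.union_disjoint) auto
  also have "(\<Sum>i\<in>{j..<l}. r ^ i * of_int (v (i - j))) = (\<Sum>k<l - j. r ^ j * (of_int (v k) * r ^ k))"
  proof (rule sum.reindex_bij_witness[of _ "\<lambda>k. k + j" "\<lambda>i. i - j"])
    fix i assume "i \<in> {j..<l}"
    then have pw: "r ^ i = r ^ j * r ^ (i - j)" by (simp flip: power_add)
    show "r ^ j * (of_int (v (i - j)) * r ^ (i - j)) = r ^ i * of_int (v (i - j))" unfolding pw by (simp add: mult_ac)
  qed (use j in auto)
  also have "(\<Sum>i<j. r ^ i * of_int (b * v (l + i - j))) = of_int b * (\<Sum>i<j. r ^ i * of_int (v (l + i - j)))"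
    by (simp add: sum_distrib_left mult_ac)
  finally have 1: "(\<Sum>i<l. r ^ i * of_int (mulmat l b v $$ (i, j))) =
    of_int b * (\<Sum>i<j. r ^ i * of_int (v (l + i - j))) + r ^ j * (\<Sum>k<l - j. of_int (v k) * r ^ k)"
    by (simp add: sum_distrib_left)
  have "{..<l} = {..<l - j} \<union> {l - j..<l}" by auto
  then have "(\<Sum>k<l. of_int (v k) * r ^ k) = (\<Sum>k<l - j. of_int (v k) * r ^ k) + (\<Sum>k\<in>{l - j..<l}. of_int (v k) * r ^ k)"
    by (metis (no_types, lifting) finite_atLeastLessThan finite_lessThan ivl_disj_int_one(2) sum.union_disjoint lessThan_atLeast0 ivl_disj_int_two(3))
  moreover have "r ^ j * (\<Sum>k\<in>{l - j..<l}. of_int (v k) * r ^ k) = r ^ l * (\<Sum>i<j. r ^ i * of_int (v (l + i - j)))"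
    unfolding sum_distrib_left using j
  proof (intro sum.reindex_bij_witness[of _ "\<lambda>i. l + i - j" "\<lambda>k. k + j - l"])
    fix k assume k: "k \<in> {l - j..<l}"
    then have "j + k = l + (k + j - l)" using j by auto
    then have pw: "r ^ j * r ^ k = r ^ l * r ^ (k + j - l)" by (metis power_add)
    have e: "l + (k + j - l) - j = k" using k j by auto
    show "r ^ l * (r ^ (k + j - l) * of_int (v (l + (k + j - l) - j))) = r ^ j * (of_int (v k) * r ^ k)"
      unfolding e using pw by (metis mult.assoc mult.commute)
  qed (use j in auto)
  ultimately show ?thesis using 1 by (simp add: ring_distribs)
qed

text \<open>The matrix represents multiplication by a nonzero element of a field.\<close>

lemma mulmat_det_nonzero:
  assumes irr: "irreducible (monom 1 l - [:of_int b:] :: rat poly)" and l: "l > 0"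
    and v: "k < l" "v k \<noteq> 0"
  shows "Determinant.det (mulmat l b v) \<noteq> 0"
proof
  assume d0: "Determinant.det (mulmat l b v) = 0"
  obtain a :: complex where "of_int b = a ^ l"
    using exists_complex_root[of l "of_int b"] l by (metis not_gr_zero)
  then have a: "a ^ l = of_int b" by (rule sym)
  let ?A = "map_mat rat_of_int (mulmat l b v)"
  have "Determinant.det ?A = 0" using d0 by (simp add: of_int_hom.hom_det)
  then obtain w where w: "w \<in> carrier_vec l" "w \<noteq> 0\<^sub>v l" "?A *\<^sub>v w = 0\<^sub>v l"
    using det_0_iff_vec_prod_zero_field[of ?A l] by auto
  define V where "V = (\<Sum>k<l. of_int (v k) * a ^ k)"
  define W where "W = (\<Sum>j<l. of_rat (vec_index w j) * a ^ j)"
  have row: "(\<Sum>j<l. rat_of_int (mulmat l b v $$ (i, j)) * vec_index w j) = 0" if i: "i < l" for i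
  proof -
    have "vec_index (?A *\<^sub>v w) i = (\<Sum>j<l. rat_of_int (mulmat l b v $$ (i, j)) * vec_index w j)"
      using index_mult_mat_vec_sum[of ?A l w i] i w(1) carrier_matD[OF mulmat_carrier[of l b v]] by auto
    then show ?thesis using w(3) i by simp
  qed
  have "V * W = (\<Sum>j<l. of_rat (vec_index w j) * (a ^ j * V))"
    by (simp add: W_def sum_distrib_left mult_ac)
  also have "\<dots> = (\<Sum>j<l. of_rat (vec_index w j) * (\<Sum>i<l. a ^ i * of_int (mulmat l b v $$ (i, j))))"
    by (intro sum.cong refl) (simp add: mulmat_eigenrow a V_def)
  also have "\<dots> = (\<Sum>i<l. a ^ i * of_rat (\<Sum>j<l. rat_of_int (mulmat l b v $$ (i, j)) * vec_index w j))"
    unfolding sum_distrib_left of_rat_sum by (subst sum.swap) (simp add: of_rat_mult mult_ac)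
  also have "\<dots> = 0" using row by simp
  finally have "V = 0 \<or> W = 0" by simp
  then show False
  proof
    assume "V = 0"
    then have "(\<Sum>k<l. of_rat (rat_of_int (v k)) * a ^ k) = 0" by (simp add: V_def)
    from radical_powers_independent[OF irr a this v(1)] show False using v(2) by simp
  next
    assume "W = 0"
    then have "vec_index w j = 0" if "j < l" for j
      using radical_powers_independent[OF irr a _ that, of "vec_index w"] by (simp add: W_def)
    then have "w = 0\<^sub>v l" using w(1) by (intro eq_vecI) auto
    then show False using w(2) by simp
  qed
qed

text \<open>A row of powers of \<open>r\<close> replaces the first row without changing the determinant, and all its entries are divisible by \<open>m\<close>.\<close>

lemma mulmat_det_dvd:
  assumes l: "l > 0" and m: "m dvd (\<Sum>k<l. v k * r ^ k)" "m dvd r ^ l - b"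
  shows "m dvd Determinant.det (mulmat l b v)"
proof -
  define W where "W = Matrix.mat l l (\<lambda>(i, j). if i = 0 then r ^ j else if i = j then 1 else 0)"
  have W: "W \<in> carrier_mat l l" by (simp add: W_def)
  have "upper_triangular W" by (auto simp: W_def upper_triangular_def)
  then have "Determinant.det W = (\<Prod>i = 0..<l. W $$ (i, i))"
    using W by (simp add: det_upper_triangular[OF _ W] prod_list_diag_prod)
  also have "\<dots> = 1" by (intro prod.neutral) (auto simp: W_def)
  finally have dW: "Determinant.det W = 1" .
  define c where "c i = (if i = 0 then m else 1)" for i :: nat
  have "(\<Prod>i<l. c i) dvd Determinant.det (W * mulmat l b v)"
  proof (rule det_dvd_row_factors)
    fix i j assume ij: "i < l" "j < l"
    show "c i dvd (W * mulmat l b v) $$ (i, j)"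
    proof (cases "i = 0")
      case True
      have "(W * mulmat l b v) $$ (0, j) = (\<Sum>k<l. r ^ k * mulmat l b v $$ (k, j))"
        unfolding index_mult_mat_sum[OF W mulmat_carrier l ij(2)]
        by (intro sum.cong) (auto simp: W_def)
      also have "m dvd \<dots>"
        using mulmat_eigenrow[OF ij(2), of r b v] m
        by (simp add: dvd_add dvd_mult dvd_mult2 dvd_diff_commute)
      finally show ?thesis using True by (simp add: c_def)
    qed (simp add: c_def)
  qed (use W in auto)
  moreover have "(\<Prod>i<l. c i) = m" using l by (simp add: c_def prod.delta)
  ultimately show ?thesis by (simp add: det_mult[OF W mulmat_carrier] dW)
qed

text \<open>Two distinct roots modulo \<open>p\<close> give two independent rows divisible by \<open>p\<close>.\<close>

lemma mulmat_det_dvd_square: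
  assumes l: "l \<ge> 2" and p: "prime (p::int)" and rs: "\<not> p dvd r - s"
    and r: "p dvd (\<Sum>k<l. v k * r ^ k)" "p dvd r ^ l - b"
    and s: "p dvd (\<Sum>k<l. v k * s ^ k)" "p dvd s ^ l - b"
  shows "p ^ 2 dvd Determinant.det (mulmat l b v)"
proof -
  define W where "W = Matrix.mat l l (\<lambda>(i, j). if i = 0 then r ^ j else if i = 1 then s ^ j - r ^ j else if i = j then 1 else 0)"
  have W: "W \<in> carrier_mat l l" by (simp add: W_def)
  have "upper_triangular W" by (auto simp: W_def upper_triangular_def)
  then have "Determinant.det W = (\<Prod>i = 0..<l. W $$ (i, i))"
    using W by (simp add: det_upper_triangular[OF _ W] prod_list_diag_prod)
  also have "\<dots> = (\<Prod>i = 0..<l. if i = 1 then s - r else 1)" by (intro prod.cong) (auto simp: W_def)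
  also have "\<dots> = s - r" using l by (simp add: prod.delta)
  finally have dW: "Determinant.det W = s - r" .
  define c where "c i = (if i = 0 then p else if i = 1 then p else 1)" for i :: nat
  have rowdvd: "p dvd (\<Sum>k<l. t ^ k * mulmat l b v $$ (k, j))" if "j < l" "p dvd (\<Sum>k<l. v k * t ^ k)" "p dvd t ^ l - b" for t j
    using mulmat_eigenrow[OF that(1), of t b v] that by (simp add: dvd_add dvd_mult dvd_mult2 dvd_diff_commute)
  have "(\<Prod>i<l. c i) dvd Determinant.det (W * mulmat l b v)"
  proof (rule det_dvd_row_factors)
    fix i j assume ij: "i < l" "j < l"
    have prod: "(W * mulmat l b v) $$ (i, j) = (\<Sum>k<l. W $$ (i, k) * mulmat l b v $$ (k, j))"
      by (rule index_mult_mat_sum[OF W mulmat_carrier ij])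
    consider "i = 0" | "i = 1" | "i > 1" by linarith
    then show "c i dvd (W * mulmat l b v) $$ (i, j)"
    proof cases
      case 1
      have "(W * mulmat l b v) $$ (i, j) = (\<Sum>k<l. r ^ k * mulmat l b v $$ (k, j))"
        unfolding prod using 1 ij by (intro sum.cong) (auto simp: W_def)
      then show ?thesis using rowdvd[OF ij(2) r] 1 by (simp add: c_def)
    next
      case 2
      have "(W * mulmat l b v) $$ (i, j) = (\<Sum>k<l. s ^ k * mulmat l b v $$ (k, j)) - (\<Sum>k<l. r ^ k * mulmat l b v $$ (k, j))"
        unfolding prod sum_subtractf[symmetric] using 2 ij by (intro sum.cong) (auto simp: W_def algebra_simps)
      then show ?thesis using rowdvd[OF ij(2) r] rowdvd[OF ij(2) s] 2 by (simp add: c_def)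
    qed (simp add: c_def)
  qed (use W in auto)
  moreover have "(\<Prod>i<l. c i) = p ^ 2"
  proof -
    have "{..<l} = insert 0 (insert 1 {2..<l})" using l by auto
    then show ?thesis by (simp add: c_def power2_eq_square)
  qed
  ultimately have "p ^ 2 dvd (s - r) * Determinant.det (mulmat l b v)"
    by (simp add: det_mult[OF W mulmat_carrier] dW)
  moreover have "coprime (p ^ 2) (s - r)"
    using prime_imp_coprime[OF p] rs by (simp add: dvd_diff_commute)
  ultimately show ?thesis using coprime_dvd_mult_right_iff by blast
qed

section \<open>Integers whose prime factors admit a given power residue\<close>

lemma ex_floor_root:
  assumes l: "l > 0"
  obtains k :: nat where "k ^ l \<le> m" "m < (k + 1) ^ l"
proof -
  define k where "k = (LEAST k. m < (k + 1) ^ l)"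
  have "m < (m + 1) ^ l" using l self_le_power[of "m + 1" l] by simp
  then have 1: "m < (k + 1) ^ l" unfolding k_def by (rule LeastI)
  have "k ^ l \<le> m"
  proof (cases k)
    case 0
    then show ?thesis using l by (simp add: power_0_left)
  next
    case (Suc j)
    then have "\<not> m < (j + 1) ^ l" using not_less_Least[of j "\<lambda>k. m < (k + 1) ^ l"] by (simp add: k_def)
    then show ?thesis using Suc by simp
  qed
  then show ?thesis using that 1 by blast
qed

text \<open>Thue's pigeonhole argument: there are more than \<open>m\<close> vectors with entries in \<open>{0..k}\<close>.\<close>

lemma small_relation:
  fixes l m k :: nat and r :: int
  assumes m: "m > 0" "m < (k + 1) ^ l"
  obtains v :: "nat \<Rightarrow> int" where "v \<in> {..<l} \<rightarrow>\<^sub>E {- int k..int k}" "\<exists>i<l. v i \<noteq> 0"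
    "int m dvd (\<Sum>i<l. v i * r ^ i)"
proof -
  define U where "U = ({..<l} \<rightarrow>\<^sub>E {0..int k})"
  define f where "f u = (\<Sum>i<l. u i * r ^ i) mod int m" for u
  have "nat (int k + 1) = k + 1" by linarith
  then have "card U = (k + 1) ^ l" by (simp add: U_def card_PiE)
  moreover have "f ` U \<subseteq> {0..<int m}" using m by (auto simp: f_def)
  then have "card (f ` U) \<le> m" using card_mono[of "{0..<int m}" "f ` U"] by simp
  ultimately have "card (f ` U) < card U" using m by linarith
  then have "\<not> inj_on f U" by (rule pigeonhole)
  then have "\<exists>u\<in>U. \<exists>w\<in>U. f u = f w \<and> u \<noteq> w" by (simp add: inj_on_def)
  then obtain u w where uw: "u \<in> U" "w \<in> U" "u \<noteq> w" "f u = f w" by (elim bexE conjE)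
  define v where "v = restrict (\<lambda>i. u i - w i) {..<l}"
  show ?thesis
  proof (rule that[of v])
    show "v \<in> {..<l} \<rightarrow>\<^sub>E {- int k..int k}"
    proof -
      have "u i - w i \<in> {- int k..int k}" if i: "i \<in> {..<l}" for i
      proof -
        have "u i \<in> {0..int k}" "w i \<in> {0..int k}" using uw(1,2) i unfolding U_def by (blast dest: PiE_mem)+
        then show ?thesis by simp
      qed
      then show ?thesis unfolding v_def restrict_PiE_iff by blast
    qed
    show "\<exists>i<l. v i \<noteq> 0"
    proof (rule ccontr)
      assume "\<not> (\<exists>i<l. v i \<noteq> 0)"
      then have "u i = w i" if "i \<in> {..<l}" for i using that by (auto simp: v_def)
      then have "u = w" using uw(1,2) unfolding U_def by (intro PiE_ext)
      then show False using uw by simp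
    qed
    have "int m dvd (\<Sum>i<l. u i * r ^ i) - (\<Sum>i<l. w i * r ^ i)" using uw(4) by (simp add: f_def mod_eq_dvd_iff)
    also have "(\<Sum>i<l. u i * r ^ i) - (\<Sum>i<l. w i * r ^ i) = (\<Sum>i<l. v i * r ^ i)"
      unfolding sum_subtractf[symmetric] by (intro sum.cong) (auto simp: v_def algebra_simps)
    finally show "int m dvd (\<Sum>i<l. v i * r ^ i)" .
  qed
qed

lemma squarefree_dvdI:
  fixes m x :: int
  assumes "squarefree m" and "\<And>p. prime p \<Longrightarrow> p dvd m \<Longrightarrow> p dvd x"
  shows "m dvd x"
proof (cases "x = 0")
  case False
  have m0: "m \<noteq> 0" using assms(1) by auto
  show ?thesis
  proof (rule multiplicity_le_imp_dvd[OF m0])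
    fix p :: int assume p: "prime p"
    show "multiplicity p m \<le> multiplicity p x"
    proof (cases "p dvd m")
      case True
      have "\<not> p ^ 2 dvd m" using assms(1) p by (auto simp: squarefree_def)
      then have "multiplicity p m < 2" using p m0 
        by (metis multiplicity_dvd' not_less)
      moreover have "multiplicity p x \<ge> 1" using assms(2)[OF p True] p False
        by (intro multiplicity_geI) auto
      ultimately show ?thesis by linarith
    qed (simp add: not_dvd_imp_multiplicity_0)
  qed
qed simp

definition root_pairs :: "nat \<Rightarrow> int \<Rightarrow> nat \<Rightarrow> (nat \<times> nat) set" where
  "root_pairs l b Xb = {(m, r). 1 \<le> m \<and> m \<le> Xb \<and> squarefree (int m) \<and> r < m \<and> int m dvd int r ^ l - b}"

lemma finite_root_pairs: "finite (root_pairs l b Xb)"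
  by (rule finite_subset[of _ "{..Xb} \<times> {..Xb}"]) (auto simp: root_pairs_def)

text \<open>To a root \<open>r\<close> modulo \<open>m\<close> is attached a short vector \<open>v\<close> in the lattice of relations \<open>m dvd \<Sum>i<l. v i * r ^ i\<close>. Its norm, the determinant of the multiplication matrix, is a nonzero multiple of \<open>m\<close> of size \<open>O(m)\<close>, so it leaves only boundedly many \<open>m\<close>. Two roots belonging to the same \<open>v\<close> and \<open>m\<close> can differ only modulo primes whose square divides the norm, hence only modulo the bounded cofactor. As there are \<open>O(Xb)\<close> short vectors, there are \<open>O(Xb)\<close> pairs.\<close>

lemma card_root_pairs_le:
  assumes irr: "irreducible (monom 1 l - [:of_int b:] :: rat poly)" and l: "l \<ge> 2" and b: "b \<noteq> 0"
  obtains C :: nat where "\<And>Xb. Xb \<ge> 1 \<Longrightarrow> card (root_pairs l b Xb) \<le> C * Xb"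
proof -
  define K where "K = nat (fact l * \<bar>b\<bar> ^ l)"
  have K: "int K = fact l * \<bar>b\<bar> ^ l" by (simp add: K_def)
  define C where "C = 3 ^ l * ((2 * K + 1) * (K + 1))"
  have "card (root_pairs l b Xb) \<le> C * Xb" if Xb: "Xb \<ge> 1" for Xb
  proof -
    obtain Y where Y: "Y ^ l \<le> Xb" "Xb < (Y + 1) ^ l" using ex_floor_root[of l Xb] l by auto
    have Y1: "Y \<ge> 1" using Y Xb l by (cases Y) auto
    define VV where "VV = ({..<l} \<rightarrow>\<^sub>E {- int Y..int Y})"
    have finVV: "finite VV" by (auto simp: VV_def intro: finite_PiE)
    have cVV: "card VV \<le> 3 ^ l * Xb"
    proof -
      have "card {- int Y..int Y} = 2 * Y + 1" by simp
      then have "card VV = (2 * Y + 1) ^ l" by (simp add: VV_def card_PiE)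
      also have "\<dots> \<le> (3 * Y) ^ l" using Y1 by (intro power_mono) auto
      also have "\<dots> \<le> 3 ^ l * Xb" using Y by (simp add: power_mult_distrib)
      finally show ?thesis .
    qed
    have "\<exists>v. v \<in> VV \<and> (\<exists>i<l. v i \<noteq> 0) \<and> int m dvd (\<Sum>i<l. v i * int r ^ i) \<and> \<bar>Determinant.det (mulmat l b v)\<bar> \<le> int K * int m"
      if mr: "(m, r) \<in> root_pairs l b Xb" for m r
    proof -
      have m: "1 \<le> m" "m \<le> Xb" using mr by (auto simp: root_pairs_def)
      obtain k where k: "k ^ l \<le> m" "m < (k + 1) ^ l" using ex_floor_root[of l m] l by auto
      obtain v where v: "v \<in> {..<l} \<rightarrow>\<^sub>E {- int k..int k}" "\<exists>i<l. v i \<noteq> 0" "int m dvd (\<Sum>i<l. v i * int r ^ i)"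
        using small_relation[of m k l "int r"] m k by auto
      have "k ^ l < (Y + 1) ^ l" using k(1) m(2) Y(2) by linarith
      then have kY: "k \<le> Y" by (auto dest!: power_less_imp_less_base)
      have vb: "\<bar>v i\<bar> \<le> int k" if "i < l" for i using v(1) that by (auto simp: PiE_def Pi_def abs_le_iff)
      have "\<bar>Determinant.det (mulmat l b v)\<bar> \<le> fact l * (\<bar>b\<bar> * int k) ^ l"
      proof (rule det_bound)
        fix i j assume ij: "i < l" "j < l"
        show "\<bar>mulmat l b v $$ (i, j)\<bar> \<le> \<bar>b\<bar> * int k"
        proof (cases "j \<le> i")
          case True
          have "\<bar>v (i - j)\<bar> \<le> int k" using ij by (intro vb) auto
          also have "\<dots> \<le> \<bar>b\<bar> * int k" using b mult_right_mono[of 1 "\<bar>b\<bar>" "int k"] by simp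
          finally show ?thesis using ij True by (simp add: mulmat_def)
        next
          case False
          have "\<bar>v (l + i - j)\<bar> \<le> int k" using ij False by (intro vb) auto
          then show ?thesis using ij False by (simp add: mulmat_def abs_mult mult_left_mono)
        qed
      qed simp
      also have "\<dots> = int K * int (k ^ l)" by (simp add: K power_mult_distrib)
      also have "\<dots> \<le> int K * int m" using k(1) by (intro mult_left_mono) (simp_all only: of_nat_le_iff of_nat_0_le_iff)
      finally have db: "\<bar>Determinant.det (mulmat l b v)\<bar> \<le> int K * int m" .
      have "v \<in> VV" unfolding VV_def using v(1) kY by (auto simp: PiE_def Pi_def)
      then show ?thesis using v db by blast
    qed
    note ex = this
    define ch where "ch = (\<lambda>(m, r). SOME v. v \<in> VV \<and> (\<exists>i<l. v i \<noteq> 0) \<and> int m dvd (\<Sum>i<l. v i * int r ^ i)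
      \<and> \<bar>Determinant.det (mulmat l b v)\<bar> \<le> int K * int m)"
    have ch: "ch (m, r) \<in> VV \<and> (\<exists>i<l. ch (m, r) i \<noteq> 0) \<and>
        int m dvd (\<Sum>i<l. ch (m, r) i * int r ^ i) \<and> \<bar>Determinant.det (mulmat l b (ch (m, r)))\<bar> \<le> int K * int m"
      if "(m, r) \<in> root_pairs l b Xb" for m r
      using ex[OF that] unfolding ch_def prod.case by (rule someI_ex)
    have fiber: "card {x \<in> root_pairs l b Xb. ch x = v} \<le> (2 * K + 1) * (K + 1)" (is "card ?S \<le> _") for v
    proof -
      define D where "D = Determinant.det (mulmat l b v)"
      \<comment> \<open>The cofactor determines \<open>m\<close>, and \<open>r\<close> modulo its common part with \<open>m\<close> determines \<open>r\<close>.\<close>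
      define h where "h = (\<lambda>(m::nat, r::nat). (D div int m, r mod nat (gcd (int m) (D div int m))))"
      have props: "D \<noteq> 0 \<and> D = int m * (D div int m) \<and> \<bar>D div int m\<bar> \<le> int K \<and> m \<ge> 1" if "(m, r) \<in> ?S" for m r
      proof -
        have mr: "(m, r) \<in> root_pairs l b Xb" "ch (m, r) = v" using that by auto
        note c = ch[OF mr(1), unfolded mr(2)]
        obtain i where "i < l" "v i \<noteq> 0" using c by blast
        then have D0: "D \<noteq> 0" unfolding D_def using irr l by (intro mulmat_det_nonzero) auto
        have m1: "m \<ge> 1" using mr by (auto simp: root_pairs_def)
        have "int m dvd D" unfolding D_def using c mr(1) l by (intro mulmat_det_dvd[of l _ _ "int r"]) (auto simp: root_pairs_def)
        then have D: "D = int m * (D div int m)" by simp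
        have "int m * \<bar>D div int m\<bar> = \<bar>D\<bar>" using D by (metis abs_mult abs_of_nat)
        also have "\<dots> \<le> int m * int K" using c by (simp add: D_def mult.commute)
        finally have "\<bar>D div int m\<bar> \<le> int K" using m1 by simp
        then show ?thesis using D0 D m1 by blast
      qed
      have "inj_on h ?S"
      proof (rule inj_onI, clarify)
        fix m r m' r' assume a: "(m, r) \<in> root_pairs l b Xb" "(m', r') \<in> root_pairs l b Xb" "h (m, r) = h (m', r')"
          "v = ch (m, r)" "ch (m', r') = ch (m, r)"
        have S: "(m, r) \<in> ?S" "(m', r') \<in> ?S" using a by auto
        have k: "D div int m = D div int m'" using a(3) by (simp add: h_def)
        have "int m * (D div int m) = int m' * (D div int m)" using props[OF S(1)] props[OF S(2)] k by metis
        moreover have "D div int m \<noteq> 0" using props[OF S(1)] by auto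
        ultimately have mm: "m = m'" by simp
        define q where "q = D div int m"
        have Dq: "D = int m * q" using props[OF S(1)] by (simp add: q_def)
        have rr: "[int r = int r'] (mod (gcd (int m) q))"
        proof -
          have "r mod nat (gcd (int m) q) = r' mod nat (gcd (int m) q)" using a(3) mm by (simp add: h_def q_def)
          then have "int r mod int (nat (gcd (int m) q)) = int r' mod int (nat (gcd (int m) q))" by (metis zmod_int)
          then show ?thesis by (simp add: unique_euclidean_semiring_class.cong_def)
        qed
        have sqm: "squarefree (int m)" using a(1) by (auto simp: root_pairs_def)
        have "int m dvd int r - int r'"
        proof (rule squarefree_dvdI[OF sqm], rule ccontr)
          fix p :: int assume p: "prime p" "p dvd int m" "\<not> p dvd int r - int r'"
          have "p ^ 2 dvd D" unfolding D_def
          proof (rule mulmat_det_dvd_square[OF l p(1) p(3)])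
            show "p dvd (\<Sum>k<l. v k * int r ^ k)" "p dvd (\<Sum>k<l. v k * int r' ^ k)"
              using ch[OF a(1)] ch[OF a(2)] a p(2) mm dvd_trans by metis+
            show "p dvd int r ^ l - b" "p dvd int r' ^ l - b"
              using a p(2) mm dvd_trans by (auto simp: root_pairs_def)
          qed
          moreover have "\<not> p ^ 2 dvd int m" using sqm p(1) by (auto simp: squarefree_def)
          ultimately have "p dvd q"
          proof -
            obtain m1 where m1: "int m = p * m1" using p(2) by blast
            have "\<not> p dvd m1" using m1 \<open>\<not> p ^ 2 dvd int m\<close> by (auto simp: power2_eq_square)
            moreover have "p * p dvd p * (m1 * q)" using \<open>p ^ 2 dvd D\<close> Dq m1 by (simp add: power2_eq_square mult.assoc)
            then have "p dvd m1 * q" using p(1) by (simp add: dvd_mult_cancel_left)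
            ultimately show ?thesis using p(1) prime_dvd_mult_iff by blast
          qed
          then have "p dvd gcd (int m) q" using p(2) by simp
          moreover have "gcd (int m) q dvd int r - int r'" using rr by (simp add: cong_iff_dvd_diff)
          ultimately show False using p(3) dvd_trans by blast
        qed
        then have "int r mod int m = int r' mod int m" by (simp add: mod_eq_dvd_iff)
        moreover have "r < m" "r' < m" using a mm by (auto simp: root_pairs_def)
        ultimately show "m = m' \<and> r = r'" using mm by simp
      qed
      moreover have "h ` ?S \<subseteq> {- int K..int K} \<times> {..K}"
      proof (rule image_subsetI)
        fix x assume x: "x \<in> ?S"
        obtain m r where mr: "x = (m, r)" by (cases x)
        define q where "q = D div int m"
        have q: "\<bar>q\<bar> \<le> int K" "q \<noteq> 0" "m \<ge> 1" using props[of m r] x mr by (auto simp: q_def)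
        have g: "0 < gcd (int m) q" "gcd (int m) q \<le> \<bar>q\<bar>" using q zdvd_imp_le[of "gcd (int m) q" "\<bar>q\<bar>"] by auto
        then have "r mod nat (gcd (int m) q) < nat (gcd (int m) q)" by (intro mod_less_divisor) simp
        then have "r mod nat (gcd (int m) q) \<le> K" using g q by linarith
        then show "h x \<in> {- int K..int K} \<times> {..K}" using q by (auto simp: mr h_def q_def abs_le_iff)
      qed
      ultimately have "card ?S \<le> card ({- int K..int K} \<times> {..K})" by (intro card_inj_on_le) auto
      moreover have "card {- int K..int K} = 2 * K + 1" by simp
      moreover have "card {..K} = K + 1" by simp
      ultimately show ?thesis by (simp only: card_cartesian_product)
    qed
    have "root_pairs l b Xb = (\<Union>v\<in>VV. {x \<in> root_pairs l b Xb. ch x = v})" using ch by auto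
    then have "card (root_pairs l b Xb) \<le> (\<Sum>v\<in>VV. card {x \<in> root_pairs l b Xb. ch x = v})"
      using card_UN_le[OF finVV, of "\<lambda>v. {x \<in> root_pairs l b Xb. ch x = v}"] by simp
    also have "\<dots> \<le> (\<Sum>v\<in>VV. (2 * K + 1) * (K + 1))" by (intro sum_mono fiber)
    also have "\<dots> = card VV * ((2 * K + 1) * (K + 1))" by simp
    also have "\<dots> \<le> (3 ^ l * Xb) * ((2 * K + 1) * (K + 1))" using cVV by (intro mult_right_mono) auto
    finally show ?thesis unfolding C_def by (simp only: mult_ac)
  qed
  then show ?thesis by (rule that)
qed

definition nroots :: "nat \<Rightarrow> int \<Rightarrow> nat \<Rightarrow> nat" where
  "nroots l b m = card {r. r < m \<and> int m dvd int r ^ l - b}"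

lemma nroots_mult_ge:
  assumes "coprime m n" "m > 0" "n > 0"
  shows "nroots l b m * nroots l b n \<le> nroots l b (m * n)"
proof -
  have "\<exists>x. x < m * n \<and> [x = r] (mod m) \<and> [x = s] (mod n)" for r s
    using binary_chinese_remainder_unique_nat[of m n r s] assms by auto
  note ex = this
  define f where "f = (\<lambda>(r, s). SOME x. x < m * n \<and> [x = r] (mod m) \<and> [x = s] (mod n))"
  have f: "f (r, s) < m * n \<and> [f (r, s) = r] (mod m) \<and> [f (r, s) = s] (mod n)" for r s
    unfolding f_def prod.case by (rule someI_ex[OF ex])
  let ?A = "{r. r < m \<and> int m dvd int r ^ l - b} \<times> {s. s < n \<and> int n dvd int s ^ l - b}"
  have "inj_on f ?A"
  proof (rule inj_onI, clarify)
    fix r s r' s' assume h: "r < m" "r' < m" "s < n" "s' < n" "f (r, s) = f (r', s')"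
    have "[r = r'] (mod m)" "[s = s'] (mod n)" using f[of r s] f[of r' s'] h(5) by (metis cong_sym cong_trans)+
    then show "r = r' \<and> s = s'" using h by (simp add: unique_euclidean_semiring_class.cong_def)
  qed
  moreover have "f ` ?A \<subseteq> {r. r < m * n \<and> int (m * n) dvd int r ^ l - b}"
  proof (rule image_subsetI, clarify, intro conjI)
    fix r s assume h: "int m dvd int r ^ l - b" "int n dvd int s ^ l - b"
    show "f (r, s) < m * n" using f by blast
    have "[int (f (r, s)) = int r] (mod int m)" "[int (f (r, s)) = int s] (mod int n)" using f[of r s] by (auto simp: cong_int_iff)
    then have "[int (f (r, s)) ^ l = int r ^ l] (mod int m)" "[int (f (r, s)) ^ l = int s ^ l] (mod int n)" by (auto intro: cong_pow)
    then have "int m dvd int (f (r, s)) ^ l - b" "int n dvd int (f (r, s)) ^ l - b"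
      using h by (metis cong_iff_dvd_diff cong_trans)+
    moreover have "coprime (int m) (int n)" using assms(1) by simp
    ultimately show "int (m * n) dvd int (f (r, s)) ^ l - b" by (simp add: divides_mult)
  qed
  ultimately have "card ?A \<le> nroots l b (m * n)" unfolding nroots_def by (intro card_inj_on_le) auto
  then show ?thesis by (simp add: nroots_def card_cartesian_product)
qed

text \<open>For \<open>p\<close> congruent to \<open>1\<close> modulo \<open>l\<close> there is a nontrivial \<open>l\<close>-th root of unity modulo \<open>p\<close>, which yields a second solution.\<close>

lemma nroots_prime:
  assumes p: "prime p" and y: "[y ^ l = b] (mod int p)"
  shows "nroots l b p \<ge> 1" and "prime l \<Longrightarrow> [p = 1] (mod l) \<Longrightarrow> \<not> int p dvd b \<Longrightarrow> nroots l b p \<ge> 2"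
proof -
  have p0: "p > 0" using p prime_gt_0_nat by blast
  have red: "nat (z mod int p) \<in> {r. r < p \<and> int p dvd int r ^ l - b}" if "[z ^ l = b] (mod int p)" for z
  proof -
    have z: "int (nat (z mod int p)) = z mod int p" using p0 by simp
    have "[(z mod int p) ^ l = z ^ l] (mod int p)" by (intro cong_pow) (simp add: unique_euclidean_semiring_class.cong_def)
    then have "[(z mod int p) ^ l = b] (mod int p)" using that cong_trans by blast
    then show ?thesis using p0 z by (auto simp: cong_iff_dvd_diff nat_less_iff)
  qed
  have fin: "finite {r. r < p \<and> int p dvd int r ^ l - b}" by simp
  show "nroots l b p \<ge> 1" unfolding nroots_def using red[OF y] fin card_gt_0_iff by (metis One_nat_def Suc_leI empty_iff)
  assume l: "prime l" and pl: "[p = 1] (mod l)" and pb: "\<not> int p dvd b"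
  obtain g where g: "residue_primroot p g" using prime_primitive_root_exists[of p] p prime_gt_1_nat by auto
  have lp: "l dvd p - 1" using pl by (rule cong_to_1_nat)
  \<comment> \<open>An element of order \<open>l\<close> modulo \<open>p\<close>.\<close>
  define h where "h = g ^ ((p - 1) div l)"
  have og: "ord p g = p - 1" using g p by (simp add: residue_primroot_def totient_prime)
  have hl: "[h ^ l = 1] (mod p)"
  proof -
    have "h ^ l = g ^ (p - 1)" using lp by (simp add: h_def flip: power_mult)
    then show ?thesis using ord_divides[of g "p - 1" p] og by simp
  qed
  have h1: "\<not> [h = 1] (mod p)"
  proof
    assume "[h = 1] (mod p)"
    then have "p - 1 dvd (p - 1) div l" using ord_divides[of g _ p] og by (simp add: h_def)
    moreover have "(p - 1) div l > 0" "(p - 1) div l < p - 1"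
      using lp p prime_gt_1_nat[OF p] prime_gt_1_nat[OF l] by (auto simp: div_greater_zero_iff dvd_imp_le)
    ultimately show False by (auto dest: dvd_imp_le)
  qed
  have "[int h ^ l = 1] (mod int p)" using hl by (metis cong_int_iff of_nat_1 of_nat_power)
  then have y2: "[(y * int h) ^ l = b] (mod int p)" using y cong_mult[of "y ^ l" b "int p" "int h ^ l" 1] by (simp add: power_mult_distrib)
  have ne: "nat (y mod int p) \<noteq> nat ((y * int h) mod int p)"
  proof
    assume "nat (y mod int p) = nat ((y * int h) mod int p)"
    then have "y mod int p = (y * int h) mod int p" using p0 by (simp add: eq_nat_nat_iff)
    then have "int p dvd y * (1 - int h)" by (simp add: mod_eq_dvd_iff algebra_simps)
    moreover have "\<not> int p dvd y"
    proof
      assume "int p dvd y"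
      then have "int p dvd y ^ l" using l prime_gt_0_nat by (meson dvd_power dvd_trans)
      then show False using y pb cong_dvd_iff by blast
    qed
    ultimately have "int p dvd 1 - int h" using p prime_dvd_mult_iff[of "int p"] by simp
    then have "[int h = int 1] (mod int p)" by (simp add: cong_iff_dvd_diff dvd_diff_commute)
    then show False using h1 by (simp only: cong_int_iff)
  qed
  have "card {nat (y mod int p), nat ((y * int h) mod int p)} \<le> nroots l b p"
    unfolding nroots_def using red[OF y] red[OF y2] fin by (intro card_mono) auto
  then show "nroots l b p \<ge> 2" using ne by simp
qed

lemma nroots_prod_ge:
  assumes "finite S" "\<And>p. p \<in> S \<Longrightarrow> prime p \<and> \<not> int p dvd b \<and> (\<exists>y. [y ^ l = b] (mod int p))" "prime l"
  shows "2 ^ card {p \<in> S. [p = 1] (mod l)} \<le> nroots l b (\<Prod>S)"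
  using assms(1,2)
proof (induction S rule: finite_induct)
  case empty
  have "{r. r < 1 \<and> int 1 dvd int r ^ l - b} = {0}" by auto
  then show ?case by (simp add: nroots_def)
next
  case (insert p S)
  have p: "prime p" "\<not> int p dvd b" "\<exists>y. [y ^ l = b] (mod int p)" using insert.prems by auto
  then obtain y where y: "[y ^ l = b] (mod int p)" by blast
  have cop: "coprime p (\<Prod>S)" 
    using insert p by (intro prod_coprime_right) (metis insertCI primes_coprime)
  have pos: "\<Prod>S > 0" using insert.prems prime_gt_0_nat by (intro prod_pos) auto
  have "nroots l b p * nroots l b (\<Prod>S) \<le> nroots l b (p * \<Prod>S)"
    using cop pos p(1) prime_gt_0_nat by (intro nroots_mult_ge) auto
  moreover have IH: "2 ^ card {p \<in> S. [p = 1] (mod l)} \<le> nroots l b (\<Prod>S)" using insert by auto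
  moreover have "2 ^ card {q \<in> insert p S. [q = 1] (mod l)} \<le> nroots l b p * 2 ^ card {p \<in> S. [p = 1] (mod l)}"
  proof (cases "[p = 1] (mod l)")
    case True
    then have "{q \<in> insert p S. [q = 1] (mod l)} = insert p {q \<in> S. [q = 1] (mod l)}" by auto
    then have "card {q \<in> insert p S. [q = 1] (mod l)} = Suc (card {q \<in> S. [q = 1] (mod l)})"
      using insert.hyps by simp
    then show ?thesis using nroots_prime(2)[OF p(1) y assms(3) True p(2)] by simp
  next
    case False
    then have "{q \<in> insert p S. [q = 1] (mod l)} = {q \<in> S. [q = 1] (mod l)}" by auto
    then show ?thesis using nroots_prime(1)[OF p(1) y] by simp
  qed
  moreover have "nroots l b p * 2 ^ card {p \<in> S. [p = 1] (mod l)} \<le> nroots l b p * nroots l b (\<Prod>S)"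
    using IH by (rule mult_le_mono2)
  moreover have "\<Prod>(insert p S) = p * \<Prod>S" using insert.hyps by simp
  ultimately show ?case by (simp only: le_trans)
qed

definition power_residue_set :: "nat \<Rightarrow> int \<Rightarrow> int set" where
  "power_residue_set l b = {m. squarefree m \<and> (\<forall>p. prime p \<longrightarrow> int p dvd m \<longrightarrow> \<not> int p dvd b \<and> (\<exists>y. [y ^ l = b] (mod int p)))}"

text \<open>Integers with fewer than \<open>k\<close> prime factors that are \<open>1\<close> modulo \<open>l\<close> are negligible. Every other element \<open>m\<close> of the set contributes at least \<open>2 ^ k\<close> pairs to \<open>root_pairs\<close>, so there are at most \<open>O(x / 2 ^ k)\<close> of them.\<close>

theorem density_power_residue_set:
  assumes l: "prime l" and irr: "irreducible (monom 1 l - [:of_int b:] :: rat poly)" and b: "b \<noteq> 0"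
  shows "has_two_sided_density (power_residue_set l b) 0"
proof -
  have l2: "l \<ge> 2" using l prime_ge_2_nat by blast
  obtain C where C: "\<And>Xb. Xb \<ge> 1 \<Longrightarrow> card (root_pairs l b Xb) \<le> C * Xb" using card_root_pairs_le[OF irr l2 b] by blast
  define om where "om m = card {p. prime p \<and> [p = 1] (mod l) \<and> int p dvd m}" for m :: int
  have dens: "has_two_sided_density {m. m \<noteq> 0 \<and> om m < k} 0" for k
    unfolding om_def by (rule density_few_prime_factors) (rule reciprocal_primes_1_mod_prime_not_summable[OF l])
  let ?T = "power_residue_set l b"
  have nr: "2 ^ om m \<le> nroots l b (nat \<bar>m\<bar>)" if m: "m \<in> ?T" for m
  proof -
    have sq: "squarefree m" using m by (auto simp: power_residue_set_def)
    then have m0: "m \<noteq> 0" by auto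
    define S where "S = {p. prime p \<and> int p dvd m}"
    have S: "S = prime_factors (nat \<bar>m\<bar>)"
      using m0 by (simp add: S_def prime_factors_dvd dvd_nat_abs_iff)
    have sqn: "squarefree (nat \<bar>m\<bar>)"
    proof (rule squarefreeI)
      fix x assume "x ^ 2 dvd nat \<bar>m\<bar>"
      then have "int x ^ 2 dvd m" by (simp add: dvd_nat_abs_iff)
      then have "int x dvd 1" using sq squarefreeD by blast
      then show "x dvd 1" by simp
    qed
    have "nat \<bar>m\<bar> = (\<Prod>p\<in>prime_factors (nat \<bar>m\<bar>). p ^ multiplicity p (nat \<bar>m\<bar>))"
      using m0 by (simp add: prime_factorization_nat)
    also have "\<dots> = \<Prod>S" unfolding S
    proof (rule prod.cong[OF refl])
      fix p assume "p \<in> prime_factors (nat \<bar>m\<bar>)"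
      then have p: "prime p" "p dvd nat \<bar>m\<bar>" by (auto simp: in_prime_factors_iff)
      have "\<not> p ^ 2 dvd nat \<bar>m\<bar>" using sqn p(1) by (auto simp: squarefree_def)
      then have "multiplicity p (nat \<bar>m\<bar>) = 1" using p
        by (intro multiplicity_eqI) (auto simp: power2_eq_square)
      then show "p ^ multiplicity p (nat \<bar>m\<bar>) = p" by simp
    qed
    finally have prodS: "nat \<bar>m\<bar> = \<Prod>S" .
    have "2 ^ card {p \<in> S. [p = 1] (mod l)} \<le> nroots l b (\<Prod>S)"
      using m l by (intro nroots_prod_ge) (auto simp: S power_residue_set_def, auto simp: S_def S[symmetric])
    moreover have "{p \<in> S. [p = 1] (mod l)} = {p. prime p \<and> [p = 1] (mod l) \<and> int p dvd m}" by (auto simp: S_def)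
    ultimately show ?thesis using prodS by (simp add: om_def)
  qed
  have count: "2 ^ k * card {m \<in> {m \<in> ?T. om m \<ge> k}. real_of_int \<bar>m\<bar> \<le> x} \<le> 2 * (C * nat \<lfloor>x\<rfloor>)" if x: "x \<ge> 1" for k x
  proof -
    define Xb where "Xb = nat \<lfloor>x\<rfloor>"
    have Xb: "Xb \<ge> 1" using x by (simp add: Xb_def le_nat_iff)
    let ?S = "{m \<in> {m \<in> ?T. om m \<ge> k}. real_of_int \<bar>m\<bar> \<le> x}"
    define N where "N = (\<lambda>m. nat \<bar>m\<bar>) ` ?S"
    have finS: "finite ?S" by (rule finite_int_abs_le)
    have sub: "?S \<subseteq> int ` N \<union> (\<lambda>n. - int n) ` N"
    proof
      fix m assume "m \<in> ?S"
      then have "nat \<bar>m\<bar> \<in> N" by (auto simp: N_def)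
      moreover have "m = int (nat \<bar>m\<bar>) \<or> m = - int (nat \<bar>m\<bar>)" by auto
      ultimately show "m \<in> int ` N \<union> (\<lambda>n. - int n) ` N" by blast
    qed
    have finN: "finite N" using finS by (simp add: N_def)
    have "card ?S \<le> card (int ` N \<union> (\<lambda>n. - int n) ` N)" using sub finN by (intro card_mono) auto
    also have "\<dots> \<le> card N + card N" using card_Un_le card_image_le[OF finN] by (meson add_mono order.trans)
    finally have cS: "card ?S \<le> 2 * card N" by simp
    have Nprop: "1 \<le> n \<and> n \<le> Xb \<and> squarefree (int n) \<and> 2 ^ k \<le> nroots l b n" if nN: "n \<in> N" for n
    proof -
      obtain m where m: "m \<in> ?S" "n = nat \<bar>m\<bar>" using nN unfolding N_def by blast
      have sq: "squarefree m" using m by (auto simp: power_residue_set_def)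
      then have "m \<noteq> 0" by auto
      moreover have "\<bar>m\<bar> \<le> \<lfloor>x\<rfloor>" using m by (simp add: le_floor_iff)
      moreover have "2 ^ k \<le> nroots l b n"
      proof -
        have "(2::nat) ^ k \<le> 2 ^ om m" using m by (intro power_increasing) auto
        also have "\<dots> \<le> nroots l b (nat \<bar>m\<bar>)" using m(1) by (intro nr) simp
        finally show ?thesis unfolding m(2) .
      qed
      moreover have "squarefree \<bar>m\<bar>" using sq by (auto simp: squarefree_def)
      ultimately show ?thesis using m(2) by (auto simp: Xb_def)
    qed
    have "card N * 2 ^ k = (\<Sum>n\<in>N. 2 ^ k)" by simp
    also have "\<dots> \<le> (\<Sum>n\<in>N. nroots l b n)" using Nprop by (intro sum_mono) auto
    also have "\<dots> = card (SIGMA n:N. {r. r < n \<and> int n dvd int r ^ l - b})"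
      unfolding nroots_def using finN by (subst card_SigmaI) auto
    also have "\<dots> \<le> card (root_pairs l b Xb)"
      using Nprop by (intro card_mono finite_root_pairs) (auto simp: root_pairs_def)
    also have "\<dots> \<le> C * Xb" using C Xb by blast
    finally have "card N * 2 ^ k \<le> C * Xb" .
    have "2 ^ k * card ?S \<le> 2 ^ k * (2 * card N)" using cS by (rule mult_le_mono2)
    also have "\<dots> = 2 * (card N * 2 ^ k)" by simp
    also have "\<dots> \<le> 2 * (C * Xb)" using \<open>card N * 2 ^ k \<le> C * Xb\<close> by (rule mult_le_mono2)
    finally show ?thesis unfolding Xb_def .
  qed
  show ?thesis unfolding density_0_iff
  proof (intro allI impI)
    fix e :: real assume e: "e > 0"
    obtain k where k: "2 * real C / e < 2 ^ k" using real_arch_pow[of 2 "2 * real C / e"] by auto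
    have "\<forall>\<^sub>F x in at_top. real (card {m \<in> {m. m \<noteq> 0 \<and> om m < k}. real_of_int \<bar>m\<bar> \<le> x}) \<le> e / 2 * (2 * x)"
      using dens[of k] e unfolding density_0_iff using half_gt_zero by blast
    then show "\<forall>\<^sub>F x in at_top. real (card {m \<in> ?T. real_of_int \<bar>m\<bar> \<le> x}) \<le> e * (2 * x)"
      using eventually_ge_at_top[of 1]
    proof eventually_elim
      case (elim x)
      let ?A = "{m \<in> {m. m \<noteq> 0 \<and> om m < k}. real_of_int \<bar>m\<bar> \<le> x}"
      let ?B = "{m \<in> {m \<in> ?T. om m \<ge> k}. real_of_int \<bar>m\<bar> \<le> x}"
      have "{m \<in> ?T. real_of_int \<bar>m\<bar> \<le> x} \<subseteq> ?A \<union> ?B" by (auto simp: power_residue_set_def)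
      then have "card {m \<in> ?T. real_of_int \<bar>m\<bar> \<le> x} \<le> card (?A \<union> ?B)" by (intro card_mono finite_UnI finite_int_abs_le)
      also have "\<dots> \<le> card ?A + card ?B" by (rule card_Un_le)
      finally have 1: "real (card {m \<in> ?T. real_of_int \<bar>m\<bar> \<le> x}) \<le> real (card ?A) + real (card ?B)"
        unfolding of_nat_add[symmetric] by (rule of_nat_mono)
      have "real (2 ^ k * card ?B) \<le> real (2 * (C * nat \<lfloor>x\<rfloor>))" using count[OF elim(2), of k] by (rule of_nat_mono)
      also have "\<dots> \<le> 2 * real C * x" using elim(2) by (simp add: mult_left_mono)
      finally have 2: "2 ^ k * real (card ?B) \<le> 2 * real C * x" by simp
      have "2 * real C * x \<le> 2 ^ k * (e * x)" using k e elim(2) by (simp add: field_simps mult_right_mono)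
      then have "2 ^ k * real (card ?B) \<le> 2 ^ k * (e * x)" using 2 by linarith
      then have "real (card ?B) \<le> e * x" by simp
      then show ?case using 1 elim(1) by simp
    qed
  qed
qed

section \<open>Algebraic integers\<close>

text \<open>The characteristic polynomial of an integer matrix is monic with integer coefficients.\<close>

lemma algebraic_int_eigenvalue:
  fixes v :: "nat \<Rightarrow> complex"
  assumes M: "M \<in> carrier_mat n n" and i: "i < n" "v i \<noteq> 0"
    and ev: "\<And>i. i < n \<Longrightarrow> x * v i = (\<Sum>j<n. of_int (M $$ (i, j)) * v j)"
  shows "algebraic_int x"
proof -
  let ?A = "map_mat complex_of_int M"
  let ?v = "Matrix.vec n v"
  have A: "?A \<in> carrier_mat n n" using M by simp
  have "?A *\<^sub>v ?v = x \<cdot>\<^sub>v ?v"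
  proof (rule eq_vecI)
    fix k assume k: "k < dim_vec (x \<cdot>\<^sub>v ?v)"
    then have k: "k < n" by simp
    have "vec_index (?A *\<^sub>v ?v) k = (\<Sum>j<n. ?A $$ (k, j) * vec_index ?v j)"
      by (rule index_mult_mat_vec_sum[OF A _ k]) simp
    also have "\<dots> = (\<Sum>j<n. of_int (M $$ (k, j)) * v j)"
      using k M by (intro sum.cong) auto
    also have "\<dots> = x * v k" using ev[OF k] by simp
    finally show "vec_index (?A *\<^sub>v ?v) k = vec_index (x \<cdot>\<^sub>v ?v) k" using k by simp
  qed (use M in auto)
  moreover have "?v \<noteq> 0\<^sub>v n"
  proof
    assume "?v = 0\<^sub>v n"
    then have "vec_index ?v i = vec_index (0\<^sub>v n) i" by simp
    then show False using i by simp
  qed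
  ultimately have "eigenvector ?A ?v x" using M by (auto simp: eigenvector_def)
  then have "eigenvalue ?A x" unfolding eigenvalue_def by blast
  then have "poly (char_poly ?A) x = 0" using eigenvalue_root_char_poly[OF A] by simp
  then have "poly (map_poly of_int (char_poly M)) x = 0" by (simp add: of_int_hom.char_poly_hom[OF M])
  moreover have "lead_coeff (char_poly M) = 1" using degree_monic_char_poly[OF M] by simp
  ultimately show ?thesis unfolding algebraic_int_altdef_ipoly by blast
qed

definition zspan :: "complex set \<Rightarrow> complex set" where
  "zspan S = {y. \<exists>c::complex \<Rightarrow> int. y = (\<Sum>t\<in>S. of_int (c t) * t)}"

lemma zspan_add: "x \<in> zspan S \<Longrightarrow> y \<in> zspan S \<Longrightarrow> x + y \<in> zspan S"
proof -
  assume "x \<in> zspan S" "y \<in> zspan S"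
  then obtain c d :: "complex \<Rightarrow> int" where "x = (\<Sum>t\<in>S. of_int (c t) * t)" "y = (\<Sum>t\<in>S. of_int (d t) * t)"
    unfolding zspan_def by blast
  then have "x + y = (\<Sum>t\<in>S. of_int (c t + d t) * t)" by (simp add: sum.distrib ring_distribs)
  then show ?thesis unfolding zspan_def by (intro CollectI exI[of _ "\<lambda>t. c t + d t"])
qed

lemma zspan_scale: "x \<in> zspan S \<Longrightarrow> of_int a * x \<in> zspan S"
proof -
  assume "x \<in> zspan S"
  then obtain c :: "complex \<Rightarrow> int" where "x = (\<Sum>t\<in>S. of_int (c t) * t)" unfolding zspan_def by blast
  then have "of_int a * x = (\<Sum>t\<in>S. of_int (a * c t) * t)" by (simp add: sum_distrib_left mult.assoc)
  then show ?thesis unfolding zspan_def by (intro CollectI exI[of _ "\<lambda>t. a * c t"])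
qed

lemma zspan_0: "0 \<in> zspan S"
  unfolding zspan_def by (intro CollectI exI[of _ "\<lambda>_. 0"]) simp

lemma zspan_sum: "(\<And>i. i \<in> A \<Longrightarrow> f i \<in> zspan S) \<Longrightarrow> (\<Sum>i\<in>A. f i) \<in> zspan S"
  by (induction A rule: infinite_finite_induct) (auto intro: zspan_0 zspan_add)

lemma zspan_base: "finite S \<Longrightarrow> s \<in> S \<Longrightarrow> s \<in> zspan S"
proof -
  assume "finite S" "s \<in> S"
  then have "s = (\<Sum>t\<in>S. of_int (if t = s then 1 else 0) * t)" by (simp add: if_distrib if_distribR cong: if_cong)
  then show ?thesis unfolding zspan_def by (intro CollectI exI[of _ "\<lambda>t. if t = s then 1 else 0"])
qed

lemma zspan_mult_closed:
  assumes "\<And>s. s \<in> S \<Longrightarrow> x * s \<in> zspan S" "y \<in> zspan S"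
  shows "x * y \<in> zspan S"
proof -
  obtain c :: "complex \<Rightarrow> int" where "y = (\<Sum>t\<in>S. of_int (c t) * t)" using assms(2) unfolding zspan_def by blast
  then have "x * y = (\<Sum>t\<in>S. of_int (c t) * (x * t))" by (simp add: sum_distrib_left mult_ac)
  also have "\<dots> \<in> zspan S" by (intro zspan_sum zspan_scale assms(1))
  finally show ?thesis .
qed

text \<open>The standard finiteness criterion: multiplication by \<open>x\<close> acts on the generators through an integer matrix.\<close>

lemma algebraic_int_zspan:
  assumes S: "finite S" "s \<in> S" "s \<noteq> 0" and x: "\<And>s. s \<in> S \<Longrightarrow> x * s \<in> zspan S"
  shows "algebraic_int x"
proof -
  have "\<forall>s\<in>S. \<exists>c::complex \<Rightarrow> int. x * s = (\<Sum>t\<in>S. of_int (c t) * t)"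
    using x unfolding zspan_def by blast
  then obtain c :: "complex \<Rightarrow> complex \<Rightarrow> int" where c: "\<forall>s\<in>S. x * s = (\<Sum>t\<in>S. of_int (c s t) * t)"
    unfolding bchoice_iff by (elim exE)
  define n where "n = card S"
  obtain h where h: "bij_betw h {0..<n} S" using ex_bij_betw_nat_finite[OF S(1)] unfolding n_def by blast
  then have h: "bij_betw h {..<n} S" by (simp add: lessThan_atLeast0)
  define M where "M = Matrix.mat n n (\<lambda>(i, j). c (h i) (h j))"
  obtain i where i: "i < n" "h i = s" using h S(2) unfolding bij_betw_def by blast
  show ?thesis
  proof (rule algebraic_int_eigenvalue[of M n i h])
    show "M \<in> carrier_mat n n" by (simp add: M_def)
    show "i < n" "h i \<noteq> 0" using i S by auto
    fix k assume k: "k < n"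
    then have "h k \<in> S" using h bij_betwE by blast
    then have "x * h k = (\<Sum>t\<in>S. of_int (c (h k) t) * t)" using c by blast
    also have "\<dots> = (\<Sum>j<n. of_int (c (h k) (h j)) * h j)"
      using sum.reindex_bij_betw[OF h, of "\<lambda>t. of_int (c (h k) t) * t"] by simp
    finally show "x * h k = (\<Sum>j<n. of_int (M $$ (k, j)) * h j)" using k by (simp add: M_def)
  qed
qed

lemma algebraic_int_power_relation:
  assumes "algebraic_int (x::complex)"
  shows "\<exists>d c. d > 0 \<and> x ^ d = (\<Sum>i<d. of_int (c i) * x ^ i)"
proof -
  obtain p where p: "poly (map_poly of_int p) x = 0" "lead_coeff p = 1"
    using assms unfolding algebraic_int_altdef_ipoly by blast
  define d where "d = degree p"
  have d: "d > 0"
  proof (rule ccontr)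
    assume "\<not> d > 0"
    then obtain a where a: "p = [:a:]" unfolding d_def using degree_eq_zeroE[of p] by blast
    then have "p = [:1:]" using p(2) by simp
    then show False using p(1) by simp
  qed
  have "0 = (\<Sum>i\<le>d. of_int (coeff p i) * x ^ i)"
    using p(1) unfolding d_def by (simp add: poly_altdef)
  also have "\<dots> = (\<Sum>i<d. of_int (coeff p i) * x ^ i) + x ^ d"
    using p(2) by (simp add: d_def lessThan_Suc_atMost[symmetric])
  finally have "x ^ d = (\<Sum>i<d. of_int (- coeff p i) * x ^ i)"
    by (simp add: sum_negf eq_neg_iff_add_eq_0 add.commute)
  then show ?thesis using d by (intro exI[of _ d] exI[of _ "\<lambda>i. - coeff p i"]) simp
qed

lemma algebraic_int_add_mult:
  assumes a: "algebraic_int (a::complex)" and b: "algebraic_int b"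
  shows "algebraic_int (a + b)" "algebraic_int (a * b)"
proof -
  obtain p c where p: "p > 0" "a ^ p = (\<Sum>i<p. of_int (c i) * a ^ i)" using algebraic_int_power_relation[OF a] by (elim exE conjE)
  obtain q d where q: "q > 0" "b ^ q = (\<Sum>i<q. of_int (d i) * b ^ i)" using algebraic_int_power_relation[OF b] by (elim exE conjE)
  define S where "S = (\<lambda>(i, j). a ^ i * b ^ j) ` ({..<p} \<times> {..<q})"
  have fin: "finite S" by (simp add: S_def)
  have S: "a ^ i * b ^ j \<in> S" if "i < p" "j < q" for i j unfolding S_def using that by force
  have one: "1 \<in> S" using S[of 0 0] p q by simp
  have aS: "a * s \<in> zspan S" if s: "s \<in> S" for s
  proof -
    obtain i j where ij: "i < p" "j < q" "s = a ^ i * b ^ j" using s unfolding S_def by auto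
    show ?thesis
    proof (cases "Suc i = p")
      case False
      then have "a ^ Suc i * b ^ j \<in> S" using ij by (intro S) auto
      then show ?thesis using zspan_base[OF fin] ij by (simp add: mult.assoc)
    next
      case True
      have "a * s = a ^ p * b ^ j" using ij True by (auto simp: mult.assoc)
      also have "\<dots> = (\<Sum>i<p. of_int (c i) * (a ^ i * b ^ j))" by (simp add: p(2) sum_distrib_right mult.assoc)
      also have "\<dots> \<in> zspan S" using ij by (intro zspan_sum zspan_scale zspan_base[OF fin] S) auto
      finally show ?thesis .
    qed
  qed
  have bS: "b * s \<in> zspan S" if s: "s \<in> S" for s
  proof -
    obtain i j where ij: "i < p" "j < q" "s = a ^ i * b ^ j" using s unfolding S_def by auto
    show ?thesis
    proof (cases "Suc j = q")
      case False
      then have "a ^ i * b ^ Suc j \<in> S" using ij by (intro S) auto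
      then show ?thesis using zspan_base[OF fin] ij by (simp add: mult_ac)
    next
      case True
      have "b * s = a ^ i * b ^ q" using ij True by (auto simp: mult_ac)
      also have "\<dots> = (\<Sum>j<q. of_int (d j) * (a ^ i * b ^ j))" by (simp add: q(2) sum_distrib_left mult_ac)
      also have "\<dots> \<in> zspan S" using ij by (intro zspan_sum zspan_scale zspan_base[OF fin] S) auto
      finally show ?thesis .
    qed
  qed
  show "algebraic_int (a + b)"
  proof (rule algebraic_int_zspan[OF fin one])
    show "(a + b) * s \<in> zspan S" if "s \<in> S" for s
      using zspan_add[OF aS[OF that] bS[OF that]] by (simp add: distrib_right)
  qed simp
  show "algebraic_int (a * b)"
  proof (rule algebraic_int_zspan[OF fin one])
    show "a * b * s \<in> zspan S" if "s \<in> S" for s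
      using zspan_mult_closed[OF aS bS[OF that]] by (simp add: mult.assoc)
  qed simp
qed

lemmas algebraic_int_add = algebraic_int_add_mult(1)
lemmas algebraic_int_mult = algebraic_int_add_mult(2)

lemma algebraic_int_diff: "algebraic_int (a::complex) \<Longrightarrow> algebraic_int b \<Longrightarrow> algebraic_int (a - b)"
  using algebraic_int_add[of a "- b"] by simp

lemma algebraic_int_power: "algebraic_int (a::complex) \<Longrightarrow> algebraic_int (a ^ k)"
  by (induction k) (auto intro: algebraic_int_mult)

lemma algebraic_int_sum: "(\<And>i. i \<in> A \<Longrightarrow> algebraic_int (f i :: complex)) \<Longrightarrow> algebraic_int (\<Sum>i\<in>A. f i)"
  by (induction A rule: infinite_finite_induct) (auto intro: algebraic_int_add)

lemma algebraic_int_prod: "(\<And>i. i \<in> A \<Longrightarrow> algebraic_int (f i :: complex)) \<Longrightarrow> algebraic_int (\<Prod>i\<in>A. f i)"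
  by (induction A rule: infinite_finite_induct) (auto intro: algebraic_int_mult)

lemma algebraic_int_int_eval: "algebraic_int x \<Longrightarrow> algebraic_int (int_eval P x)"
  by (induction P) (auto intro: algebraic_int_add algebraic_int_mult)

lemma algebraic_int_of_power:
  assumes "algebraic_int ((x::complex) ^ k)" "k > 0"
  shows "algebraic_int x"
  by (rule algebraic_int_root[OF assms(1), of "monom 1 k"]) (use assms(2) in \<open>auto simp: poly_monom degree_monom_eq\<close>)

lemma algebraic_int_rational_cases:
  assumes "algebraic_int (x::complex)" "x \<in> \<rat>"
  obtains z where "x = of_int z"
  using rational_algebraic_int_is_int[OF assms] by (rule Ints_cases)

text \<open>The quotient \<open>b / a\<close> is rational and an algebraic integer.\<close>

lemma int_dvd_of_algebraic_int_quotient: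
  assumes "algebraic_int (x::complex)" "of_int a * x = of_int b" "a \<noteq> 0"
  shows "a dvd b"
proof -
  have "x = of_int b / of_int a" using assms by (simp add: field_simps)
  then have "x \<in> \<rat>" by simp
  then obtain z where "x = of_int z" by (rule algebraic_int_rational_cases[OF assms(1)])
  then have "of_int (a * z) = (of_int b :: complex)" using assms by simp
  then have "a * z = b" by (simp only: of_int_eq_iff)
  then show ?thesis by auto
qed

section \<open>The rings and fields generated by one complex number\<close>

lemma type_algebra_a_inv: "\<ominus>\<^bsub>(ring_of_type_algebra :: complex ring)\<^esub> x = - x"
proof -
  interpret R: cring "ring_of_type_algebra :: complex ring" by (rule cring_from_type_algebra)
  show ?thesis by (rule R.minus_equality) (auto simp: ring_of_type_algebra_def)
qed

lemma type_algebra_m_inv: "x \<noteq> 0 \<Longrightarrow> inv\<^bsub>(ring_of_type_algebra :: complex ring)\<^esub> x = inverse x"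
proof -
  interpret R: cring "ring_of_type_algebra :: complex ring" by (rule cring_from_type_algebra)
  assume "x \<noteq> 0"
  then show ?thesis by (intro R.comm_inv_char) (auto simp: ring_of_type_algebra_def)
qed

lemma type_algebra_simps:
  "x \<oplus>\<^bsub>(ring_of_type_algebra :: complex ring)\<^esub> y = x + y"
  "x \<otimes>\<^bsub>(ring_of_type_algebra :: complex ring)\<^esub> y = x * y"
  "\<one>\<^bsub>(ring_of_type_algebra :: complex ring)\<^esub> = 1" "\<zero>\<^bsub>(ring_of_type_algebra :: complex ring)\<^esub> = 0"
  by (simp_all add: ring_of_type_algebra_def)

lemma int_adjoin_eq: "int_adjoin t = range (\<lambda>P. int_eval P t)"
proof (intro equalityI subsetI)
  fix x assume "x \<in> int_adjoin t"
  then show "x \<in> range (\<lambda>P. int_eval P t)" unfolding int_adjoin_def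
  proof (induction rule: generate_ring.induct)
    case one
    show ?case using rangeI[of "\<lambda>P. int_eval P t" 1] by (simp add: type_algebra_simps)
  next
    case (incl h)
    then show ?case using rangeI[of "\<lambda>P. int_eval P t" "[:0, 1:]"] by simp
  next
    case (a_inv h)
    then obtain P where "h = int_eval P t" by blast
    then show ?case using rangeI[of "\<lambda>P. int_eval P t" "- P"] by (simp add: type_algebra_a_inv)
  next
    case (eng_add h1 h2)
    then obtain P Q where "h1 = int_eval P t" "h2 = int_eval Q t" by blast
    then show ?case using rangeI[of "\<lambda>P. int_eval P t" "P + Q"] by (simp add: type_algebra_simps)
  next
    case (eng_mult h1 h2)
    then obtain P Q where "h1 = int_eval P t" "h2 = int_eval Q t" by blast
    then show ?case using rangeI[of "\<lambda>P. int_eval P t" "P * Q"] by (simp add: type_algebra_simps)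
  qed
next
  let ?G = "generate_ring (ring_of_type_algebra :: complex ring) {t}"
  have 1: "1 \<in> ?G" and t: "t \<in> ?G" and uminus: "\<And>x. x \<in> ?G \<Longrightarrow> - x \<in> ?G"
    and add: "\<And>x y. x \<in> ?G \<Longrightarrow> y \<in> ?G \<Longrightarrow> x + y \<in> ?G" and mult: "\<And>x y. x \<in> ?G \<Longrightarrow> y \<in> ?G \<Longrightarrow> x * y \<in> ?G"
    using generate_ring.one[of "ring_of_type_algebra :: complex ring" "{t}"]
      generate_ring.incl[of _ "{t}" "ring_of_type_algebra :: complex ring"]
      generate_ring.a_inv[of _ "ring_of_type_algebra :: complex ring" "{t}"]
      generate_ring.eng_add[of _ "ring_of_type_algebra :: complex ring" "{t}"]
      generate_ring.eng_mult[of _ "ring_of_type_algebra :: complex ring" "{t}"]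
    by (simp_all add: type_algebra_simps type_algebra_a_inv)
  have 0: "0 \<in> ?G" using add[OF 1 uminus[OF 1]] by simp
  have nat: "of_nat k \<in> ?G" for k by (induction k) (use 0 1 add in auto)
  have int: "of_int k \<in> ?G" for k by (cases k rule: int_cases2) (use nat uminus in auto)
  fix x assume "x \<in> range (\<lambda>P. int_eval P t)"
  then obtain P where "x = int_eval P t" by blast
  moreover have "int_eval P t \<in> ?G" by (induction P) (use 0 int add mult t in auto)
  ultimately show "x \<in> int_adjoin t" by (simp add: int_adjoin_def)
qed

text \<open>The polynomial values form a field because an irreducible polynomial is coprime to every polynomial that does not vanish at its root.\<close>

lemma rat_adjoin_eq:
  assumes irr: "irreducible (monom 1 n - [:of_int m:] :: rat poly)" and a: "a ^ n = of_int m"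
  shows "rat_adjoin a = range (\<lambda>P. rat_eval P a)"
proof (intro equalityI subsetI)
  let ?f = "monom 1 n - [:of_int m:] :: rat poly"
  fix x assume "x \<in> rat_adjoin a"
  then show "x \<in> range (\<lambda>P. rat_eval P a)" unfolding rat_adjoin_def
  proof (induction rule: generate_field.induct)
    case one
    show ?case using rangeI[of "\<lambda>P. rat_eval P a" 1] by (simp add: type_algebra_simps)
  next
    case (incl h)
    then show ?case using rangeI[of "\<lambda>P. rat_eval P a" "[:0, 1:]"] by simp
  next
    case (a_inv h)
    then obtain P where "h = rat_eval P a" by blast
    then show ?case using rangeI[of "\<lambda>P. rat_eval P a" "- P"] by (simp add: type_algebra_a_inv)
  next
    case (m_inv h)
    then obtain P where P: "h = rat_eval P a" by blast
    have h0: "h \<noteq> 0" using m_inv by (simp add: type_algebra_simps)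
    have nd: "\<not> ?f dvd P"
    proof
      assume "?f dvd P"
      then obtain Q where "P = ?f * Q" by (rule dvdE)
      then have "rat_eval P a = (a ^ n - of_int m) * rat_eval Q a" by simp
      then show False using a h0 P by simp
    qed
    have "prime_elem ?f" using irr by (rule irreducible_imp_prime_elem)
    then have "coprime ?f P" using nd by (rule prime_elem_imp_coprime)
    then have bz: "fst (bezout_coefficients ?f P) * ?f + snd (bezout_coefficients ?f P) * P = 1"
      using bezout_coefficients_fst_snd[of ?f P] by (simp only: coprime_iff_gcd_eq_1)
    define v where "v = snd (bezout_coefficients ?f P)"
    have "rat_eval (fst (bezout_coefficients ?f P) * ?f + v * P) a = 1" unfolding v_def bz by simp
    then have "rat_eval v a * h = 1" using a P by simp
    then have "inverse h = rat_eval v a" using h0 by (simp add: field_simps)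
    then show ?case using h0 by (simp add: type_algebra_m_inv)
  next
    case (eng_add h1 h2)
    then obtain P Q where "h1 = rat_eval P a" "h2 = rat_eval Q a" by blast
    then show ?case using rangeI[of "\<lambda>P. rat_eval P a" "P + Q"] by (simp add: type_algebra_simps)
  next
    case (eng_mult h1 h2)
    then obtain P Q where "h1 = rat_eval P a" "h2 = rat_eval Q a" by blast
    then show ?case using rangeI[of "\<lambda>P. rat_eval P a" "P * Q"] by (simp add: type_algebra_simps)
  qed
next
  let ?G = "generate_field (ring_of_type_algebra :: complex ring) {a}"
  have 1: "1 \<in> ?G" and t: "a \<in> ?G" and uminus: "\<And>x. x \<in> ?G \<Longrightarrow> - x \<in> ?G"
    and add: "\<And>x y. x \<in> ?G \<Longrightarrow> y \<in> ?G \<Longrightarrow> x + y \<in> ?G" and mult: "\<And>x y. x \<in> ?G \<Longrightarrow> y \<in> ?G \<Longrightarrow> x * y \<in> ?G"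
    using generate_field.one[of "ring_of_type_algebra :: complex ring" "{a}"]
      generate_field.incl[of _ "{a}" "ring_of_type_algebra :: complex ring"]
      generate_field.a_inv[of _ "ring_of_type_algebra :: complex ring" "{a}"]
      generate_field.eng_add[of _ "ring_of_type_algebra :: complex ring" "{a}"]
      generate_field.eng_mult[of _ "ring_of_type_algebra :: complex ring" "{a}"]
    by (simp_all add: type_algebra_simps type_algebra_a_inv)
  have inv: "inverse x \<in> ?G" if "x \<in> ?G" "x \<noteq> 0" for x
    using generate_field.m_inv[of x "ring_of_type_algebra :: complex ring" "{a}"] that
    by (simp add: type_algebra_simps type_algebra_m_inv)
  have 0: "0 \<in> ?G" using add[OF 1 uminus[OF 1]] by simp
  have nat: "of_nat k \<in> ?G" for k by (induction k) (use 0 1 add in auto)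
  have int: "of_int k \<in> ?G" for k by (cases k rule: int_cases2) (use nat uminus in auto)
  have rat: "of_rat c \<in> ?G" for c
  proof -
    obtain u v where uv: "quotient_of c = (u, v)" by (cases "quotient_of c")
    have "of_rat c = of_int u * inverse (of_int v :: complex)"
    proof -
      have "of_rat c = of_int u / (of_int v :: complex)"
        unfolding quotient_of_div[OF uv] by (simp add: of_rat_divide)
      then show ?thesis by (simp only: divide_inverse)
    qed
    moreover have "of_int v \<noteq> (0::complex)" using quotient_of_denom_pos[OF uv] by simp
    ultimately show ?thesis using mult[OF int inv[OF int]] by simp
  qed
  fix x assume "x \<in> range (\<lambda>P. rat_eval P a)"
  then obtain P where "x = rat_eval P a" by blast
  moreover have "rat_eval P a \<in> ?G" by (induction P) (use 0 rat add mult t in auto)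
  ultimately show "x \<in> rat_adjoin a" by (simp add: rat_adjoin_def)
qed

text \<open>The reduced coefficients do not depend on the root, so one computation serves all conjugates.\<close>

lemma int_eval_reduce:
  assumes n: "n > 0"
  shows "\<exists>r. \<forall>x. x ^ n = of_int m \<longrightarrow> int_eval P x = (\<Sum>k<n. of_int (r k) * x ^ k)"
proof (induction P)
  case 0
  show ?case by (intro exI[of _ "\<lambda>_. 0"]) simp
next
  case (pCons a P)
  then obtain r where r: "\<And>x. x ^ n = of_int m \<Longrightarrow> int_eval P x = (\<Sum>k<n. of_int (r k) * x ^ k)" by blast
  obtain n' where n': "n = Suc n'" using n by (cases n) auto
  define s where "s k = (case k of 0 \<Rightarrow> a + m * r n' | Suc j \<Rightarrow> r j)" for k
  have "int_eval (pCons a P) x = (\<Sum>k<n. of_int (s k) * x ^ k)" if x: "x ^ n = of_int m" for x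
  proof -
    have "int_eval (pCons a P) x = of_int a + x * (\<Sum>k<n. of_int (r k) * x ^ k)" by (simp add: r[OF x])
    also have "x * (\<Sum>k<n. of_int (r k) * x ^ k) = (\<Sum>k<n'. of_int (r k) * x ^ Suc k) + of_int (r n') * x ^ n"
      by (simp add: n' sum_distrib_left ring_distribs mult_ac)
    also have "of_int a + \<dots> = (\<Sum>k<n. of_int (s k) * x ^ k)"
      unfolding x by (simp add: n' sum.lessThan_Suc_shift s_def del: sum.lessThan_Suc)
    finally show ?thesis .
  qed
  then show ?case by blast
qed

lemma rat_eval_reduce:
  assumes n: "n > 0"
  shows "\<exists>r. \<forall>x. x ^ n = of_int m \<longrightarrow> rat_eval P x = (\<Sum>k<n. of_rat (r k) * x ^ k)"
proof (induction P)
  case 0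
  show ?case by (intro exI[of _ "\<lambda>_. 0"]) simp
next
  case (pCons a P)
  then obtain r where r: "\<And>x. x ^ n = of_int m \<Longrightarrow> rat_eval P x = (\<Sum>k<n. of_rat (r k) * x ^ k)" by blast
  obtain n' where n': "n = Suc n'" using n by (cases n) auto
  define s where "s k = (case k of 0 \<Rightarrow> a + of_int m * r n' | Suc j \<Rightarrow> r j)" for k
  have "rat_eval (pCons a P) x = (\<Sum>k<n. of_rat (s k) * x ^ k)" if x: "x ^ n = of_int m" for x
  proof -
    have "rat_eval (pCons a P) x = of_rat a + x * (\<Sum>k<n. of_rat (r k) * x ^ k)" by (simp add: r[OF x])
    also have "x * (\<Sum>k<n. of_rat (r k) * x ^ k) = (\<Sum>k<n'. of_rat (r k) * x ^ Suc k) + of_rat (r n') * x ^ n"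
      by (simp add: n' sum_distrib_left ring_distribs mult_ac)
    also have "of_rat a + \<dots> = (\<Sum>k<n. of_rat (s k) * x ^ k)"
      unfolding x by (simp add: n' sum.lessThan_Suc_shift s_def of_rat_add of_rat_mult del: sum.lessThan_Suc)
    finally show ?thesis .
  qed
  then show ?case by blast
qed

text \<open>The reduction of \<open>P\<close> modulo \<open>X ^ n - m\<close> vanishes identically, since the powers of \<open>a\<close> are independent.\<close>

lemma radical_conjugate_root:
  assumes irr: "irreducible (monom 1 n - [:of_int m:] :: rat poly)" and n: "n > 0"
    and a: "a ^ n = of_int m" "b ^ n = of_int m" and P: "rat_eval P a = 0"
  shows "rat_eval P b = 0"
proof -
  obtain r where r: "\<And>x. x ^ n = of_int m \<Longrightarrow> rat_eval P x = (\<Sum>k<n. of_rat (r k) * x ^ k)"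
    using rat_eval_reduce[OF n] by blast
  have "(\<Sum>k<n. of_rat (r k) * a ^ k) = 0" using r[OF a(1)] P by simp
  then have "r k = 0" if "k < n" for k using radical_powers_independent[OF irr a(1) _ that] by blast
  then show ?thesis using r[OF a(2)] by simp
qed

section \<open>Integers of pure fields\<close>

lemma rat_eval_pcompose: "rat_eval (pcompose Q T) x = rat_eval Q (rat_eval T x)"
  by (induction Q) (auto simp: pcompose_pCons)

lemma sum_prim_root_powers:
  assumes n: "n > 0"
  shows "(\<Sum>i<n. prim_root n ^ (i * s)) = (if n dvd s then of_nat n else 0)"
proof (cases "n dvd s")
  case True
  then have "prim_root n ^ (i * s) = 1" for i using prim_root_power_eq_1_iff[OF n] by simp
  then show ?thesis using True by simp
next
  case False
  define w where "w = prim_root n ^ s"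
  have "w \<noteq> 1" using False prim_root_power_eq_1_iff[OF n] by (simp add: w_def)
  moreover have "w ^ n = 1" using prim_root_power_eq_1_iff[OF n, of "s * n"] by (simp add: w_def flip: power_mult)
  ultimately have "(\<Sum>i<n. w ^ i) = 0" by (simp add: geometric_sum)
  moreover have "prim_root n ^ (i * s) = w ^ i" for i by (simp add: w_def mult.commute flip: power_mult)
  ultimately show ?thesis using False by simp
qed

locale pure_field =
  fixes n :: nat and m :: int and \<alpha> :: complex
  assumes n2: "n \<ge> 2" and sq: "squarefree m"
    and irr: "irreducible (monom 1 n - [:of_int m:] :: rat poly)"
    and root: "\<alpha> ^ n = of_int m"
begin

lemma n0: "n > 0" using n2 by simp
lemma m0: "m \<noteq> 0" using sq by auto
lemma \<alpha>0: "\<alpha> \<noteq> 0" using root m0 n0 by (auto simp: power_0_left)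
lemma \<alpha>_int: "algebraic_int \<alpha>" using algebraic_int_of_power[of \<alpha> n] root n0 by simp

abbreviation OK :: "complex set" where "OK \<equiv> ring_of_integers (rat_adjoin \<alpha>)"

text \<open>The conjugates of \<open>\<alpha>\<close>; the index matters modulo \<open>n\<close> only.\<close>

definition cj :: "nat \<Rightarrow> complex" where "cj i = prim_root n ^ i * \<alpha>"

lemma cj_root: "cj i ^ n = of_int m"
proof -
  have "(prim_root n ^ i) ^ n = 1" using prim_root_power_eq_1_iff[OF n0, of "i * n"] by (simp add: power_mult)
  then show ?thesis by (simp add: cj_def power_mult_distrib root)
qed

lemma cj_0 [simp]: "cj 0 = \<alpha>" by (simp add: cj_def)
lemma cj_nonzero: "cj i \<noteq> 0" using \<alpha>0 by (simp add: cj_def)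
lemma cj_int: "algebraic_int (cj i)" using algebraic_int_of_power[of "cj i" n] cj_root n0 by simp

lemma prim_root_inj:
  assumes "i < n" "j < n" "prim_root n ^ i = prim_root n ^ j"
  shows "i = j"
proof -
  have main: "i = j" if "i \<le> j" "j < n" "prim_root n ^ i = prim_root n ^ j" for i j
  proof -
    have "prim_root n ^ j = prim_root n ^ i * prim_root n ^ (j - i)" using that(1) by (simp flip: power_add)
    then have "prim_root n ^ (j - i) = 1" using that(3) by simp
    then have "n dvd j - i" using prim_root_power_eq_1_iff[OF n0] by simp
    then show ?thesis using that(1,2) by (cases "j - i = 0") (auto dest: dvd_imp_le)
  qed
  show ?thesis
  proof (cases "i \<le> j")
    case True
    then show ?thesis using main assms by simp
  next
    case False
    then have "j = i" by (intro main) (use assms in auto)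
    then show ?thesis by simp
  qed
qed

lemma cj_inj: "i < n \<Longrightarrow> j < n \<Longrightarrow> cj i = cj j \<Longrightarrow> i = j"
  using \<alpha>0 prim_root_inj by (simp add: cj_def)

lemma conj_transfer: "rat_eval P \<alpha> = 0 \<Longrightarrow> rat_eval P (cj i) = 0"
  using radical_conjugate_root[OF irr n0 root cj_root] .

text \<open>Polynomial relations over the rationals pass from \<open>\<alpha>\<close> to all its conjugates; this takes the place of the action of the Galois group.\<close>

lemma conj_transfer_int_eval:
  assumes "int_eval g (rat_eval T \<alpha>) = rat_eval S \<alpha>"
  shows "int_eval g (rat_eval T (cj i)) = rat_eval S (cj i)"
proof -
  define P where "P = pcompose (map_poly of_int g) T - S"
  have P: "rat_eval P x = int_eval g (rat_eval T x) - rat_eval S x" for x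
    by (simp add: P_def rat_eval_pcompose int_eval_as_rat_eval)
  have "rat_eval P \<alpha> = 0" using assms by (simp add: P)
  then have "rat_eval P (cj i) = 0" by (rule conj_transfer)
  then show ?thesis by (simp add: P)
qed

lemma conj_algebraic_int:
  assumes "algebraic_int (rat_eval T \<alpha>)"
  shows "algebraic_int (rat_eval T (cj i))"
proof -
  obtain p where p: "poly (map_poly of_int p) (rat_eval T \<alpha>) = 0" "lead_coeff p = 1"
    using assms unfolding algebraic_int_altdef_ipoly by blast
  have "int_eval p (rat_eval T \<alpha>) = rat_eval 0 \<alpha>" using p(1) by (simp add: int_eval_def)
  then have "int_eval p (rat_eval T (cj i)) = rat_eval 0 (cj i)" by (rule conj_transfer_int_eval)
  then show ?thesis unfolding algebraic_int_altdef_ipoly using p(2) by (intro exI[of _ p]) (simp add: int_eval_def)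
qed

lemma coords_unique:
  assumes "(\<Sum>k<n. of_rat (s k) * \<alpha> ^ k) = (\<Sum>k<n. of_rat (t k) * \<alpha> ^ k)" "k < n"
  shows "s k = t k"
proof -
  have "(\<Sum>k<n. of_rat (s k - t k) * \<alpha> ^ k) = 0"
    using assms(1) by (simp add: of_rat_diff left_diff_distrib sum_subtractf)
  from radical_powers_independent[OF irr root this assms(2)] show ?thesis by simp
qed

lemma int_coords_unique:
  assumes "(\<Sum>k<n. of_int (s k) * \<alpha> ^ k) = (\<Sum>k<n. of_int (t k) * \<alpha> ^ k)" "k < n"
  shows "s k = t k"
  using coords_unique[of "\<lambda>k. of_int (s k)" "\<lambda>k. of_int (t k)" k] assms by simp

lemma OK_coords:
  assumes "x \<in> OK"
  obtains t where "x = (\<Sum>k<n. of_rat (t k) * \<alpha> ^ k)" "algebraic_int x"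
proof -
  have x: "x \<in> rat_adjoin \<alpha>" "algebraic_int x" using assms by (auto simp: ring_of_integers_def)
  then obtain P where P: "x = rat_eval P \<alpha>" using rat_adjoin_eq[OF irr root] by blast
  obtain t where "\<forall>x. x ^ n = of_int m \<longrightarrow> rat_eval P x = (\<Sum>k<n. of_rat (t k) * x ^ k)"
    using rat_eval_reduce[OF n0] by blast
  then have "x = (\<Sum>k<n. of_rat (t k) * \<alpha> ^ k)" using P root by blast
  then show ?thesis using that x(2) by blast
qed

lemma int_combination_in_OK: "int_eval P \<alpha> \<in> OK"
  using rat_adjoin_eq[OF irr root] algebraic_int_int_eval[OF \<alpha>_int]
  by (simp add: ring_of_integers_def int_eval_as_rat_eval)

text \<open>The polynomial \<open>X ^ n - m\<close> is Eisenstein at \<open>p\<close>. Let \<open>j\<close> be the first index with \<open>B j\<close> prime to \<open>p\<close>. Multiplying by \<open>\<alpha> ^ (n - 1 - j)\<close> turns all later terms into multiples of \<open>p\<close>, so \<open>B j * \<alpha> ^ (n - 1) / p\<close> is an algebraic integer; its norm \<open>B j ^ n * m ^ (n - 1) / p ^ n\<close> is not an integer, because \<open>p\<close> divides \<open>m\<close> only once.\<close>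

lemma ramified_prime_maximal:
  assumes p: "prime p" "p dvd m" and x: "algebraic_int x"
    and B: "of_int p * x = (\<Sum>k<n. of_int (B k) * \<alpha> ^ k)" and k: "k < n"
  shows "p dvd B k"
proof (rule ccontr)
  assume nd: "\<not> p dvd B k"
  define j where "j = (LEAST j. \<not> p dvd B j)"
  have j: "\<not> p dvd B j" unfolding j_def by (rule LeastI) (rule nd)
  have jk: "j \<le> k" unfolding j_def by (rule Least_le) (rule nd)
  have jn: "j < n" using jk k by simp
  have small: "p dvd B i" if "i < j" for i using not_less_Least[of i "\<lambda>j. \<not> p dvd B j"] that unfolding j_def by blast
  define c where "c i = B i div p" for i
  have c: "B i = p * c i" if "i < j" for i using small[OF that] by (simp add: c_def)
  obtain m' where m': "m = p * m'" using p(2) by blast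
  have nm': "\<not> p dvd m'"
  proof
    assume "p dvd m'"
    then have "p ^ 2 dvd m" unfolding m' power2_eq_square by (intro mult_dvd_mono) auto
    then have "p dvd 1" using sq squarefreeD by blast
    then show False using p(1) by auto
  qed
  have p0: "p \<noteq> 0" using p(1) by auto
  define y where "y = x - (\<Sum>i<j. of_int (c i) * \<alpha> ^ i)"
  have yint: "algebraic_int y" unfolding y_def
    by (intro algebraic_int_diff x algebraic_int_sum algebraic_int_mult algebraic_int_power \<alpha>_int algebraic_int_of_int)
  have "{..<n} = {..<j} \<union> {j..<n}" using jn by auto
  then have "(\<Sum>k<n. of_int (B k) * \<alpha> ^ k) = (\<Sum>k<j. of_int (B k) * \<alpha> ^ k) + (\<Sum>k\<in>{j..<n}. of_int (B k) * \<alpha> ^ k)"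
    by (simp add: sum.union_disjoint ivl_disj_int)
  moreover have "(\<Sum>k<j. of_int (B k) * \<alpha> ^ k) = of_int p * (\<Sum>i<j. of_int (c i) * \<alpha> ^ i)"
    unfolding sum_distrib_left by (intro sum.cong) (auto simp: c)
  ultimately have py: "of_int p * y = (\<Sum>k\<in>{j..<n}. of_int (B k) * \<alpha> ^ k)"
    using B by (simp add: y_def right_diff_distrib)
  define z where "z = y * \<alpha> ^ (n - 1 - j) - (\<Sum>k\<in>{Suc j..<n}. of_int (B k * m') * \<alpha> ^ (k - Suc j))"
  have zint: "algebraic_int z" unfolding z_def
    by (intro algebraic_int_diff algebraic_int_sum algebraic_int_mult algebraic_int_power \<alpha>_int algebraic_int_of_int yint)
  have "{j..<n} = insert j {Suc j..<n}" using jn by auto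
  then have "(\<Sum>k\<in>{j..<n}. of_int (B k) * \<alpha> ^ k) * \<alpha> ^ (n - 1 - j) =
    of_int (B j) * (\<alpha> ^ j * \<alpha> ^ (n - 1 - j)) + (\<Sum>k\<in>{Suc j..<n}. of_int (B k) * \<alpha> ^ k * \<alpha> ^ (n - 1 - j))"
    by (simp add: distrib_right sum_distrib_right mult.assoc)
  also have "\<alpha> ^ j * \<alpha> ^ (n - 1 - j) = \<alpha> ^ (n - 1)" using jn by (simp flip: power_add)
  also have "(\<Sum>k\<in>{Suc j..<n}. of_int (B k) * \<alpha> ^ k * \<alpha> ^ (n - 1 - j)) = of_int p * (\<Sum>k\<in>{Suc j..<n}. of_int (B k * m') * \<alpha> ^ (k - Suc j))"
    unfolding sum_distrib_left
  proof (intro sum.cong refl)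
    fix k assume "k \<in> {Suc j..<n}"
    then have "k + (n - 1 - j) = n + (k - Suc j)" using jn by auto
    then have "\<alpha> ^ k * \<alpha> ^ (n - 1 - j) = of_int m * \<alpha> ^ (k - Suc j)" by (metis power_add root)
    then show "of_int (B k) * \<alpha> ^ k * \<alpha> ^ (n - 1 - j) = of_int p * (of_int (B k * m') * \<alpha> ^ (k - Suc j))"
      by (simp add: m' mult_ac)
  qed
  finally have pz: "of_int p * z = of_int (B j) * \<alpha> ^ (n - 1)"
    unfolding z_def right_diff_distrib using py by (simp add: mult.assoc[symmetric])
  have "of_int (p ^ n) * z ^ n = (of_int (B j) * \<alpha> ^ (n - 1)) ^ n"
    unfolding pz[symmetric] by (simp add: power_mult_distrib)
  also have "\<dots> = of_int (B j ^ n * m ^ (n - 1))"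
    using root by (simp add: power_mult_distrib power_mult[symmetric] mult.commute[of _ n]) (simp add: power_mult)
  finally have "p ^ n dvd B j ^ n * m ^ (n - 1)"
    by (rule int_dvd_of_algebraic_int_quotient[OF algebraic_int_power[OF zint]]) (use p0 in simp)
  moreover have "coprime (p ^ n) (B j ^ n)"
    using prime_imp_coprime[OF p(1) j] by simp
  ultimately have "p ^ n dvd m ^ (n - 1)" using coprime_dvd_mult_right_iff by blast
  then have "p ^ (n - 1) * p dvd p ^ (n - 1) * m' ^ (n - 1)"
    unfolding power_minus_mult[OF n0] m' power_mult_distrib .
  then have "p dvd m' ^ (n - 1)" using p0 by (simp add: dvd_mult_cancel_left)
  then show False using nm' p(1) prime_dvd_power by blast
qed

text \<open>Traces of \<open>x * \<alpha> ^ (n - k)\<close> bound the denominators by \<open>n * m\<close>, and the factor \<open>m\<close> is removed by \<open>ramified_prime_maximal\<close>.\<close>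

lemma OK_denominator:
  assumes x: "x \<in> OK"
  shows "\<exists>A. of_nat n * x = (\<Sum>k<n. of_int (A k) * \<alpha> ^ k)"
proof -
  obtain t where t: "x = (\<Sum>k<n. of_rat (t k) * \<alpha> ^ k)" and xint: "algebraic_int x" by (rule OK_coords[OF x])
  define T where "T = (\<Sum>k<n. monom (t k) k)"
  have T: "rat_eval T y = (\<Sum>k<n. of_rat (t k) * y ^ k)" for y by (simp add: T_def rat_eval_sum)
  have Tint: "algebraic_int (rat_eval T (cj i))" for i by (rule conj_algebraic_int) (use t xint in \<open>simp add: T\<close>)
  have tr: "\<exists>B. of_rat (of_nat n * of_int m * t k) = complex_of_int B" if k: "k < n" for k
  proof -
    let ?S = "\<Sum>i<n. rat_eval T (cj i) * cj i ^ (n - k)"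
    have "?S = (\<Sum>i<n. \<Sum>j<n. of_rat (t j) * \<alpha> ^ (j + (n - k)) * prim_root n ^ (i * (j + (n - k))))"
      unfolding T sum_distrib_right
      by (intro sum.cong refl) (simp add: cj_def power_mult_distrib power_add distrib_left power_mult mult_ac)
    also have "\<dots> = (\<Sum>j<n. of_rat (t j) * \<alpha> ^ (j + (n - k)) * (\<Sum>i<n. prim_root n ^ (i * (j + (n - k)))))"
      by (subst sum.swap) (simp add: sum_distrib_left)
    also have "\<dots> = (\<Sum>j<n. if j = k then of_rat (t k) * of_int m * of_nat n else 0)"
    proof (intro sum.cong refl)
      fix j assume j: "j \<in> {..<n}"
      have "n dvd j + (n - k) \<longleftrightarrow> j = k"
      proof
        assume "n dvd j + (n - k)"
        then obtain q where q: "j + (n - k) = n * q" by blast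
        have "j < n" using j by simp
        have "0 < n * q" unfolding q[symmetric] using k by simp
        moreover have "n * q < n * 2" unfolding q[symmetric] using \<open>j < n\<close> k by linarith
        ultimately have "0 < q" "q < 2" by simp_all
        then have "q = 1" by simp
        then show "j = k" using q k by simp
      qed (use k in simp)
      then show "of_rat (t j) * \<alpha> ^ (j + (n - k)) * (\<Sum>i<n. prim_root n ^ (i * (j + (n - k)))) = (if j = k then of_rat (t k) * of_int m * of_nat n else 0)"
        unfolding sum_prim_root_powers[OF n0] using k root by auto
    qed
    also have "\<dots> = of_rat (of_nat n * of_int m * t k)" using k by (simp add: of_rat_mult mult_ac)
    finally have S: "?S = of_rat (of_nat n * of_int m * t k)" .
    have "algebraic_int ?S" by (intro algebraic_int_sum algebraic_int_mult algebraic_int_power Tint cj_int)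
    then have "algebraic_int (complex_of_rat (of_nat n * of_int m * t k))" unfolding S .
    then show ?thesis by (rule algebraic_int_rational_cases) auto
  qed
  have "\<forall>k\<in>{..<n}. \<exists>B. of_rat (of_nat n * of_int m * t k) = complex_of_int B" using tr by blast
  then obtain B where B: "\<forall>k\<in>{..<n}. of_rat (of_nat n * of_int m * t k) = complex_of_int (B k)" unfolding bchoice_iff by (elim exE)
  have nmx: "of_int m * (of_nat n * x) = (\<Sum>k<n. of_int (B k) * \<alpha> ^ k)"
  proof -
    have "of_int m * (of_nat n * x) = (\<Sum>k<n. of_rat (of_nat n * of_int m * t k) * \<alpha> ^ k)"
      unfolding t sum_distrib_left by (intro sum.cong) (auto simp: of_rat_mult mult_ac)
    also have "\<dots> = (\<Sum>k<n. of_int (B k) * \<alpha> ^ k)" using B by (intro sum.cong) auto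
    finally show ?thesis .
  qed
  have mB: "m dvd B k" if k: "k < n" for k
  proof (rule squarefree_dvdI[OF sq])
    fix p :: int assume p: "prime p" "p dvd m"
    then obtain m' where m': "m = p * m'" by blast
    show "p dvd B k"
    proof (rule ramified_prime_maximal[OF p _ _ k])
      show "algebraic_int (of_int m' * (of_nat n * x))" by (intro algebraic_int_mult xint) auto
      show "of_int p * (of_int m' * (of_nat n * x)) = (\<Sum>k<n. of_int (B k) * \<alpha> ^ k)"
        using nmx by (simp add: m' mult.assoc)
    qed
  qed
  have "(\<Sum>k<n. of_int (B k) * \<alpha> ^ k) = of_int m * (\<Sum>k<n. of_int (B k div m) * \<alpha> ^ k)"
    unfolding sum_distrib_left
  proof (intro sum.cong refl)
    fix k assume "k \<in> {..<n}"
    then have "B k = m * (B k div m)" using mB by simp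
    then have "of_int (B k) = (of_int m * of_int (B k div m) :: complex)" by (metis of_int_mult)
    then show "of_int (B k) * \<alpha> ^ k = of_int m * (of_int (B k div m) * \<alpha> ^ k)" by simp
  qed
  then have "of_nat n * x = (\<Sum>k<n. of_int (B k div m) * \<alpha> ^ k)" using nmx m0 by simp
  then show ?thesis by (rule exI[of _ "\<lambda>k. B k div m"])
qed

text \<open>The least denominator that divides \<open>n\<close> contains no prime at which \<open>\<int>[\<alpha>]\<close> is maximal. The predicate \<open>Q\<close> selects the primes known to have this property.\<close>

lemma OK_denominator_descent:
  assumes x: "x \<in> OK"
    and max: "\<And>q y B k. prime (q::nat) \<Longrightarrow> q dvd n \<Longrightarrow> Q q \<Longrightarrow> algebraic_int y \<Longrightarrow>
      of_int (int q) * y = (\<Sum>k<n. of_int (B k) * \<alpha> ^ k) \<Longrightarrow> k < n \<Longrightarrow> int q dvd B k"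
  obtains N A where "N > 0" "N dvd n" "\<And>q. prime q \<Longrightarrow> q dvd N \<Longrightarrow> \<not> Q q"
    "of_nat N * x = (\<Sum>k<n. of_int (A k) * \<alpha> ^ k)"
proof -
  have xint: "algebraic_int x" using x by (simp add: ring_of_integers_def)
  define PN where "PN N \<longleftrightarrow> N > 0 \<and> N dvd n \<and> (\<exists>A. of_nat N * x = (\<Sum>k<n. of_int (A k) * \<alpha> ^ k))" for N
  define N where "N = (LEAST N. PN N)"
  have "PN n" using OK_denominator[OF x] n0 by (simp add: PN_def)
  then have PN: "PN N" unfolding N_def by (rule LeastI)
  have least: "\<not> PN M" if "M < N" for M using not_less_Least[of M PN] that unfolding N_def by blast
  obtain A where A: "of_nat N * x = (\<Sum>k<n. of_int (A k) * \<alpha> ^ k)" and N: "N > 0" "N dvd n" using PN unfolding PN_def by blast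
  have "\<not> Q q" if q: "prime q" "q dvd N" for q
  proof
    assume Qq: "Q q"
    obtain M where M: "N = q * M" using q(2) by blast
    have M0: "M > 0" using M N by (auto intro: Nat.gr0I)
    have q0: "q > 1" using q(1) prime_gt_1_nat by blast
    have eq: "of_int (int q) * (of_nat M * x) = (\<Sum>k<n. of_int (A k) * \<alpha> ^ k)" using A by (simp add: M mult.assoc)
    have dvd: "int q dvd A k" if k: "k < n" for k
      by (rule max[OF q(1) _ Qq _ eq k]) (use q(2) N(2) dvd_trans xint in \<open>auto intro: algebraic_int_mult\<close>)
    have "(\<Sum>k<n. of_int (A k) * \<alpha> ^ k) = of_int (int q) * (\<Sum>k<n. of_int (A k div int q) * \<alpha> ^ k)"
      unfolding sum_distrib_left
    proof (intro sum.cong refl)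
      fix k assume "k \<in> {..<n}"
      then have "A k = int q * (A k div int q)" using dvd by simp
      then have "of_int (A k) = (of_int (int q) * of_int (A k div int q) :: complex)" by (metis of_int_mult)
      then show "of_int (A k) * \<alpha> ^ k = of_int (int q) * (of_int (A k div int q) * \<alpha> ^ k)" by simp
    qed
    then have "of_nat M * x = (\<Sum>k<n. of_int (A k div int q) * \<alpha> ^ k)" using eq q0 by simp
    then have "\<exists>A. of_nat M * x = (\<Sum>k<n. of_int (A k) * \<alpha> ^ k)" by (rule exI[of _ "\<lambda>k. A k div int q"])
    moreover have "M dvd n" using M N(2) dvd_mult_right by blast
    ultimately have "PN M" using M0 unfolding PN_def by (intro conjI)
    moreover have "M < N" using M M0 q0 by simp
    ultimately show False using least by blast
  qed
  then show ?thesis using that[OF N _ A] by blast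
qed

end

section \<open>Local maximality at primes dividing the degree\<close>

lemma power_cong_prime_square:
  fixes a b :: int
  assumes "int q dvd a - b" "prime q"
  shows "(int q)\<^sup>2 dvd a ^ q - b ^ q"
proof -
  have "a ^ q - b ^ q = (a - b) * (\<Sum>i<q. a ^ i * b ^ (q - Suc i))"
    by (simp add: power_diff_sumr2 mult.commute)
  moreover have "int q dvd (\<Sum>i<q. a ^ i * b ^ (q - Suc i))"
  proof -
    have ab: "[a = b] (mod int q)" using assms(1) by (simp add: cong_iff_dvd_diff)
    have "[(\<Sum>i<q. a ^ i * b ^ (q - Suc i)) = (\<Sum>i<q. b ^ i * b ^ (q - Suc i))] (mod int q)"
      by (intro cong_sum cong_mult cong_pow ab cong_refl)
    moreover have "(\<Sum>i<q. b ^ i * b ^ (q - Suc i)) = int q * b ^ (q - 1)"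
      by (simp flip: power_add)
    ultimately show ?thesis by (metis cong_dvd_iff dvd_triv_left)
  qed
  ultimately show ?thesis using assms(1) by (simp add: power2_eq_square mult_dvd_mono)
qed

lemma fermat_int:
  assumes "prime q"
  shows "int q dvd m ^ q - m"
proof (cases "int q dvd m")
  case True
  then show ?thesis using assms prime_gt_0_nat by (intro dvd_diff dvd_trans[OF True]) auto
next
  case False
  have "[m ^ totient q = 1] (mod int q)"
  proof -
    define a where "a = nat (m mod int q)"
    have q0: "q > 0" using assms prime_gt_0_nat by blast
    have a: "int a = m mod int q" using q0 by (simp add: a_def)
    have am: "[int a = m] (mod int q)" unfolding a by (simp add: unique_euclidean_semiring_class.cong_def)
    have "\<not> q dvd a" using False am cong_dvd_iff[of "int a" m "int q"] by simp
    then have "coprime a q" using assms by (metis coprime_commute prime_imp_coprime)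
    then have "[a ^ totient q = 1] (mod q)" by (rule euler_theorem)
    then have "[int a ^ totient q = 1] (mod int q)" by (metis cong_int_iff of_nat_1 of_nat_power)
    then show ?thesis using cong_pow[OF am, of "totient q"] by (meson cong_sym cong_trans)
  qed
  then have "[m ^ (q - 1) * m = 1 * m] (mod int q)" using assms by (intro cong_mult) (auto simp: totient_prime)
  moreover have "m ^ (q - 1) * m = m ^ q" using assms prime_gt_0_nat by (intro power_minus_mult) auto
  ultimately show ?thesis by (simp add: cong_iff_dvd_diff)
qed

text \<open>The condition \<open>q\<^sup>2 dvd m ^ q - m\<close> does not depend on the power of \<open>q\<close> that is used as exponent.\<close>

lemma prime_power_frobenius_square:
  assumes q: "prime q" and k: "k > 0"
  shows "(int q)\<^sup>2 dvd (m ^ (q ^ k) - m) - (m ^ q - m)"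
  using k
proof (induction k rule: nat_induct_non_zero)
  case 1
  then show ?case by simp
next
  case (Suc k)
  have "int q dvd (m ^ (q ^ k) - m) - (m ^ q - m)" using Suc.IH by (meson dvd_power dvd_trans pos2)
  then have "int q dvd m ^ (q ^ k) - m ^ q" by simp
  moreover have "int q dvd m ^ q - m" by (rule fermat_int[OF q])
  ultimately have "int q dvd (m ^ (q ^ k) - m ^ q) + (m ^ q - m)" by (rule dvd_add)
  then have "int q dvd m ^ (q ^ k) - m" by simp
  then have "(int q)\<^sup>2 dvd (m ^ (q ^ k)) ^ q - m ^ q" using q by (rule power_cong_prime_square)
  also have "(m ^ (q ^ k)) ^ q - m ^ q = (m ^ (q ^ Suc k) - m) - (m ^ q - m)" by (simp add: mult.commute flip: power_mult)
  finally show ?case .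
qed

context pure_field
begin

definition R :: "complex set" where "R = range (\<lambda>P. int_eval P \<alpha>)"

lemma R_closed:
  shows R_add: "x \<in> R \<Longrightarrow> y \<in> R \<Longrightarrow> x + y \<in> R" and R_mult: "x \<in> R \<Longrightarrow> y \<in> R \<Longrightarrow> x * y \<in> R"
    and R_diff: "x \<in> R \<Longrightarrow> y \<in> R \<Longrightarrow> x - y \<in> R" and R_uminus: "x \<in> R \<Longrightarrow> - x \<in> R"
    and R_of_int: "of_int c \<in> R" and R_alpha: "\<alpha> \<in> R"
proof -
  show "x \<in> R \<Longrightarrow> y \<in> R \<Longrightarrow> x + y \<in> R" unfolding R_def
    by (elim rangeE) (metis int_eval_simps(3) rangeI)
  show "x \<in> R \<Longrightarrow> y \<in> R \<Longrightarrow> x * y \<in> R" unfolding R_def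
    by (elim rangeE) (metis int_eval_simps(4) rangeI)
  show "x \<in> R \<Longrightarrow> y \<in> R \<Longrightarrow> x - y \<in> R" unfolding R_def
    by (elim rangeE) (metis int_eval_simps(5) rangeI)
  show "x \<in> R \<Longrightarrow> - x \<in> R" unfolding R_def
    by (elim rangeE) (metis int_eval_simps(6) rangeI)
  show "of_int c \<in> R" unfolding R_def using rangeI[of "\<lambda>P. int_eval P \<alpha>" "[:c:]"] by simp
  show "\<alpha> \<in> R" unfolding R_def using rangeI[of "\<lambda>P. int_eval P \<alpha>" "[:0, 1:]"] by simp
qed

lemma R_0: "0 \<in> R" and R_1: "1 \<in> R" using R_of_int[of 0] R_of_int[of 1] by simp_all
lemma R_of_nat: "of_nat k \<in> R" using R_of_int[of "int k"] by simp
lemma R_power: "x \<in> R \<Longrightarrow> x ^ k \<in> R" by (induction k) (auto intro: R_1 R_mult)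
lemma R_sum: "(\<And>i. i \<in> A \<Longrightarrow> f i \<in> R) \<Longrightarrow> sum f A \<in> R"
  by (induction A rule: infinite_finite_induct) (auto intro: R_0 R_add)
lemma R_int: "x \<in> R \<Longrightarrow> algebraic_int x" unfolding R_def using algebraic_int_int_eval[OF \<alpha>_int] by blast

lemmas R_intros = R_add R_mult R_diff R_uminus R_of_int R_alpha R_0 R_1 R_of_nat R_power R_sum

lemma R_coords: "x \<in> R \<Longrightarrow> \<exists>B. x = (\<Sum>k<n. of_int (B k) * \<alpha> ^ k)"
  using int_eval_reduce[OF n0, of m] root unfolding R_def by blast

lemma R_induct: "x \<in> R \<Longrightarrow> P 0 \<Longrightarrow> (\<And>c y. y \<in> R \<Longrightarrow> P y \<Longrightarrow> P (of_int c + \<alpha> * y)) \<Longrightarrow> P x"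
proof -
  assume x: "x \<in> R" and 0: "P 0" and step: "\<And>c y. y \<in> R \<Longrightarrow> P y \<Longrightarrow> P (of_int c + \<alpha> * y)"
  obtain p where p: "x = int_eval p \<alpha>" using x unfolding R_def by blast
  have "P (int_eval p \<alpha>)"
  proof (induction p)
    case (pCons c p)
    have "int_eval p \<alpha> \<in> R" by (simp add: R_def)
    from step[OF this pCons.IH] show ?case by simp
  qed (use 0 in simp)
  then show ?thesis using p by simp
qed

text \<open>Here and below the error terms are kept inside the order \<open>R\<close>, where divisibility by \<open>q\<close> can be read off from coordinates.\<close>

lemma power_add_expand:
  assumes "a \<in> R" "b \<in> R"
  shows "\<exists>e\<in>R. (a + b) ^ k = a ^ k + b * e"
proof (induction k)
  case 0
  show ?case by (rule bexI[of _ 0]) (auto intro: R_0)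
next
  case (Suc k)
  then obtain e where e: "e \<in> R" "(a + b) ^ k = a ^ k + b * e" by blast
  have "(a + b) ^ Suc k = a ^ Suc k + b * (a ^ k + (a + b) * e)" using e(2) by (simp add: algebra_simps)
  moreover have "a ^ k + (a + b) * e \<in> R" using assms e(1) by (intro R_intros)
  ultimately show ?case by blast
qed

lemma frobenius_expand:
  assumes q: "prime q" and a: "a \<in> R" and b: "b \<in> R"
  shows "\<exists>e\<in>R. (a + b) ^ q = a ^ q + b ^ q + of_nat q * (a * e)"
proof -
  have q0: "q \<ge> 2" using q prime_ge_2_nat by blast
  define e where "e = (\<Sum>i\<in>{1..<q}. of_nat ((q choose i) div q) * a ^ (i - 1) * b ^ (q - i))"
  have eR: "e \<in> R" unfolding e_def by (intro R_intros a b)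
  have "(a + b) ^ q = (\<Sum>i\<le>q. of_nat (q choose i) * a ^ i * b ^ (q - i))" by (rule binomial_ring)
  also have "{..q} = insert 0 (insert q {1..<q})" using q0 by auto
  also have "(\<Sum>i\<in>\<dots>. of_nat (q choose i) * a ^ i * b ^ (q - i)) = b ^ q + (a ^ q + (\<Sum>i\<in>{1..<q}. of_nat (q choose i) * a ^ i * b ^ (q - i)))"
    using q0 by simp
  also have "(\<Sum>i\<in>{1..<q}. of_nat (q choose i) * a ^ i * b ^ (q - i)) = of_nat q * (a * e)"
    unfolding e_def sum_distrib_left
  proof (intro sum.cong refl)
    fix i assume i: "i \<in> {1..<q}"
    then have "q dvd (q choose i)" by (intro dvd_choose_prime) (use q in auto)
    then have "q choose i = q * ((q choose i) div q)" by simp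
    then have c: "of_nat (q choose i) = (of_nat q * of_nat ((q choose i) div q) :: complex)" by (metis of_nat_mult)
    have "a ^ i = a * a ^ (i - 1)" using i power_minus_mult[of i a] by (simp add: mult.commute)
    then show "of_nat (q choose i) * a ^ i * b ^ (q - i) = of_nat q * (a * (of_nat ((q choose i) div q) * a ^ (i - 1) * b ^ (q - i)))"
      using c by (simp add: mult_ac)
  qed
  finally show ?thesis using eR by (intro bexI[of _ e]) (auto simp: algebra_simps)
qed

lemma frobenius_iterate:
  assumes q: "prime q" and a: "a \<in> R" and b: "b \<in> R"
  shows "\<exists>e\<in>R. (a + b) ^ (q ^ j) = a ^ (q ^ j) + b ^ (q ^ j) + of_nat q * (a * e)"
proof (induction j)
  case 0
  show ?case by (rule bexI[of _ 0]) (auto intro: R_0)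
next
  case (Suc j)
  then obtain e where e: "e \<in> R" "(a + b) ^ (q ^ j) = a ^ (q ^ j) + b ^ (q ^ j) + of_nat q * (a * e)" by blast
  define x where "x = a ^ (q ^ j)"
  define y where "y = b ^ (q ^ j)"
  have xy: "x \<in> R" "y \<in> R" unfolding x_def y_def by (intro R_intros a b)+
  obtain f where f: "f \<in> R" "(x + y) ^ q = x ^ q + y ^ q + of_nat q * (x * f)" using frobenius_expand[OF q xy] by blast
  obtain g where g: "g \<in> R" "((x + y) + of_nat q * (a * e)) ^ q = (x + y) ^ q + (of_nat q * (a * e)) * g"
    using power_add_expand[of "x + y" "of_nat q * (a * e)" q] xy e(1) a by (blast intro: R_intros)
  have "q ^ j > 0" using q prime_gt_0_nat by simp
  then have xa: "x = a * a ^ (q ^ j - 1)" unfolding x_def using power_minus_mult[of "q ^ j" a] by (simp add: mult.commute)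
  have "(a + b) ^ (q ^ Suc j) = ((a + b) ^ (q ^ j)) ^ q" by (simp add: mult.commute flip: power_mult)
  also have "\<dots> = x ^ q + y ^ q + of_nat q * (x * f) + (of_nat q * (a * e)) * g"
    unfolding e(2) x_def[symmetric] y_def[symmetric] g(2) f(2) ..
  also have "\<dots> = x ^ q + y ^ q + of_nat q * (a * (a ^ (q ^ j - 1) * f + e * g))"
  proof -
    have "x * f = a * (a ^ (q ^ j - 1) * f)" by (subst xa) (simp only: mult.assoc)
    then show ?thesis by (simp only: distrib_left mult.assoc add.assoc)
  qed
  also have "x ^ q = a ^ (q ^ Suc j)" by (simp add: x_def mult.commute flip: power_mult)
  also have "y ^ q = b ^ (q ^ Suc j)" by (simp add: y_def mult.commute flip: power_mult)
  finally have eq: "(a + b) ^ (q ^ Suc j) = a ^ (q ^ Suc j) + b ^ (q ^ Suc j) + of_nat q * (a * (a ^ (q ^ j - 1) * f + e * g))" .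
  have "a ^ (q ^ j - 1) * f + e * g \<in> R" by (intro R_intros a e f g)
  then show ?case using eq by (rule bexI[rotated])
qed

text \<open>Write \<open>n = Q * n'\<close> with \<open>Q\<close> the \<open>q\<close>-part, and let \<open>\<pi> = \<alpha> ^ n' - m\<close>. The hypothesis says that \<open>\<pi> ^ Q\<close> is \<open>q\<close> times an element that is a unit at \<open>q\<close>, so that \<open>\<pi>\<close> is a local generator of the radical of \<open>q\<close>. If \<open>y\<close> were not in \<open>R\<close>, take the largest \<open>a\<close> with \<open>q * y\<close> in the ideal generated by \<open>q\<close> and \<open>\<pi> ^ a\<close>, and let \<open>w\<close> be the cofactor of \<open>\<pi> ^ a\<close>. Multiplying \<open>y\<close> by a power of \<open>\<pi>\<close> shows that a power of \<open>w\<close>, times a unit at \<open>q\<close>, lies in \<open>q * R\<close>. Modulo \<open>q\<close> and \<open>\<pi>\<close> a suitable iterate of the Frobenius map is the identity, as \<open>n'\<close> is prime to \<open>q\<close>; hence \<open>w\<close> itself lies in the ideal generated by \<open>q\<close> and \<open>\<pi>\<close>, against the choice of \<open>a\<close>.\<close>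

lemma unramified_prime_maximal:
  assumes q: "prime q" "q dvd n" and qm: "\<not> int q dvd m" and good: "\<not> (int q)\<^sup>2 dvd m ^ q - m"
    and y: "algebraic_int y" and B: "of_int (int q) * y = (\<Sum>k<n. of_int (B k) * \<alpha> ^ k)" and k: "k < n"
  shows "int q dvd B k"
proof -
  define Z where "Z = of_nat q * y"
  have ZR: "Z \<in> R" unfolding Z_def using B by (auto intro!: R_intros)
  have "\<exists>u\<in>R. Z = of_nat q * u"
  proof (rule ccontr)
    assume Zn: "\<not> (\<exists>u\<in>R. Z = of_nat q * u)"
    have q2: "q \<ge> 2" using q(1) prime_ge_2_nat by blast
    obtain e n' where en: "n = q ^ e * n'" "\<not> q dvd n'"
      using multiplicity_decompose'[of n q] n0 q by (metis mult.commute not_prime_unit not_gr_zero)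
    have e0: "e > 0" using en q(2) by (auto intro: Nat.gr0I)
    define Q where "Q = q ^ e"
    have Q0: "Q > 0" using q2 by (simp add: Q_def)
    have nQ: "n = Q * n'" using en by (simp add: Q_def)
    have n'0: "n' > 0" using n0 nQ by (auto intro: Nat.gr0I)
    define x0 where "x0 = \<alpha> ^ n'"
    define pi' where "pi' = x0 - of_int m"
    have x0R: "x0 \<in> R" and piR: "pi' \<in> R" unfolding x0_def pi'_def by (intro R_intros)+
    have "x0 ^ Q = of_int m" unfolding x0_def using root nQ by (simp add: mult.commute flip: power_mult)
    \<comment> \<open>The \<open>Q\<close>-th power of the local parameter is \<open>q\<close> times a unit at \<open>q\<close>.\<close>
    have "int q dvd m ^ Q - m"
    proof -
      have "(int q)\<^sup>2 dvd (m ^ Q - m) - (m ^ q - m)" unfolding Q_def by (rule prime_power_frobenius_square[OF q(1) e0])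
      then have "int q dvd (m ^ Q - m) - (m ^ q - m)" by (meson dvd_power dvd_trans pos2)
      then show ?thesis using fermat_int[OF q(1), of m] dvd_add[of "int q" "(m ^ Q - m) - (m ^ q - m)" "m ^ q - m"] by simp
    qed
    then obtain d where d: "m ^ Q - m = int q * d" by blast
    have nd: "\<not> int q dvd d"
    proof
      assume "int q dvd d"
      then have "(int q)\<^sup>2 dvd m ^ Q - m" unfolding d power2_eq_square by (intro mult_dvd_mono) auto
      moreover have "(int q)\<^sup>2 dvd (m ^ Q - m) - (m ^ q - m)" unfolding Q_def by (rule prime_power_frobenius_square[OF q(1) e0])
      ultimately have "(int q)\<^sup>2 dvd (m ^ Q - m) - ((m ^ Q - m) - (m ^ q - m))" by (rule dvd_diff)
      then show False using good by simp
    qed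
    obtain E where E: "E \<in> R" "(pi' + of_int m) ^ Q = pi' ^ Q + of_int m ^ Q + of_nat q * (pi' * E)"
      using frobenius_iterate[OF q(1) piR R_of_int[of m], of e] unfolding Q_def by blast
    have "pi' + of_int m = x0" by (simp add: pi'_def)
    then have e1: "of_int m = pi' ^ Q + of_int m ^ Q + of_nat q * (pi' * E)" using E(2) \<open>x0 ^ Q = of_int m\<close> by simp
    have e2: "of_int m ^ Q = (of_int m + of_nat q * of_int d :: complex)"
    proof -
      have "m ^ Q = m + int q * d" using d by simp
      then have "(of_int (m ^ Q) :: complex) = of_int (m + int q * d)" by (rule arg_cong)
      then show ?thesis by simp
    qed
    have piQ: "pi' ^ Q = - of_nat q * (of_int d + pi' * E)"
    proof -
      have "pi' ^ Q = of_int m - of_int m ^ Q - of_nat q * (pi' * E)" by (subst e1) simp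
      also have "\<dots> = - of_nat q * (of_int d + pi' * E)" unfolding e2 by (simp add: distrib_left)
      finally show ?thesis .
    qed
    define I where "I a z \<longleftrightarrow> (\<exists>u\<in>R. \<exists>w\<in>R. z = of_nat q * u + pi' ^ a * w)" for a z
    have I0: "I 0 Z" unfolding I_def using ZR by (intro bexI[of _ 0] bexI[of _ Z]) (auto intro: R_0)
    have IQ: "\<not> I Q Z"
    proof
      assume "I Q Z"
      then obtain u w where uw: "u \<in> R" "w \<in> R" "Z = of_nat q * u + pi' ^ Q * w" unfolding I_def by blast
      have "Z = of_nat q * (u - (of_int d + pi' * E) * w)" unfolding uw(3) piQ by (simp add: algebra_simps)
      moreover have "u - (of_int d + pi' * E) * w \<in> R" by (intro R_intros uw piR E)
      ultimately show False using Zn by blast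
    qed
    \<comment> \<open>The largest exponent with \<open>Z\<close> in the ideal generated by \<open>q\<close> and \<open>pi' ^ a\<close>.\<close>
    define a where "a = (LEAST a. \<not> I (Suc a) Z)"
    have exa: "\<not> I (Suc (Q - 1)) Z" using IQ Q0 by simp
    have a1: "\<not> I (Suc a) Z" unfolding a_def by (rule LeastI) (rule exa)
    have aQ: "a < Q"
    proof -
      have "a \<le> Q - 1" unfolding a_def by (rule Least_le) (rule exa)
      then show ?thesis using Q0 by simp
    qed
    have a0: "I a Z"
    proof (cases a)
      case 0
      then show ?thesis using I0 by simp
    next
      case (Suc b)
      then have "b < a" by simp
      then have "I (Suc b) Z" using not_less_Least[of b "\<lambda>a. \<not> I (Suc a) Z"] unfolding a_def by blast
      then show ?thesis using Suc by simp
    qed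
    obtain u w where uw: "u \<in> R" "w \<in> R" "Z = of_nat q * u + pi' ^ a * w" using a0 unfolding I_def by blast
    have wJ: "\<not> I 1 w"
    proof
      assume "I 1 w"
      then obtain u' w' where uw': "u' \<in> R" "w' \<in> R" "w = of_nat q * u' + pi' * w'" unfolding I_def by auto
      have "Z = of_nat q * (u + pi' ^ a * u') + pi' ^ Suc a * w'" unfolding uw(3) uw'(3) by (simp add: algebra_simps)
      moreover have "u + pi' ^ a * u' \<in> R" by (intro R_intros uw uw' piR)
      ultimately have "I (Suc a) Z" unfolding I_def using uw'(2) by blast
      then show False using a1 by blast
    qed
    \<comment> \<open>The exponent of \<open>pi'\<close> in \<open>q * y1\<close> becomes \<open>Q - 1\<close>, so that the \<open>Q\<close>-th power of \<open>q * y1\<close> contains exactly \<open>q ^ (Q - 1)\<close>.\<close>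
    define y1 where "y1 = (y - u) * pi' ^ (Q - 1 - a)"
    have y1int: "algebraic_int y1" unfolding y1_def
      by (intro algebraic_int_mult algebraic_int_diff algebraic_int_power y R_int[OF uw(1)] R_int[OF piR])
    have qy1: "of_nat q * y1 = pi' ^ (Q - 1) * w"
    proof -
      have "of_nat q * (y - u) = pi' ^ a * w" using uw(3) by (simp add: Z_def right_diff_distrib)
      then have "of_nat q * y1 = pi' ^ a * pi' ^ (Q - 1 - a) * w" unfolding y1_def by (simp add: mult_ac)
      also have "pi' ^ a * pi' ^ (Q - 1 - a) = pi' ^ (Q - 1)" using aQ by (simp flip: power_add)
      finally show ?thesis .
    qed
    define F where "F = of_int d + pi' * E"
    have FR: "F \<in> R" unfolding F_def by (intro R_intros piR E)
    define V where "V = F ^ (Q - 1) * w ^ Q"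
    define y2 where "y2 = (- 1) ^ (Q - 1) * y1 ^ Q"
    have qn0: "of_nat q \<noteq> (0::complex)" using q2 by simp
    have y2int: "algebraic_int y2" unfolding y2_def
      by (intro algebraic_int_mult algebraic_int_power y1int) simp
    have qy2: "of_nat q * y2 = V"
    proof -
      have "(of_nat q * y1) ^ Q = (pi' ^ Q) ^ (Q - 1) * w ^ Q" unfolding qy1 by (simp add: power_mult_distrib mult.commute flip: power_mult)
      also have "\<dots> = (- of_nat q) ^ (Q - 1) * V" unfolding piQ F_def[symmetric] V_def power_mult_distrib by (simp only: mult.assoc)
      also have "(- of_nat q :: complex) ^ (Q - 1) = of_nat q ^ (Q - 1) * (- 1) ^ (Q - 1)" by (simp flip: power_mult_distrib)
      finally have "of_nat q ^ Q * y1 ^ Q = of_nat q ^ (Q - 1) * ((- 1) ^ (Q - 1) * V)" by (simp add: power_mult_distrib mult.assoc)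
      moreover have "(of_nat q :: complex) ^ Q = of_nat q ^ (Q - 1) * of_nat q" using power_minus_mult[OF Q0] by metis
      ultimately have "of_nat q ^ (Q - 1) * (of_nat q * y1 ^ Q) = of_nat q ^ (Q - 1) * ((- 1) ^ (Q - 1) * V)" by (simp add: mult.assoc)
      then have eq: "of_nat q * y1 ^ Q = (- 1) ^ (Q - 1) * V" using qn0 by simp
      have "of_nat q * y2 = (- 1) ^ (Q - 1) * (of_nat q * y1 ^ Q)" by (simp add: y2_def mult_ac)
      also have "\<dots> = ((- 1) ^ (Q - 1) * (- 1) ^ (Q - 1)) * V" unfolding eq by (simp add: mult.assoc)
      also have "(- 1 :: complex) ^ (Q - 1) * (- 1) ^ (Q - 1) = 1" by (simp flip: power_mult_distrib)
      finally show ?thesis by simp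
    qed
    have VR: "V \<in> R" unfolding V_def by (intro R_intros FR uw)
    obtain s c where s: "s > 0" "y2 ^ s = (\<Sum>i<s. of_int (c i) * y2 ^ i)"
      using algebraic_int_power_relation[OF y2int] by (elim exE conjE)
    have Vs: "\<exists>g\<in>R. V ^ t = of_nat q * g" if t: "t \<ge> s" for t
    proof -
      have "V ^ s = of_nat q ^ s * y2 ^ s" unfolding qy2[symmetric] by (simp add: power_mult_distrib)
      also have "\<dots> = (\<Sum>i<s. of_int (c i) * of_nat q ^ s * y2 ^ i)" unfolding s(2) sum_distrib_left by (simp add: mult_ac)
      also have "\<dots> = (\<Sum>i<s. of_nat q * (of_int (c i) * of_nat q ^ (s - Suc i) * V ^ i))"
      proof (intro sum.cong refl)
        fix i assume i: "i \<in> {..<s}"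
        then have "s = Suc ((s - Suc i) + i)" by simp
        then have "(of_nat q :: complex) ^ s = of_nat q * (of_nat q ^ (s - Suc i) * of_nat q ^ i)" by (metis power_Suc power_add)
        then show "of_int (c i) * of_nat q ^ s * y2 ^ i = of_nat q * (of_int (c i) * of_nat q ^ (s - Suc i) * V ^ i)"
          unfolding qy2[symmetric] by (simp add: power_mult_distrib mult_ac)
      qed
      also have "\<dots> = of_nat q * (\<Sum>i<s. of_int (c i) * of_nat q ^ (s - Suc i) * V ^ i)" by (simp add: sum_distrib_left)
      finally have Vseq: "V ^ s = of_nat q * (\<Sum>i<s. of_int (c i) * of_nat q ^ (s - Suc i) * V ^ i)" .
      have "V ^ t = V ^ s * V ^ (t - s)" using t by (simp flip: power_add)
      also have "\<dots> = of_nat q * ((\<Sum>i<s. of_int (c i) * of_nat q ^ (s - Suc i) * V ^ i) * V ^ (t - s))" unfolding Vseq by (simp add: mult.assoc)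
      finally have "V ^ t = of_nat q * ((\<Sum>i<s. of_int (c i) * of_nat q ^ (s - Suc i) * V ^ i) * V ^ (t - s))" .
      moreover have "(\<Sum>i<s. of_int (c i) * of_nat q ^ (s - Suc i) * V ^ i) * V ^ (t - s) \<in> R" by (intro R_intros VR)
      ultimately show ?thesis by blast
    qed
    define J where "J z \<longleftrightarrow> (\<exists>u\<in>R. \<exists>w\<in>R. z = of_nat q * u + pi' * w)" for z
    have J_add: "J (x + z)" if J1: "J x" and J2: "J z" for x z
    proof -
      obtain u w where 1: "u \<in> R" "w \<in> R" "x = of_nat q * u + pi' * w" using J1 unfolding J_def by (elim bexE)
      obtain u' w' where 2: "u' \<in> R" "w' \<in> R" "z = of_nat q * u' + pi' * w'" using J2 unfolding J_def by (elim bexE)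
      have "x + z = of_nat q * (u + u') + pi' * (w + w')" unfolding 1(3) 2(3) by (simp add: algebra_simps)
      then show ?thesis unfolding J_def by (intro bexI[of _ "u + u'"] bexI[of _ "w + w'"] R_add 1 2)
    qed
    have J_mult: "J (r * x)" if J1: "J x" and r: "r \<in> R" for x r
    proof -
      obtain u w where 1: "u \<in> R" "w \<in> R" "x = of_nat q * u + pi' * w" using J1 unfolding J_def by (elim bexE)
      have "r * x = of_nat q * (r * u) + pi' * (r * w)" unfolding 1(3) by (simp add: algebra_simps)
      then show ?thesis unfolding J_def by (intro bexI[of _ "r * u"] bexI[of _ "r * w"] R_mult r 1)
    qed
    have J_q: "J (of_nat q * x)" if "x \<in> R" for x
      unfolding J_def using that by (intro bexI[of _ x] bexI[of _ 0]) (auto intro: R_0)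
    have J_pi: "J (pi' * x)" if "x \<in> R" for x
      unfolding J_def using that by (intro bexI[of _ 0] bexI[of _ x]) (auto intro: R_0)
    have J_uminus: "J (- x)" if "J x" for x using J_mult[OF that, of "-1"] R_of_int[of "-1"] by simp
    have J_dvd: "J (of_int c)" if "int q dvd c" for c
    proof -
      obtain c' where "c = int q * c'" using \<open>int q dvd c\<close> by blast
      then show ?thesis using J_q[OF R_of_int[of c']] by simp
    qed
    have wJ': "\<not> J w" using wJ unfolding I_def J_def by simp
    \<comment> \<open>Modulo \<open>q\<close> and \<open>pi'\<close> one has \<open>\<alpha> ^ n' = m\<close>, so \<open>\<alpha> ^ M = 1\<close>; a power of \<open>q\<close> that is \<open>1\<close> modulo \<open>M\<close> gives an iterate of the Frobenius map fixing \<open>\<alpha>\<close>. The iterate is taken large enough for \<open>V ^ t\<close> to lie in \<open>q * R\<close>.\<close>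
    define M where "M = n' * (q - 1)"
    have M0: "M > 0" using n'0 q2 by (simp add: M_def)
    have cop: "coprime q M"
    proof -
      have "coprime q n'" using prime_imp_coprime[OF q(1) en(2)] .
      moreover have "\<not> q dvd q - 1" using q2 by (auto dest: dvd_imp_le)
      then have "coprime q (q - 1)" by (rule prime_imp_coprime[OF q(1)])
      ultimately show ?thesis unfolding M_def by (simp only: coprime_mult_right_iff)
    qed
    define j where "j = totient M * (e + s)"
    have tM: "totient M > 0" using M0 by simp
    then have "1 * (e + s) \<le> totient M * (e + s)" by (intro mult_le_mono1) linarith
    then have jge: "j \<ge> e + s" by (simp only: j_def mult_1)
    have "[q ^ totient M = 1] (mod M)" using euler_theorem[OF cop] .
    then have "[(q ^ totient M) ^ (e + s) = 1 ^ (e + s)] (mod M)" by (rule cong_pow)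
    then have qj: "[q ^ j = 1] (mod M)" by (simp add: j_def power_mult)
    then have "M dvd q ^ j - 1" by (rule cong_to_1_nat)
    then obtain c' where c': "q ^ j - 1 = M * c'" by blast
    have qj1: "q ^ j = Suc (M * c')" using c' q2 by (metis Suc_pred' zero_less_power less_le_trans pos2)
    have frob: "J (x ^ (q ^ j) - x)" if x: "x \<in> R" for x
    proof (rule R_induct[where P = "\<lambda>x. J (x ^ (q ^ j) - x)", OF x])
      have "(0::complex) ^ (q ^ j) = 0" using q2 by simp
      then show "J (0 ^ (q ^ j) - 0)" using J_q[OF R_0] by (simp only: diff_self mult_zero_right)
    next
      fix c z assume 2: "z \<in> R" "J (z ^ (q ^ j) - z)"
      obtain e' where e': "e' \<in> R" "(of_int c + \<alpha> * z) ^ (q ^ j) = of_int c ^ (q ^ j) + (\<alpha> * z) ^ (q ^ j) + of_nat q * (of_int c * e')"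
        using frobenius_iterate[OF q(1) R_of_int[of c] R_mult[OF R_alpha 2(1)], of j] by blast
      have A: "J (of_int c ^ (q ^ j) - of_int c)"
      proof -
        have "j > 0" using jge e0 by simp
        then have "(int q)\<^sup>2 dvd (c ^ (q ^ j) - c) - (c ^ q - c)" by (rule prime_power_frobenius_square[OF q(1)])
        then have "int q dvd (c ^ (q ^ j) - c) - (c ^ q - c)" by (meson dvd_power dvd_trans pos2)
        then have "int q dvd c ^ (q ^ j) - c"
          using fermat_int[OF q(1), of c] dvd_add[of "int q" "(c ^ (q ^ j) - c) - (c ^ q - c)" "c ^ q - c"] by simp
        then have "J (of_int (c ^ (q ^ j) - c))" by (rule J_dvd)
        then show ?thesis by simp
      qed
      have Bx: "J (\<alpha> ^ (q ^ j) - \<alpha>)"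
      proof -
        have "\<alpha> ^ (q ^ j) = \<alpha> * (pi' + of_int m) ^ ((q - 1) * c')"
          unfolding qj1 M_def by (simp add: pi'_def x0_def mult.assoc flip: power_mult)
        obtain g where g: "g \<in> R" "(of_int m + pi') ^ ((q - 1) * c') = of_int m ^ ((q - 1) * c') + pi' * g"
          using power_add_expand[OF R_of_int[of m] piR] by blast
        have "int q dvd m ^ ((q - 1) * c') - 1"
        proof -
          have "int q dvd m * (m ^ (q - 1) - 1)"
            using fermat_int[OF q(1), of m] q2 power_minus_mult[of q m] by (simp add: right_diff_distrib mult.commute)
          then have "int q dvd m ^ (q - 1) - 1" using qm q(1) prime_dvd_mult_iff[of "int q"] by simp
          then have "[m ^ (q - 1) = 1] (mod int q)" by (simp add: cong_iff_dvd_diff)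
          then have "[(m ^ (q - 1)) ^ c' = 1 ^ c'] (mod int q)" by (rule cong_pow)
          then show ?thesis by (simp add: cong_iff_dvd_diff power_mult)
        qed
        then have J1: "J (of_int (m ^ ((q - 1) * c') - 1))" by (rule J_dvd)
        have "\<alpha> ^ (q ^ j) - \<alpha> = \<alpha> * (of_int (m ^ ((q - 1) * c') - 1) + pi' * g)"
          using \<open>\<alpha> ^ (q ^ j) = _\<close> g(2) by (simp add: algebra_simps)
        then show ?thesis using J_mult[OF J_add[OF J1 J_pi[OF g(1)]] R_alpha] by simp
      qed
      have "(of_int c + \<alpha> * z) ^ (q ^ j) - (of_int c + \<alpha> * z) = (of_int c ^ (q ^ j) - of_int c) + (z ^ (q ^ j) * (\<alpha> ^ (q ^ j) - \<alpha>) + \<alpha> * (z ^ (q ^ j) - z)) + of_nat q * (of_int c * e')"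
        unfolding e'(2) by (simp add: power_mult_distrib algebra_simps)
      also have "J \<dots>"
        by (intro J_add A J_mult[OF Bx] J_mult[OF 2(2)] J_q R_intros 2(1) e'(1))
      finally show "J ((of_int c + \<alpha> * z) ^ (q ^ j) - (of_int c + \<alpha> * z))" .
    qed
    define t where "t = q ^ (j - e)"
    have ts: "t \<ge> s"
    proof -
      have "s \<le> j - e" using jge by simp
      also have "j - e < t" unfolding t_def using q2 by (intro power_gt_expt) simp
      finally show ?thesis by simp
    qed
    have Qt: "Q * t = q ^ j" unfolding Q_def t_def using jge by (simp flip: power_add)
    obtain g where g: "g \<in> R" "V ^ t = of_nat q * g" using Vs[OF ts] by blast
    obtain f where f: "f \<in> R" "(of_int d + pi' * E) ^ ((Q - 1) * t) = of_int d ^ ((Q - 1) * t) + pi' * E * f"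
      using power_add_expand[OF R_of_int[of d] R_mult[OF piR E(1)]] by blast
    have "V ^ t = F ^ ((Q - 1) * t) * w ^ (q ^ j)" unfolding V_def Qt[symmetric] by (simp add: power_mult_distrib power_mult)
    then have Jd: "J (of_int (d ^ ((Q - 1) * t)) * w ^ (q ^ j))"
    proof -
      assume V: "V ^ t = F ^ ((Q - 1) * t) * w ^ (q ^ j)"
      have "of_int (d ^ ((Q - 1) * t)) * w ^ (q ^ j) = of_nat q * g + - (pi' * (E * f * w ^ (q ^ j)))"
        using V g(2) f(2) by (simp add: F_def algebra_simps)
      also have "J \<dots>" by (intro J_add J_q g(1) J_uminus J_pi R_intros E(1) f(1) uw(2))
      finally show ?thesis .
    qed
    define D where "D = d ^ ((Q - 1) * t)"
    have "coprime (int q) D" unfolding D_def using prime_imp_coprime[of "int q" d] nd q(1) by simp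
    then obtain v where v: "[D * v = 1] (mod int q)" using cong_solve_coprime_int[of D "int q"] by (auto simp: coprime_commute)
    have JD: "J (of_int v * (of_int D * w ^ (q ^ j)))" using J_mult[OF Jd R_of_int] by (simp add: D_def)
    have "int q dvd 1 - D * v" using v by (simp add: cong_iff_dvd_diff dvd_diff_commute)
    then have "J (w ^ (q ^ j) * of_int (1 - D * v))" by (intro J_mult J_dvd R_intros uw(2))
    from J_add[OF JD this] have "J (w ^ (q ^ j))" by (simp add: algebra_simps)
    moreover have "J (- (w ^ (q ^ j) - w))" by (intro J_uminus frob uw(2))
    ultimately have "J (w ^ (q ^ j) + - (w ^ (q ^ j) - w))" by (rule J_add)
    then show False using wJ' by simp
  qed
  then obtain u where u: "u \<in> R" "Z = of_nat q * u" by blast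
  obtain C where C: "u = (\<Sum>k<n. of_int (C k) * \<alpha> ^ k)" using R_coords[OF u(1)] by blast
  have "(\<Sum>k<n. of_int (B k) * \<alpha> ^ k) = (\<Sum>k<n. of_int (int q * C k) * \<alpha> ^ k)"
    using u(2) B unfolding Z_def C sum_distrib_left by (simp add: mult.assoc)
  then have "B k = int q * C k" by (rule int_coords_unique[OF _ k])
  then show ?thesis by simp
qed

text \<open>The element is \<open>(\<Sum>i<q. m ^ (q - 1 - i) * x ^ i) / q\<close> with \<open>x = \<alpha> ^ (n div q)\<close>, that is \<open>(x ^ q - m ^ q) / (q * (x - m))\<close>. Up to elements of \<open>R\<close> it equals \<open>z = (x - m) ^ (q - 1) / q\<close>, and \<open>z\<close> satisfies a monic quadratic equation over \<open>R\<close> because \<open>q\<^sup>2\<close> divides \<open>m ^ q - m\<close>.\<close>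

lemma wild_integer:
  assumes q: "prime q" "q dvd n" and bad: "(int q)\<^sup>2 dvd m ^ q - m"
  shows "\<exists>y B k. y \<in> OK \<and> of_nat q * y = (\<Sum>k<n. of_int (B k) * \<alpha> ^ k) \<and> k < n \<and> B k = 1"
proof -
  have q2: "q \<ge> 2" using q(1) prime_ge_2_nat by blast
  define n' where "n' = n div q"
  have nq: "n = q * n'" using q(2) by (simp add: n'_def)
  have n'0: "n' > 0" using nq n0 by (auto intro: Nat.gr0I)
  have n'n: "n' < n" using nq n'0 q2 by simp
  define x0 where "x0 = \<alpha> ^ n'"
  define t where "t = x0 - of_int m"
  have x0R: "x0 \<in> R" and tR: "t \<in> R" unfolding x0_def t_def by (intro R_intros)+
  have x0q: "x0 ^ q = of_int m" unfolding x0_def using root nq by (simp add: mult.commute flip: power_mult)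
  have t0: "t \<noteq> 0"
  proof
    assume "t = 0"
    then have eq: "\<alpha> ^ n' = of_int m" by (simp add: t_def x0_def)
    have 1: "(\<Sum>k<n. of_int (if k = n' then 1 else 0) * \<alpha> ^ k) = \<alpha> ^ n'"
    proof -
      have "(\<Sum>k<n. of_int (if k = n' then 1 else 0) * \<alpha> ^ k) = (\<Sum>k<n. if k = n' then \<alpha> ^ k else 0)" by (intro sum.cong) auto
      then show ?thesis using n'n by simp
    qed
    have 2: "(\<Sum>k<n. of_int (if k = 0 then m else 0) * \<alpha> ^ k) = of_int m"
    proof -
      have "(\<Sum>k<n. of_int (if k = 0 then m else 0) * \<alpha> ^ k) = (\<Sum>k<n. if k = 0 then of_int m else 0)" by (intro sum.cong) auto
      then show ?thesis using n0 by simp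
    qed
    have "(\<Sum>k<n. of_int (if k = n' then 1 else 0) * \<alpha> ^ k) = (\<Sum>k<n. of_int (if k = 0 then m else 0) * \<alpha> ^ k)"
      unfolding 1 2 by (rule eq)
    from int_coords_unique[OF this n'n] n'0 show False by simp
  qed
  obtain d where d: "m ^ q - m = (int q)\<^sup>2 * d" using bad by (elim dvdE)
  have qc: "(of_nat q :: complex) \<noteq> 0" using q2 by simp
  obtain e where e: "e \<in> R" "(t + of_int m) ^ q = t ^ q + of_int m ^ q + of_nat q * (t * e)"
    using frobenius_expand[OF q(1) tR R_of_int[of m]] by (elim bexE)
  have mq: "of_int m ^ q = (of_int m + (of_nat q)\<^sup>2 * of_int d :: complex)"
  proof -
    have "m ^ q = m + (int q)\<^sup>2 * d" using d by simp
    then have "(of_int (m ^ q) :: complex) = of_int (m + (int q)\<^sup>2 * d)" by (rule arg_cong)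
    then show ?thesis by simp
  qed
  have tm: "t + of_int m = x0" by (simp add: t_def)
  have tq: "t ^ q = - of_nat q * (of_nat q * of_int d + t * e)"
    using e(2) unfolding tm x0q mq by (simp add: algebra_simps power2_eq_square) (metis add_eq_0_iff add.commute add.assoc minus_add_distrib)
  define z where "z = t ^ (q - 1) / of_nat q"
  have tz: "t * z = - (of_nat q * of_int d + t * e)"
  proof -
    have "of_nat q * (t * z) = t ^ q" using qc power_minus_mult[of q t] q2 by (simp add: z_def mult.commute)
    also have "\<dots> = of_nat q * - (of_nat q * of_int d + t * e)" unfolding tq by (simp only: mult_minus_left mult_minus_right)
    finally show ?thesis using qc by (metis mult_left_cancel)
  qed
  \<comment> \<open>One factor \<open>t\<close> of the numerator of \<open>z\<close> is traded for \<open>t * z\<close>, which lies in \<open>R\<close>.\<close>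
  have zz: "z * z = - of_int d * t ^ (q - 2) - e * z"
  proof -
    have "q - 1 = Suc (q - 2)" using q2 by simp
    then have "of_nat q * z = t ^ (q - 2) * t" using qc by (simp add: z_def)
    then have "of_nat q * (z * z) = t ^ (q - 2) * (t * z)" by (simp add: mult.assoc[symmetric])
    also have "\<dots> = of_nat q * (- of_int d * t ^ (q - 2)) - (t ^ (q - 2) * t) * e" unfolding tz by (simp add: algebra_simps)
    also have "\<dots> = of_nat q * (- of_int d * t ^ (q - 2)) - (of_nat q * z) * e" using \<open>of_nat q * z = t ^ (q - 2) * t\<close> by simp
    also have "\<dots> = of_nat q * (- of_int d * t ^ (q - 2) - e * z)" by (simp add: algebra_simps)
    finally show ?thesis using qc by (metis mult_left_cancel)
  qed
  \<comment> \<open>Generators of the module spanned by \<open>1\<close> and \<open>z\<close> over \<open>R\<close>.\<close>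
  define S where "S = (\<lambda>k. \<alpha> ^ k) ` {..<n} \<union> (\<lambda>k. z * \<alpha> ^ k) ` {..<n}"
  have fS: "finite S" by (simp add: S_def)
  have \<alpha>S: "\<alpha> ^ k \<in> S" "z * \<alpha> ^ k \<in> S" if "k < n" for k using that unfolding S_def by blast+
  have RS: "r \<in> zspan S" if r: "r \<in> R" for r
  proof -
    obtain C where C: "r = (\<Sum>k<n. of_int (C k) * \<alpha> ^ k)" using R_coords[OF r] by (elim exE)
    show ?thesis unfolding C by (intro zspan_sum zspan_scale zspan_base fS \<alpha>S) simp
  qed
  have RzS: "z * r \<in> zspan S" if r: "r \<in> R" for r
  proof -
    obtain C where C: "r = (\<Sum>k<n. of_int (C k) * \<alpha> ^ k)" using R_coords[OF r] by (elim exE)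
    have "z * r = (\<Sum>k<n. of_int (C k) * (z * \<alpha> ^ k))" unfolding C sum_distrib_left by (simp add: mult_ac)
    also have "\<dots> \<in> zspan S" by (intro zspan_sum zspan_scale zspan_base fS \<alpha>S) simp
    finally show ?thesis .
  qed
  have zint: "algebraic_int z"
  proof (rule algebraic_int_zspan[OF fS, of 1])
    show "1 \<in> S" using n0 by (auto simp: S_def intro!: image_eqI[of _ _ 0])
    fix s assume "s \<in> S"
    then obtain k where k: "s = \<alpha> ^ k \<or> s = z * \<alpha> ^ k" by (auto simp: S_def)
    show "z * s \<in> zspan S"
    proof (cases "s = \<alpha> ^ k")
      case True
      then show ?thesis using RzS[of s] by (simp add: R_power R_alpha)
    next
      case False
      then have "z * s = (z * z) * \<alpha> ^ k" using k by simp
      also have "\<dots> = - of_int d * t ^ (q - 2) * \<alpha> ^ k + z * (- (e * \<alpha> ^ k))" unfolding zz by (simp add: algebra_simps)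
      also have "\<dots> \<in> zspan S" by (intro zspan_add RS RzS R_intros tR e(1))
      finally show ?thesis .
    qed
  qed simp
  define y where "y = z + e"
  have yint: "algebraic_int y" unfolding y_def by (intro algebraic_int_add zint R_int e(1))
  define B where "B k = (if n' dvd k then m ^ (q - 1 - k div n') else 0)" for k
  have Bsum: "(\<Sum>k<n. of_int (B k) * \<alpha> ^ k) = (\<Sum>i<q. of_int m ^ (q - Suc i) * x0 ^ i)"
  proof -
    have im: "{k \<in> {..<n}. n' dvd k} = (\<lambda>i. n' * i) ` {..<q}" using n'0 by (auto simp: nq)
    have "(\<Sum>k<n. of_int (B k) * \<alpha> ^ k) = (\<Sum>k\<in>{k \<in> {..<n}. n' dvd k}. of_int (B k) * \<alpha> ^ k)"
      by (rule sum.mono_neutral_right) (auto simp: B_def)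
    also have "\<dots> = (\<Sum>i<q. of_int (B (n' * i)) * \<alpha> ^ (n' * i))" unfolding im
      using n'0 by (subst sum.reindex) (auto simp: inj_on_def)
    also have "\<dots> = (\<Sum>i<q. of_int m ^ (q - Suc i) * x0 ^ i)"
      using n'0 by (intro sum.cong) (auto simp: B_def x0_def power_mult)
    finally show ?thesis .
  qed
  have qy: "of_nat q * y = (\<Sum>k<n. of_int (B k) * \<alpha> ^ k)"
  proof -
    have "t * (\<Sum>i<q. of_int m ^ (q - Suc i) * x0 ^ i) = x0 ^ q - of_int m ^ q"
      unfolding t_def by (simp add: power_diff_sumr2[of x0] mult.commute)
    also have "\<dots> = - (of_nat q)\<^sup>2 * of_int d" unfolding x0q mq by simp
    also have "\<dots> = t * (of_nat q * y)"
    proof -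
      have "t * (of_nat q * y) = of_nat q * (t * z + t * e)" by (simp add: y_def algebra_simps)
      also have "\<dots> = - (of_nat q)\<^sup>2 * of_int d" unfolding tz by (simp add: power2_eq_square)
      finally show ?thesis by simp
    qed
    finally show ?thesis using t0 unfolding Bsum by (metis mult_left_cancel)
  qed
  have yK: "y \<in> rat_adjoin \<alpha>"
  proof -
    have "rat_eval (\<Sum>k<n. monom (of_int (B k) / of_nat q) k) \<alpha> = (\<Sum>k<n. of_int (B k) * \<alpha> ^ k) / of_nat q"
      by (simp add: rat_eval_sum sum_divide_distrib of_rat_divide)
    also have "\<dots> = y" unfolding qy[symmetric] using qc by simp
    finally show ?thesis unfolding rat_adjoin_eq[OF irr root] by (metis rangeI)
  qed
  have "y \<in> OK" using yK yint by (simp add: ring_of_integers_def)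
  moreover have "(q - 1) * n' < n" using q2 n'0 by (simp add: nq)
  moreover have "B ((q - 1) * n') = 1" using n'0 by (simp add: B_def)
  ultimately show ?thesis using qy by (intro exI[of _ y] exI[of _ B] exI[of _ "(q - 1) * n'"]) simp
qed

lemma good_imp_monogenic:
  assumes good: "\<And>q. prime q \<Longrightarrow> q dvd n \<Longrightarrow> \<not> (int q)\<^sup>2 dvd m ^ q - m"
  shows "monogenic OK"
proof -
  have "x \<in> int_adjoin \<alpha>" if x: "x \<in> OK" for x
  proof -
    have max: "int q dvd B k" if q: "prime q" "q dvd n" and y: "algebraic_int y"
      and B: "of_int (int q) * y = (\<Sum>k<n. of_int (B k) * \<alpha> ^ k)" and k: "k < n" for q y B k
    proof (cases "int q dvd m")
      case True
      have "prime (int q)" using q(1) by simp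
      from ramified_prime_maximal[OF this True y B k] show ?thesis .
    next
      case False
      show ?thesis by (rule unramified_prime_maximal[OF q False good[OF q] y B k])
    qed
    show ?thesis
    proof (rule OK_denominator_descent[OF x, where Q = "\<lambda>_. True"])
      fix q y B k
      assume "prime q" "q dvd n" True "algebraic_int y" "of_int (int q) * y = (\<Sum>k<n. of_int (B k) * \<alpha> ^ k)" "k < n"
      then show "int q dvd B k" by (intro max)
    next
      fix N A
      assume N: "N > 0" "N dvd n" "\<And>q. prime q \<Longrightarrow> q dvd N \<Longrightarrow> \<not> True" "of_nat N * x = (\<Sum>k<n. of_int (A k) * \<alpha> ^ k)"
      have "N = 1" using N(1,3) prime_factor_nat[of N] by auto
      then have "x = int_eval (\<Sum>k<n. monom (A k) k) \<alpha>" using N(4) by (simp add: int_eval_sum)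
      then show ?thesis unfolding int_adjoin_eq by blast
    qed
  qed
  moreover have "int_adjoin \<alpha> \<subseteq> OK" unfolding int_adjoin_eq using int_combination_in_OK by blast
  moreover have "\<alpha> \<in> OK" using int_combination_in_OK[of "[:0, 1:]"] by simp
  ultimately show ?thesis unfolding monogenic_def by blast
qed

end

section \<open>Vandermonde determinants and norms\<close>

lemma poly_sum_lessThan: "degree (p::complex poly) < n \<Longrightarrow> poly p x = (\<Sum>i<n. coeff p i * x ^ i)"
  unfolding poly_altdef by (intro sum.mono_neutral_left) (auto intro: coeff_eq_0)

definition root_poly :: "(nat \<Rightarrow> complex) \<Rightarrow> nat \<Rightarrow> complex poly" where
  "root_poly x j = (\<Prod>k<j. [:- x k, 1:])"

lemma root_poly_Suc: "root_poly x (Suc j) = root_poly x j * [:- x j, 1:]" by (simp add: root_poly_def)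

lemma root_poly_monic: "degree (root_poly x j) = j \<and> coeff (root_poly x j) j = 1"
proof (induction j)
  case 0
  show ?case by (simp add: root_poly_def)
next
  case (Suc j)
  then have nz: "root_poly x j \<noteq> 0" by auto
  have d: "degree (root_poly x (Suc j)) = Suc j" unfolding root_poly_Suc using Suc nz by (subst degree_mult_eq) auto
  have "lead_coeff (root_poly x (Suc j)) = 1" unfolding root_poly_Suc lead_coeff_mult using Suc by simp
  then show ?case using d by simp
qed

lemma poly_root_poly: "poly (root_poly x j) y = (\<Prod>k<j. y - x k)"
  by (simp add: root_poly_def poly_prod)

text \<open>The Newton basis \<open>\<Prod>k<j. X - x k\<close> is related to the monomials by a unipotent triangular matrix and makes the evaluation matrix triangular.\<close>

lemma vandermonde_det:
  fixes x :: "nat \<Rightarrow> complex"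
  shows "Determinant.det (Matrix.mat n n (\<lambda>(i, j). x i ^ j)) = (\<Prod>j<n. \<Prod>k<j. x j - x k)"
proof -
  define V where "V = Matrix.mat n n (\<lambda>(i, j). x i ^ j)"
  define S where "S = Matrix.mat n n (\<lambda>(k, j). coeff (root_poly x j) k)"
  define N where "N = Matrix.mat n n (\<lambda>(i, j). poly (root_poly x j) (x i))"
  have c: "V \<in> carrier_mat n n" "S \<in> carrier_mat n n" "N \<in> carrier_mat n n" by (simp_all add: V_def S_def N_def)
  have VS: "V * S = N"
  proof (rule eq_matI)
    fix i j assume "i < dim_row N" "j < dim_col N"
    then have ij: "i < n" "j < n" using c by auto
    have "(V * S) $$ (i, j) = (\<Sum>k<n. x i ^ k * coeff (root_poly x j) k)"
      unfolding index_mult_mat_sum[OF c(1,2) ij] using ij by (intro sum.cong) (auto simp: V_def S_def)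
    also have "\<dots> = poly (root_poly x j) (x i)"
      using poly_sum_lessThan[of "root_poly x j" n "x i"] root_poly_monic[of x j] ij by (simp add: mult.commute)
    finally show "(V * S) $$ (i, j) = N $$ (i, j)" using ij by (simp add: N_def)
  qed (use c in auto)
  have dS: "Determinant.det S = 1"
  proof -
    have ut: "upper_triangular S"
    proof (rule upper_triangularI)
      fix i j assume "j < i" "i < dim_row S"
      then have "j < n" "i < n" using c by auto
      then show "S $$ (i, j) = 0" using \<open>j < i\<close> root_poly_monic[of x j] by (simp add: S_def coeff_eq_0)
    qed
    have "S $$ (i, i) = 1" if "i < n" for i using that root_poly_monic[of x i] by (simp add: S_def)
    then show ?thesis unfolding det_upper_triangular[OF ut c(2)] prod_list_diag_prod using c by simp
  qed
  have dN: "Determinant.det N = (\<Prod>j<n. \<Prod>k<j. x j - x k)"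
  proof -
    have z: "N $$ (i, j) = 0" if "i < j" "j < n" for i j
      using that by (auto simp: N_def poly_root_poly intro!: prod_zero)
    have "Determinant.det N = prod_list (diag_mat N)" by (rule det_lower_triangular[OF _ c(3)]) (rule z)
    then show ?thesis unfolding prod_list_diag_prod using c by (simp add: N_def poly_root_poly atLeast0LessThan)
  qed
  have "Determinant.det V * Determinant.det S = Determinant.det N"
    unfolding VS[symmetric] by (rule det_mult[OF c(1,2), symmetric])
  then show ?thesis using dS dN by (simp add: V_def)
qed

lemma vandermonde_nonzero:
  fixes x :: "nat \<Rightarrow> complex"
  assumes "inj_on x {..<n}"
  shows "(\<Prod>j<n. \<Prod>k<j. x j - x k) \<noteq> 0"
proof -
  have "x j - x k \<noteq> 0" if "j < n" "k < j" for j k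
    using inj_onD[OF assms, of j k] that by auto
  then show ?thesis by simp
qed

lemma algebraic_int_det:
  assumes M: "M \<in> carrier_mat n n" and i: "\<And>i j. i < n \<Longrightarrow> j < n \<Longrightarrow> algebraic_int (M $$ (i, j) :: complex)"
  shows "algebraic_int (Determinant.det M)"
  unfolding det_def'[OF M]
proof (intro algebraic_int_sum algebraic_int_mult algebraic_int_prod)
  fix p assume p: "p \<in> {p. p permutes {0..<n}}"
  show "algebraic_int (signof p :: complex)" by (simp add: sign_def)
  fix k assume "k \<in> {0..<n}"
  then show "algebraic_int (M $$ (k, p k))" using p permutes_in_image[of p "{0..<n}" k] by (intro i) auto
qed

lemma root_poly_coeff_int:
  assumes "\<And>i. algebraic_int (x i)"
  shows "algebraic_int (coeff (root_poly x j) k)"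
proof (induction j arbitrary: k)
  case 0
  show ?case by (cases k) (simp_all add: root_poly_def)
next
  case (Suc j)
  have eq: "root_poly x (Suc j) = smult (- x j) (root_poly x j) + pCons 0 (root_poly x j)"
    unfolding root_poly_Suc by simp
  show ?case unfolding eq
    by (cases k) (auto simp: coeff_pCons intro!: algebraic_int_diff algebraic_int_mult assms Suc)
qed

text \<open>Division by the monic polynomial with roots \<open>x i\<close>, whose coefficients are algebraic integers.\<close>

lemma int_eval_reduce_at_points:
  assumes n: "n > 0" and x: "\<And>i. algebraic_int (x i)"
  shows "\<exists>r. (\<forall>k. algebraic_int (r k)) \<and> (\<forall>i<n. int_eval f (x i) = (\<Sum>k<n. r k * x i ^ k))"
proof (induction f)
  case 0
  show ?case by (rule exI[of _ "\<lambda>_. 0"]) simp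
next
  case (pCons a f)
  then obtain r where r: "\<forall>k. algebraic_int (r k)" "\<forall>i<n. int_eval f (x i) = (\<Sum>k<n. r k * x i ^ k)" by (elim exE conjE)
  obtain N where N: "n = Suc N" using n by (cases n) auto
  define c where "c k = coeff (root_poly x n) k" for k
  define s where "s k = (if k = 0 then of_int a else r (k - 1)) - r N * c k" for k
  have "algebraic_int (s k)" for k unfolding s_def
    by (intro algebraic_int_diff algebraic_int_mult) (use r(1) root_poly_coeff_int[OF x] in \<open>auto simp: c_def\<close>)
  moreover have "int_eval (pCons a f) (x i) = (\<Sum>k<n. s k * x i ^ k)" if i: "i < n" for i
  proof -
    have "0 = poly (root_poly x n) (x i)" using i by (auto simp: poly_root_poly intro!: prod_zero[symmetric])
    also have "\<dots> = (\<Sum>k<n. c k * x i ^ k) + c n * x i ^ n"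
      using poly_sum_lessThan[of "root_poly x n" "Suc n" "x i"] root_poly_monic[of x n] by (simp add: c_def)
    also have "c n = 1" using root_poly_monic[of x n] by (simp add: c_def)
    finally have xn: "(\<Sum>k<n. c k * x i ^ k) = - (x i ^ n)" by (simp add: eq_neg_iff_add_eq_0)
    have "(\<Sum>k<n. s k * x i ^ k) = (\<Sum>k<n. (if k = 0 then of_int a else r (k - 1)) * x i ^ k) - r N * (\<Sum>k<n. c k * x i ^ k)"
      by (simp add: s_def left_diff_distrib sum_subtractf sum_distrib_left mult.assoc)
    also have "\<dots> = of_int a + (\<Sum>k<N. r k * x i ^ Suc k) + r N * x i ^ n"
      unfolding xn unfolding N by (subst sum.lessThan_Suc_shift) simp
    also have "\<dots> = of_int a + x i * (\<Sum>k<n. r k * x i ^ k)"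
      unfolding N by (simp add: distrib_left sum_distrib_left mult_ac)
    finally show ?thesis using r(2) i by simp
  qed
  ultimately show ?case by (intro exI[of _ s]) simp
qed

lemma int_poly_det_Vandermonde:
  assumes n: "n > 0" and x: "\<And>i. algebraic_int (x i)"
  shows "\<exists>z. algebraic_int z \<and> Determinant.det (Matrix.mat n n (\<lambda>(i, k). int_eval (f k) (x i))) = (\<Prod>j<n. \<Prod>k<j. x j - x k) * z"
proof -
  have "\<forall>k. \<exists>r. (\<forall>l. algebraic_int (r l)) \<and> (\<forall>i<n. int_eval (f k) (x i) = (\<Sum>l<n. r l * x i ^ l))"
    by (intro allI int_eval_reduce_at_points n x)
  from choice[OF this] obtain r where r: "\<forall>k. (\<forall>l. algebraic_int (r k l)) \<and> (\<forall>i<n. int_eval (f k) (x i) = (\<Sum>l<n. r k l * x i ^ l))"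
    by (elim exE)
  define V where "V = Matrix.mat n n (\<lambda>(i, j). x i ^ j)"
  define S where "S = Matrix.mat n n (\<lambda>(l, k). r k l)"
  have c: "V \<in> carrier_mat n n" "S \<in> carrier_mat n n" by (simp_all add: V_def S_def)
  have "Matrix.mat n n (\<lambda>(i, k). int_eval (f k) (x i)) = V * S"
  proof (rule eq_matI)
    fix i k assume "i < dim_row (V * S)" "k < dim_col (V * S)"
    then have ik: "i < n" "k < n" using c by auto
    have "(V * S) $$ (i, k) = (\<Sum>l<n. x i ^ l * r k l)"
      unfolding index_mult_mat_sum[OF c ik] using ik by (intro sum.cong) (auto simp: V_def S_def)
    then show "Matrix.mat n n (\<lambda>(i, k). int_eval (f k) (x i)) $$ (i, k) = (V * S) $$ (i, k)"
      using r ik by (simp add: mult.commute)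
  qed (use c in auto)
  then have "Determinant.det (Matrix.mat n n (\<lambda>(i, k). int_eval (f k) (x i))) = (\<Prod>j<n. \<Prod>k<j. x j - x k) * Determinant.det S"
    using det_mult[OF c] vandermonde_det[of n x] by (simp add: V_def)
  moreover have "algebraic_int (Determinant.det S)"
    by (rule algebraic_int_det[OF c(2)]) (use r in \<open>simp add: S_def\<close>)
  ultimately show ?thesis by blast
qed

text \<open>Cramer's rule. All entries of the numerator are integer polynomials in \<open>x i\<close>, so the numerator is divisible by the Vandermonde determinant of the \<open>x i\<close>.\<close>

lemma coordinate_times_index:
  assumes n: "n > 0" and x: "\<And>i. algebraic_int (x i)"
    and a: "\<And>i. i < n \<Longrightarrow> y i = int_eval g (x i)"
    and h: "\<And>i. i < n \<Longrightarrow> (\<Sum>k<n. h k * y i ^ k) = int_eval f (x i)" and b: "b < n"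
  shows "\<exists>z. algebraic_int z \<and> h b * (\<Prod>j<n. \<Prod>k<j. y j - y k) = (\<Prod>j<n. \<Prod>k<j. x j - x k) * z"
proof -
  define V where "V = Matrix.mat n n (\<lambda>(i, j). y i ^ j)"
  define v where "v = Matrix.vec n h"
  have c: "V \<in> carrier_mat n n" "v \<in> carrier_vec n" by (simp_all add: V_def v_def)
  have "replace_col V (V *\<^sub>v v) b = Matrix.mat n n (\<lambda>(i, k). int_eval (if k = b then f else g ^ k) (x i))"
  proof (rule eq_matI)
    fix i k assume "i < dim_row (Matrix.mat n n (\<lambda>(i, k). int_eval (if k = b then f else g ^ k) (x i)))"
      "k < dim_col (Matrix.mat n n (\<lambda>(i, k). int_eval (if k = b then f else g ^ k) (x i)))"
    then have ik: "i < n" "k < n" by auto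
    have "vec_index (V *\<^sub>v v) i = (\<Sum>k<n. V $$ (i, k) * vec_index v k)"
      using index_mult_mat_vec_sum[of V n v i] c ik by auto
    also have "\<dots> = (\<Sum>k<n. h k * y i ^ k)" using ik by (intro sum.cong) (auto simp: V_def v_def)
    finally show "replace_col V (V *\<^sub>v v) b $$ (i, k) = Matrix.mat n n (\<lambda>(i, k). int_eval (if k = b then f else g ^ k) (x i)) $$ (i, k)"
      using ik h[of i] a[of i] c by (simp add: replace_col_def V_def)
  qed (use c in \<open>auto simp: replace_col_def\<close>)
  then have eq: "h b * Determinant.det V = Determinant.det (Matrix.mat n n (\<lambda>(i, k). int_eval (if k = b then f else g ^ k) (x i)))"
    using cramer_lemma_mat[OF c b] b by (simp add: v_def)
  obtain z where z: "algebraic_int z" "Determinant.det (Matrix.mat n n (\<lambda>(i, k). int_eval (if k = b then f else g ^ k) (x i))) = (\<Prod>j<n. \<Prod>k<j. x j - x k) * z"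
    using int_poly_det_Vandermonde[where x = x, OF n x, of "\<lambda>k. if k = b then f else g ^ k"] by (elim exE conjE)
  show ?thesis using eq z vandermonde_det[of n y] by (intro exI[of _ z]) (simp add: V_def)
qed

text \<open>Sorting the monomials by their exponents modulo \<open>d\<close>.\<close>

lemma section_decomposition:
  assumes d: "d > 0"
  shows "\<exists>c. \<forall>x. int_eval f x = (\<Sum>a<d. int_eval (c a) (x ^ d) * x ^ a)"
proof (induction f)
  case 0
  show ?case by (rule exI[of _ "\<lambda>_. 0"]) simp
next
  case (pCons a0 f)
  then obtain c where c: "\<forall>x. int_eval f x = (\<Sum>a<d. int_eval (c a) (x ^ d) * x ^ a)" by (elim exE)
  obtain N where N: "d = Suc N" using d by (cases d) auto
  define c' where "c' a = (if a = 0 then pCons a0 (c N) else c (a - 1))" for a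
  have "int_eval (pCons a0 f) x = (\<Sum>a<d. int_eval (c' a) (x ^ d) * x ^ a)" for x
  proof -
    have "(\<Sum>a<d. int_eval (c' a) (x ^ d) * x ^ a) = of_int a0 + x ^ d * int_eval (c N) (x ^ d) + (\<Sum>a<N. int_eval (c a) (x ^ d) * x ^ Suc a)"
      by (subst (1) N, subst sum.lessThan_Suc_shift) (simp add: c'_def)
    also have "\<dots> = of_int a0 + x * ((\<Sum>a<N. int_eval (c a) (x ^ d) * x ^ a) + int_eval (c N) (x ^ d) * x ^ N)"
      by (simp add: distrib_left sum_distrib_left mult_ac) (simp add: N mult_ac)
    also have "\<dots> = of_int a0 + x * (\<Sum>a<d. int_eval (c a) (x ^ d) * x ^ a)" by (subst (3) N) simp
    finally show ?thesis using c by simp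
  qed
  then show ?case by (intro exI[of _ c']) simp
qed

text \<open>When all \<open>y a\<close> have the same \<open>d\<close>-th power \<open>g\<close>, the powers of \<open>p (y a)\<close> are combinations of \<open>1, y a, ..., y a ^ (d - 1)\<close> with coefficients that are integer polynomials in \<open>g\<close>. Hence the Vandermonde determinant of the values is that of the \<open>y a\<close> times the determinant of these coefficients.\<close>

lemma coset_divided_differences:
  assumes d: "d > 0"
  shows "\<exists>J. \<forall>y g. (\<forall>a<d. y a ^ d = g) \<longrightarrow>
    (\<Prod>b<d. \<Prod>a<b. int_eval p (y b) - int_eval p (y a)) = (\<Prod>b<d. \<Prod>a<b. y b - y a) * int_eval J g"
proof -
  have "\<forall>k. \<exists>c. \<forall>x. int_eval (p ^ k) x = (\<Sum>a<d. int_eval (c a) (x ^ d) * x ^ a)"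
    by (intro allI section_decomposition d)
  from choice[OF this] obtain c where c: "\<forall>k x. int_eval (p ^ k) x = (\<Sum>a<d. int_eval (c k a) (x ^ d) * x ^ a)" by (elim exE)
  define C where "C = Matrix.mat d d (\<lambda>(a, k). c k a)"
  have "(\<Prod>b<d. \<Prod>a<b. int_eval p (y b) - int_eval p (y a)) = (\<Prod>b<d. \<Prod>a<b. y b - y a) * int_eval (Determinant.det C) g"
    if y: "\<forall>a<d. y a ^ d = g" for y g
  proof -
    interpret h: comm_ring_hom "\<lambda>P. int_eval P g" by unfold_locales auto
    define V where "V = Matrix.mat d d (\<lambda>(i, j). y i ^ j)"
    define W where "W = Matrix.mat d d (\<lambda>(i, j). int_eval p (y i) ^ j)"
    define D where "D = map_mat (\<lambda>P. int_eval P g) C"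
    have cc: "V \<in> carrier_mat d d" "D \<in> carrier_mat d d" "W \<in> carrier_mat d d" by (simp_all add: V_def W_def C_def D_def)
    have VD: "W = V * D"
    proof (rule eq_matI)
      fix i k assume "i < dim_row (V * D)" "k < dim_col (V * D)"
      then have ik: "i < d" "k < d" using cc by auto
      have "(V * D) $$ (i, k) = (\<Sum>a<d. y i ^ a * int_eval (c k a) g)"
        unfolding index_mult_mat_sum[OF cc(1,2) ik] using ik by (intro sum.cong) (auto simp: V_def D_def C_def)
      also have "\<dots> = int_eval (p ^ k) (y i)" using c y ik by (simp add: mult.commute)
      finally show "W $$ (i, k) = (V * D) $$ (i, k)" using ik by (simp add: W_def)
    qed (use cc in auto)
    have "Determinant.det W = Determinant.det V * Determinant.det D" unfolding VD by (rule det_mult[OF cc(1,2)])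
    also have "Determinant.det D = int_eval (Determinant.det C) g" unfolding D_def by (rule h.hom_det)
    finally show ?thesis unfolding V_def W_def vandermonde_det .
  qed
  then show ?thesis by (intro exI[of _ "Determinant.det C"]) simp
qed

text \<open>The product is the determinant of multiplication by \<open>J\<close> on \<open>\<int>[X] / (X ^ e - m)\<close>; the Vandermonde matrix of the roots diagonalises it.\<close>

lemma norm_rational:
  assumes e: "e > 0" and inj: "inj_on g {..<e}" and g: "\<And>r. r < e \<Longrightarrow> g r ^ e = (of_int m :: complex)"
  shows "\<exists>z::int. (\<Prod>r<e. int_eval J (g r)) = of_int z"
proof -
  have "\<forall>j. \<exists>c. \<forall>x. x ^ e = of_int m \<longrightarrow> int_eval (monom 1 j * J) x = (\<Sum>k<e. of_int (c k) * x ^ k)"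
    by (intro allI int_eval_reduce e)
  from choice[OF this] obtain c where c: "\<forall>j x. x ^ e = of_int m \<longrightarrow> int_eval (monom 1 j * J) x = (\<Sum>k<e. of_int (c j k) * x ^ k)"
    by (elim exE)
  define V where "V = Matrix.mat e e (\<lambda>(i, j). g i ^ j)"
  define L where "L = Matrix.mat e e (\<lambda>(i, j). if i = j then int_eval J (g i) else 0)"
  define M where "M = Matrix.mat e e (\<lambda>(k, j). c j k)"
  define M' where "M' = map_mat complex_of_int M"
  have cc: "V \<in> carrier_mat e e" "L \<in> carrier_mat e e" "M' \<in> carrier_mat e e" "M \<in> carrier_mat e e"
    by (simp_all add: V_def L_def M'_def M_def)
  have LV: "L * V = V * M'"
  proof (rule eq_matI)
    fix i j assume "i < dim_row (V * M')" "j < dim_col (V * M')"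
    then have ij: "i < e" "j < e" using cc by auto
    have "(L * V) $$ (i, j) = (\<Sum>k<e. (if i = k then int_eval J (g i) else 0) * g k ^ j)"
      unfolding index_mult_mat_sum[OF cc(2,1) ij] using ij by (intro sum.cong) (auto simp: V_def L_def)
    also have "\<dots> = (\<Sum>k<e. if i = k then int_eval J (g i) * g i ^ j else 0)" by (intro sum.cong) auto
    also have "\<dots> = int_eval J (g i) * g i ^ j" using ij by simp
    also have "\<dots> = int_eval (monom 1 j * J) (g i)" by simp
    also have "\<dots> = (\<Sum>k<e. of_int (c j k) * g i ^ k)" using c g[OF ij(1)] by blast
    also have "\<dots> = (V * M') $$ (i, j)"
      unfolding index_mult_mat_sum[OF cc(1,3) ij] using ij by (intro sum.cong) (auto simp: V_def M'_def M_def)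
    finally show "(L * V) $$ (i, j) = (V * M') $$ (i, j)" .
  qed (use cc in auto)
  have "Determinant.det L * Determinant.det V = Determinant.det V * Determinant.det M'"
    unfolding det_mult[OF cc(2,1), symmetric] det_mult[OF cc(1,3), symmetric] LV ..
  moreover have "Determinant.det V \<noteq> 0" unfolding V_def vandermonde_det by (rule vandermonde_nonzero[OF inj])
  ultimately have "Determinant.det L = Determinant.det M'" by (metis mult.commute mult_left_cancel)
  moreover have "Determinant.det L = (\<Prod>r<e. int_eval J (g r))"
  proof -
    have z: "L $$ (i, j) = 0" if "i < j" "j < e" for i j using that by (simp add: L_def)
    have "Determinant.det L = prod_list (diag_mat L)" by (rule det_lower_triangular[OF _ cc(2)]) (rule z)
    then show ?thesis unfolding prod_list_diag_prod using cc by (simp add: L_def atLeast0LessThan)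
  qed
  moreover have "Determinant.det M' = of_int (Determinant.det M)" unfolding M'_def by (rule of_int_hom.hom_det)
  ultimately show ?thesis by (intro exI[of _ "Determinant.det M"]) simp
qed

section \<open>Differences of conjugates of a generator\<close>

lemma rat_eval_smult: "rat_eval (smult c P) x = of_rat c * rat_eval P x"
  using rat_eval_simps(4)[of "[:c:]" P x] by simp

text \<open>When \<open>e\<close> divides \<open>n\<close>, these are the pairs of conjugates of \<open>\<alpha>\<close> with the same power of exponent \<open>n div e\<close>; all pairs for \<open>e = 1\<close>.\<close>

definition pairs :: "nat \<Rightarrow> nat \<Rightarrow> (nat \<times> nat) set" where
  "pairs n e = {(i, j). i < j \<and> j < n \<and> i mod e = j mod e}"

lemma finite_pairs [simp]: "finite (pairs n e)"
  by (rule finite_subset[of _ "{..<n} \<times> {..<n}"]) (auto simp: pairs_def)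

text \<open>The pairs are grouped by the common residue \<open>r\<close>, that is by conjugates of \<open>\<alpha> ^ (n div e)\<close>.\<close>

lemma prod_pairs:
  fixes f :: "nat \<Rightarrow> nat \<Rightarrow> 'a :: comm_monoid_mult"
  assumes n: "n = e * d" and e: "e > 0"
  shows "(\<Prod>(i, j)\<in>pairs n e. f i j) = (\<Prod>r<e. \<Prod>b<d. \<Prod>a<b. f (r + e * a) (r + e * b))"
proof -
  define S where "S = (SIGMA r:{..<e}. SIGMA b:{..<d}. {..<b})"
  have "(\<Prod>r<e. \<Prod>b<d. \<Prod>a<b. f (r + e * a) (r + e * b)) = (\<Prod>(r, b, a)\<in>S. f (r + e * a) (r + e * b))"
    unfolding S_def by (simp add: prod.Sigma)
  also have "\<dots> = (\<Prod>(i, j)\<in>pairs n e. f i j)"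
  proof (rule prod.reindex_bij_witness[where i = "\<lambda>(i, j). (i mod e, j div e, i div e)" and j = "\<lambda>(r, b, a). (r + e * a, r + e * b)"])
    fix x assume "x \<in> S"
    then obtain r b a where x: "x = (r, b, a)" "r < e" "b < d" "a < b" by (auto simp: S_def)
    show "(case (case x of (r, b, a) \<Rightarrow> (r + e * a, r + e * b)) of (i, j) \<Rightarrow> (i mod e, j div e, i div e)) = x"
      using x e by simp
    have "e * Suc b \<le> e * d" using x(3) by (intro mult_le_mono2) simp
    then have "r + e * b < n" using x(2) n by simp
    moreover have "r + e * a < r + e * b" using x(4) e by simp
    ultimately show "(case x of (r, b, a) \<Rightarrow> (r + e * a, r + e * b)) \<in> pairs n e" using x by (simp add: pairs_def)
    show "(case (case x of (r, b, a) \<Rightarrow> (r + e * a, r + e * b)) of (i, j) \<Rightarrow> f i j) = (case x of (r, b, a) \<Rightarrow> f (r + e * a) (r + e * b))"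
      using x by simp
  next
    fix y assume "y \<in> pairs n e"
    then obtain i j where y: "y = (i, j)" "i < j" "j < n" "i mod e = j mod e" by (auto simp: pairs_def)
    have i: "i mod e + e * (i div e) = i" by simp
    have j: "i mod e + e * (j div e) = j" unfolding y(4) by simp
    show "(case (case y of (i, j) \<Rightarrow> (i mod e, j div e, i div e)) of (r, b, a) \<Rightarrow> (r + e * a, r + e * b)) = y"
      using y(1) i j by simp
    have "i div e < j div e"
    proof (rule ccontr)
      assume "\<not> i div e < j div e"
      then have "e * (j div e) \<le> e * (i div e)" by (intro mult_le_mono2) simp
      then show False using i j y(2) by linarith
    qed
    moreover have "j div e < d" using y(3) n by (simp add: less_mult_imp_div_less mult.commute)
    ultimately show "(case y of (i, j) \<Rightarrow> (i mod e, j div e, i div e)) \<in> S" using y(1) e by (simp add: S_def)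
  qed
  finally show ?thesis by simp
qed

lemma card_pairs:
  assumes n: "n = e * d" and e: "e > 0"
  shows "2 * card (pairs n e) = n * (d - 1)"
proof -
  have g: "2 * (\<Sum>b<k. b) = k * (k - 1)" for k :: nat
  proof (induction k)
    case (Suc k)
    then show ?case by (cases k) (auto simp: algebra_simps)
  qed simp
  have "(2::nat) ^ card (pairs n e) = (\<Prod>(i, j)\<in>pairs n e. 2)" by (simp add: case_prod_beta)
  also have "\<dots> = (\<Prod>r<e. \<Prod>b<d. \<Prod>a<b. 2)" by (rule prod_pairs[OF n e])
  also have "\<dots> = 2 ^ (e * (\<Sum>b<d. b))" by (simp add: mult.commute flip: power_sum power_mult)
  finally have "card (pairs n e) = e * (\<Sum>b<d. b)" by simp
  then have "2 * card (pairs n e) = e * (2 * (\<Sum>b<d. b))" by simp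
  then show ?thesis unfolding g n by simp
qed

text \<open>The product is the derivative of \<open>X ^ d - c\<close> at \<open>y a\<close>.\<close>

lemma prod_differences_to_others:
  fixes y :: "nat \<Rightarrow> complex"
  assumes y: "\<And>x. (\<Prod>a<d. x - y a) = x ^ d - c" and a: "a < d"
  shows "(\<Prod>b\<in>{..<d} - {a}. y a - y b) = of_nat d * y a ^ (d - 1)"
proof -
  define p where "p = (\<Prod>b\<in>{..<d} - {a}. [:- y b, 1:])"
  have p: "poly p x = (\<Prod>b\<in>{..<d} - {a}. x - y b)" for x by (simp add: p_def poly_prod)
  have "poly ([:- y a, 1:] * p) = poly (monom 1 d - [:c:])"
  proof
    fix x
    have "poly ([:- y a, 1:] * p) x = (x - y a) * (\<Prod>b\<in>{..<d} - {a}. x - y b)" by (simp add: p left_diff_distrib)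
    also have "\<dots> = (\<Prod>a<d. x - y a)" using a by (simp add: prod.remove[of "{..<d}" a])
    finally show "poly ([:- y a, 1:] * p) x = poly (monom 1 d - [:c:]) x" by (simp add: y poly_monom)
  qed
  then have "[:- y a, 1:] * p = monom 1 d - [:c:]" by (simp only: poly_eq_poly_eq_iff)
  then have "pderiv ([:- y a, 1:] * p) = pderiv (monom 1 d - [:c:])" by simp
  then have "poly (pderiv ([:- y a, 1:] * p)) (y a) = poly (pderiv (monom 1 d - [:c:])) (y a)" by simp
  then show ?thesis unfolding p[symmetric] by (simp add: pderiv_mult pderiv_diff pderiv_monom pderiv_pCons pderiv_smult poly_monom)
qed

lemma prod_ordered_pairs:
  fixes f :: "nat \<Rightarrow> nat \<Rightarrow> 'a :: comm_monoid_mult"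
  shows "(\<Prod>b<d. \<Prod>a<b. f a b * f b a) = (\<Prod>a<d. \<Prod>b\<in>{..<d} - {a}. f a b)"
proof (induction d)
  case (Suc d)
  have "(\<Prod>a<Suc d. \<Prod>b\<in>{..<Suc d} - {a}. f a b) = (\<Prod>a<d. \<Prod>b\<in>{..<Suc d} - {a}. f a b) * (\<Prod>b<d. f d b)"
  proof -
    have "{..<Suc d} - {d} = {..<d}" by auto
    then show ?thesis by (simp add: mult.commute)
  qed
  also have "(\<Prod>a<d. \<Prod>b\<in>{..<Suc d} - {a}. f a b) = (\<Prod>a<d. f a d * (\<Prod>b\<in>{..<d} - {a}. f a b))"
  proof (intro prod.cong refl)
    fix a assume "a \<in> {..<d}"
    then have "{..<Suc d} - {a} = insert d ({..<d} - {a})" by auto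
    then show "(\<Prod>b\<in>{..<Suc d} - {a}. f a b) = f a d * (\<Prod>b\<in>{..<d} - {a}. f a b)" by simp
  qed
  finally show ?case using Suc by (simp add: prod.distrib mult_ac)
qed simp

lemma prod_residues:
  fixes f :: "nat \<Rightarrow> 'a :: comm_monoid_mult"
  assumes n: "n = e * d" and e: "e > 0"
  shows "(\<Prod>r<e. \<Prod>a<d. f (r + e * a)) = (\<Prod>i<n. f i)"
proof -
  have "(\<Prod>r<e. \<Prod>a<d. f (r + e * a)) = (\<Prod>(r, a)\<in>{..<e} \<times> {..<d}. f (r + e * a))" by (simp add: prod.cartesian_product)
  also have "\<dots> = (\<Prod>i<n. f i)"
  proof (rule prod.reindex_bij_witness[where i = "\<lambda>i. (i mod e, i div e)" and j = "\<lambda>(r, a). r + e * a"])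
    fix x assume "x \<in> {..<e} \<times> {..<d}"
    then obtain r a where x: "x = (r, a)" "r < e" "a < d" by auto
    have "e * Suc a \<le> e * d" using x(3) by (intro mult_le_mono2) simp
    then show "(case x of (r, a) \<Rightarrow> r + e * a) \<in> {..<n}" using x n by simp
  qed (use e n in \<open>auto simp: less_mult_imp_div_less mult.commute\<close>)
  finally show ?thesis .
qed

lemma int_eval_difference:
  assumes x: "algebraic_int x" and y: "algebraic_int y"
  shows "\<exists>z. algebraic_int z \<and> int_eval p x - int_eval p y = (x - y) * z"
proof (induction p)
  case 0
  show ?case by (rule exI[of _ 0]) simp
next
  case (pCons c p)
  then obtain z where z: "algebraic_int z" "int_eval p x - int_eval p y = (x - y) * z" by (elim exE conjE)
  have "int_eval (pCons c p) x - int_eval (pCons c p) y = (x - y) * int_eval p x + y * (int_eval p x - int_eval p y)"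
    by (simp add: algebra_simps)
  also have "\<dots> = (x - y) * (int_eval p x + y * z)" unfolding z(2) by (simp add: algebra_simps)
  finally show ?case by (intro exI[of _ "int_eval p x + y * z"] conjI algebraic_int_add algebraic_int_mult algebraic_int_int_eval x y z(1))
qed

lemma prod_perturbed:
  assumes a: "algebraic_int (\<alpha>::complex)" and fin: "finite S"
    and f: "\<And>s. s \<in> S \<Longrightarrow> \<exists>z. algebraic_int z \<and> f s = of_int c + \<alpha> * z"
  shows "\<exists>z. algebraic_int z \<and> (\<Prod>s\<in>S. f s) = of_int c ^ card S + \<alpha> * z"
  using fin f
proof (induction S rule: finite_induct)
  case empty
  show ?case by (rule exI[of _ 0]) simp
next
  case (insert s S)
  have "\<exists>z. algebraic_int z \<and> (\<Prod>s\<in>S. f s) = of_int c ^ card S + \<alpha> * z"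
    by (rule insert.IH) (rule insert.prems, simp)
  then obtain z where z: "algebraic_int z" "(\<Prod>s\<in>S. f s) = of_int c ^ card S + \<alpha> * z" by (elim exE conjE)
  have "\<exists>w. algebraic_int w \<and> f s = of_int c + \<alpha> * w" by (rule insert.prems) simp
  then obtain w where w: "algebraic_int w" "f s = of_int c + \<alpha> * w" by (elim exE conjE)
  have "(\<Prod>s\<in>insert s S. f s) = of_int c ^ card (insert s S) + \<alpha> * (of_int c * z + w * (of_int c ^ card S + \<alpha> * z))"
    using insert.hyps z(2) w(2) by (simp add: algebra_simps)
  then show ?case
    by (intro exI[of _ "of_int c * z + w * (of_int c ^ card S + \<alpha> * z)"] conjI algebraic_int_add algebraic_int_mult algebraic_int_power a z(1) w(1)) auto
qed

context pure_field
begin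

lemma prim_root_int: "algebraic_int (prim_root n ^ i)"
proof -
  have "prim_root n ^ n = 1" using prim_root_power_eq_1_iff[OF n0, of n] by simp
  then have "algebraic_int (prim_root n)" using algebraic_int_of_power[of "prim_root n" n] n0 by simp
  then show ?thesis by (rule algebraic_int_power)
qed

text \<open>Every conjugate of \<open>\<alpha>\<close> is \<open>\<alpha>\<close> times an algebraic integer, so only the linear coefficient of a divided difference survives modulo \<open>\<alpha>\<close>. This is total ramification in a form that needs no ideals.\<close>

lemma divided_difference_mod_radical:
  "\<exists>z. algebraic_int z \<and> int_eval p (cj i) - int_eval p (cj j) = (cj i - cj j) * (of_int (coeff p 1) + \<alpha> * z)"
proof -
  obtain c0 p1 where p1: "p = pCons c0 p1" by (cases p)
  obtain c1 s where s: "p1 = pCons c1 s" by (cases p1)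
  have p: "p = pCons c0 (pCons c1 s)" using p1 s by simp
  obtain w where w: "algebraic_int w" "int_eval s (cj i) - int_eval s (cj j) = (cj i - cj j) * w"
    using int_eval_difference[OF cj_int cj_int, of s i j] by (elim exE conjE)
  define z where "z = (prim_root n ^ i + prim_root n ^ j) * int_eval s (cj i) + prim_root n ^ j * cj j * w"
  have "algebraic_int z" unfolding z_def
    by (intro algebraic_int_add algebraic_int_mult prim_root_int algebraic_int_int_eval cj_int w(1))
  moreover have "int_eval p (cj i) - int_eval p (cj j) = (cj i - cj j) * (of_int (coeff p 1) + \<alpha> * z)"
  proof -
    have az: "\<alpha> * z = (cj i + cj j) * int_eval s (cj i) + cj j * cj j * w"
      by (simp add: z_def cj_def algebra_simps)
    have "int_eval p (cj i) - int_eval p (cj j) = (cj i - cj j) * (of_int c1 + (cj i + cj j) * int_eval s (cj i)) + cj j * cj j * (int_eval s (cj i) - int_eval s (cj j))"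
      by (simp add: p algebra_simps)
    also have "\<dots> = (cj i - cj j) * (of_int c1 + \<alpha> * z)" unfolding w(2) az by (simp add: algebra_simps)
    finally show ?thesis by (simp add: p)
  qed
  ultimately show ?thesis by blast
qed

lemma coset_polynomial:
  assumes nn: "n = e * d" and e: "e > 0" and d: "d > 0"
  shows "(\<Prod>a<d. x - cj (r + e * a)) = x ^ d - cj r ^ d"
proof -
  define w where "w = prim_root n ^ e"
  have cja: "cj (r + e * a) = cj r * w ^ a" for a by (simp add: cj_def w_def power_add mult_ac flip: power_mult)
  have w1: "w ^ i = 1 \<longleftrightarrow> d dvd i" for i
    using prim_root_power_eq_1_iff[OF n0, of "e * i"] e by (simp add: w_def nn flip: power_mult)
  have "(\<Prod>a<d. x - cj (r + e * a)) = (\<Prod>a<d. cj r * (x / cj r - w ^ a))"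
    by (intro prod.cong refl) (simp add: cja cj_nonzero right_diff_distrib)
  also have "\<dots> = cj r ^ d * (\<Prod>a<d. x / cj r - w ^ a)" by (simp add: prod.distrib)
  also have "(\<Prod>a<d. x / cj r - w ^ a) = (x / cj r) ^ d - 1"
    by (rule prod_minus_powers_of_root[OF d]) (use w1 in \<open>auto dest: dvd_imp_le\<close>)
  finally show ?thesis by (simp add: right_diff_distrib power_divide cj_nonzero)
qed

lemma prod_conjugates: "(\<Prod>i<n. cj i) = of_int ((- 1) ^ (n + 1) * m)"
proof -
  have "(\<Prod>i<n. - cj i) = - of_int m" using coset_polynomial[of 1 n 0 0] n0 root by (simp add: power_0_left)
  moreover have "(\<Prod>i<n. - cj i) = (- 1) ^ n * (\<Prod>i<n. cj i)"
    using prod.distrib[of "\<lambda>_. - 1" cj "{..<n}"] by simp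
  ultimately have "(- 1) ^ n * ((- 1) ^ n * (\<Prod>i<n. cj i)) = (- 1) ^ n * - of_int m" by simp
  moreover have "(- 1 :: complex) ^ n * (- 1) ^ n = 1" by (simp flip: power_mult_distrib)
  ultimately show ?thesis by (simp add: mult.assoc[symmetric])
qed

text \<open>Both orders of each pair are used, which fixes the sign of the discriminant.\<close>

lemma discriminant_of_pairs:
  assumes nn: "n = e * d" and e: "e > 0" and d: "d > 0"
  shows "(\<Prod>(i, j)\<in>pairs n e. (cj j - cj i) * (cj i - cj j)) = of_int (int d ^ n * ((- 1) ^ (n + 1) * m) ^ (d - 1))"
proof -
  have "(\<Prod>(i, j)\<in>pairs n e. (cj j - cj i) * (cj i - cj j)) = (\<Prod>r<e. \<Prod>b<d. \<Prod>a<b. (cj (r + e * b) - cj (r + e * a)) * (cj (r + e * a) - cj (r + e * b)))"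
    by (rule prod_pairs[OF nn e])
  also have "\<dots> = (\<Prod>r<e. of_nat d ^ d * (\<Prod>a<d. cj (r + e * a)) ^ (d - 1))"
  proof (intro prod.cong refl)
    fix r
    have "(\<Prod>b<d. \<Prod>a<b. (cj (r + e * b) - cj (r + e * a)) * (cj (r + e * a) - cj (r + e * b)))
        = (\<Prod>b<d. \<Prod>a<b. (cj (r + e * a) - cj (r + e * b)) * (cj (r + e * b) - cj (r + e * a)))"
      by (simp only: mult.commute)
    also have "\<dots> = (\<Prod>a<d. \<Prod>b\<in>{..<d} - {a}. cj (r + e * a) - cj (r + e * b))"
      by (rule prod_ordered_pairs[of "\<lambda>a b. cj (r + e * a) - cj (r + e * b)"])
    also have "\<dots> = (\<Prod>a<d. of_nat d * cj (r + e * a) ^ (d - 1))"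
      by (intro prod.cong refl prod_differences_to_others[where y = "\<lambda>a. cj (r + e * a)" and c = "cj r ^ d"] coset_polynomial[OF nn e d]) simp
    also have "\<dots> = of_nat d ^ d * (\<Prod>a<d. cj (r + e * a)) ^ (d - 1)" by (simp add: prod.distrib prod_power_distrib)
    finally show "(\<Prod>b<d. \<Prod>a<b. (cj (r + e * b) - cj (r + e * a)) * (cj (r + e * a) - cj (r + e * b))) = of_nat d ^ d * (\<Prod>a<d. cj (r + e * a)) ^ (d - 1)" .
  qed
  also have "\<dots> = of_nat d ^ (d * e) * (\<Prod>r<e. \<Prod>a<d. cj (r + e * a)) ^ (d - 1)"
    by (simp add: prod.distrib power_mult flip: prod_power_distrib)
  also have "(\<Prod>r<e. \<Prod>a<d. cj (r + e * a)) = (\<Prod>i<n. cj i)" by (rule prod_residues[OF nn e])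
  finally show ?thesis unfolding prod_conjugates by (simp add: nn mult.commute)
qed

end

text \<open>The data of a generator \<open>\<theta> = rat_eval T \<alpha>\<close> of an order that contains \<open>\<alpha>\<close>, with a denominator \<open>n1\<close> prime to \<open>m\<close>.\<close>

locale monogenic_field = pure_field +
  fixes T :: "rat poly" and g A :: "int poly" and n1 :: nat
  assumes th_int0: "algebraic_int (rat_eval T \<alpha>)" and g: "int_eval g (rat_eval T \<alpha>) = \<alpha>"
    and n1: "n1 > 0" and A: "of_nat n1 * rat_eval T \<alpha> = int_eval A \<alpha>" and cop: "coprime (int n1) m"
begin

text \<open>The conjugates of the generator, numbered like those of \<open>\<alpha>\<close>.\<close>

definition th :: "nat \<Rightarrow> complex" where "th i = rat_eval T (cj i)"

lemma th_int: "algebraic_int (th i)" unfolding th_def by (rule conj_algebraic_int[OF th_int0])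

lemma g_th: "int_eval g (th i) = cj i"
  using conj_transfer_int_eval[of g T "[:0, 1:]" i] g by (simp add: th_def)

lemma A_th: "of_nat n1 * th i = int_eval A (cj i)"
proof -
  have "rat_eval (smult (of_nat n1) T - map_poly of_int A) \<alpha> = 0" using A by (simp add: int_eval_as_rat_eval rat_eval_smult)
  then have "rat_eval (smult (of_nat n1) T - map_poly of_int A) (cj i) = 0" by (rule conj_transfer)
  then show ?thesis by (simp add: th_def int_eval_as_rat_eval rat_eval_smult)
qed

lemma th_inj: "i < n \<Longrightarrow> j < n \<Longrightarrow> th i = th j \<Longrightarrow> i = j"
  using g_th cj_inj by metis

definition u :: "nat \<Rightarrow> nat \<Rightarrow> complex" where "u i j = (cj j - cj i) / (th j - th i)"

lemma u_int: "i < j \<Longrightarrow> j < n \<Longrightarrow> algebraic_int (u i j)"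
proof -
  assume ij: "i < j" "j < n"
  obtain z where z: "algebraic_int z" "int_eval g (th j) - int_eval g (th i) = (th j - th i) * z"
    using int_eval_difference[OF th_int th_int, of g j i] by (elim exE conjE)
  have "th j - th i \<noteq> 0" using th_inj[of j i] ij by auto
  then have "u i j = z" using z(2) by (simp add: u_def g_th)
  then show ?thesis using z(1) by simp
qed

text \<open>For \<open>e = 1\<close> this is, up to sign, the index of \<open>\<int>[\<alpha>]\<close> in \<open>\<int>[\<theta>]\<close>.\<close>

definition index_along :: "nat \<Rightarrow> complex" where "index_along e = (\<Prod>(i, j)\<in>pairs n e. u i j)"

lemma prod_u_int: "S \<subseteq> pairs n 1 \<Longrightarrow> algebraic_int (\<Prod>(i, j)\<in>S. u i j)"
  by (intro algebraic_int_prod) (auto simp: pairs_def intro: u_int)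

lemma pairs_subset: "pairs n e \<subseteq> pairs n 1" by (auto simp: pairs_def)

text \<open>The product of the divided differences of \<open>A\<close>, the conjugates of \<open>n1 * \<theta>\<close> being the values of \<open>A\<close>.\<close>

definition slope_product :: "nat \<Rightarrow> complex" where
  "slope_product e = (\<Prod>(i, j)\<in>pairs n e. (int_eval A (cj j) - int_eval A (cj i)) / (cj j - cj i))"

lemma slope_product_index_along: "slope_product e * index_along e = of_nat n1 ^ card (pairs n e)"
proof -
  have "slope_product e * index_along e = (\<Prod>(i, j)\<in>pairs n e. of_nat n1)"
    unfolding slope_product_def index_along_def prod.distrib[symmetric]
  proof (intro prod.cong refl)
    fix x assume "x \<in> pairs n e"
    then obtain i j where x: "x = (i, j)" "i < j" "j < n" by (auto simp: pairs_def)
    have "th j - th i \<noteq> 0" "cj j - cj i \<noteq> 0" using th_inj[of j i] cj_inj[of j i] x by auto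
    then show "(case x of (i, j) \<Rightarrow> (int_eval A (cj j) - int_eval A (cj i)) / (cj j - cj i)) * (case x of (i, j) \<Rightarrow> u i j) = (case x of (i, j) \<Rightarrow> of_nat n1)"
      using x by (simp add: u_def flip: A_th right_diff_distrib)
  qed
  then show ?thesis by (simp add: case_prod_beta)
qed

text \<open>The product over the pairs above one conjugate \<open>\<gamma>\<close> of \<open>\<alpha> ^ d\<close> is an integer polynomial in \<open>\<gamma>\<close>, the same for all \<open>\<gamma>\<close>, and the product over all \<open>\<gamma>\<close> is a norm.\<close>

lemma slope_product_rational:
  assumes nn: "n = e * d" and e: "e > 0" and d: "d > 0"
  shows "\<exists>h::int. slope_product e = of_int h"
proof -
  obtain J where J: "\<forall>y c. (\<forall>a<d. y a ^ d = c) \<longrightarrow>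
    (\<Prod>b<d. \<Prod>a<b. int_eval A (y b) - int_eval A (y a)) = (\<Prod>b<d. \<Prod>a<b. y b - y a) * int_eval J c"
    using coset_divided_differences[OF d, of A] by (elim exE)
  have coset: "(\<Prod>b<d. \<Prod>a<b. (int_eval A (cj (r + e * b)) - int_eval A (cj (r + e * a))) / (cj (r + e * b) - cj (r + e * a))) = int_eval J (cj r ^ d)"
    if r: "r < e" for r
  proof -
    define y where "y a = cj (r + e * a)" for a
    have small: "r + e * a < n" if "a < d" for a
    proof -
      have "e * Suc a \<le> e * d" using that by (intro mult_le_mono2) simp
      then show ?thesis using r nn by simp
    qed
    have yd: "\<forall>a<d. y a ^ d = cj r ^ d"
    proof (intro allI impI)
      fix a assume "a < d"
      then have "(\<Prod>b<d. y a - cj (r + e * b)) = 0" by (intro prod_zero) (auto simp: y_def)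
      then show "y a ^ d = cj r ^ d" unfolding coset_polynomial[OF nn e d] by simp
    qed
    have "inj_on y {..<d}"
    proof (rule inj_onI)
      fix a b assume "a \<in> {..<d}" "b \<in> {..<d}" "y a = y b"
      then show "a = b" using cj_inj[of "r + e * a" "r + e * b"] small e by (simp add: y_def)
    qed
    then have nz: "(\<Prod>b<d. \<Prod>a<b. y b - y a) \<noteq> 0" by (rule vandermonde_nonzero)
    have "(\<Prod>b<d. \<Prod>a<b. int_eval A (y b) - int_eval A (y a)) = (\<Prod>b<d. \<Prod>a<b. y b - y a) * int_eval J (cj r ^ d)"
      using J yd by blast
    then have "(\<Prod>b<d. \<Prod>a<b. int_eval A (y b) - int_eval A (y a)) / (\<Prod>b<d. \<Prod>a<b. y b - y a) = int_eval J (cj r ^ d)"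
      using nonzero_mult_div_cancel_left[OF nz] by (simp only:)
    moreover have "(\<Prod>b<d. \<Prod>a<b. (int_eval A (y b) - int_eval A (y a)) / (y b - y a)) = (\<Prod>b<d. \<Prod>a<b. int_eval A (y b) - int_eval A (y a)) / (\<Prod>b<d. \<Prod>a<b. y b - y a)"
      by (simp only: prod_dividef)
    ultimately show ?thesis by (simp only: y_def)
  qed
  have "slope_product e = (\<Prod>r<e. int_eval J (cj r ^ d))"
    unfolding slope_product_def prod_pairs[OF nn e] by (intro prod.cong refl coset) simp
  moreover have "\<exists>z::int. (\<Prod>r<e. int_eval J (cj r ^ d)) = of_int z"
  proof (rule norm_rational[OF e, where m = m])
    show "inj_on (\<lambda>r. cj r ^ d) {..<e}"
    proof (rule inj_onI)
      fix r s assume rs: "r \<in> {..<e}" "s \<in> {..<e}" "cj r ^ d = cj s ^ d"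
      then have "prim_root n ^ (r * d) = prim_root n ^ (s * d)" using \<alpha>0 by (simp add: cj_def power_mult_distrib power_mult)
      moreover have "r * d < n" "s * d < n" using rs d nn by simp_all
      ultimately have "r * d = s * d" by (intro prim_root_inj)
      then show "r = s" using d by simp
    qed
    show "(cj r ^ d) ^ e = of_int m" for r using cj_root[of r] by (simp add: nn mult.commute flip: power_mult)
  qed
  ultimately show ?thesis by simp
qed

text \<open>Being the quotient of a power of \<open>n1\<close> by \<open>slope_product e\<close>, the algebraic integer \<open>index_along e\<close> is rational. The congruence holds modulo \<open>\<alpha>\<close>; between rational integers it then holds modulo every prime dividing \<open>m\<close>.\<close>

lemma index_along_integer:
  assumes nn: "n = e * d" and e: "e > 0" and d: "d > 0"
  shows "\<exists>p h::int. index_along e = of_int p \<and> h * p = int n1 ^ card (pairs n e) \<and> m dvd h - coeff A 1 ^ card (pairs n e)"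
proof -
  obtain h :: int where h: "slope_product e = of_int h" using slope_product_rational[OF assms] by (elim exE)
  have hP: "of_int h * index_along e = of_nat n1 ^ card (pairs n e)" using slope_product_index_along[of e] h by simp
  then have h0: "h \<noteq> 0" using n1 by auto
  then have "index_along e = of_int (int n1 ^ card (pairs n e)) / of_int h" using hP by (simp add: field_simps)
  then have "index_along e \<in> \<rat>" by simp
  moreover have "algebraic_int (index_along e)" unfolding index_along_def by (rule prod_u_int[OF pairs_subset])
  ultimately obtain p where p: "index_along e = of_int p" using algebraic_int_rational_cases by blast
  have "of_int (h * p) = (of_int (int n1 ^ card (pairs n e)) :: complex)" using hP p by simp
  then have hp: "h * p = int n1 ^ card (pairs n e)" by (simp only: of_int_eq_iff)
  have "\<exists>z. algebraic_int z \<and> slope_product e = of_int (coeff A 1) ^ card (pairs n e) + \<alpha> * z"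
    unfolding slope_product_def
  proof (rule prod_perturbed[OF \<alpha>_int finite_pairs])
    fix x assume "x \<in> pairs n e"
    then obtain i j where x: "x = (i, j)" "i < j" "j < n" by (auto simp: pairs_def)
    obtain z where z: "algebraic_int z" "int_eval A (cj j) - int_eval A (cj i) = (cj j - cj i) * (of_int (coeff A 1) + \<alpha> * z)"
      using divided_difference_mod_radical[of A j i] by (elim exE conjE)
    have "cj j - cj i \<noteq> 0" using cj_inj[of j i] x by auto
    then show "\<exists>z. algebraic_int z \<and> (case x of (i, j) \<Rightarrow> (int_eval A (cj j) - int_eval A (cj i)) / (cj j - cj i)) = of_int (coeff A 1) + \<alpha> * z"
      using x z by (intro exI[of _ z]) simp
  qed
  then obtain z where z: "algebraic_int z" "slope_product e = of_int (coeff A 1) ^ card (pairs n e) + \<alpha> * z" by (elim exE conjE)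
  define c where "c = h - coeff A 1 ^ card (pairs n e)"
  have "of_int c = \<alpha> * z" using z(2) h by (simp add: c_def)
  then have "of_int m * z ^ n = of_int (c ^ n)" by (simp add: power_mult_distrib root)
  then have dvd: "m dvd c ^ n" by (rule int_dvd_of_algebraic_int_quotient[OF algebraic_int_power[OF z(1)] _ m0])
  have "m dvd c"
  proof (rule squarefree_dvdI[OF sq])
    fix p assume "prime p" "p dvd m"
    then show "p dvd c" using dvd prime_dvd_power dvd_trans by blast
  qed
  then show ?thesis using p hp c_def by blast
qed

text \<open>Since \<open>n1\<close> is prime to \<open>m\<close>, so is the linear coefficient of \<open>A\<close>, and \<open>c\<close> is \<open>n1\<close> divided by it modulo \<open>m\<close>.\<close>

lemma index_congruence:
  "\<exists>c. \<forall>e d p. n = e * d \<longrightarrow> e > 0 \<longrightarrow> d > 0 \<longrightarrow> index_along e = of_int p \<longrightarrow>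
    [p = c ^ card (pairs n e)] (mod m) \<and> p dvd int n1 ^ card (pairs n e)"
proof -
  have nn1: "n = 1 * n" by simp
  obtain p1 h1 where 1: "index_along 1 = of_int p1" "h1 * p1 = int n1 ^ card (pairs n 1)" "m dvd h1 - coeff A 1 ^ card (pairs n 1)"
    using index_along_integer[OF nn1 _ n0] by auto
  have "2 * card (pairs n 1) = n * (n - 1)" by (rule card_pairs[OF nn1]) simp
  then have cpos: "card (pairs n 1) > 0" using n2 by (auto intro: Nat.gr0I)
  have "coprime (coeff A 1) m"
  proof (rule ccontr)
    assume "\<not> coprime (coeff A 1) m"
    then obtain b where b: "b dvd coeff A 1" "b dvd m" "\<not> is_unit b" by (elim not_coprimeE)
    then have "b \<noteq> 0" using m0 by auto
    then obtain p where "p dvd b" "prime p" using prime_divisor_exists[of b] b(3) by blast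
    then have p: "prime p" "p dvd coeff A 1" "p dvd m" using b by (auto intro: dvd_trans)
    have "p dvd h1 - coeff A 1 ^ card (pairs n 1)" using p(3) 1(3) by (rule dvd_trans)
    moreover have "p dvd coeff A 1 ^ card (pairs n 1)" using p(2) cpos by (meson dvd_power dvd_trans)
    ultimately have "p dvd h1" by (metis dvd_diff_left_iff diff_add_cancel dvd_add)
    then have "p dvd int n1 ^ card (pairs n 1)" using 1(2) by (metis dvd_mult2)
    then have "p dvd int n1" using p(1) by (rule prime_dvd_power[rotated])
    then show False using cop p by (meson coprime_common_divisor not_prime_unit)
  qed
  then obtain x where x: "[coeff A 1 * x = 1] (mod m)" using cong_solve_coprime_int by blast
  have "[p = (x * int n1) ^ card (pairs n e)] (mod m) \<and> p dvd int n1 ^ card (pairs n e)"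
    if e: "n = e * d" "e > 0" "d > 0" and p: "index_along e = of_int p" for e d p
  proof -
    define k where "k = card (pairs n e)"
    obtain p' h where ph: "index_along e = of_int p'" "h * p' = int n1 ^ k" "m dvd h - coeff A 1 ^ k"
      using index_along_integer[OF e] unfolding k_def by blast
    have pp: "p' = p" using ph(1) p by simp
    have "[h = coeff A 1 ^ k] (mod m)" using ph(3) by (simp add: cong_iff_dvd_diff)
    then have "[(x ^ k * p) * h = (x ^ k * p) * coeff A 1 ^ k] (mod m)" by (rule cong_scalar_left)
    moreover have "(x ^ k * p) * h = (x * int n1) ^ k" using ph(2) unfolding pp by (simp add: power_mult_distrib mult_ac)
    moreover have "(x ^ k * p) * coeff A 1 ^ k = p * (coeff A 1 * x) ^ k" by (simp add: power_mult_distrib mult_ac)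
    moreover have "[p * (coeff A 1 * x) ^ k = p * 1 ^ k] (mod m)" by (intro cong_scalar_left cong_pow x)
    ultimately have "[(x * int n1) ^ k = p] (mod m)" by (metis cong_trans mult_1_right power_one)
    moreover have "p dvd int n1 ^ k" using ph(2) pp by (metis dvd_triv_right)
    ultimately show ?thesis by (simp add: k_def cong_sym)
  qed
  then show ?thesis by (intro exI[of _ "x * int n1"]) blast
qed

text \<open>The square of the complementary factor divides the quotient of two discriminants, which up to sign is \<open>e ^ n\<close> times a power of \<open>m\<close>; the factor is prime to \<open>m\<close> because it divides a power of \<open>n1\<close>.\<close>

lemma index_quotient:
  assumes nn: "n = e * d" and e: "e > 0" and d: "d > 0" and p1: "index_along 1 = of_int p1"
  shows "\<exists>p p'. index_along e = of_int p \<and> p1 = p * p' \<and> p'\<^sup>2 dvd int e ^ n"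
proof -
  define D where "D = pairs n 1 - pairs n e"
  define Q where "Q = (\<Prod>(i, j)\<in>D. u i j)"
  obtain p h where p: "index_along e = of_int p" "h * p = int n1 ^ card (pairs n e)"
    using index_along_integer[OF nn e d] by (elim exE conjE)
  have p0: "p \<noteq> 0" using p(2) n1 by auto
  have split: "(\<Prod>x\<in>pairs n 1. f x) = (\<Prod>x\<in>pairs n e. f x) * (\<Prod>x\<in>D. f x)" for f :: "nat \<times> nat \<Rightarrow> complex"
    unfolding D_def using prod.subset_diff[OF pairs_subset[of e] finite_pairs, of f] by (simp add: mult.commute)
  have PQ: "of_int p1 = of_int p * Q" using split[of "\<lambda>(i, j). u i j"] p1 p(1) by (simp add: index_along_def Q_def)
  then have "Q = of_int p1 / of_int p" using p0 by (simp add: field_simps)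
  then have "Q \<in> \<rat>" by simp
  moreover have "algebraic_int Q" unfolding Q_def by (rule prod_u_int) (auto simp: D_def)
  ultimately obtain p' where p': "Q = of_int p'" using algebraic_int_rational_cases by blast
  have "(of_int p1 :: complex) = of_int (p * p')" using PQ p' by simp
  then have pp: "p1 = p * p'" by (simp only: of_int_eq_iff)
  define M where "M = (- 1) ^ (n + 1) * m"
  have M0: "M \<noteq> 0" using m0 by (simp add: M_def)
  define W where "W = (\<Prod>(i, j)\<in>D. (th j - th i) * (th i - th j))"
  have Wint: "algebraic_int W" unfolding W_def
    by (intro algebraic_int_prod) (auto intro!: algebraic_int_mult algebraic_int_diff th_int)
  have disc: "(\<Prod>(i, j)\<in>D. (cj j - cj i) * (cj i - cj j)) = of_int (int e ^ n * M ^ (n - d))"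
  proof -
    have "of_int (int n ^ n * M ^ (n - 1)) = of_int (int d ^ n * M ^ (d - 1)) * (\<Prod>(i, j)\<in>D. (cj j - cj i) * (cj i - cj j))"
      using split[of "\<lambda>(i, j). (cj j - cj i) * (cj i - cj j)"] discriminant_of_pairs[OF nn e d] discriminant_of_pairs[of 1 n] n0
      by (simp add: M_def)
    moreover have "int n ^ n * M ^ (n - 1) = (int d ^ n * M ^ (d - 1)) * (int e ^ n * M ^ (n - d))"
    proof -
      have "d \<le> n" using nn e by simp
      then have "M ^ (n - 1) = M ^ (d - 1) * M ^ (n - d)" using d by (simp flip: power_add)
      moreover have "int n ^ n = int d ^ n * int e ^ n" by (subst (1) nn) (simp add: power_mult_distrib mult.commute)
      ultimately show ?thesis by simp
    qed
    ultimately have "of_int (int d ^ n * M ^ (d - 1)) * (\<Prod>(i, j)\<in>D. (cj j - cj i) * (cj i - cj j)) = of_int ((int d ^ n * M ^ (d - 1)) * (int e ^ n * M ^ (n - d)))"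
      by (simp only:)
    also have "\<dots> = of_int (int d ^ n * M ^ (d - 1)) * of_int (int e ^ n * M ^ (n - d))" by (rule of_int_mult)
    finally have eq: "of_int (int d ^ n * M ^ (d - 1)) * (\<Prod>(i, j)\<in>D. (cj j - cj i) * (cj i - cj j)) = of_int (int d ^ n * M ^ (d - 1)) * of_int (int e ^ n * M ^ (n - d))" .
    have "(of_int (int d ^ n * M ^ (d - 1)) :: complex) \<noteq> 0" using M0 d by simp
    then show ?thesis by (rule mult_left_cancel[THEN iffD1, OF _ eq])
  qed
  have "of_int (p'\<^sup>2) * W = (\<Prod>(i, j)\<in>D. (cj j - cj i) * (cj i - cj j))"
  proof -
    have "of_int (p'\<^sup>2) * W = (\<Prod>x\<in>D. (case x of (i, j) \<Rightarrow> u i j) * (case x of (i, j) \<Rightarrow> u i j) * (case x of (i, j) \<Rightarrow> (th j - th i) * (th i - th j)))"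
      using p' by (simp add: Q_def W_def power2_eq_square prod.distrib)
    also have "\<dots> = (\<Prod>(i, j)\<in>D. (cj j - cj i) * (cj i - cj j))"
    proof (intro prod.cong refl)
      fix x assume "x \<in> D"
      then obtain i j where x: "x = (i, j)" "i < j" "j < n" by (auto simp: D_def pairs_def)
      have nz: "th j - th i \<noteq> 0" using th_inj[of j i] x by auto
      have "u i j * (th j - th i) = cj j - cj i" using nz by (simp add: u_def)
      moreover have "u i j * (th i - th j) = - (u i j * (th j - th i))" by (simp add: algebra_simps)
      ultimately have "(u i j * (th j - th i)) * (u i j * (th i - th j)) = (cj j - cj i) * (cj i - cj j)" by (simp only: minus_diff_eq)
      then show "(case x of (i, j) \<Rightarrow> u i j) * (case x of (i, j) \<Rightarrow> u i j) * (case x of (i, j) \<Rightarrow> (th j - th i) * (th i - th j)) = (case x of (i, j) \<Rightarrow> (cj j - cj i) * (cj i - cj j))"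
        unfolding x(1) prod.case by (simp only: mult_ac)
    qed
    finally show ?thesis .
  qed
  then have eq: "of_int (p'\<^sup>2) * W = of_int (int e ^ n * M ^ (n - d))" using disc by simp
  have nn1: "n = 1 * n" by simp
  obtain c where c: "\<forall>e d p. n = e * d \<longrightarrow> e > 0 \<longrightarrow> d > 0 \<longrightarrow> index_along e = of_int p \<longrightarrow>
    [p = c ^ card (pairs n e)] (mod m) \<and> p dvd int n1 ^ card (pairs n e)" using index_congruence by (elim exE)
  have cong: "p1 dvd int n1 ^ card (pairs n 1)"
    using c[THEN spec, of 1, THEN spec, of n, THEN spec, of p1] n0 p1 by simp
  have p10: "p1 \<noteq> 0" using cong n1 by auto
  have "p'\<^sup>2 dvd int e ^ n * M ^ (n - d)"
    by (rule int_dvd_of_algebraic_int_quotient[OF Wint eq]) (use pp p10 in auto)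
  moreover have "coprime (p'\<^sup>2) (M ^ (n - d))"
  proof -
    have "p' dvd int n1 ^ card (pairs n 1)" using pp cong by (meson dvd_trans dvd_triv_right)
    moreover have "coprime (int n1 ^ card (pairs n 1)) m" using cop by (rule coprime_power_left_iff[THEN iffD2, OF disjI1])
    ultimately have "coprime p' m" by (meson coprime_divisors dvd_refl)
    then have "coprime p' M" unfolding M_def by (cases "even (n + 1)") (simp_all)
    then show ?thesis by simp
  qed
  ultimately have "p'\<^sup>2 dvd int e ^ n" by (simp add: coprime_dvd_mult_left_iff)
  then show ?thesis using p(1) pp by blast
qed

text \<open>By Cramer's rule the index multiplies the coordinates of elements of \<open>\<int>[\<theta>]\<close> into algebraic integers, and here one coordinate is \<open>1 / q\<close>.\<close>

lemma prime_dvd_index: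
  assumes p1: "index_along 1 = of_int p1" and q: "q > 0" and y: "of_nat q * int_eval f (rat_eval T \<alpha>) = (\<Sum>k<n. of_int (B k) * \<alpha> ^ k)"
    and k: "k < n" "B k = 1"
  shows "int q dvd p1"
proof -
  define S :: "rat poly" where "S = (\<Sum>k<n. monom (of_int (B k) / of_nat q) k)"
  have S: "rat_eval S x = (\<Sum>k<n. of_int (B k) / of_nat q * x ^ k)" for x
    by (simp add: S_def rat_eval_sum of_rat_divide)
  have "int_eval f (rat_eval T \<alpha>) = rat_eval S \<alpha>"
  proof -
    have "of_nat q * rat_eval S \<alpha> = (\<Sum>k<n. of_int (B k) * \<alpha> ^ k)" unfolding S sum_distrib_left using q by simp
    then have "of_nat q * rat_eval S \<alpha> = of_nat q * int_eval f (rat_eval T \<alpha>)" using y by simp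
    then show ?thesis using q by simp
  qed
  then have tr: "int_eval f (th i) = (\<Sum>k<n. of_int (B k) / of_nat q * cj i ^ k)" for i
    unfolding th_def S[symmetric] by (rule conj_transfer_int_eval)
  define E1 where "E1 = (\<Prod>j<n. \<Prod>k<j. cj j - cj k)"
  define E2 where "E2 = (\<Prod>j<n. \<Prod>k<j. th j - th k)"
  obtain z where z: "algebraic_int z" "of_int (B k) / of_nat q * E1 = E2 * z"
    using coordinate_times_index[where x = th and y = cj and g = g and f = f and h = "\<lambda>k. of_int (B k) / of_nat q" and b = k, OF n0 th_int g_th[symmetric] tr[symmetric] k(1)]
    unfolding E1_def E2_def by (elim exE conjE)
  have nz: "E2 \<noteq> 0" unfolding E2_def by (rule vandermonde_nonzero) (auto intro: inj_onI th_inj)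
  have "index_along 1 = (\<Prod>b<n. \<Prod>a<b. u a b)" unfolding index_along_def using prod_pairs[of n 1 n u] by simp
  also have "\<dots> = E1 / E2" unfolding E1_def E2_def u_def by (simp only: prod_dividef)
  finally have pe: "index_along 1 = E1 / E2" .
  have "of_int p1 * E2 = E1" using pe nz unfolding p1 by (simp add: field_simps)
  also have "E1 = of_nat q * (of_int (B k) / of_nat q * E1)" using k(2) q by simp
  also have "\<dots> = of_nat q * z * E2" unfolding z(2) by simp
  finally have "of_int (int q) * z = of_int p1" using nz by simp
  then show ?thesis by (rule int_dvd_of_algebraic_int_quotient[OF z(1)]) (use q in simp)
qed

end

section \<open>Monogenic fields that are not maximal at a prime\<close>

text \<open>Put \<open>d = n div l\<close>. Cancelling \<open>p ^ (n - 1)\<close> in \<open>x ^ (n - 1) = (p * p') ^ (n - 1)\<close> leaves \<open>x ^ (n - d) = p' ^ (n - 1)\<close>, where \<open>p'\<close> is up to sign a power of \<open>l\<close>. As \<open>q\<close> divides \<open>x\<close>, every \<open>l\<close> equals \<open>q\<close>. If \<open>\<bar>p'\<bar> = q ^ w\<close> and \<open>\<bar>x\<bar> = q ^ W\<close>, then \<open>W * (n - n div q) = w * (n - 1)\<close> with \<open>2 * w \<le> n\<close>; were \<open>W\<close> divisible by \<open>q\<close>, then \<open>n = q ^ k\<close> would divide \<open>w\<close>.\<close>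

lemma index_is_prime_power:
  fixes x :: int
  assumes q: "prime q" "q dvd n" "int q dvd x" and x0: "x \<noteq> 0" and n: "n \<ge> 2"
    and H: "\<And>l. prime l \<Longrightarrow> l dvd n \<Longrightarrow>
      \<exists>p p'. x = p * p' \<and> x ^ (n div l - 1) = p ^ (n - 1) \<and> p'\<^sup>2 dvd int l ^ n"
  shows "\<exists>k W. n = q ^ k \<and> \<not> q dvd W \<and> \<bar>x\<bar> = int q ^ W"
proof -
  have step: "\<exists>p'. x ^ (n - n div l) = p' ^ (n - 1) \<and> p'\<^sup>2 dvd int l ^ n" if l: "prime l" "l dvd n" for l
  proof -
    obtain p p' where p: "x = p * p'" "x ^ (n div l - 1) = p ^ (n - 1)" "p'\<^sup>2 dvd int l ^ n"
      using H[OF l] by (elim exE conjE)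
    have "n = l * (n div l)" using l(2) by simp
    then have d1: "n div l \<ge> 1" using n by (cases "n div l") auto
    have dn: "n div l < n" using l n prime_gt_1_nat[OF l(1)] by (intro div_less_dividend) auto
    have "n - 1 = (n div l - 1) + (n - n div l)" using d1 dn by simp
    then have "x ^ (n - 1) = p ^ (n - 1) * x ^ (n - n div l)" by (metis p(2) power_add)
    moreover have "x ^ (n - 1) = p ^ (n - 1) * p' ^ (n - 1)" by (subst p(1)) (rule power_mult_distrib)
    moreover have "p ^ (n - 1) \<noteq> 0" using x0 p(1) by auto
    ultimately have "x ^ (n - n div l) = p' ^ (n - 1)" by (metis mult_left_cancel)
    then show ?thesis using p(3) by blast
  qed
  have smaller: "n div l < n" if "prime l" for l using n prime_gt_1_nat[OF that] by (intro div_less_dividend) auto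
  obtain k n' where kn: "n = q ^ k * n'" "\<not> q dvd n'"
    using multiplicity_decompose'[of n q] n q(1) by (metis mult.commute not_prime_unit not_numeral_le_zero)
  have "n' = 1"
  proof (rule ccontr)
    assume "n' \<noteq> 1"
    then obtain l where l: "prime l" "l dvd n'" using prime_factor_nat by blast
    then have ln: "l dvd n" using kn(1) by simp
    obtain p' where p': "x ^ (n - n div l) = p' ^ (n - 1)" "p'\<^sup>2 dvd int l ^ n" using step[OF l(1) ln] by (elim exE conjE)
    have "int q dvd x ^ (n - n div l)" using q(3) smaller[OF l(1)] by (intro dvd_trans[OF q(3)] dvd_power) auto
    then have "int q dvd p' ^ (n - 1)" unfolding p'(1) .
    moreover have pq: "prime (int q)" using q(1) by simp
    ultimately have "int q dvd p'" using prime_dvd_power by blast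
    then have "int q dvd p'\<^sup>2" by (simp add: power2_eq_square)
    then have "int q dvd int l ^ n" using p'(2) by (rule dvd_trans)
    then have "int q dvd int l" using pq prime_dvd_power by blast
    then have "q = l" using q(1) l(1) primes_dvd_imp_eq by simp
    then show False using l(2) kn(2) by simp
  qed
  then have nk: "n = q ^ k" using kn(1) by simp
  have q2: "q \<ge> 2" using q(1) prime_ge_2_nat by blast
  have k0: "k > 0" using nk n by (auto intro: Nat.gr0I)
  obtain p' where p': "x ^ (n - n div q) = p' ^ (n - 1)" "p'\<^sup>2 dvd int q ^ n" using step[OF q(1,2)] by (elim exE conjE)
  define X1 where "X1 = nat \<bar>x\<bar>"
  define P1 where "P1 = nat \<bar>p'\<bar>"
  have XP: "X1 ^ (n - n div q) = P1 ^ (n - 1)"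
  proof -
    have "int (X1 ^ (n - n div q)) = \<bar>x ^ (n - n div q)\<bar>" by (simp add: X1_def power_abs)
    also have "\<dots> = int (P1 ^ (n - 1))" unfolding p'(1) by (simp add: P1_def power_abs)
    finally show ?thesis by (simp only: of_nat_eq_iff)
  qed
  have "int (P1\<^sup>2) dvd int (q ^ n)" using p'(2) by (simp add: P1_def)
  then have P1q: "P1\<^sup>2 dvd q ^ n" by (simp only: int_dvd_int_iff)
  have "P1 dvd q ^ n" by (rule dvd_trans[OF _ P1q]) (simp add: power2_eq_square)
  then obtain w where w: "P1 = q ^ w" using divides_primepow_nat[OF q(1)] by blast
  have w2: "2 * w \<le> n"
  proof -
    have "q ^ (w * 2) dvd q ^ n" using P1q by (simp add: w power_mult)
    then show ?thesis using power_dvd_imp_le[of q "w * 2" n] q2 by simp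
  qed
  have e0: "n - n div q > 0" using smaller[OF q(1)] by simp
  have "X1 dvd X1 ^ (n - n div q)" using e0 by (intro dvd_power) auto
  also have "\<dots> = q ^ (w * (n - 1))" unfolding XP w by (simp add: power_mult)
  finally obtain W where W: "X1 = q ^ W" using divides_primepow_nat[OF q(1)] by blast
  have "q ^ (W * (n - n div q)) = q ^ (w * (n - 1))" using XP by (simp add: W w power_mult)
  then have Ww: "W * (n - n div q) = w * (n - 1)" using power_inject_exp[of q] q2 by simp
  have "\<not> q dvd W"
  proof
    assume qW: "q dvd W"
    have "n - n div q = (n div q) * (q - 1)" using q(2) by (metis dvd_mult_div_cancel diff_mult_distrib2 mult.commute nat_mult_1_right)
    then have "n div q dvd n - n div q" by simp
    then have "q * (n div q) dvd W * (n - n div q)" using qW by (intro mult_dvd_mono)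
    then have "n dvd w * (n - 1)" using q(2) Ww by simp
    moreover have "coprime n (n - 1)" by (rule coprime_diff_one_right_nat) (use n in simp)
    ultimately have "n dvd w" by (simp add: coprime_dvd_mult_left_iff)
    then have "w = 0" using w2 n by (auto dest: dvd_imp_le)
    then have "W = 0" using Ww e0 by simp
    then have "\<bar>x\<bar> = 1" using W by (simp add: X1_def)
    then show False using q(1,3) by (metis dvd_abs_iff int_dvd_int_iff of_nat_1 not_prime_unit)
  qed
  moreover have "\<bar>x\<bar> = int q ^ W"
  proof -
    have "int X1 = int (q ^ W)" unfolding W ..
    then show ?thesis by (simp add: X1_def)
  qed
  ultimately show ?thesis using nk by blast
qed

text \<open>Both sides are congruent to the same power of \<open>c\<close> modulo \<open>m\<close>, and they are bounded by \<open>n ^ (n * n)\<close>.\<close>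

lemma (in monogenic_field) index_powers_equal:
  assumes l: "prime l" "l dvd n" and p1: "index_along 1 = of_int p1" and big: "\<bar>m\<bar> > 2 * int n ^ (n * n)"
  shows "\<exists>p p'. p1 = p * p' \<and> p1 ^ (n div l - 1) = p ^ (n - 1) \<and> p'\<^sup>2 dvd int l ^ n"
proof -
  define D where "D = n div l"
  have nn: "n = l * D" using l(2) by (simp add: D_def)
  have l0: "l > 0" using l(1) prime_gt_0_nat by blast
  have D0: "D > 0" using nn n0 by (auto intro: Nat.gr0I)
  obtain p p' where p: "index_along l = of_int p" "p1 = p * p'" "p'\<^sup>2 dvd int l ^ n" using index_quotient[OF nn l0 D0 p1] by (elim exE conjE)
  obtain c where c: "\<And>e d p. n = e * d \<Longrightarrow> e > 0 \<Longrightarrow> d > 0 \<Longrightarrow> index_along e = of_int p \<Longrightarrow>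
    [p = c ^ card (pairs n e)] (mod m) \<and> p dvd int n1 ^ card (pairs n e)" using index_congruence by (elim exE) blast
  have nn1: "n = 1 * n" and n_1: "n = n * 1" by simp_all
  have c1: "[p1 = c ^ card (pairs n 1)] (mod m)" "p1 dvd int n1 ^ card (pairs n 1)" using c[OF nn1 _ n0 p1] by auto
  have cl: "[p = c ^ card (pairs n l)] (mod m)" using c[OF nn l0 D0 p(1)] by auto
  have p10: "p1 \<noteq> 0" using c1(2) n1 by auto
  have bound1: "\<bar>p1\<bar> \<le> int n ^ n"
  proof -
    \<comment> \<open>For \<open>e = n\<close> the complementary factor is the whole index, whose square therefore divides \<open>n ^ n\<close>.\<close>
    have "pairs n n = {}" by (auto simp: pairs_def)
    then have "index_along n = 1" by (simp add: index_along_def)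
    moreover obtain b b' where b: "index_along n = of_int b" "p1 = b * b'" "b'\<^sup>2 dvd int n ^ n"
      using index_quotient[OF n_1 n0 _ p1] by (elim meta_impE exE conjE) auto
    ultimately have "b = 1" by simp
    then have "p1\<^sup>2 dvd int n ^ n" using b by simp
    then have "p1 dvd int n ^ n" by (rule dvd_trans[rotated]) (simp add: power2_eq_square)
    then show ?thesis using n0 dvd_imp_le_int[of "int n ^ n" p1] by simp
  qed
  have bound: "\<bar>p\<bar> \<le> int n ^ n"
  proof -
    have "\<bar>p\<bar> \<le> \<bar>p1\<bar>" using p(2) p10 by (intro dvd_imp_le_int) auto
    then show ?thesis using bound1 by linarith
  qed
  have cards: "card (pairs n 1) * (D - 1) = card (pairs n l) * (n - 1)"
  proof -
    have "2 * card (pairs n 1) = n * (n - 1)" by (rule card_pairs[OF nn1]) simp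
    moreover have "2 * card (pairs n l) = n * (D - 1)" by (rule card_pairs[OF nn l0])
    ultimately have "(2 * card (pairs n 1)) * (D - 1) = (2 * card (pairs n l)) * (n - 1)" by simp
    then show ?thesis by simp
  qed
  have "[p1 ^ (D - 1) = (c ^ card (pairs n 1)) ^ (D - 1)] (mod m)" by (intro cong_pow c1)
  moreover have "[p ^ (n - 1) = (c ^ card (pairs n l)) ^ (n - 1)] (mod m)" by (intro cong_pow cl)
  moreover have "(c ^ card (pairs n 1)) ^ (D - 1) = (c ^ card (pairs n l)) ^ (n - 1)" using cards by (simp flip: power_mult)
  ultimately have "[p1 ^ (D - 1) = p ^ (n - 1)] (mod m)" by (metis cong_sym cong_trans)
  then have dvd: "m dvd p1 ^ (D - 1) - p ^ (n - 1)" by (simp add: cong_iff_dvd_diff)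
  have pb: "\<bar>y ^ j\<bar> \<le> int n ^ (n * n)" if "\<bar>y\<bar> \<le> int n ^ n" "j \<le> n" for y :: int and j
  proof -
    have "\<bar>y ^ j\<bar> \<le> (int n ^ n) ^ j" using that(1) by (simp add: power_abs power_mono)
    also have "\<dots> \<le> (int n ^ n) ^ n" using that(2) n0 by (intro power_increasing) auto
    finally show ?thesis by (simp add: power_mult)
  qed
  have "D \<le> n" using nn l0 by simp
  then have "\<bar>p1 ^ (D - 1)\<bar> \<le> int n ^ (n * n)" "\<bar>p ^ (n - 1)\<bar> \<le> int n ^ (n * n)" by (intro pb bound bound1; simp)+
  then have "\<bar>p1 ^ (D - 1) - p ^ (n - 1)\<bar> < \<bar>m\<bar>" using big by linarith
  then have "p1 ^ (D - 1) - p ^ (n - 1) = 0" using dvd dvd_imp_le_int[of "p1 ^ (D - 1) - p ^ (n - 1)" m] by linarith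
  then show ?thesis using p(2,3) by (intro exI[of _ p] exI[of _ p']) (simp add: D_def)
qed

text \<open>The index \<open>\<plusminus> q ^ W\<close> is a \<open>q\<close>-th power modulo \<open>m\<close>. Raising it to an inverse of \<open>W\<close> modulo \<open>q\<close> gives \<open>\<plusminus> q\<close> times a \<open>q\<close>-th power.\<close>

lemma (in monogenic_field) power_residue_if_prime_dvd_index:
  assumes n4: "n \<ge> 4" and q: "prime q" "q dvd n" "\<not> int q dvd m" and p1: "index_along 1 = of_int p1" and qp: "int q dvd p1"
    and big: "\<bar>m\<bar> > 2 * int n ^ (n * n)"
  shows "\<exists>s\<in>{1, -1}. m \<in> power_residue_set q (s * int q)"
proof -
  obtain c where c: "\<And>e d p. n = e * d \<Longrightarrow> e > 0 \<Longrightarrow> d > 0 \<Longrightarrow> index_along e = of_int p \<Longrightarrow>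
    [p = c ^ card (pairs n e)] (mod m) \<and> p dvd int n1 ^ card (pairs n e)" using index_congruence by (elim exE) blast
  have nn1: "n = 1 * n" by simp
  have c1: "[p1 = c ^ card (pairs n 1)] (mod m)" "p1 dvd int n1 ^ card (pairs n 1)" using c[OF nn1 _ n0 p1] by auto
  have p10: "p1 \<noteq> 0" using c1(2) n1 by auto
  have "\<exists>k W. n = q ^ k \<and> \<not> q dvd W \<and> \<bar>p1\<bar> = int q ^ W"
    by (rule index_is_prime_power[OF q(1,2) qp p10 n2]) (rule index_powers_equal[OF _ _ p1 big])
  then obtain k W where kW: "n = q ^ k" "\<not> q dvd W" "\<bar>p1\<bar> = int q ^ W" by (elim exE conjE)
  have q2: "q \<ge> 2" using q(1) prime_ge_2_nat by blast
  have qC: "q dvd card (pairs n 1)"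
  proof -
    have C: "2 * card (pairs n 1) = n * (n - 1)" by (rule card_pairs[OF nn1]) simp
    show ?thesis
    proof (cases "q = 2")
      case True
      have "k \<ge> 2"
      proof (rule ccontr)
        assume "\<not> k \<ge> 2"
        then have "k = 0 \<or> k = 1" by auto
        then show False using kW(1) True n4 by auto
      qed
      then have "n = 4 * 2 ^ (k - 2)" using kW(1) True by (metis le_add_diff_inverse power_add power2_eq_square mult_2_right numeral_Bit0 mult_2)
      then have "card (pairs n 1) = 2 * (2 ^ (k - 2) * (n - 1))" using C by simp
      then show ?thesis using True by simp
    next
      case False
      then have "\<not> q dvd 2" using q(1) two_is_prime_nat primes_dvd_imp_eq by blast
      moreover have "q dvd 2 * card (pairs n 1)" unfolding C using q(2) by simp
      ultimately show ?thesis using q(1) prime_dvd_mult_iff by blast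
    qed
  qed
  then obtain C where C: "card (pairs n 1) = q * C" by (elim dvdE)
  have "coprime W q" using kW(2) q(1) by (metis coprime_commute prime_imp_coprime)
  then obtain v where v: "[W * v = 1] (mod q)" using cong_solve_coprime_nat[of W q] by auto
  have Wv: "W * v \<ge> 1"
  proof (rule ccontr)
    assume "\<not> W * v \<ge> 1"
    then have z: "W * v = 0" by linarith
    have "[0 = 1] (mod q)" using v unfolding z .
    then show False using q2 by (simp add: unique_euclidean_semiring_class.cong_def)
  qed
  have "q dvd W * v - 1" using v by (rule cong_to_1_nat)
  then obtain t where t: "W * v = q * t + 1" using Wv by (metis dvd_def le_add_diff_inverse2)
  \<comment> \<open>The sign of the index survives as the sign of \<open>q\<close>.\<close>
  define s :: int where "s = sgn p1 ^ v"
  have s: "s \<in> {1, -1}"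
  proof -
    have "sgn p1 = 1 \<or> sgn p1 = - 1" using p10 by (auto simp: sgn_if)
    then have "sgn p1 ^ v = 1 \<or> sgn p1 ^ v = - 1" by (cases "even v") auto
    then show ?thesis by (simp add: s_def)
  qed
  have p1v: "p1 ^ v = s * int q * (int q ^ t) ^ q"
  proof -
    have "p1 ^ v = (sgn p1 * \<bar>p1\<bar>) ^ v" by (simp add: mult_sgn_abs)
    also have "\<dots> = s * int q ^ (W * v)" unfolding kW(3) by (simp add: s_def power_mult_distrib power_mult)
    also have "\<dots> = s * int q * (int q ^ t) ^ q" unfolding t by (simp add: mult.commute mult.left_commute flip: power_mult)
    finally show ?thesis .
  qed
  have "m \<in> power_residue_set q (s * int q)" unfolding power_residue_set_def mem_Collect_eq
  proof (intro conjI allI impI sq)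
    fix p assume p: "prime p" "int p dvd m"
    have pq: "p \<noteq> q" using p(2) q(3) by blast
    have nd: "\<not> int p dvd int q" using pq p(1) q(1) primes_dvd_imp_eq by auto
    then show "\<not> int p dvd s * int q" using s by auto
    have "coprime (int p) (int q)" using nd p(1) prime_imp_coprime[of "int p" "int q"] by simp
    then have "coprime (int q ^ t) (int p)" by (simp add: coprime_commute)
    then obtain z where z: "[int q ^ t * z = 1] (mod int p)" using cong_solve_coprime_int[of "int q ^ t" "int p"] by auto
    have "[p1 = (c ^ C) ^ q] (mod int p)"
    proof -
      have "[p1 = c ^ (q * C)] (mod int p)" using c1(1) p(2) unfolding C by (rule cong_dvd_modulus)
      then show ?thesis by (simp add: mult.commute flip: power_mult)
    qed
    then have "[p1 ^ v = ((c ^ C) ^ q) ^ v] (mod int p)" by (rule cong_pow)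
    then have "[p1 ^ v * z ^ q = ((c ^ C) ^ q) ^ v * z ^ q] (mod int p)" by (rule cong_scalar_right)
    moreover have "((c ^ C) ^ q) ^ v * z ^ q = (c ^ (C * v) * z) ^ q" by (simp add: power_mult_distrib mult_ac flip: power_mult)
    moreover have "p1 ^ v * z ^ q = s * int q * (int q ^ t * z) ^ q" unfolding p1v by (simp add: power_mult_distrib mult.assoc)
    moreover have "[s * int q * (int q ^ t * z) ^ q = s * int q * 1 ^ q] (mod int p)" by (intro cong_scalar_left cong_pow z)
    ultimately have "[(c ^ (C * v) * z) ^ q = s * int q] (mod int p)" by (metis cong_sym cong_trans mult_1_right power_one)
    then show "\<exists>y. [y ^ q = s * int q] (mod int p)" by blast
  qed
  then show ?thesis using s by blast
qed

lemma (in pure_field) bad_monogenic_imp_power_residue: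
  assumes n4: "n \<ge> 4" and mono: "monogenic OK" and q: "prime q" "q dvd n" and bad: "(int q)\<^sup>2 dvd m ^ q - m"
    and big: "\<bar>m\<bar> > 2 * int n ^ (n * n)"
  shows "\<exists>s\<in>{1, -1}. m \<in> power_residue_set q (s * int q)"
proof -
  obtain \<theta> where th: "\<theta> \<in> OK" "OK = int_adjoin \<theta>" using mono unfolding monogenic_def by (elim bexE)
  have q2: "q \<ge> 2" using q(1) prime_ge_2_nat by blast
  have qm: "\<not> int q dvd m"
  proof
    assume qm: "int q dvd m"
    then have "(int q)\<^sup>2 dvd m ^ 2" by simp
    then have "(int q)\<^sup>2 dvd m ^ q" using q2 le_imp_power_dvd dvd_trans by blast
    then have "(int q)\<^sup>2 dvd m ^ q - (m ^ q - m)" using bad by (rule dvd_diff)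
    then have "(int q)\<^sup>2 dvd m" by simp
    then have "int q dvd 1" using sq unfolding squarefree_def by blast
    then show False using q2 by simp
  qed
  have thK: "\<theta> \<in> rat_adjoin \<alpha>" and thint: "algebraic_int \<theta>" using th(1) by (auto simp: ring_of_integers_def)
  obtain T where T: "\<theta> = rat_eval T \<alpha>" using thK unfolding rat_adjoin_eq[OF irr root] by (elim rangeE)
  have "\<alpha> \<in> OK" using int_combination_in_OK[of "[:0, 1:]"] by simp
  then have "\<alpha> \<in> range (\<lambda>P. int_eval P \<theta>)" unfolding th(2) int_adjoin_eq .
  then obtain g where g: "\<alpha> = int_eval g \<theta>" by (elim rangeE)
  have "\<exists>N A. N > 0 \<and> coprime (int N) m \<and> of_nat N * \<theta> = int_eval A \<alpha>"
  proof (rule OK_denominator_descent[OF th(1), where Q = "\<lambda>l. int l dvd m"])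
    fix l y B k
    assume l: "prime l" "l dvd n" "int l dvd m" "algebraic_int y" "of_int (int l) * y = (\<Sum>k<n. of_int (B k) * \<alpha> ^ k)" "k < n"
    have "prime (int l)" using l(1) by simp
    then show "int l dvd B k" by (rule ramified_prime_maximal[OF _ l(3,4,5,6)])
  next
    fix N A
    assume N: "N > 0" "N dvd n" "\<And>l. prime l \<Longrightarrow> l dvd N \<Longrightarrow> \<not> int l dvd m" "of_nat N * \<theta> = (\<Sum>k<n. of_int (A k) * \<alpha> ^ k)"
    have "coprime (int N) m"
    proof (rule ccontr)
      assume "\<not> coprime (int N) m"
      then obtain b where b: "b dvd int N" "b dvd m" "\<not> is_unit b" by (elim not_coprimeE)
      then have "b \<noteq> 0" using m0 by auto
      then obtain l where l: "l dvd b" "prime l" using prime_divisor_exists[of b] b(3) by blast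
      obtain l' where l': "l = int l'" using prime_ge_0_int[OF l(2)] nonneg_int_cases by blast
      have "int l' dvd int N" using dvd_trans[OF l(1) b(1)] unfolding l' .
      then have "l' dvd N" by simp
      moreover have "prime l'" using l(2) unfolding l' by simp
      moreover have "int l' dvd m" using dvd_trans[OF l(1) b(2)] unfolding l' .
      ultimately show False using N(3) by blast
    qed
    moreover have "of_nat N * \<theta> = int_eval (\<Sum>k<n. monom (A k) k) \<alpha>" using N(4) by (simp add: int_eval_sum)
    ultimately show ?thesis using N(1) by blast
  qed
  then obtain N A where N: "N > 0" "coprime (int N) m" "of_nat N * \<theta> = int_eval A \<alpha>" by (elim exE conjE)
  \<comment> \<open>The denominator is prime to \<open>m\<close> because \<open>\<int>[\<alpha>]\<close> is maximal at the primes dividing \<open>m\<close>.\<close>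
  interpret monogenic_field n m \<alpha> T g A N
  proof
    show "algebraic_int (rat_eval T \<alpha>)" using thint unfolding T .
    show "int_eval g (rat_eval T \<alpha>) = \<alpha>" using g unfolding T by (rule sym)
    show "of_nat N * rat_eval T \<alpha> = int_eval A \<alpha>" using N(3) unfolding T .
  qed (fact N(1) N(2))+
  obtain p1 where p1: "index_along 1 = of_int p1" using index_along_integer[of 1 n] n0 by auto
  obtain y B k where y: "y \<in> OK" "of_nat q * y = (\<Sum>k<n. of_int (B k) * \<alpha> ^ k)" "k < n" "B k = 1"
    using wild_integer[OF q bad] by (elim exE conjE)
  have "y \<in> range (\<lambda>P. int_eval P \<theta>)" using y(1) unfolding th(2) int_adjoin_eq .
  then obtain f where f: "y = int_eval f \<theta>" by (elim rangeE)
  have q0: "q > 0" using q2 by simp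
  have "of_nat q * int_eval f (rat_eval T \<alpha>) = (\<Sum>k<n. of_int (B k) * \<alpha> ^ k)" using y(2) unfolding f T .
  then have "int q dvd p1" using prime_dvd_index[where B = B and k = k and f = f, OF p1 q0] y(3,4) by blast
  then show ?thesis by (rule power_residue_if_prime_dvd_index[OF n4 q qm p1 _ big])
qed

section \<open>Density of the maximal case\<close>

definition good :: "nat \<Rightarrow> int set" where
  "good n = {m. (\<forall>p. prime p \<longrightarrow> \<not> p dvd n \<longrightarrow> \<not> (int p)\<^sup>2 dvd m) \<and> (\<forall>p. prime p \<longrightarrow> p dvd n \<longrightarrow> \<not> (int p)\<^sup>2 dvd m ^ p - m)}"

text \<open>The solutions are the values \<open>r ^ p\<close> for \<open>r\<close> modulo \<open>p\<close>, which are the Teichmueller representatives modulo \<open>p\<^sup>2\<close>.\<close>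

lemma card_frobenius_fixed:
  assumes p: "prime p"
  shows "card {r \<in> {0..<(int p)\<^sup>2}. (int p)\<^sup>2 dvd r ^ p - r} = p"
proof -
  have p0: "p > 0" using p prime_gt_0_nat by blast
  \<comment> \<open>The value of \<open>r ^ p\<close> modulo \<open>p\<^sup>2\<close> depends on \<open>r\<close> modulo \<open>p\<close> only.\<close>
  let ?f = "\<lambda>r. r ^ p mod (int p)\<^sup>2"
  let ?S = "{r \<in> {0..<(int p)\<^sup>2}. (int p)\<^sup>2 dvd r ^ p - r}"
  have inj: "inj_on ?f {0..<int p}"
  proof (rule inj_onI)
    fix r s assume rs: "r \<in> {0..<int p}" "s \<in> {0..<int p}" "r ^ p mod (int p)\<^sup>2 = s ^ p mod (int p)\<^sup>2"
    have "(int p)\<^sup>2 dvd r ^ p - s ^ p" using rs(3) by (simp add: mod_eq_dvd_iff)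
    then have "int p dvd r ^ p - s ^ p" by (meson dvd_power dvd_trans pos2)
    then have "int p dvd (r ^ p - s ^ p) - (r ^ p - r)" using fermat_int[OF p] by (rule dvd_diff)
    then have "int p dvd (r ^ p - s ^ p) - (r ^ p - r) + (s ^ p - s)" using fermat_int[OF p] by (rule dvd_add)
    then have "int p dvd r - s" by simp
    then have "r mod int p = s mod int p" by (simp add: mod_eq_dvd_iff)
    then show "r = s" using rs by simp
  qed
  have 1: "?f r \<in> ?S" for r
  proof -
    define x where "x = ?f r"
    have "int p dvd r ^ p - r" by (rule fermat_int[OF p])
    then have "(int p)\<^sup>2 dvd (r ^ p) ^ p - r ^ p" by (rule power_cong_prime_square[OF _ p])
    then have "[(r ^ p) ^ p = r ^ p] (mod (int p)\<^sup>2)" by (simp add: cong_iff_dvd_diff)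
    moreover have xr: "[x = r ^ p] (mod (int p)\<^sup>2)" by (simp add: x_def unique_euclidean_semiring_class.cong_def)
    ultimately have "[x ^ p = x] (mod (int p)\<^sup>2)" using cong_pow[OF xr, of p] by (meson cong_sym cong_trans)
    then have "(int p)\<^sup>2 dvd x ^ p - x" by (simp add: cong_iff_dvd_diff)
    moreover have "x \<in> {0..<(int p)\<^sup>2}" using p0 by (simp add: x_def)
    ultimately show ?thesis unfolding x_def by blast
  qed
  have 2: "x \<in> ?f ` {0..<int p}" if x: "x \<in> ?S" for x
  proof -
    define r where "r = x mod int p"
    have "int p dvd r - x" by (simp add: r_def mod_eq_dvd_iff[symmetric])
    then have "(int p)\<^sup>2 dvd r ^ p - x ^ p" by (rule power_cong_prime_square[OF _ p])
    then have "(int p)\<^sup>2 dvd (r ^ p - x ^ p) + (x ^ p - x)" using x by (intro dvd_add) auto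
    then have "r ^ p mod (int p)\<^sup>2 = x mod (int p)\<^sup>2" by (simp add: mod_eq_dvd_iff)
    then have "x = r ^ p mod (int p)\<^sup>2" using x by simp
    moreover have "r \<in> {0..<int p}" using p0 by (simp add: r_def)
    ultimately show ?thesis by blast
  qed
  have "?S = ?f ` {0..<int p}" using 1 2 by blast
  then have "card ?S = card {0..<int p}" by (simp only: card_image[OF inj])
  then show ?thesis by simp
qed

definition local_good :: "nat \<Rightarrow> nat \<Rightarrow> int set" where
  "local_good n p = {r \<in> {0..<(int p)\<^sup>2}. if p dvd n then \<not> (int p)\<^sup>2 dvd r ^ p - r else \<not> (int p)\<^sup>2 dvd r}"

lemma card_local_good:
  assumes p: "prime p"
  shows "real (card (local_good n p)) / (real p)\<^sup>2 = (if p dvd n then 1 - 1 / real p else 1 - 1 / (real p)\<^sup>2)"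
proof -
  have p2: "p \<ge> 2" using p prime_ge_2_nat by blast
  define Z where "Z = {0..<(int p)\<^sup>2}"
  define Bd where "Bd = {r \<in> Z. if p dvd n then (int p)\<^sup>2 dvd r ^ p - r else (int p)\<^sup>2 dvd r}"
  have cZ: "card Z = p\<^sup>2" by (simp add: Z_def nat_power_eq)
  have "local_good n p = Z - Bd" by (auto simp: local_good_def Z_def Bd_def)
  moreover have BZ: "Bd \<subseteq> Z" by (auto simp: Bd_def)
  moreover have "finite Bd" by (rule finite_subset[OF BZ]) (simp add: Z_def)
  ultimately have "card (local_good n p) = card Z - card Bd" by (simp add: card_Diff_subset)
  moreover have "card Bd \<le> card Z" by (rule card_mono) (auto simp: Bd_def Z_def)
  ultimately have c: "real (card (local_good n p)) = (real p)\<^sup>2 - real (card Bd)" using cZ by simp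
  show ?thesis
  proof (cases "p dvd n")
    case True
    then have "card Bd = p" using card_frobenius_fixed[OF p] by (simp add: Bd_def Z_def)
    then show ?thesis using c True p2 by (simp add: field_simps power2_eq_square)
  next
    case False
    have "Bd = {0}"
    proof
      show "Bd \<subseteq> {0}" using False by (auto simp: Bd_def Z_def dest: zdvd_imp_le)
      show "{0} \<subseteq> Bd" using False p2 by (simp add: Bd_def Z_def)
    qed
    then show ?thesis using c False p2 by (simp add: field_simps)
  qed
qed

lemma count_square_multiples:
  assumes k: "k > 0" and x: "x \<ge> 0"
  shows "real (card {m::int. m \<noteq> 0 \<and> real_of_int \<bar>m\<bar> \<le> x \<and> (int k)\<^sup>2 dvd m}) \<le> 2 * x / (real k)\<^sup>2"
proof -
  define t where "t = \<lfloor>x / (real k)\<^sup>2\<rfloor>"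
  have t0: "t \<ge> 0" using x by (simp add: t_def)
  have "{m::int. m \<noteq> 0 \<and> real_of_int \<bar>m\<bar> \<le> x \<and> (int k)\<^sup>2 dvd m} \<subseteq> (\<lambda>s. (int k)\<^sup>2 * s) ` ({- t..t} - {0})"
  proof
    fix m assume "m \<in> {m::int. m \<noteq> 0 \<and> real_of_int \<bar>m\<bar> \<le> x \<and> (int k)\<^sup>2 dvd m}"
    then obtain s where s: "m = (int k)\<^sup>2 * s" "m \<noteq> 0" "real_of_int \<bar>m\<bar> \<le> x" by auto
    have "real_of_int \<bar>s\<bar> \<le> x / (real k)\<^sup>2" using s k by (simp add: abs_mult field_simps)
    then have "\<bar>s\<bar> \<le> t" by (simp add: t_def le_floor_iff)
    then show "m \<in> (\<lambda>s. (int k)\<^sup>2 * s) ` ({- t..t} - {0})" using s by (intro image_eqI[of _ _ s]) auto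
  qed
  then have "card {m::int. m \<noteq> 0 \<and> real_of_int \<bar>m\<bar> \<le> x \<and> (int k)\<^sup>2 dvd m} \<le> card ((\<lambda>s. (int k)\<^sup>2 * s) ` ({- t..t} - {0}))"
    by (rule card_mono[rotated]) simp
  also have "\<dots> \<le> card ({- t..t} - {0})" by (rule card_image_le) simp
  also have "card ({- t..t} - {0}) = nat (2 * t)" using t0 by (simp add: card_Diff_subset nat_diff_distrib)
  finally have "real (card {m::int. m \<noteq> 0 \<and> real_of_int \<bar>m\<bar> \<le> x \<and> (int k)\<^sup>2 dvd m}) \<le> 2 * real_of_int t" using t0 by linarith
  also have "real_of_int t \<le> x / (real k)\<^sup>2" unfolding t_def by (rule of_int_floor_le)
  finally show ?thesis by simp
qed

lemma sum_inverse_squares_tail: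
  assumes z: "z > 0"
  shows "(\<Sum>k\<in>{z<..y}. 1 / (real k)\<^sup>2) \<le> 1 / real z"
proof -
  have "(\<Sum>k\<in>{z<..z + d}. 1 / (real k)\<^sup>2) \<le> 1 / real z - 1 / real (z + d)" for d
  proof (induction d)
    case (Suc d)
    have "{z<..z + Suc d} = insert (z + Suc d) {z<..z + d}" by auto
    then have "(\<Sum>k\<in>{z<..z + Suc d}. 1 / (real k)\<^sup>2) = 1 / (real (z + Suc d))\<^sup>2 + (\<Sum>k\<in>{z<..z + d}. 1 / (real k)\<^sup>2)" by simp
    also have "\<dots> \<le> 1 / (real (z + Suc d))\<^sup>2 + (1 / real z - 1 / real (z + d))" using Suc by simp
    also have "1 / (real (z + Suc d))\<^sup>2 \<le> 1 / real (z + d) - 1 / real (z + Suc d)"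
    proof -
      define N where "N = real (z + d)"
      have N: "N > 0" using z by (simp add: N_def)
      have "1 / (N + 1)\<^sup>2 \<le> 1 / (N * (N + 1))" using N by (intro divide_left_mono) (auto simp: power2_eq_square)
      also have "\<dots> = 1 / N - 1 / (N + 1)" using N by (simp add: field_simps)
      finally show ?thesis by (simp add: N_def add_ac)
    qed
    finally show ?case by simp
  qed simp
  from this[of "y - z"] have "(\<Sum>k\<in>{z<..z + (y - z)}. 1 / (real k)\<^sup>2) \<le> 1 / real z"
    by (smt (verit) divide_nonneg_nonneg of_nat_0_le_iff)
  then show ?thesis by (cases "y \<ge> z") auto
qed

lemma count_large_squares:
  assumes z: "z > 0" and x: "x \<ge> 0"
  shows "real (card {m::int. m \<noteq> 0 \<and> real_of_int \<bar>m\<bar> \<le> x \<and> (\<exists>k>z. (int k)\<^sup>2 dvd m)}) \<le> 2 * x / real z"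
proof -
  define y where "y = nat \<lfloor>x\<rfloor>"
  define E where "E k = {m::int. m \<noteq> 0 \<and> real_of_int \<bar>m\<bar> \<le> x \<and> (int k)\<^sup>2 dvd m}" for k
  have fin: "finite (E k)" for k by (rule finite_subset[OF _ finite_int_abs_le[of UNIV x]]) (auto simp: E_def)
  have "{m::int. m \<noteq> 0 \<and> real_of_int \<bar>m\<bar> \<le> x \<and> (\<exists>k>z. (int k)\<^sup>2 dvd m)} \<subseteq> (\<Union>k\<in>{z<..y}. E k)"
  proof
    fix m assume "m \<in> {m::int. m \<noteq> 0 \<and> real_of_int \<bar>m\<bar> \<le> x \<and> (\<exists>k>z. (int k)\<^sup>2 dvd m)}"
    then obtain k where k: "k > z" "(int k)\<^sup>2 dvd m" "m \<noteq> 0" "real_of_int \<bar>m\<bar> \<le> x" by auto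
    have "(int k)\<^sup>2 \<le> \<bar>m\<bar>" using dvd_imp_le_int[of m "(int k)\<^sup>2"] k(2,3) by simp
    moreover have "int k \<le> (int k)\<^sup>2" using k(1) by (simp add: power2_eq_square)
    ultimately have "real k \<le> x" using k(4) by linarith
    then have "k \<le> y" by (simp add: y_def le_nat_floor)
    then show "m \<in> (\<Union>k\<in>{z<..y}. E k)" using k by (auto simp: E_def)
  qed
  then have "card {m::int. m \<noteq> 0 \<and> real_of_int \<bar>m\<bar> \<le> x \<and> (\<exists>k>z. (int k)\<^sup>2 dvd m)} \<le> card (\<Union>k\<in>{z<..y}. E k)"
    by (intro card_mono) (auto intro: fin)
  also have "\<dots> \<le> (\<Sum>k\<in>{z<..y}. card (E k))" by (rule card_UN_le) simp
  finally have "card {m::int. m \<noteq> 0 \<and> real_of_int \<bar>m\<bar> \<le> x \<and> (\<exists>k>z. (int k)\<^sup>2 dvd m)} \<le> (\<Sum>k\<in>{z<..y}. card (E k))" .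
  then have "real (card {m::int. m \<noteq> 0 \<and> real_of_int \<bar>m\<bar> \<le> x \<and> (\<exists>k>z. (int k)\<^sup>2 dvd m)}) \<le> real (\<Sum>k\<in>{z<..y}. card (E k))"
    by (simp only: of_nat_le_iff)
  also have "\<dots> = (\<Sum>k\<in>{z<..y}. real (card (E k)))" by simp
  also have "\<dots> \<le> (\<Sum>k\<in>{z<..y}. 2 * x * (1 / (real k)\<^sup>2))"
  proof (rule sum_mono)
    fix k assume "k \<in> {z<..y}"
    then show "real (card (E k)) \<le> 2 * x * (1 / (real k)\<^sup>2)" using count_square_multiples[of k x] x by (simp add: E_def)
  qed
  also have "\<dots> = 2 * x * (\<Sum>k\<in>{z<..y}. 1 / (real k)\<^sup>2)" by (simp add: sum_distrib_left)
  also have "\<dots> \<le> 2 * x * (1 / real z)" using sum_inverse_squares_tail[OF z, of y] x by (intro mult_left_mono) auto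
  finally show ?thesis by simp
qed

text \<open>The sets \<open>B z\<close> impose the conditions at the primes up to \<open>z\<close> only; the error is uniform in \<open>x\<close>, so the limits in \<open>x\<close> and \<open>z\<close> may be taken in turn.\<close>

lemma density_sieve_limit:
  assumes B: "\<And>z. z \<ge> zmin \<Longrightarrow> has_two_sided_density (B z) (d z)" and sub: "\<And>z. z \<ge> zmin \<Longrightarrow> G \<subseteq> B z"
    and err: "\<And>z x. z \<ge> zmin \<Longrightarrow> x > 0 \<Longrightarrow> real (card {m \<in> B z - G. real_of_int \<bar>m\<bar> \<le> x}) \<le> 2 * x / real z"
    and d: "d \<longlonglongrightarrow> L"
  shows "has_two_sided_density G L"
  unfolding has_two_sided_density_def
proof (rule tendstoI)
  fix e :: real assume e: "e > 0"
  have "\<forall>\<^sub>F z in sequentially. dist (d z) L < e / 3" using d e by (intro tendstoD) auto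
  moreover have "\<forall>\<^sub>F z in sequentially. 1 / real z < e / 3" using e by real_asymp
  ultimately have "\<forall>\<^sub>F z in sequentially. z \<ge> zmin \<and> dist (d z) L < e / 3 \<and> 1 / real z < e / 3"
    using eventually_ge_at_top[of zmin] by eventually_elim auto
  then obtain z where z: "z \<ge> zmin" "dist (d z) L < e / 3" "1 / real z < e / 3" by (auto dest: eventually_happens)
  have "\<forall>\<^sub>F x in at_top. dist (real (card {m \<in> B z. real_of_int \<bar>m\<bar> \<le> x}) / (2 * x)) (d z) < e / 3"
    using B[OF z(1)] e unfolding has_two_sided_density_def by (intro tendstoD) auto
  then show "\<forall>\<^sub>F x in at_top. dist (real (card {m \<in> G. real_of_int \<bar>m\<bar> \<le> x}) / (2 * x)) L < e"
    using eventually_gt_at_top[of 0]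
  proof eventually_elim
    case (elim x)
    have "{m \<in> B z. real_of_int \<bar>m\<bar> \<le> x} = {m \<in> G. real_of_int \<bar>m\<bar> \<le> x} \<union> {m \<in> B z - G. real_of_int \<bar>m\<bar> \<le> x}" using sub[OF z(1)] by auto
    moreover have "{m \<in> G. real_of_int \<bar>m\<bar> \<le> x} \<inter> {m \<in> B z - G. real_of_int \<bar>m\<bar> \<le> x} = {}" by auto
    ultimately have "card {m \<in> B z. real_of_int \<bar>m\<bar> \<le> x} = card {m \<in> G. real_of_int \<bar>m\<bar> \<le> x} + card {m \<in> B z - G. real_of_int \<bar>m\<bar> \<le> x}"
      by (simp only: card_Un_disjoint[OF finite_int_abs_le finite_int_abs_le])
    then have "real (card {m \<in> G. real_of_int \<bar>m\<bar> \<le> x}) / (2 * x) = real (card {m \<in> B z. real_of_int \<bar>m\<bar> \<le> x}) / (2 * x) - real (card {m \<in> B z - G. real_of_int \<bar>m\<bar> \<le> x}) / (2 * x)"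
      by (simp add: add_divide_distrib)
    moreover have "real (card {m \<in> B z - G. real_of_int \<bar>m\<bar> \<le> x}) / (2 * x) \<le> 1 / real z"
      using err[OF z(1) elim(2)] elim(2) by (simp add: field_simps)
    moreover have "real (card {m \<in> B z - G. real_of_int \<bar>m\<bar> \<le> x}) / (2 * x) \<ge> 0" using elim(2) by simp
    ultimately show ?case using elim(1) z(2,3) unfolding dist_real_def by linarith
  qed
qed

text \<open>Beyond \<open>n\<close> the local condition is squarefreeness at \<open>p\<close>, and the integers violating it for some \<open>p > z\<close> have upper density at most \<open>1 / z\<close>.\<close>

lemma density_good:
  assumes n: "n > 0"
  shows "has_two_sided_density (good n) (6 / pi\<^sup>2 * (\<Prod>p\<in>prime_factors n. real p / (real p + 1)))"
proof -
  define B where "B z = {m. \<forall>p\<in>{p. prime p \<and> p \<le> z}. m mod (int p)\<^sup>2 \<in> local_good n p}" for z :: nat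
  define d where "d z = (\<Prod>p | prime p \<and> p \<le> z. real (card (local_good n p)) / real_of_int ((int p)\<^sup>2))" for z :: nat
  have memB: "m mod (int p)\<^sup>2 \<in> local_good n p \<longleftrightarrow> (if p dvd n then \<not> (int p)\<^sup>2 dvd m ^ p - m else \<not> (int p)\<^sup>2 dvd m)" if p: "prime p" for m p
  proof -
    have p0: "(int p)\<^sup>2 > 0" using p prime_gt_0_nat by simp
    have c: "[m mod (int p)\<^sup>2 = m] (mod (int p)\<^sup>2)" by (simp add: unique_euclidean_semiring_class.cong_def)
    have "[(m mod (int p)\<^sup>2) ^ p - m mod (int p)\<^sup>2 = m ^ p - m] (mod (int p)\<^sup>2)" by (intro cong_diff cong_pow c)
    then have 1: "(int p)\<^sup>2 dvd (m mod (int p)\<^sup>2) ^ p - m mod (int p)\<^sup>2 \<longleftrightarrow> (int p)\<^sup>2 dvd m ^ p - m" by (rule cong_dvd_iff)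
    have 2: "(int p)\<^sup>2 dvd m mod (int p)\<^sup>2 \<longleftrightarrow> (int p)\<^sup>2 dvd m" using c by (rule cong_dvd_iff)
    show ?thesis using p0 unfolding local_good_def mem_Collect_eq 1 2 by simp
  qed
  show ?thesis
  proof (rule density_sieve_limit[where B = B and d = d and zmin = "n + 2"])
    fix z assume "z \<ge> n + 2"
    show "has_two_sided_density (B z) (d z)" unfolding B_def d_def
    proof (rule density_congruences)
      show "finite {p. prime p \<and> p \<le> z}" by simp
      show "local_good n p \<subseteq> {0..<(int p)\<^sup>2}" for p by (auto simp: local_good_def)
      show "(int p)\<^sup>2 > 0" if "p \<in> {p. prime p \<and> p \<le> z}" for p using that prime_gt_0_nat by auto
      show "coprime ((int p)\<^sup>2) ((int q)\<^sup>2)" if "p \<in> {p. prime p \<and> p \<le> z}" "q \<in> {p. prime p \<and> p \<le> z}" "p \<noteq> q" for p q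
        using that primes_coprime[of p q] by (simp add: coprime_int_iff)
    qed
    show "good n \<subseteq> B z" by (auto simp: B_def memB good_def)
  next
    fix z :: nat and x :: real assume z: "z \<ge> n + 2" and x: "x > 0"
    have "{m \<in> B z - good n. real_of_int \<bar>m\<bar> \<le> x} \<subseteq> {m. m \<noteq> 0 \<and> real_of_int \<bar>m\<bar> \<le> x \<and> (\<exists>k>z. (int k)\<^sup>2 dvd m)}"
    proof
      fix m assume m: "m \<in> {m \<in> B z - good n. real_of_int \<bar>m\<bar> \<le> x}"
      then have mB: "m mod (int p)\<^sup>2 \<in> local_good n p" if "prime p" "p \<le> z" for p using that by (auto simp: B_def)
      have m0: "m \<noteq> 0"
      proof
        assume "m = 0"
        have "prime (2::nat)" "(2::nat) \<le> z" using z by auto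
        from mB[OF this] show False using memB[of 2 m] \<open>m = 0\<close> by (auto split: if_splits)
      qed
      obtain p where p: "prime p" "\<not> m mod (int p)\<^sup>2 \<in> local_good n p"
        using m memB by (auto simp: good_def split: if_splits)
      then have pz: "p > z" using mB by (meson not_le)
      then have "\<not> p dvd n" using n z by (auto dest: dvd_imp_le)
      then have "(int p)\<^sup>2 dvd m" using p memB[OF p(1)] by simp
      then show "m \<in> {m. m \<noteq> 0 \<and> real_of_int \<bar>m\<bar> \<le> x \<and> (\<exists>k>z. (int k)\<^sup>2 dvd m)}" using m m0 pz by auto
    qed
    then have "card {m \<in> B z - good n. real_of_int \<bar>m\<bar> \<le> x} \<le> card {m::int. m \<noteq> 0 \<and> real_of_int \<bar>m\<bar> \<le> x \<and> (\<exists>k>z. (int k)\<^sup>2 dvd m)}"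
      by (intro card_mono finite_subset[OF _ finite_int_abs_le[of UNIV x]]) auto
    then show "real (card {m \<in> B z - good n. real_of_int \<bar>m\<bar> \<le> x}) \<le> 2 * x / real z"
      using count_large_squares[of z x] z x by linarith
  next
    define c where "c p = (if p dvd n then real p / (real p + 1) else 1)" for p
    have dz: "d z = (\<Prod>p | prime p \<and> p \<le> z. 1 - 1 / (real p)\<^sup>2) * (\<Prod>p\<in>prime_factors n. real p / (real p + 1))" if z: "z \<ge> n" for z
    proof -
      have "d z = (\<Prod>p | prime p \<and> p \<le> z. (1 - 1 / (real p)\<^sup>2) * c p)" unfolding d_def
      proof (intro prod.cong refl)
        fix p assume "p \<in> {p. prime p \<and> p \<le> z}"
        then have p: "prime p" "p \<ge> 2" using prime_ge_2_nat by auto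
        have "(1 - 1 / (real p)\<^sup>2) * (real p / (real p + 1)) = 1 - 1 / real p"
        proof -
          have "1 - 1 / (real p)\<^sup>2 = (1 - 1 / real p) * ((real p + 1) / real p)" using p(2) by (simp add: field_simps power2_eq_square)
          then show ?thesis using p(2) by simp
        qed
        then show "real (card (local_good n p)) / real_of_int ((int p)\<^sup>2) = (1 - 1 / (real p)\<^sup>2) * c p"
          using card_local_good[OF p(1), of n] by (simp add: c_def)
      qed
      also have "\<dots> = (\<Prod>p | prime p \<and> p \<le> z. 1 - 1 / (real p)\<^sup>2) * (\<Prod>p | prime p \<and> p \<le> z. c p)" by (rule prod.distrib)
      also have "(\<Prod>p | prime p \<and> p \<le> z. c p) = (\<Prod>p\<in>prime_factors n. c p)"
        using z n by (intro prod.mono_neutral_right) (auto simp: c_def prime_factors_dvd dest: dvd_imp_le)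
      also have "\<dots> = (\<Prod>p\<in>prime_factors n. real p / (real p + 1))" by (intro prod.cong) (auto simp: c_def)
      finally show ?thesis .
    qed
    have "(\<lambda>z. (\<Prod>p | prime p \<and> p \<le> z. 1 - 1 / (real p)\<^sup>2) * (\<Prod>p\<in>prime_factors n. real p / (real p + 1))) \<longlonglongrightarrow> 6 / pi\<^sup>2 * (\<Prod>p\<in>prime_factors n. real p / (real p + 1))"
      by (intro tendsto_mult prime_square_product_tendsto tendsto_const)
    then show "d \<longlonglongrightarrow> 6 / pi\<^sup>2 * (\<Prod>p\<in>prime_factors n. real p / (real p + 1))"
      by (rule Lim_transform_eventually) (use eventually_ge_at_top[of n] in \<open>eventually_elim, simp add: dz\<close>)
  qed
qed

lemma density_modify:
  assumes G: "has_two_sided_density G d" and 1: "has_two_sided_density (G - S) 0" and 2: "has_two_sided_density (S - G) 0"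
  shows "has_two_sided_density S d"
proof -
  have eq: "real (card {m \<in> S. real_of_int \<bar>m\<bar> \<le> x}) / (2 * x) = real (card {m \<in> G. real_of_int \<bar>m\<bar> \<le> x}) / (2 * x)
      - real (card {m \<in> G - S. real_of_int \<bar>m\<bar> \<le> x}) / (2 * x) + real (card {m \<in> S - G. real_of_int \<bar>m\<bar> \<le> x}) / (2 * x)" for x
  proof -
    have s: "card {m \<in> A. real_of_int \<bar>m\<bar> \<le> x} = card {m \<in> A \<inter> C. real_of_int \<bar>m\<bar> \<le> x} + card {m \<in> A - C. real_of_int \<bar>m\<bar> \<le> x}" for A C
    proof -
      have "{m \<in> A. real_of_int \<bar>m\<bar> \<le> x} = {m \<in> A \<inter> C. real_of_int \<bar>m\<bar> \<le> x} \<union> {m \<in> A - C. real_of_int \<bar>m\<bar> \<le> x}" by auto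
      moreover have "{m \<in> A \<inter> C. real_of_int \<bar>m\<bar> \<le> x} \<inter> {m \<in> A - C. real_of_int \<bar>m\<bar> \<le> x} = {}" by auto
      ultimately show ?thesis by (simp only: card_Un_disjoint[OF finite_int_abs_le finite_int_abs_le])
    qed
    show ?thesis using s[of S G] s[of G S] by (simp add: Int_commute add_divide_distrib)
  qed
  show ?thesis unfolding has_two_sided_density_def eq
    using tendsto_add[OF tendsto_diff[OF G[unfolded has_two_sided_density_def] 1[unfolded has_two_sided_density_def]] 2[unfolded has_two_sided_density_def]] by simp
qed

section \<open>The density of monogenic pure fields\<close>

lemma good_squarefree:
  assumes m: "m \<in> good n"
  shows "squarefree m"
proof -
  have nd: "\<not> (int p)\<^sup>2 dvd m" if p: "prime p" for p
  proof (cases "p dvd n")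
    case True
    have "(int p)\<^sup>2 dvd m ^ p - m" if d: "(int p)\<^sup>2 dvd m"
    proof -
      have "p > 0" using p prime_gt_0_nat by blast
      then have "m dvd m ^ p" by simp
      then have "(int p)\<^sup>2 dvd m ^ p" using d by (rule dvd_trans[rotated])
      then show ?thesis using d by (rule dvd_diff)
    qed
    then show ?thesis using m True p by (auto simp: good_def)
  qed (use m p in \<open>auto simp: good_def\<close>)
  show ?thesis unfolding squarefree_def
  proof (intro allI impI)
    fix x assume x: "x\<^sup>2 dvd m"
    show "x dvd 1"
    proof (rule ccontr)
      assume "\<not> x dvd 1"
      then have "nat \<bar>x\<bar> \<noteq> 1" by auto
      then obtain p where p: "prime p" "p dvd nat \<bar>x\<bar>" using prime_factor_nat by blast
      then have "int p dvd x" by (simp add: dvd_nat_abs_iff)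
      then have "(int p)\<^sup>2 dvd x\<^sup>2" by (simp add: dvd_power_same)
      then show False using nd[OF p(1)] x dvd_trans by blast
    qed
  qed
qed

lemma density_power_residue_prime:
  assumes q: "prime q" and s: "s \<in> {1, -1}"
  shows "has_two_sided_density (power_residue_set q (s * int q)) 0"
proof (rule density_power_residue_set[OF q])
  have q2: "q \<ge> 2" using q prime_ge_2_nat by blast
  have "squarefree (int q)" using q by (intro squarefree_prime) simp
  then have "squarefree (s * int q)" using s by (auto simp: squarefree_def)
  moreover have "\<bar>s * int q\<bar> \<noteq> 1" using q2 s by auto
  ultimately show "irreducible (monom 1 q - [:of_int (s * int q):] :: rat poly)" using q2 by (intro irreducible_radical) auto
  show "s * int q \<noteq> 0" using q2 s by auto
qed

theorem mainTheorem4: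
  fixes n :: nat and \<alpha> :: "int \<Rightarrow> complex"
  assumes "n \<ge> 4"
    and "\<And>m. m \<in> M_sf n \<Longrightarrow> \<alpha> m ^ n = of_int m"
  shows "has_two_sided_density
           {m \<in> M_sf n. monogenic (ring_of_integers (rat_adjoin (\<alpha> m)))}
           (6 / pi\<^sup>2 * (\<Prod>p\<in>prime_factors n. real p / (real p + 1)))"
proof -
  define S where "S = {m \<in> M_sf n. monogenic (ring_of_integers (rat_adjoin (\<alpha> m)))}"
  have n0: "n > 0" using assms(1) by simp
  have pf: "pure_field n m (\<alpha> m)" if "m \<in> M_sf n" for m
    using that assms(1) assms(2)[OF that] by unfold_locales (auto simp: M_sf_def)
  have "good n - S \<subseteq> {1, -1}"
  proof
    fix m assume m: "m \<in> good n - S"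
    show "m \<in> {1, -1}"
    proof (rule ccontr)
      assume "m \<notin> {1, -1}"
      then have m1: "\<bar>m\<bar> \<noteq> 1" by auto
      have sq: "squarefree m" using m good_squarefree by blast
      have M: "m \<in> M_sf n" unfolding M_sf_def using sq irreducible_radical[OF sq m1 n0] by simp
      have "monogenic (ring_of_integers (rat_adjoin (\<alpha> m)))"
        by (rule pure_field.good_imp_monogenic[OF pf[OF M]]) (use m in \<open>auto simp: good_def\<close>)
      then show False using M m by (simp add: S_def)
    qed
  qed
  then have 1: "has_two_sided_density (good n - S) 0" by (rule density_0_subset[OF density_finite, rotated]) simp
  define Bd where "Bd = {m::int. \<bar>m\<bar> \<le> 2 * int n ^ (n * n)}"
  define PR where "PR = (\<Union>q\<in>prime_factors n. \<Union>s\<in>{1, -1}. power_residue_set q (s * int q))"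
  have "S - good n \<subseteq> Bd \<union> PR"
  proof
    fix m assume m: "m \<in> S - good n"
    then have M: "m \<in> M_sf n" and mono: "monogenic (ring_of_integers (rat_adjoin (\<alpha> m)))" by (auto simp: S_def)
    have sq: "squarefree m" using M by (simp add: M_sf_def)
    have nd: "\<not> (int p)\<^sup>2 dvd m" if p: "prime p" for p
    proof
      assume "(int p)\<^sup>2 dvd m"
      then have "int p dvd 1" using sq unfolding squarefree_def by blast
      then show False using p by (simp add: prime_nat_iff)
    qed
    then obtain q where q: "prime q" "q dvd n" "(int q)\<^sup>2 dvd m ^ q - m" using m by (auto simp: good_def)
    show "m \<in> Bd \<union> PR"
    proof (cases "m \<in> Bd")
      case False
      then have big: "\<bar>m\<bar> > 2 * int n ^ (n * n)" by (simp add: Bd_def)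
      have "\<exists>s\<in>{1, -1}. m \<in> power_residue_set q (s * int q)"
        by (rule pure_field.bad_monogenic_imp_power_residue[OF pf[OF M] assms(1) mono q big])
      moreover have "q \<in> prime_factors n" using q n0 by (simp add: prime_factors_dvd)
      ultimately show ?thesis unfolding PR_def by blast
    qed simp
  qed
  moreover have "has_two_sided_density (Bd \<union> PR) 0"
  proof (rule density_0_Un)
    have "Bd \<subseteq> {- (2 * int n ^ (n * n))..2 * int n ^ (n * n)}" by (auto simp: Bd_def)
    then have "finite Bd" by (rule finite_subset) simp
    then show "has_two_sided_density Bd 0" by (rule density_finite)
    show "has_two_sided_density PR 0" unfolding PR_def
      by (intro density_0_Union density_power_residue_prime) (auto dest: in_prime_factors_imp_prime)
  qed
  ultimately have 2: "has_two_sided_density (S - good n) 0" by (rule density_0_subset[rotated])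
  show ?thesis using density_modify[OF density_good[OF n0] 1 2] unfolding S_def .
qed

end
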